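(* Let $f:\mathbb{T}\to\mathbb{R}$ be a time series, $N\ge1$, and let $\Psi_f$ be its $N$-truncated Liouville torus. Let $\ell$ be the ray with direction vector $\mathbf a=(a_1,\dots,a_N)$, each $a_i>0$, and endpoint $\mathbf b=(b_1,\dots,b_N)\in\mathbb{R}^N$. Then for every integer $n\ge 0$, $$\mathsf{bcd}_{n}^{\mathcal R,\ell}(\Psi_f)=\left\{J_1^{n_1,\ell}\cap\cdots\cap J_N^{n_N,\ell}:\ J_L^{n_L,\ell}\in\mathsf{bcd}_{n_L}^{\mathcal R,\ell}(\pi_L\Psi_f)\ \text{and}\ \sum_{L=1}^N n_L=n\right\},$$ where the $n_L\ge0$ are integers and $$J_L^{n,\ell}=\begin{cases}\left(\dfrac{-b_L}{\sqrt N a_L/\|\mathbf a\|},\infty\right), & n=0,\\[2ex]\left(\dfrac{2r_L^f\sin\left(\pi\frac{k}{2k+1}\right)-b_L}{\sqrt N a_L/\|\mathbf a\|},\ \dfrac{2r_L^f\sin\left(\pi\frac{k+1}{2k+3}\right)-b_L}{\sqrt N a_L/\|\mathbf a\|}\right], & n=2k+1,\ k\in\mathbb{Z}_{\ge0},\\[2ex]\emptyset, &\text{otherwise.}\end{cases}$$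
   Context: For a metric space $(X,d)$ and $\epsilon\in\mathbb{R}$, the Vietoris–Rips complex $\mathcal R_\epsilon(X)$ is the simplicial complex whose simplices are the nonempty finite subsets $\{x_0,\dots,x_n\}\subset X$ with $\max_{i,j}d(x_i,x_j)<\epsilon$ (empty for $\epsilon\le 0$). The $n$-dimensional barcode of a one-parameter filtration of simplicial complexes is the multiset of intervals (bars) $(b,d]$ (or $(b,\infty)$) of its $n$-dimensional persistent homology over a fixed field; for q-tame modules it is the persistence diagram, each off-diagonal point $(b,d)$ recorded as the bar $(b,d]$. Empty intervals are not bars and are discarded. The product $K\times K'$ of simplicial complexes has vertex set the product of vertex sets, a finite set being a simplex iff both coordinate projections are simplices. $\mathbb{T}=\mathbb{R}/2\pi\mathbb{Z}$; $\hat f(L)=\frac1{2\pi}\int_0^{2\pi}f(t)e^{-iLt}\,dt$; $r_L^f=2|\hat f(L)|$. The $N$-truncated Liouville torus $\Psi_f$ is the Liouville torus in phase space $\mathbb{R}^{2N}$ of $H(\mathbf q,\mathbf p)=\sum_{L=1}^N\frac L2(p_L^2+q_L^2)$ on which $\frac{p_L^2+q_L^2}{2}=\frac{(r_L^f)^2}{2}$ for each $L$; i.e. $\Psi_f=\{(\mathbf q,\mathbf p): q_L^2+p_L^2=(r_L^f)^2,\ L=1,\dots,N\}$. $\pi_L$ is the projection onto the $(q_L,p_L)$-plane (Euclidean metric), so $\pi_L\Psi_f$ is a circle of radius $r_L^f$. The ray is $\ell(t)=\mathbf b+\sqrt N\,t\,\frac{\mathbf a}{\|\mathbf a\|}$ ($\|\cdot\|$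 Euclidean). The filtration along $\ell$ is $$\mathcal R^\ell_t(\Psi_f)=\mathcal R_{b_1+\sqrt N t a_1/\|\mathbf a\|}(\pi_1\Psi_f)\times\cdots\times\mathcal R_{b_N+\sqrt N t a_N/\|\mathbf a\|}(\pi_N\Psi_f),\qquad t\in\mathbb{R},$$ and $\mathsf{bcd}_n^{\mathcal R,\ell}(\Psi_f)$ is its $n$-dimensional barcode. Likewise $\mathsf{bcd}_n^{\mathcal R,\ell}(\pi_L\Psi_f)$ is the barcode of $t\mapsto\mathcal R^\ell_t(\pi_L\Psi_f):=\mathcal R_{b_L+\sqrt N t a_L/\|\mathbf a\|}(\pi_L\Psi_f)$. *)

theory Defs
  imports
    "HOL-Analysis.Analysis"
    "HOL-Library.Poly_Mapping"
    "HOL-Library.Multiset"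
    "HOL-Library.Extended_Nat"
    "HOL-Library.Extended_Real"
begin

section \<open>Simplicial complexes\<close>

text \<open>A simplicial complex is represented by its set of simplices, which are nonempty finite
  sets of vertices; the vertex set of \<open>K\<close> is \<open>\<Union>K\<close>.\<close>

definition vietoris_rips :: "'a::metric_space set \<Rightarrow> real \<Rightarrow> 'a set set" where
  "vietoris_rips X \<epsilon> =
     {\<sigma>. \<sigma> \<subseteq> X \<and> finite \<sigma> \<and> \<sigma> \<noteq> {} \<and> (\<forall>x\<in>\<sigma>. \<forall>y\<in>\<sigma>. dist x y < \<epsilon>)}"

text \<open>The product of a family of complexes; its vertices are the extensional functions on the
  index set.\<close>

definition product_complex :: "'i set \<Rightarrow> ('i \<Rightarrow> 'a set set) \<Rightarrow> ('i \<Rightarrow> 'a) set set" where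
  "product_complex I K =
     {\<sigma>. \<sigma> \<subseteq> (\<Pi>\<^sub>E i\<in>I. \<Union>(K i)) \<and> finite \<sigma> \<and> \<sigma> \<noteq> {} \<and> (\<forall>i\<in>I. (\<lambda>x. x i) ` \<sigma> \<in> K i)}"


section \<open>Simplicial homology with field coefficients\<close>

text \<open>Homology is that of the ordered simplicial chain complex: the \<open>n\<close>-chains of \<open>K\<close> are the
  finite formal linear combinations of tuples \<open>(x\<^sub>0, \<dots>, x\<^sub>n)\<close>, represented as lists and possibly
  with repetitions, whose entries span a simplex of \<open>K\<close>. Homology is not reduced: the boundary
  of a \<open>0\<close>-chain is zero.\<close>

definition chains :: "nat \<Rightarrow> 'v set set \<Rightarrow> ('v list \<Rightarrow>\<^sub>0 'k::field) set" where
  "chains n K = {c. \<forall>xs \<in> Poly_Mapping.keys c. length xs = Suc n \<and> set xs \<in> K}"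

definition boundary :: "nat \<Rightarrow> ('v list \<Rightarrow>\<^sub>0 'k::field) \<Rightarrow> ('v list \<Rightarrow>\<^sub>0 'k)" where
  "boundary n c = (if n = 0 then 0 else
     (\<Sum>xs \<in> Poly_Mapping.keys c. \<Sum>i\<le>n.
        Poly_Mapping.single (take i xs @ drop (Suc i) xs) ((-1) ^ i * Poly_Mapping.lookup c xs)))"

definition cycles :: "nat \<Rightarrow> 'v set set \<Rightarrow> ('v list \<Rightarrow>\<^sub>0 'k::field) set" where
  "cycles n K = {c \<in> chains n K. boundary n c = 0}"

definition boundaries :: "nat \<Rightarrow> 'v set set \<Rightarrow> ('v list \<Rightarrow>\<^sub>0 'k::field) set" where
  "boundaries n K = boundary (Suc n) ` chains (Suc n) K"

definition independent_modulo ::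
    "('x \<Rightarrow>\<^sub>0 'k::field) set \<Rightarrow> ('x \<Rightarrow>\<^sub>0 'k) set \<Rightarrow> bool" where
  "independent_modulo W A \<longleftrightarrow>
     finite A \<and>
     (\<forall>u. (\<Sum>c\<in>A. Poly_Mapping.map ((*) (u c)) c) \<in> W \<longrightarrow> (\<forall>c\<in>A. u c = 0))"

text \<open>For subspaces \<open>U\<close> and \<open>W\<close>, the dimension of \<open>(U + W) / W\<close>, i.e. of the image of \<open>U\<close> in the
  quotient by \<open>W\<close>.\<close>

definition dim_modulo :: "('x \<Rightarrow>\<^sub>0 'k::field) set \<Rightarrow> ('x \<Rightarrow>\<^sub>0 'k) set \<Rightarrow> enat" where
  "dim_modulo U W = (SUP A \<in> {A. A \<subseteq> U \<and> independent_modulo W A}. enat (card A))"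

text \<open>The rank of the map \<open>H\<^sub>n(K) \<rightarrow> H\<^sub>n(L)\<close> induced by an inclusion \<open>K \<subseteq> L\<close>: its image consists of
  the classes modulo \<open>boundaries n L\<close> of the cycles of \<open>K\<close>. The coefficient field is the type
  \<open>'k\<close>.\<close>

definition homology_rank :: "'k::field itself \<Rightarrow> nat \<Rightarrow> 'v set set \<Rightarrow> 'v set set \<Rightarrow> enat" where
  "homology_rank _ n K L =
     dim_modulo (cycles n K :: ('v list \<Rightarrow>\<^sub>0 'k) set) (boundaries n L)"


section \<open>Persistence diagrams and barcodes\<close>

text \<open>The rank of \<open>H\<^sub>n(F s) \<rightarrow> H\<^sub>n(F t)\<close>, where the persistence module is extended by zero to
  \<open>-\<infinity>\<close> and \<open>\<infinity>\<close>. For a q-tame module the rank is finite for \<open>s < t\<close>; nothing is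
  specified about \<^term>\<open>the_enat \<infinity>\<close>.\<close>

definition persistent_rank ::
    "'k::field itself \<Rightarrow> nat \<Rightarrow> (real \<Rightarrow> 'v set set) \<Rightarrow> ereal \<Rightarrow> ereal \<Rightarrow> nat" where
  "persistent_rank k n F s t =
     (if s = -\<infinity> \<or> t = \<infinity> then 0
      else the_enat (homology_rank k n (F (real_of_ereal s)) (F (real_of_ereal t))))"

text \<open>The rectangle measure of \<open>[a,b] \<times> [c,d]\<close>, for \<open>a < b < c < d\<close>.\<close>

definition rectangle_measure ::
    "'k::field itself \<Rightarrow> nat \<Rightarrow> (real \<Rightarrow> 'v set set) \<Rightarrow> ereal \<Rightarrow> ereal \<Rightarrow> ereal \<Rightarrow> ereal \<Rightarrow> nat" where
  "rectangle_measure k n F a b c d =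
     nat (int (persistent_rank k n F b c) - int (persistent_rank k n F a c)
        - int (persistent_rank k n F b d) + int (persistent_rank k n F a d))"

text \<open>The multiplicity of the off-diagonal point \<open>(p,q)\<close>, \<open>p < q\<close>, in the persistence diagram: the
  minimum of the measures of the rectangles containing \<open>(p,q)\<close> in their interior relative to the
  extended plane \<open>[-\<infinity>,\<infinity>] \<times> [-\<infinity>,\<infinity>]\<close>.\<close>

definition diagram_multiplicity ::
    "'k::field itself \<Rightarrow> nat \<Rightarrow> (real \<Rightarrow> 'v set set) \<Rightarrow> ereal \<Rightarrow> ereal \<Rightarrow> nat" where
  "diagram_multiplicity k n F p q =
     Inf {rectangle_measure k n F a b c d | a b c d.
            (a < p \<or> a = -\<infinity> \<and> p = -\<infinity>) \<and> p < b \<and> b < c \<and> c < q \<and>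
            (q < d \<or> q = \<infinity> \<and> d = \<infinity>)}"

definition bar :: "ereal \<Rightarrow> ereal \<Rightarrow> real set" where
  "bar p q = {t. p < ereal t \<and> ereal t \<le> q}"

text \<open>The \<open>n\<close>-dimensional barcode of the filtration \<open>F\<close>, as a multiplicity function on sets of reals
  (a barcode may have infinitely many bars, so the type of finite multisets is not suitable in
  general). A set of the form \<open>bar p q\<close> with \<open>p < q\<close> determines \<open>p\<close> and \<open>q\<close> as its infimum and
  supremum.\<close>

definition barcode ::
    "'k::field itself \<Rightarrow> nat \<Rightarrow> (real \<Rightarrow> 'v set set) \<Rightarrow> real set \<Rightarrow> nat" where
  "barcode k n F I =
     (if \<exists>p q. p < q \<and> I = bar p q
      then diagram_multiplicity k n F (Inf (ereal ` I)) (Sup (ereal ` I))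
      else 0)"


section \<open>Liouville tori and the filtration along a ray\<close>

text \<open>A function on \<open>\<real>/2\<pi>\<int>\<close> is represented by a \<open>2\<pi>\<close>-periodic function on the reals.\<close>

definition fourier_coefficient :: "(real \<Rightarrow> real) \<Rightarrow> int \<Rightarrow> complex" where
  "fourier_coefficient f L =
     of_real (1 / (2 * pi)) *
     (LINT t:{0..2 * pi}|lebesgue. of_real (f t) * exp (- \<i> * of_int L * of_real t))"

definition torus_radius :: "(real \<Rightarrow> real) \<Rightarrow> nat \<Rightarrow> real" where
  "torus_radius f L = 2 * cmod (fourier_coefficient f (int L))"

text \<open>A point of the phase space \<open>\<real>\<^bsup>2N\<^esup>\<close> is represented by the extensional function
  \<open>L \<mapsto> (q\<^sub>L, p\<^sub>L)\<close> on \<open>{1..N}\<close>.\<close>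

definition liouville_torus :: "(real \<Rightarrow> real) \<Rightarrow> nat \<Rightarrow> (nat \<Rightarrow> real \<times> real) set" where
  "liouville_torus f N =
     {x \<in> {1..N} \<rightarrow>\<^sub>E UNIV. \<forall>L\<in>{1..N}.
        ((snd (x L))\<^sup>2 + (fst (x L))\<^sup>2) / 2 = (torus_radius f L)\<^sup>2 / 2}"

definition torus_projection :: "(real \<Rightarrow> real) \<Rightarrow> nat \<Rightarrow> nat \<Rightarrow> (real \<times> real) set" where
  "torus_projection f N L = (\<lambda>x. x L) ` liouville_torus f N"

definition ray_speed :: "nat \<Rightarrow> (nat \<Rightarrow> real) \<Rightarrow> nat \<Rightarrow> real" where
  "ray_speed N a L = sqrt (real N) * a L / L2_set a {1..N}"

definition ray :: "nat \<Rightarrow> (nat \<Rightarrow> real) \<Rightarrow> (nat \<Rightarrow> real) \<Rightarrow> real \<Rightarrow> nat \<Rightarrow> real" where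
  "ray N a b t L = b L + ray_speed N a L * t"

definition circle_filtration ::
    "(real \<Rightarrow> real) \<Rightarrow> nat \<Rightarrow> (nat \<Rightarrow> real) \<Rightarrow> (nat \<Rightarrow> real) \<Rightarrow> nat \<Rightarrow> real \<Rightarrow> (real \<times> real) set set" where
  "circle_filtration f N a b L t = vietoris_rips (torus_projection f N L) (ray N a b t L)"

definition torus_filtration ::
    "(real \<Rightarrow> real) \<Rightarrow> nat \<Rightarrow> (nat \<Rightarrow> real) \<Rightarrow> (nat \<Rightarrow> real) \<Rightarrow> real \<Rightarrow> (nat \<Rightarrow> real \<times> real) set set" where
  "torus_filtration f N a b t = product_complex {1..N} (\<lambda>L. circle_filtration f N a b L t)"

definition ray_interval ::
    "(real \<Rightarrow> real) \<Rightarrow> nat \<Rightarrow> (nat \<Rightarrow> real) \<Rightarrow> (nat \<Rightarrow> real) \<Rightarrow> nat \<Rightarrow> nat \<Rightarrow> real set" where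
  "ray_interval f N a b L n =
     (if n = 0 then {- b L / ray_speed N a L <..}
      else if odd n then
        (let k = real (n div 2); r = torus_radius f L in
          {(2 * r * sin (pi * (k / (2 * k + 1))) - b L) / ray_speed N a L <..
           (2 * r * sin (pi * ((k + 1) / (2 * k + 3))) - b L) / ray_speed N a L})
      else {})"

end

theory Submission
  imports Defs
begin

text \<open>The Vietoris-Rips complex of a circle is approximated by clique complexes of cyclic graphs on
  \<open>\<int>/n\<close>. As long as the winding fraction of such a graph stays strictly between \<open>l/(2l+1)\<close> and
  \<open>(l+1)/(2l+3)\<close>, the link of an added edge is acyclic, so that adding edges does not change the
  homology; and this window contains a graph whose clique complex is the boundary of a
  cross-polytope with vertices blown up to simplices, a sphere of dimension \<open>2l+1\<close>.

  Each of these steps is carried out for the product with an arbitrary complex \<open>M\<close>. This yields the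
  Kuenneth formula for the factor at hand without an Eilenberg-Zilber theorem: the classes of
  \<open>M \<times> K\<close> are the shuffle cross products of those of \<open>M\<close> with a point and with the fundamental
  class. Iterating over the circles, the homology of the product has a basis of cross products in
  which all transition maps are diagonal. Hence the rank of a transition map counts the vectors
  \<open>(n\<^sub>1, \<dots>, n\<^sub>N)\<close> of degrees whose intervals all contain both parameters, and the barcode is read
  off from these ranks.\<close>

text \<open>Two obstacles shape the passage between the circle and the graphs. The vertex set of the
  Vietoris-Rips complex is infinite, and at the right end of a bar, where the arc length equals
  \<open>(l+1)/(2l+3)\<close> of a turn, the class is still alive although the window for finite
  graphs is open there. Both are met by the strict inequality in \<open>vietoris_rips\<close>: a
  finite chain already lives at a slightly smaller scale, so it can be rounded to a fine grid and
  back with room to spare. The graphs thus describe the inclusion of one scale into a larger one,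
  and a statement about a single scale is obtained by first moving chains to the left. This is also
  why the bars have the form \<open>(b, d]\<close>. The grid varies with the scales, so the classes
  it yields must be made comparable. A cycle on \<open>4l+4\<close> equally spaced points of the
  circle is the common reference: it lies on every grid of \<open>(4l+4) c\<close> points, and each
  generator is tied to it at some scale before the right end of the bar.\<close>

abbreviation "keys \<equiv> Poly_Mapping.keys"
abbreviation "lookup \<equiv> Poly_Mapping.lookup"
abbreviation "single \<equiv> Poly_Mapping.single"

section \<open>Formal linear combinations and linear extension of maps\<close>

definition smul :: "'k::field \<Rightarrow> ('x \<Rightarrow>\<^sub>0 'k) \<Rightarrow> ('x \<Rightarrow>\<^sub>0 'k)" where
  "smul c p = Poly_Mapping.map ((*) c) p"

lemma lookup_smul [simp]: "lookup (smul c p) x = c * lookup p x"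
  by (simp add: smul_def Poly_Mapping.map.rep_eq when_def)

interpretation pm: vector_space smul
  by unfold_locales (auto intro!: poly_mapping_eqI simp: lookup_add algebra_simps)

lemma smul_single [simp]: "smul c (single x a) = single x (c * a)"
  by (rule poly_mapping_eqI) (simp add: lookup_single when_def)

lemma keys_smul: "keys (smul c p) \<subseteq> keys p"
  by (auto simp: in_keys_iff)

text \<open>The operators on chains below are linear extensions of maps on tuples. By
  \<open>lin_lin\<close> and \<open>lin_cong\<close>, an identity between composites of them is
  checked on single tuples.\<close>

definition lin :: "('x \<Rightarrow> ('y \<Rightarrow>\<^sub>0 'k::field)) \<Rightarrow> ('x \<Rightarrow>\<^sub>0 'k) \<Rightarrow> ('y \<Rightarrow>\<^sub>0 'k)" where
  "lin f p = (\<Sum>x\<in>keys p. smul (lookup p x) (f x))"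

lemma lin_superset:
  assumes "finite A" "keys p \<subseteq> A"
  shows "lin f p = (\<Sum>x\<in>A. smul (lookup p x) (f x))"
  unfolding lin_def by (rule sum.mono_neutral_left) (use assms in \<open>auto simp: in_keys_iff\<close>)

lemma lin_add: "lin f (p + q) = lin f p + lin f q"
proof -
  let ?A = "keys p \<union> keys q"
  have "lin f (p + q) = (\<Sum>x\<in>?A. smul (lookup (p + q) x) (f x))"
    by (rule lin_superset) (use Poly_Mapping.keys_add [of p q] in auto)
  also have "\<dots> = (\<Sum>x\<in>?A. smul (lookup p x) (f x)) + (\<Sum>x\<in>?A. smul (lookup q x) (f x))"
    by (simp add: lookup_add pm.scale_left_distrib sum.distrib)
  also have "\<dots> = lin f p + lin f q"
    by (subst (1 2) lin_superset [of ?A]) auto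
  finally show ?thesis .
qed

lemma lin_smul: "lin f (smul c p) = smul c (lin f p)"
proof -
  have "lin f (smul c p) = (\<Sum>x\<in>keys p. smul (lookup (smul c p) x) (f x))"
    by (rule lin_superset) (use keys_smul [of c p] in auto)
  then show ?thesis
    by (simp add: lin_def pm.scale_sum_right)
qed

lemma lin_0 [simp]: "lin f 0 = 0"
  by (simp add: lin_def)

lemma lin_single [simp]: "lin f (single x a) = smul a (f x)"
  by (simp add: lin_def)

lemma smul_minus1: "smul (-1) p = - p"
  by simp

lemma lin_uminus: "lin f (- p) = - lin f p"
  by (metis lin_smul smul_minus1)

lemma lin_diff: "lin f (p - q) = lin f p - lin f q"
  by (metis diff_conv_add_uminus lin_add lin_uminus)

lemma lin_sum: "lin f (\<Sum>i\<in>I. p i) = (\<Sum>i\<in>I. lin f (p i))"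
  by (induction I rule: infinite_finite_induct) (auto simp: lin_add)

lemmas lin_simps = lin_add lin_diff lin_uminus lin_smul lin_sum

lemma lin_cong: "(\<And>x. x \<in> keys p \<Longrightarrow> f x = g x) \<Longrightarrow> lin f p = lin g p"
  by (simp add: lin_def)

lemma lin_lin: "lin g (lin f p) = lin (\<lambda>x. lin g (f x)) p"
  by (simp add: lin_def [of f] lin_def [of "\<lambda>x. lin g (f x)"] lin_simps)

lemma lin_id [simp]: "lin (\<lambda>x. single x 1) p = p"
  by (rule poly_mapping_eqI)
    (simp add: lin_def lookup_sum lookup_single when_def in_keys_iff)

lemma lin_fun_add: "lin (\<lambda>x. f x + g x) p = lin f p + lin g p"
  by (simp add: lin_def pm.scale_right_distrib sum.distrib)

lemma lin_fun_diff: "lin (\<lambda>x. f x - g x) p = lin f p - lin g p"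
  by (simp add: lin_def pm.scale_right_diff_distrib sum_subtractf)

lemma lin_fun_smul: "lin (\<lambda>x. smul c (f x)) p = smul c (lin f p)"
  by (simp add: lin_def pm.scale_sum_right mult.commute)

lemma lin_fun_0: "lin (\<lambda>x. 0) p = 0"
  by (simp add: lin_def)

lemma lin_swap: "lin (\<lambda>x. lin (\<lambda>y. f x y) q) p = lin (\<lambda>y. lin (\<lambda>x. f x y) p) q"
  by (simp add: lin_def pm.scale_sum_right sum.swap [of _ "keys p"] mult.commute)

lemma in_keys_lin: "y \<in> keys (lin f p) \<Longrightarrow> \<exists>x\<in>keys p. y \<in> keys (f x)"
proof -
  assume "y \<in> keys (lin f p)"
  then have "(\<Sum>x\<in>keys p. lookup p x * lookup (f x) y) \<noteq> 0"
    by (simp add: in_keys_iff lin_def lookup_sum)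
  then obtain x where "x \<in> keys p" "lookup p x * lookup (f x) y \<noteq> 0"
    by (meson sum.neutral)
  then show ?thesis
    by (auto simp: in_keys_iff)
qed

section \<open>Ordered chains\<close>

definition push :: "('v \<Rightarrow> 'w) \<Rightarrow> ('v list \<Rightarrow>\<^sub>0 'k::field) \<Rightarrow> ('w list \<Rightarrow>\<^sub>0 'k)" where
  "push h = lin (\<lambda>xs. single (map h xs) 1)"

definition consm :: "'v \<Rightarrow> ('v list \<Rightarrow>\<^sub>0 'k::field) \<Rightarrow> ('v list \<Rightarrow>\<^sub>0 'k)" where
  "consm x = lin (\<lambda>xs. single (x # xs) 1)"

lemma push_simps [simp]:
  "push h 0 = 0" "push h (p + q) = push h p + push h q" "push h (p - q) = push h p - push h q"
  "push h (- p) = - push h p" "push h (smul c p) = smul c (push h p)"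
  "push h (\<Sum>i\<in>I. f i) = (\<Sum>i\<in>I. push h (f i))"
  "push h (single xs a) = single (map h xs) a"
  by (simp_all add: push_def lin_simps)

lemma consm_simps [simp]:
  "consm x 0 = 0" "consm x (p + q) = consm x p + consm x q" "consm x (p - q) = consm x p - consm x q"
  "consm x (- p) = - consm x p" "consm x (smul c p) = smul c (consm x p)"
  "consm x (single xs a) = single (x # xs) a"
  by (simp_all add: consm_def lin_simps)

lemma push_push [simp]: "push g (push f c) = push (g \<circ> f) c"
  by (simp add: push_def lin_lin)

lemma push_ident: "(\<And>xs x. xs \<in> keys c \<Longrightarrow> x \<in> set xs \<Longrightarrow> h x = x) \<Longrightarrow> push h c = c"
  using lin_cong [of c "\<lambda>xs. single (map h xs) 1" "\<lambda>xs. single xs 1"]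
  by (simp add: push_def map_idI)

lemma push_consm: "push h (consm x c) = consm (h x) (push h c)"
  by (simp add: push_def consm_def lin_lin)

lemma in_keys_push: "ys \<in> keys (push h c) \<Longrightarrow> \<exists>xs\<in>keys c. ys = map h xs"
  unfolding push_def by (drule in_keys_lin) auto

lemma in_keys_consm: "ys \<in> keys (consm x c) \<Longrightarrow> \<exists>xs\<in>keys c. ys = x # xs"
  unfolding consm_def by (drule in_keys_lin) auto

text \<open>\<open>bda\<close> is the augmented boundary (\<open>[x] \<mapsto> []\<close>) of a simplex and \<open>bd\<close> the unaugmented one.\<close>

primrec bda :: "'v list \<Rightarrow> ('v list \<Rightarrow>\<^sub>0 'k::field)" where
  "bda [] = 0"
| "bda (x # xs) = single xs 1 - consm x (bda xs)"

definition bd :: "'v list \<Rightarrow> ('v list \<Rightarrow>\<^sub>0 'k::field)" where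
  "bd xs = (if length xs \<le> 1 then 0 else bda xs)"

definition da :: "('v list \<Rightarrow>\<^sub>0 'k::field) \<Rightarrow> ('v list \<Rightarrow>\<^sub>0 'k)" where "da = lin bda"
definition dd :: "('v list \<Rightarrow>\<^sub>0 'k::field) \<Rightarrow> ('v list \<Rightarrow>\<^sub>0 'k)" where "dd = lin bd"

lemma dd_simps [simp]:
  "dd 0 = 0" "dd (p + q) = dd p + dd q" "dd (p - q) = dd p - dd q"
  "dd (- p) = - dd p" "dd (smul c p) = smul c (dd p)" "dd (\<Sum>i\<in>I. f i) = (\<Sum>i\<in>I. dd (f i))"
  by (simp_all add: dd_def lin_simps)

lemma da_simps [simp]:
  "da 0 = 0" "da (p + q) = da p + da q" "da (p - q) = da p - da q"
  "da (- p) = - da p" "da (smul c p) = smul c (da p)" "da (single xs a) = smul a (bda xs)"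
  by (simp_all add: da_def lin_simps)

text \<open>Coning with \<open>x\<close> contracts the augmented chain complex. This identity yields
  the prism formula, the Leibniz rule for shuffles, the coned fillings of cross-polytope cycles and
  the vanishing of the positive homology of a point.\<close>

lemma da_consm: "da (consm x c) = c - consm x (da c)"
proof -
  have "da (consm x c) = lin (\<lambda>xs. single xs 1 - consm x (bda xs)) c"
    by (simp add: da_def consm_def lin_lin)
  also have "\<dots> = c - consm x (da c)"
    by (simp add: lin_fun_diff) (simp add: da_def consm_def lin_lin)
  finally show ?thesis .
qed

lemma da_bda: "da (bda xs) = 0"
  by (induction xs) (auto simp: da_consm)

lemma keys_bda:
  fixes xs :: "'v list"
  shows "ys \<in> keys (bda xs :: 'v list \<Rightarrow>\<^sub>0 'k::field) \<Longrightarrow> Suc (length ys) = length xs \<and> set ys \<subseteq> set xs"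
proof (induction xs arbitrary: ys)
  case (Cons x xs)
  have "ys = xs \<or> ys \<in> keys (consm x (bda xs) :: 'v list \<Rightarrow>\<^sub>0 'k)"
    using Cons.prems by (auto simp: in_keys_iff lookup_minus lookup_single when_def split: if_splits)
  then show ?case
  proof
    assume "ys \<in> keys (consm x (bda xs) :: 'v list \<Rightarrow>\<^sub>0 'k)"
    then obtain zs where "zs \<in> keys (bda xs :: 'v list \<Rightarrow>\<^sub>0 'k)" "ys = x # zs"
      by (auto dest: in_keys_consm)
    then show ?thesis
      using Cons.IH [of zs] by auto
  qed auto
qed auto

lemma keys_bd: "ys \<in> keys (bd xs) \<Longrightarrow> Suc (length ys) = length xs \<and> set ys \<subseteq> set xs \<and> ys \<noteq> []"
  using keys_bda [of ys xs] by (auto simp: bd_def split: if_splits)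

text \<open>The two boundaries differ only on one-entry tuples. Calculations in positive degree pass
  to \<open>da\<close>, whose recursion is free of the special case.\<close>

lemma dd_eq_da: "(\<And>xs. xs \<in> keys c \<Longrightarrow> length xs \<ge> 2) \<Longrightarrow> dd c = da c"
  unfolding dd_def da_def by (rule lin_cong) (force simp: bd_def)

lemma dd_eq_0: "(\<And>xs. xs \<in> keys c \<Longrightarrow> length xs \<le> 1) \<Longrightarrow> dd c = 0"
  using lin_cong [of c bd "\<lambda>_. 0"] by (simp add: dd_def bd_def lin_fun_0)

lemma dd_bd: "dd (bd xs) = 0"
proof (cases "length xs \<le> 2")
  case True
  then show ?thesis
    by (intro dd_eq_0) (auto dest: keys_bd)
next
  case False
  then have "dd (bd xs) = da (bd xs)"
    by (intro dd_eq_da) (auto dest: keys_bd)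
  then show ?thesis
    using False by (simp add: bd_def da_bda split: if_splits)
qed

lemma dd_dd [simp]: "dd (dd c) = 0"
proof -
  have "dd (dd c) = lin (\<lambda>xs. dd (bd xs)) c"
    by (simp add: dd_def lin_lin)
  then show ?thesis
    by (simp add: dd_bd lin_fun_0)
qed

text \<open>Unrolling the recursion gives the alternating sum over deleted entries, which links
  \<open>bda\<close> to \<open>boundary\<close>.\<close>

lemma bda_take_drop:
  fixes xs :: "'v list"
  shows "(bda xs :: 'v list \<Rightarrow>\<^sub>0 'k::field) = (\<Sum>i<length xs. single (take i xs @ drop (Suc i) xs) ((-1) ^ i))"
proof (induction xs)
  case (Cons x xs)
  have "(bda (x # xs) :: 'v list \<Rightarrow>\<^sub>0 'k) = single xs 1
      + (\<Sum>i<length xs. single (x # take i xs @ drop (Suc i) xs) ((-1) ^ Suc i))"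
    by (simp only: bda.simps Cons) (simp add: consm_def lin_simps single_uminus sum_negf)
  also have "\<dots> = (\<Sum>i<length (x # xs).
      single (take i (x # xs) @ drop (Suc i) (x # xs)) ((-1) ^ i))"
    by (simp only: list.size(4) Nat.add_0_right One_nat_def add_Suc_right sum.lessThan_Suc_shift) simp
  finally show ?case .
qed simp

lemma boundary_eq_dd:
  fixes c :: "'v list \<Rightarrow>\<^sub>0 'k::field"
  assumes "c \<in> chains n K"
  shows "boundary n c = dd c"
proof (cases n)
  case 0
  then show ?thesis
    using assms by (simp add: boundary_def chains_def dd_eq_0)
next
  case (Suc m)
  have "(bd xs :: 'v list \<Rightarrow>\<^sub>0 'k) = (\<Sum>i\<le>n. single (take i xs @ drop (Suc i) xs) ((-1) ^ i))"
    if "xs \<in> keys c" for xs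
  proof -
    have "length xs = Suc n" using assms that by (auto simp: chains_def)
    then show ?thesis using Suc by (simp add: bd_def bda_take_drop lessThan_Suc_atMost)
  qed
  then show ?thesis
    using Suc unfolding boundary_def dd_def lin_def
    by (auto intro!: sum.cong simp: pm.scale_sum_right mult.commute simp del: sum.atMost_Suc)
qed

section \<open>Complexes, cycles and boundaries\<close>

definition simplicial :: "'v set set \<Rightarrow> bool" where
  "simplicial K \<longleftrightarrow> (\<forall>S\<in>K. finite S \<and> S \<noteq> {} \<and> (\<forall>T. T \<subseteq> S \<longrightarrow> T \<noteq> {} \<longrightarrow> T \<in> K))"

lemma simplicialD: "simplicial K \<Longrightarrow> S \<in> K \<Longrightarrow> T \<subseteq> S \<Longrightarrow> T \<noteq> {} \<Longrightarrow> T \<in> K"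
  unfolding simplicial_def by blast

lemma simplicial_fin: "simplicial K \<Longrightarrow> S \<in> K \<Longrightarrow> finite S \<and> S \<noteq> {}"
  unfolding simplicial_def by blast

lemma subspace_chains: "pm.subspace (chains n K)"
  unfolding pm.subspace_def chains_def
  using Poly_Mapping.keys_add keys_smul by fastforce

lemma chains_ops [simp]:
  "0 \<in> chains n K" "p \<in> chains n K \<Longrightarrow> q \<in> chains n K \<Longrightarrow> p + q \<in> chains n K"
  "p \<in> chains n K \<Longrightarrow> q \<in> chains n K \<Longrightarrow> p - q \<in> chains n K"
  "p \<in> chains n K \<Longrightarrow> - p \<in> chains n K" "p \<in> chains n K \<Longrightarrow> smul c p \<in> chains n K"
  "(\<And>i. i \<in> I \<Longrightarrow> f i \<in> chains n K) \<Longrightarrow> (\<Sum>i\<in>I. f i) \<in> chains n K"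
  using subspace_chains [of n K]
  by (auto intro: pm.subspace_add pm.subspace_diff pm.subspace_neg pm.subspace_scale
      pm.subspace_0 pm.subspace_sum)

lemma chains_mono: "K \<subseteq> L \<Longrightarrow> c \<in> chains n K \<Longrightarrow> c \<in> chains n L"
  by (auto simp: chains_def)

lemma dd_chains:
  fixes c :: "'v list \<Rightarrow>\<^sub>0 'k::field"
  assumes "simplicial K" "c \<in> chains (Suc n) K"
  shows "dd c \<in> chains n K"
  unfolding chains_def
proof (intro CollectI ballI)
  fix ys assume "ys \<in> keys (dd c)"
  then obtain xs where "xs \<in> keys c" "ys \<in> keys (bd xs :: 'v list \<Rightarrow>\<^sub>0 'k)"
    unfolding dd_def by (auto dest: in_keys_lin)
  moreover then have "length xs = Suc (Suc n)" "set xs \<in> K"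
    using assms by (auto simp: chains_def)
  ultimately show "length ys = Suc n \<and> set ys \<in> K"
    using keys_bd [of ys xs] simplicialD [OF assms(1)] by auto
qed

lemma dd_chains0: "c \<in> chains 0 K \<Longrightarrow> dd c = 0"
  by (rule dd_eq_0) (auto simp: chains_def)

lemma cycles_iff: "c \<in> cycles n K \<longleftrightarrow> c \<in> chains n K \<and> dd c = 0"
  by (auto simp: cycles_def boundary_eq_dd)

lemma boundaries_iff: "c \<in> boundaries n K \<longleftrightarrow> (\<exists>w\<in>chains (Suc n) K. c = dd w)"
  by (auto simp: boundaries_def boundary_eq_dd)

lemma boundariesI: "w \<in> chains (Suc n) K \<Longrightarrow> dd w = c \<Longrightarrow> c \<in> boundaries n K"
  by (auto simp: boundaries_iff)

lemma subspace_cycles: "pm.subspace (cycles n K)"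
  unfolding pm.subspace_def by (simp add: cycles_iff)

lemma subspace_boundaries: "pm.subspace (boundaries n K)"
  unfolding pm.subspace_def
proof (intro conjI ballI allI)
  show "0 \<in> boundaries n K"
    by (rule boundariesI [of 0]) auto
  show "p + q \<in> boundaries n K" if "p \<in> boundaries n K" "q \<in> boundaries n K" for p q
    using that unfolding boundaries_iff by (metis chains_ops(2) dd_simps(2))
  show "smul c p \<in> boundaries n K" if "p \<in> boundaries n K" for c p
    using that unfolding boundaries_iff by (metis chains_ops(5) dd_simps(5))
qed

lemma cycles_ops [simp]:
  "0 \<in> cycles n K" "p \<in> cycles n K \<Longrightarrow> q \<in> cycles n K \<Longrightarrow> p + q \<in> cycles n K"
  "p \<in> cycles n K \<Longrightarrow> q \<in> cycles n K \<Longrightarrow> p - q \<in> cycles n K"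
  "p \<in> cycles n K \<Longrightarrow> - p \<in> cycles n K" "p \<in> cycles n K \<Longrightarrow> smul c p \<in> cycles n K"
  "(\<And>i. i \<in> I \<Longrightarrow> f i \<in> cycles n K) \<Longrightarrow> (\<Sum>i\<in>I. f i) \<in> cycles n K"
  using subspace_cycles [of n K]
  by (auto intro: pm.subspace_add pm.subspace_diff pm.subspace_neg pm.subspace_scale
      pm.subspace_0 pm.subspace_sum)

lemma boundaries_ops [simp]:
  "0 \<in> boundaries n K" "p \<in> boundaries n K \<Longrightarrow> q \<in> boundaries n K \<Longrightarrow> p + q \<in> boundaries n K"
  "p \<in> boundaries n K \<Longrightarrow> q \<in> boundaries n K \<Longrightarrow> p - q \<in> boundaries n K"
  "p \<in> boundaries n K \<Longrightarrow> - p \<in> boundaries n K" "p \<in> boundaries n K \<Longrightarrow> smul c p \<in> boundaries n K"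
  "(\<And>i. i \<in> I \<Longrightarrow> f i \<in> boundaries n K) \<Longrightarrow> (\<Sum>i\<in>I. f i) \<in> boundaries n K"
  using subspace_boundaries [of n K]
  by (auto intro: pm.subspace_add pm.subspace_diff pm.subspace_neg pm.subspace_scale
      pm.subspace_0 pm.subspace_sum)

lemma cycles_mono: "K \<subseteq> L \<Longrightarrow> c \<in> cycles n K \<Longrightarrow> c \<in> cycles n L"
  by (auto simp: cycles_iff intro: chains_mono)

lemma boundaries_mono: "K \<subseteq> L \<Longrightarrow> c \<in> boundaries n K \<Longrightarrow> c \<in> boundaries n L"
  by (auto simp: boundaries_iff intro: chains_mono)

lemma boundaries_diff_trans:
  "p - q \<in> boundaries n K \<Longrightarrow> q - s \<in> boundaries n K \<Longrightarrow> p - s \<in> boundaries n K"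
  using boundaries_ops(2) [of "p - q" n K "q - s"] by simp

lemma boundaries_diff_sym: "p - q \<in> boundaries n K \<Longrightarrow> q - p \<in> boundaries n K"
  using boundaries_ops(4) [of "p - q" n K] by simp

lemma boundaries_diff_iff: "p - q \<in> boundaries n K \<Longrightarrow> p \<in> boundaries n K \<longleftrightarrow> q \<in> boundaries n K"
  using boundaries_ops(3) [of p n K "p - q"] boundaries_ops(2) [of "p - q" n K q] by auto

subsection \<open>Simplicial maps and contiguity\<close>

lemma push_bda: "push h (bda xs) = bda (map h xs)"
  by (induction xs) (auto simp: push_consm)

lemma push_dd:
  fixes c :: "'v list \<Rightarrow>\<^sub>0 'k::field"
  shows "push h (dd c) = dd (push h c)"
proof -
  have "push h (bd xs :: 'v list \<Rightarrow>\<^sub>0 'k) = bd (map h xs)" for xs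
    by (simp add: bd_def push_bda)
  then show ?thesis
    by (simp add: dd_def push_def lin_lin)
qed

lemma push_chains:
  assumes "\<And>S. S \<in> K \<Longrightarrow> h ` S \<in> L" "c \<in> chains n K"
  shows "push h c \<in> chains n L"
  using assms unfolding chains_def by (force dest!: in_keys_push)

lemma push_cycles:
  assumes "\<And>S. S \<in> K \<Longrightarrow> h ` S \<in> L" "c \<in> cycles n K"
  shows "push h c \<in> cycles n L"
  using assms push_chains [of K h L c n] by (simp add: cycles_iff flip: push_dd)

lemma push_boundaries:
  assumes "\<And>S. S \<in> K \<Longrightarrow> h ` S \<in> L" "c \<in> boundaries n K"
  shows "push h c \<in> boundaries n L"
  using assms by (auto simp: boundaries_iff push_dd intro!: bexI push_chains)

text \<open>The usual prism operator, the alternating sum of the tuples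
  \<open>f x0, ..., f xi, g xi, ..., g xn\<close>, as a recursion parallel to that of
  \<open>bda\<close>.\<close>

primrec prism :: "('v \<Rightarrow> 'w) \<Rightarrow> ('v \<Rightarrow> 'w) \<Rightarrow> 'v list \<Rightarrow> ('w list \<Rightarrow>\<^sub>0 'k::field)" where
  "prism f g [] = 0"
| "prism f g (x # xs) =
     single (f x # g x # map g xs) 1 - consm (f x) (prism f g xs)"

lemma lin_prism_consm:
  "lin (prism f g) (consm x c) = consm (f x) (consm (g x) (push g c)) - consm (f x) (lin (prism f g) c)"
proof -
  have "lin (prism f g) (consm x c)
      = lin (\<lambda>xs. single (f x # g x # map g xs) 1 - consm (f x) (prism f g xs)) c"
    by (simp add: consm_def lin_lin)
  also have "\<dots> = consm (f x) (consm (g x) (push g c)) - consm (f x) (lin (prism f g) c)"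
    by (simp add: lin_fun_diff) (simp add: consm_def push_def lin_lin)
  finally show ?thesis .
qed

lemma da_prism:
  "da (prism f g xs) =
     single (map g xs) 1 - single (map f xs) 1 - lin (prism f g) (bda xs)"
proof (induction xs)
  case Nil
  then show ?case by simp
next
  case (Cons x xs)
  show ?case
    by (simp add: da_consm Cons lin_prism_consm lin_simps push_bda algebra_simps)
qed

lemma keys_prism:
  fixes f :: "'v \<Rightarrow> 'w"
  shows "ys \<in> keys (prism f g xs :: 'w list \<Rightarrow>\<^sub>0 'k::field) \<Longrightarrow> length ys = Suc (length xs) \<and> set ys \<subseteq> f ` set xs \<union> g ` set xs"
proof (induction xs arbitrary: ys)
  case (Cons x xs)
  have "ys = f x # g x # map g xs \<or> ys \<in> keys (consm (f x) (prism f g xs) :: 'w list \<Rightarrow>\<^sub>0 'k)"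
    using Cons.prems by (auto simp: in_keys_iff lookup_minus lookup_single when_def split: if_splits)
  then show ?case
    using Cons.IH by (force dest!: in_keys_consm)
qed auto

text \<open>The prism chain of \<open>z\<close> fills the difference. Its tuples may repeat entries,
  as ordered chains allow, and they lie in \<open>L\<close> because \<open>f\<close> and
  \<open>g\<close> send each simplex into a common one.\<close>

lemma contiguous:
  fixes f :: "'v \<Rightarrow> 'w" and z :: "'v list \<Rightarrow>\<^sub>0 'k::field"
  assumes L: "simplicial L" and fg: "\<And>S. S \<in> K \<Longrightarrow> f ` S \<union> g ` S \<in> L" and z: "z \<in> cycles n K"
  shows "push g z - push f z \<in> boundaries n L"
proof (rule boundariesI)
  have circle_class: "z \<in> chains n K" and dz: "dd z = 0"
    using z by (auto simp: cycles_iff)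
  show *: "lin (prism f g) z \<in> chains (Suc n) L"
    unfolding chains_def
  proof (intro CollectI ballI)
    fix ys assume "ys \<in> keys (lin (prism f g) z)"
    then obtain xs where "xs \<in> keys z" "ys \<in> keys (prism f g xs :: 'w list \<Rightarrow>\<^sub>0 'k)"
      by (auto dest: in_keys_lin)
    moreover have "length xs = Suc n" "set xs \<in> K"
      using circle_class \<open>xs \<in> keys z\<close> by (auto simp: chains_def)
    ultimately show "length ys = Suc (Suc n) \<and> set ys \<in> L"
      using keys_prism [of ys f g xs] simplicialD [OF L fg, of "set xs" "set ys"]
      by (metis length_0_conv nat.distinct(1) set_empty)
  qed
  \<comment> \<open>The two boundaries differ at most by the empty tuple, which the prism operator
    kills; so \<open>da_prism\<close> also gives the unaugmented identity in degree 0.\<close>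
  have "lin (prism f g) (bda xs :: 'v list \<Rightarrow>\<^sub>0 'k) = lin (prism f g) (bd xs)" for xs
    by (cases xs) (auto simp: bd_def)
  then have 1: "lin (prism f g) (da z) = lin (prism f g) (dd z)"
    by (simp add: da_def dd_def lin_lin)
  have "dd (lin (prism f g) z) = da (lin (prism f g) z)"
    using * by (intro dd_eq_da) (auto simp: chains_def)
  also have "\<dots> = push g z - push f z - lin (prism f g) (da z)"
    by (simp add: da_def lin_lin da_prism [unfolded da_def] lin_fun_diff push_def)
  finally show "dd (lin (prism f g) z) = push g z - push f z"
    using 1 dz by simp
qed

subsection \<open>The cross product\<close>

text \<open>The Eilenberg-MacLane shuffle product: a signed sum over lattice paths from the first to
  the last pair of vertices, each step advancing one coordinate. Taking a \<open>y\<close>-step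
  first moves it past the \<open>length xs\<close> remaining \<open>x\<close>-steps, hence the sign.
  The value 0 on an empty tuple makes augmentation terms drop out.\<close>

fun shuffle :: "'a list \<Rightarrow> 'b list \<Rightarrow> (('a \<times> 'b) list \<Rightarrow>\<^sub>0 'k::field)" where
  "shuffle [] ys = 0"
| "shuffle (x # xs) [] = 0"
| "shuffle (x # xs) (y # ys) =
    (if xs = [] \<and> ys = [] then single [(x, y)] 1
     else consm (x, y) (shuffle xs (y # ys) + smul ((-1) ^ length xs) (shuffle (x # xs) ys)))"

lemma shuffle_Nil2 [simp]: "shuffle xs [] = 0"
  by (cases xs) auto

definition cross :: "('a list \<Rightarrow>\<^sub>0 'k::field) \<Rightarrow> ('b list \<Rightarrow>\<^sub>0 'k) \<Rightarrow> (('a \<times> 'b) list \<Rightarrow>\<^sub>0 'k)" where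
  "cross a b = lin (\<lambda>xs. lin (shuffle xs) b) a"

lemma cross_simps [simp]:
  "cross 0 b = 0" "cross a 0 = 0"
  "cross (a + a') b = cross a b + cross a' b" "cross a (b + b') = cross a b + cross a b'"
  "cross (a - a') b = cross a b - cross a' b" "cross a (b - b') = cross a b - cross a b'"
  "cross (smul c a) b = smul c (cross a b)" "cross a (smul c b) = smul c (cross a b)"
  "cross (\<Sum>i\<in>I. f i) b = (\<Sum>i\<in>I. cross (f i) b)"
  by (simp_all add: cross_def lin_simps lin_fun_add lin_fun_diff lin_fun_smul lin_fun_0)

lemma shuffle_singleton2: "xs \<noteq> [] \<Longrightarrow> shuffle xs [y] = single (map (\<lambda>x. (x, y)) xs) 1"
  by (induction xs) (auto simp: neq_Nil_conv)

lemma shuffle_singleton1: "ys \<noteq> [] \<Longrightarrow> shuffle [x] ys = single (map (Pair x) ys) 1"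
  by (induction ys) (auto simp: neq_Nil_conv)

lemma keys_shuffle:
  fixes xs :: "'a list" and ys :: "'b list"
  shows "zs \<in> keys (shuffle xs ys :: ('a \<times> 'b) list \<Rightarrow>\<^sub>0 'k::field) \<Longrightarrow>
    Suc (length zs) = length xs + length ys \<and> fst ` set zs \<subseteq> set xs \<and> snd ` set zs \<subseteq> set ys"
proof (induction xs ys arbitrary: zs rule: shuffle.induct)
  case (3 x xs y ys)
  show ?case
  proof (cases "xs = [] \<and> ys = []")
    case True
    then show ?thesis using "3.prems" by auto
  next
    case False
    let ?A = "shuffle xs (y # ys) :: ('a \<times> 'b) list \<Rightarrow>\<^sub>0 'k"
    let ?B = "shuffle (x # xs) ys :: ('a \<times> 'b) list \<Rightarrow>\<^sub>0 'k"
    have "zs \<in> keys (consm (x, y) (?A + smul ((-1) ^ length xs) ?B))"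
      using "3.prems" False by (metis shuffle.simps(3))
    then obtain us where us: "zs = (x, y) # us" "us \<in> keys (?A + smul ((-1) ^ length xs) ?B)"
      by (blast dest: in_keys_consm)
    then have "us \<in> keys ?A \<or> us \<in> keys ?B"
      by (auto simp: in_keys_iff lookup_add)
    then show ?thesis
    proof
      assume "us \<in> keys ?A"
      from "3.IH"(1) [OF False this] show ?thesis using us by auto
    next
      assume "us \<in> keys ?B"
      from "3.IH"(2) [OF False this] show ?thesis using us by auto
    qed
  qed
qed auto

lemma push_shuffle:
  fixes xs :: "'a list" and ys :: "'b list"
  shows "push (map_prod f g) (shuffle xs ys :: ('a \<times> 'b) list \<Rightarrow>\<^sub>0 'k::field) = shuffle (map f xs) (map g ys)"
  by (induction xs ys rule: shuffle.induct) (auto simp: push_consm)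

text \<open>The Leibniz rule, by induction along the recursion of \<open>shuffle\<close>. In the
  main case the two occurrences of \<open>shuffle xs ys\<close> from the induction hypotheses cancel
  by sign. Two one-entry tuples are excluded because there the left side is the empty tuple and the
  right side vanishes.\<close>

lemma da_shuffle:
  fixes xs :: "'a list" and ys :: "'b list"
  assumes "xs \<noteq> []" "ys \<noteq> []" "length xs + length ys > 2"
  shows "da (shuffle xs ys :: ('a \<times> 'b) list \<Rightarrow>\<^sub>0 'k::field) =
    lin (\<lambda>us. shuffle us ys) (bda xs) + smul ((-1) ^ (length xs - 1)) (lin (shuffle xs) (bda ys))"
  using assms
proof (induction xs ys rule: shuffle.induct)
  case (3 x xs y ys)
  have ne: "\<not> (xs = [] \<and> ys = [])"
    using "3.prems" by auto
  consider "ys = []" "xs \<noteq> []" | "xs = []" "ys \<noteq> []" | "xs \<noteq> []" "ys \<noteq> []"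
    using ne by auto
  then show ?case
  proof cases
    case 1
    have "lin (\<lambda>us. shuffle us [y]) (bda (x # xs) :: 'a list \<Rightarrow>\<^sub>0 'k) = push (\<lambda>x. (x, y)) (bda (x # xs))"
      unfolding push_def by (rule lin_cong, rule shuffle_singleton2) (use 1 keys_bda in fastforce)
    moreover have "(shuffle (x # xs) [y] :: ('a \<times> 'b) list \<Rightarrow>\<^sub>0 'k) = single (map (\<lambda>x. (x, y)) (x # xs)) 1"
      by (rule shuffle_singleton2) simp
    moreover have "lin (shuffle (x # xs)) (bda [y] :: 'b list \<Rightarrow>\<^sub>0 'k) = 0"
      by simp
    ultimately show ?thesis
      unfolding 1(1) by (simp add: push_bda del: shuffle.simps bda.simps list.map)
  next
    case 2
    have "lin (shuffle [x]) (bda (y # ys) :: 'b list \<Rightarrow>\<^sub>0 'k) = push (Pair x) (bda (y # ys))"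
      unfolding push_def by (rule lin_cong, rule shuffle_singleton1) (use 2 keys_bda in fastforce)
    moreover have "(shuffle [x] (y # ys) :: ('a \<times> 'b) list \<Rightarrow>\<^sub>0 'k) = single (map (Pair x) (y # ys)) 1"
      by (rule shuffle_singleton1) simp
    moreover have "lin (\<lambda>us. shuffle us (y # ys)) (bda [x] :: 'a list \<Rightarrow>\<^sub>0 'k) = 0"
      by simp
    ultimately show ?thesis
      unfolding 2(1) by (simp add: push_bda del: shuffle.simps bda.simps list.map)
  next
    case 3
    define e where "e = (-1 :: 'k) ^ length xs"
    have ee: "e * e = 1"
      by (simp add: e_def flip: power_add mult_2)
    have e1: "(-1 :: 'k) ^ (length xs - 1) = - e"
      using 3 by (cases xs) (auto simp: e_def)
    have l: "Suc 0 < length xs + length ys"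
      using 3 by (cases xs; cases ys) auto
    define T1 where "T1 = lin (\<lambda>us. shuffle us (y # ys)) (bda xs :: 'a list \<Rightarrow>\<^sub>0 'k)"
    define T2 where "T2 = lin (\<lambda>us. shuffle (x # us) ys) (bda xs :: 'a list \<Rightarrow>\<^sub>0 'k)"
    define T3 where "T3 = lin (\<lambda>vs. shuffle xs (y # vs)) (bda ys :: 'b list \<Rightarrow>\<^sub>0 'k)"
    define T4 where "T4 = lin (shuffle (x # xs)) (bda ys :: 'b list \<Rightarrow>\<^sub>0 'k)"
    define A where "A = shuffle xs (y # ys) + smul e (shuffle (x # xs) ys :: ('a \<times> 'b) list \<Rightarrow>\<^sub>0 'k)"
    have IH1: "da (shuffle xs (y # ys) :: ('a \<times> 'b) list \<Rightarrow>\<^sub>0 'k) = T1 + smul (- e) (shuffle xs ys - T3)"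
      using "3.IH"(1) [OF ne] 3 l e1 unfolding T1_def T3_def
      by (simp add: lin_simps consm_def lin_lin)
    have IH2: "da (shuffle (x # xs) ys :: ('a \<times> 'b) list \<Rightarrow>\<^sub>0 'k) = shuffle xs ys - T2 + smul e T4"
      using "3.IH"(2) [OF ne] 3 l unfolding T2_def T4_def
      by (simp add: lin_simps consm_def lin_lin e_def)
    have dA: "da A = T1 + smul e T3 - smul e T2 + T4"
      unfolding A_def
      by (simp add: IH1 IH2 ee pm.scale_right_distrib pm.scale_right_diff_distrib)
    have L1: "lin (\<lambda>us. shuffle (x # us) (y # ys)) (bda xs :: 'a list \<Rightarrow>\<^sub>0 'k) = consm (x, y) (T1 - smul e T2)"
    proof -
      have "shuffle (x # us) (y # ys) = consm (x, y) (shuffle us (y # ys) - smul e (shuffle (x # us) ys :: ('a \<times> 'b) list \<Rightarrow>\<^sub>0 'k))"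
        if "us \<in> keys (bda xs :: 'a list \<Rightarrow>\<^sub>0 'k)" for us
      proof -
        have "length us = length xs - 1" using keys_bda [OF that] by auto
        then show ?thesis using e1 3 by simp
      qed
      then have "lin (\<lambda>us. shuffle (x # us) (y # ys)) (bda xs :: 'a list \<Rightarrow>\<^sub>0 'k) =
          lin (\<lambda>us. consm (x, y) (shuffle us (y # ys) - smul e (shuffle (x # us) ys))) (bda xs)"
        by (rule lin_cong)
      also have "\<dots> = consm (x, y) (T1 - smul e T2)"
        unfolding T1_def T2_def by (simp add: lin_fun_diff lin_fun_smul) (simp add: consm_def lin_lin)
      finally show ?thesis .
    qed
    have L2: "lin (\<lambda>vs. shuffle (x # xs) (y # vs)) (bda ys :: 'b list \<Rightarrow>\<^sub>0 'k) = consm (x, y) (T3 + smul e T4)"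
    proof -
      have "lin (\<lambda>vs. shuffle (x # xs) (y # vs)) (bda ys :: 'b list \<Rightarrow>\<^sub>0 'k) =
          lin (\<lambda>vs. consm (x, y) (shuffle xs (y # vs) + smul e (shuffle (x # xs) vs))) (bda ys)"
        by (rule lin_cong) (use 3 in \<open>simp add: e_def\<close>)
      also have "\<dots> = consm (x, y) (T3 + smul e T4)"
        unfolding T3_def T4_def by (simp add: lin_fun_add lin_fun_smul) (simp add: consm_def lin_lin)
      finally show ?thesis .
    qed
    have D: "da (shuffle (x # xs) (y # ys) :: ('a \<times> 'b) list \<Rightarrow>\<^sub>0 'k) = A - consm (x, y) (da A)"
      using ne by (simp only: shuffle.simps if_False da_consm A_def e_def)
    have R1: "lin (\<lambda>us. shuffle us (y # ys)) (bda (x # xs) :: 'a list \<Rightarrow>\<^sub>0 'k)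
        = shuffle xs (y # ys) - consm (x, y) (T1 - smul e T2)"
      unfolding L1 [symmetric] by (simp add: lin_simps consm_def lin_lin del: shuffle.simps)
    have R2: "lin (shuffle (x # xs)) (bda (y # ys) :: 'b list \<Rightarrow>\<^sub>0 'k)
        = shuffle (x # xs) ys - consm (x, y) (T3 + smul e T4)"
      unfolding L2 [symmetric] by (simp add: lin_simps consm_def lin_lin del: shuffle.simps)
    have len: "(-1 :: 'k) ^ (length (x # xs) - 1) = e"
      by (simp add: e_def)
    show ?thesis
      unfolding D R1 R2 dA len
      by (simp add: A_def ee pm.scale_right_distrib pm.scale_right_diff_distrib algebra_simps del: shuffle.simps)
  qed
qed auto

lemma dd_cross:
  fixes a :: "'a list \<Rightarrow>\<^sub>0 'k::field" and b :: "'b list \<Rightarrow>\<^sub>0 'k"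
  assumes "a \<in> chains p M" "b \<in> chains q K"
  shows "dd (cross a b) = cross (dd a) b + smul ((-1) ^ p) (cross a (dd b))"
proof -
  have *: "dd (shuffle xs ys :: ('a \<times> 'b) list \<Rightarrow>\<^sub>0 'k) =
      lin (\<lambda>us. shuffle us ys) (bd xs) + smul ((-1) ^ p) (lin (shuffle xs) (bd ys))"
    if "xs \<in> keys a" "ys \<in> keys b" for xs ys
  proof -
    have l: "length xs = Suc p" "length ys = Suc q"
      using that assms by (auto simp: chains_def)
    \<comment> \<open>\<open>shuffle\<close> vanishes on the empty tuple, so the augmented boundary
      of a factor may replace the unaugmented one.\<close>
    have bd1: "lin (\<lambda>us. shuffle us ys) (bd xs :: 'a list \<Rightarrow>\<^sub>0 'k) = lin (\<lambda>us. shuffle us ys) (bda xs)"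
      using l by (cases xs) (auto simp: bd_def)
    have bd2: "lin (shuffle xs) (bd ys :: 'b list \<Rightarrow>\<^sub>0 'k) = lin (shuffle xs) (bda ys)"
      using l by (cases ys) (auto simp: bd_def)
    show ?thesis
    proof (cases "p = 0 \<and> q = 0")
      case True
      then have "dd (shuffle xs ys :: ('a \<times> 'b) list \<Rightarrow>\<^sub>0 'k) = 0"
        using l by (intro dd_eq_0) (auto dest!: keys_shuffle)
      then show ?thesis using True l by (simp add: bd_def)
    next
      case False
      have "dd (shuffle xs ys :: ('a \<times> 'b) list \<Rightarrow>\<^sub>0 'k) = da (shuffle xs ys)"
        using l False by (intro dd_eq_da) (auto dest!: keys_shuffle)
      also have "\<dots> = lin (\<lambda>us. shuffle us ys) (bda xs) + smul ((-1) ^ (length xs - 1)) (lin (shuffle xs) (bda ys))"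
        by (rule da_shuffle) (use l False in auto)
      finally show ?thesis using l by (simp add: bd1 bd2)
    qed
  qed
  have "dd (cross a b) = lin (\<lambda>xs. lin (\<lambda>ys. dd (shuffle xs ys)) b) a"
    by (simp add: dd_def cross_def lin_lin)
  also have "\<dots> = lin (\<lambda>xs. lin (\<lambda>ys. lin (\<lambda>us. shuffle us ys) (bd xs) + smul ((-1) ^ p) (lin (shuffle xs) (bd ys))) b) a"
    by (intro lin_cong *)
  also have "\<dots> = cross (dd a) b + smul ((-1) ^ p) (cross a (dd b))"
  proof -
    have "lin (\<lambda>ys. lin (\<lambda>us. shuffle us ys) (bd xs :: 'a list \<Rightarrow>\<^sub>0 'k)) b =
        lin (\<lambda>us. lin (shuffle us) b) (bd xs)" for xs
      by (rule lin_swap)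
    then show ?thesis
      unfolding lin_fun_add lin_fun_smul by (simp add: dd_def cross_def lin_lin)
  qed
  finally show ?thesis .
qed

text \<open>The binary counterpart of \<open>product_complex\<close>, with pairs as vertices. For
  simplicial factors the simplices are automatically finite and nonempty.\<close>

definition prod_complex :: "'a set set \<Rightarrow> 'b set set \<Rightarrow> ('a \<times> 'b) set set" where
  "prod_complex M K = {S. fst ` S \<in> M \<and> snd ` S \<in> K}"

lemma simplicial_prod_complex:
  assumes "simplicial M" "simplicial K"
  shows "simplicial (prod_complex M K)"
  unfolding simplicial_def
proof (intro ballI conjI allI impI)
  fix S assume "S \<in> prod_complex M K"
  then have S: "fst ` S \<in> M" "snd ` S \<in> K" by (auto simp: prod_complex_def)
  have "S \<subseteq> fst ` S \<times> snd ` S" by (simp add: subset_fst_snd)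
  then show "finite S"
    using simplicial_fin [OF assms(1) S(1)] simplicial_fin [OF assms(2) S(2)] finite_subset by blast
  show "S \<noteq> {}" using simplicial_fin [OF assms(1) S(1)] by auto
  fix T assume "T \<subseteq> S" "T \<noteq> {}"
  then show "T \<in> prod_complex M K"
    using simplicialD [OF assms(1) S(1), of "fst ` T"] simplicialD [OF assms(2) S(2), of "snd ` T"]
    by (auto simp: prod_complex_def image_mono)
qed

lemma cross_chains:
  fixes a :: "'a list \<Rightarrow>\<^sub>0 'k::field" and b :: "'b list \<Rightarrow>\<^sub>0 'k"
  assumes "simplicial M" "simplicial K" "a \<in> chains p M" "b \<in> chains q K"
  shows "cross a b \<in> chains (p + q) (prod_complex M K)"
  unfolding chains_def
proof (intro CollectI ballI)
  fix zs assume "zs \<in> keys (cross a b)"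
  then obtain xs where xs: "xs \<in> keys a" "zs \<in> keys (lin (shuffle xs) b :: ('a \<times> 'b) list \<Rightarrow>\<^sub>0 'k)"
    unfolding cross_def by (auto dest: in_keys_lin)
  then obtain ys where ys: "ys \<in> keys b" "zs \<in> keys (shuffle xs ys :: ('a \<times> 'b) list \<Rightarrow>\<^sub>0 'k)"
    by (auto dest: in_keys_lin)
  have l: "length xs = Suc p" "set xs \<in> M" "length ys = Suc q" "set ys \<in> K"
    using assms xs ys by (auto simp: chains_def)
  then show "length zs = Suc (p + q) \<and> set zs \<in> prod_complex M K"
    using keys_shuffle [OF ys(2)] simplicialD [OF assms(1) l(2), of "fst ` set zs"]
      simplicialD [OF assms(2) l(4), of "snd ` set zs"]
    by (cases zs) (auto simp: prod_complex_def)
qed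

lemma push_cross: "push (map_prod f g) (cross a b) = cross (push f a) (push g b)"
proof -
  have "push (map_prod f g) (cross a b) = lin (\<lambda>xs. lin (\<lambda>ys. push (map_prod f g) (shuffle xs ys)) b) a"
    by (simp add: push_def cross_def lin_lin)
  also have "\<dots> = cross (push f a) (push g b)"
    unfolding push_shuffle by (simp add: push_def cross_def lin_lin)
  finally show ?thesis .
qed

lemma cross_vertex: "a \<in> chains n M \<Longrightarrow> cross a (single [v] 1) = push (\<lambda>x. (x, v)) a"
  unfolding cross_def push_def
  by (rule lin_cong) (auto simp: chains_def intro!: shuffle_singleton2)

lemma cross_cycles:
  "simplicial M \<Longrightarrow> simplicial K \<Longrightarrow> a \<in> cycles p M \<Longrightarrow> b \<in> cycles q K \<Longrightarrow> cross a b \<in> cycles (p + q) (prod_complex M K)"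
  by (auto simp: cycles_iff cross_chains dd_cross)

lemma cross_boundaries1:
  assumes "simplicial M" "simplicial K" "a \<in> boundaries p M" "b \<in> cycles q K"
  shows "cross a b \<in> boundaries (p + q) (prod_complex M K)"
proof -
  obtain w where w: "w \<in> chains (Suc p) M" "a = dd w"
    using assms by (auto simp: boundaries_iff)
  show ?thesis
    by (rule boundariesI [of "cross w b"])
      (use w assms cross_chains [of M K w "Suc p" b q] in \<open>auto simp: cycles_iff dd_cross\<close>)
qed

lemma cross_boundaries2:
  assumes "simplicial M" "simplicial K" "a \<in> cycles p M" "b \<in> boundaries q K"
  shows "cross a b \<in> boundaries (p + q) (prod_complex M K)"
proof -
  obtain w where w: "w \<in> chains (Suc q) K" "b = dd w"
    using assms by (auto simp: boundaries_iff)
  have "smul ((-1) ^ p) (cross a b) \<in> boundaries (p + q) (prod_complex M K)"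
    by (rule boundariesI [of "cross a w"])
      (use w assms cross_chains [of M K a p w "Suc q"] in \<open>auto simp: cycles_iff dd_cross\<close>)
  then have "smul ((-1) ^ p) (smul ((-1) ^ p) (cross a b)) \<in> boundaries (p + q) (prod_complex M K)"
    by (rule boundaries_ops)
  then show ?thesis by (simp flip: power_add mult_2)
qed

section \<open>Mayer-Vietoris arguments relative to a second factor\<close>

text \<open>Each tuple of the chain spans a simplex of \<open>P\<close> or of \<open>Q\<close>, so
  it suffices to sort the terms.\<close>

lemma chains_Un:
  assumes "c \<in> chains n (P \<union> Q)"
  obtains u v where "u \<in> chains n P" "v \<in> chains n Q" "c = u + v"
proof
  let ?u = "lin (\<lambda>xs. if set xs \<in> P then single xs 1 else 0) c"
  let ?v = "lin (\<lambda>xs. if set xs \<in> P then 0 else single xs 1) c"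
  show "?u \<in> chains n P" "?v \<in> chains n Q"
    using assms unfolding chains_def by (auto dest!: in_keys_lin split: if_splits)
  have "?u + ?v = lin (\<lambda>xs. single xs 1) c"
    unfolding lin_fun_add [symmetric] by (rule lin_cong) auto
  then show "c = ?u + ?v" by simp
qed

lemma chains_Int: "c \<in> chains n P \<Longrightarrow> c \<in> chains n Q \<Longrightarrow> c \<in> chains n (P \<inter> Q)"
  by (auto simp: chains_def)

lemma simplicial_Int: "simplicial P \<Longrightarrow> simplicial Q \<Longrightarrow> simplicial (P \<inter> Q)"
  unfolding simplicial_def by blast

lemma simplicial_Un: "simplicial P \<Longrightarrow> simplicial Q \<Longrightarrow> simplicial (P \<union> Q)"
  unfolding simplicial_def by blast

lemma prod_complex_Un: "prod_complex M (U \<union> V) = prod_complex M U \<union> prod_complex M V"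
  by (auto simp: prod_complex_def)

lemma prod_complex_Int: "prod_complex M (U \<inter> V) = prod_complex M U \<inter> prod_complex M V"
  by (auto simp: prod_complex_def)

lemma prod_complex_mono: "K \<subseteq> L \<Longrightarrow> prod_complex M K \<subseteq> prod_complex M L"
  by (auto simp: prod_complex_def)

text \<open>The map \<open>r\<close> acts as the identity on homology. For the retraction onto a
  slice \<open>M \<times> {v}\<close> this says that the slice carries all classes, and it is
  expressed without quotients.\<close>

definition acyclic_along :: "'k::field itself \<Rightarrow> 'v set set \<Rightarrow> ('v \<Rightarrow> 'v) \<Rightarrow> bool" where
  "acyclic_along _ P r \<longleftrightarrow>
     (\<forall>n. \<forall>z :: 'v list \<Rightarrow>\<^sub>0 'k. z \<in> cycles n P \<longrightarrow> z - push r z \<in> boundaries n P)"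

lemma acyclic_alongD:
  fixes z :: "'v list \<Rightarrow>\<^sub>0 'k::field"
  shows "acyclic_along TYPE('k) P r \<Longrightarrow> z \<in> cycles n P \<Longrightarrow> z - push r z \<in> boundaries n P"
  by (simp add: acyclic_along_def)

text \<open>The chain \<open>dd u\<close> represents the image of \<open>z\<close> under the
  connecting homomorphism of Mayer-Vietoris.\<close>

lemma mv_split:
  fixes z :: "'v list \<Rightarrow>\<^sub>0 'k::field"
  assumes P: "simplicial P" and Q: "simplicial Q" and z: "z \<in> cycles n (P \<union> Q)"
  obtains u v where "u \<in> chains n P" "v \<in> chains n Q" "z = u + v" "dd v = - dd u"
    "\<And>m. n = Suc m \<Longrightarrow> dd u \<in> cycles m (P \<inter> Q)"
proof -
  obtain u v where uv: "u \<in> chains n P" "v \<in> chains n Q" "z = u + v"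
    using z chains_Un by (metis cycles_iff)
  have dz: "dd v = - dd u"
    using z uv by (simp add: cycles_iff eq_neg_iff_add_eq_0 add.commute)
  have "dd u \<in> cycles m (P \<inter> Q)" if "n = Suc m" for m
  proof -
    have "dd u \<in> chains m P" "dd v \<in> chains m Q"
      using uv that dd_chains P Q by blast+
    then have "dd u \<in> chains m Q"
      using dz chains_ops(4) [of "dd v" m Q] by simp
    then show ?thesis
      using \<open>dd u \<in> chains m P\<close> by (simp add: cycles_iff chains_Int)
  qed
  then show thesis
    using that uv dz by blast
qed

text \<open>When the intersection is acyclic along \<open>r\<close>, the connecting cycle is filled
  by \<open>w\<close> up to its retraction. In degree 0 the connecting term vanishes and
  \<open>w = 0\<close>.\<close>

lemma mv_split_acyclic_along:
  fixes z :: "'v list \<Rightarrow>\<^sub>0 'k::field"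
  assumes P: "simplicial P" and Q: "simplicial Q" and z: "z \<in> cycles n (P \<union> Q)"
    and acyclic_along: "acyclic_along TYPE('k) (P \<inter> Q) r"
  obtains u v w where "u \<in> chains n P" "v \<in> chains n Q" "w \<in> chains n (P \<inter> Q)" "z = u + v"
    "dd v = - dd u" "dd u - push r (dd u) = dd w"
proof -
  obtain u v where uv: "u \<in> chains n P" "v \<in> chains n Q" "z = u + v" "dd v = - dd u"
    and y: "\<And>m. n = Suc m \<Longrightarrow> dd u \<in> cycles m (P \<inter> Q)"
    using mv_split [OF P Q z] by metis
  show thesis
  proof (cases n)
    case 0
    then have "dd u = 0" using uv dd_chains0 by blast
    then show thesis using that [of u v 0] uv by simp
  next
    case (Suc m)
    then have "dd u - push r (dd u) \<in> boundaries m (P \<inter> Q)"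
      using acyclic_alongD [OF acyclic_along y] by blast
    then show thesis using that uv Suc by (auto simp: boundaries_iff)
  qed
qed

lemma acyclic_along_Un:
  assumes P: "simplicial P" and Q: "simplicial Q" and aP: "acyclic_along TYPE('k::field) P r" and aQ: "acyclic_along TYPE('k) Q r"
    and aPQ: "acyclic_along TYPE('k) (P \<inter> Q) r"
    and r: "\<And>S. S \<in> P \<union> Q \<Longrightarrow> r ` S \<in> P \<inter> Q" and rr: "r \<circ> r = r"
  shows "acyclic_along TYPE('k) (P \<union> Q) r"
  unfolding acyclic_along_def
proof (intro allI impI)
  fix n and z :: "'a list \<Rightarrow>\<^sub>0 'k" assume "z \<in> cycles n (P \<union> Q)"
  then obtain u v w where uvw: "u \<in> chains n P" "v \<in> chains n Q" "w \<in> chains n (P \<inter> Q)" "z = u + v"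
    "dd v = - dd u" "dd u - push r (dd u) = dd w"
    using mv_split_acyclic_along [OF P Q _ aPQ] by metis
  have ru: "push r u \<in> chains n P" "push r v \<in> chains n Q"
    using uvw r by (auto intro: push_chains [of P] push_chains [of Q])
  \<comment> \<open>Since \<open>dd w = dd u - push r (dd u)\<close>, subtracting \<open>w\<close>
    from \<open>u - push r u\<close> leaves a cycle of \<open>P\<close>, and adding it to
    \<open>v - push r v\<close> leaves one of \<open>Q\<close>. In the sum \<open>w\<close> cancels,
    and the retracted parts cancel because \<open>r \<circ> r = r\<close>.\<close>
  define u' where "u' = u - push r u - w"
  define v' where "v' = v - push r v + w"
  have w: "w \<in> chains n P" "w \<in> chains n Q"
    using uvw by (auto intro: chains_mono)
  have "u' \<in> cycles n P" "v' \<in> cycles n Q"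
    using uvw(1,2,5) ru w by (simp_all add: cycles_iff u'_def v'_def uvw(6) [symmetric] flip: push_dd)
  then have "u' - push r u' \<in> boundaries n (P \<union> Q)" "v' - push r v' \<in> boundaries n (P \<union> Q)"
    using acyclic_alongD [OF aP] acyclic_alongD [OF aQ] by (meson boundaries_mono sup_ge1 sup_ge2)+
  then have "(u' - push r u') + (v' - push r v') \<in> boundaries n (P \<union> Q)"
    by simp
  moreover have "(u' - push r u') + (v' - push r v') = z - push r z"
    using uvw by (simp add: u'_def v'_def rr)
  ultimately show "z - push r z \<in> boundaries n (P \<union> Q)" by simp
qed

text \<open>The part of \<open>z\<close> in \<open>Q\<close> is corrected to a cycle of
  \<open>Q\<close>, which is homologous to its retraction. The retraction lies in the intersection,
  so exchanging the two leaves a cycle of \<open>P\<close>.\<close>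

lemma mv_surj:
  fixes z :: "'v list \<Rightarrow>\<^sub>0 'k::field"
  assumes P: "simplicial P" and Q: "simplicial Q" and aQ: "acyclic_along TYPE('k) Q r" and aPQ: "acyclic_along TYPE('k) (P \<inter> Q) r"
    and r: "\<And>S. S \<in> Q \<Longrightarrow> r ` S \<in> P \<inter> Q" and rr: "r \<circ> r = r"
    and z: "z \<in> cycles n (P \<union> Q)"
  obtains z' where "z' \<in> cycles n P" "z - z' \<in> boundaries n (P \<union> Q)"
proof -
  obtain u v w where uvw: "u \<in> chains n P" "v \<in> chains n Q" "w \<in> chains n (P \<inter> Q)" "z = u + v"
    "dd v = - dd u" "dd u - push r (dd u) = dd w"
    using mv_split_acyclic_along [OF P Q z aPQ] by metis
  have w: "w \<in> chains n P" "w \<in> chains n Q"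
    using uvw by (auto intro: chains_mono)
  have rv: "push r v \<in> chains n (P \<inter> Q)" "push r w \<in> chains n (P \<inter> Q)"
    using uvw w r by (auto intro: push_chains [of Q])
  then have rv': "push r v \<in> chains n P" "push r w \<in> chains n P" "push r v \<in> chains n Q"
    by (auto intro: chains_mono)
  define v' where "v' = v - push r v + w"
  have v': "v' \<in> cycles n Q"
    using uvw(1,2,5) rv' w by (simp add: cycles_iff v'_def uvw(6) [symmetric] flip: push_dd)
  have b: "v' - push r v' \<in> boundaries n (P \<union> Q)"
    using acyclic_alongD [OF aQ v'] by (meson boundaries_mono sup_ge2)
  define z' where "z' = z - (v' - push r v')"
  have "z' = u + push r v - w + push r w"
    using uvw by (simp add: z'_def v'_def rr)
  then have "z' \<in> chains n P"
    using uvw w rv' by simp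
  moreover have "dd z' = 0"
    using z v' by (simp add: z'_def cycles_iff flip: push_dd)
  ultimately show thesis
    using that [of z'] b by (simp add: z'_def cycles_iff)
qed

text \<open>If \<open>z = dd (u + v)\<close>, then \<open>dd v\<close> is a cycle of the
  intersection, hence \<open>push r (dd v)\<close> plus the boundary of some \<open>w\<close>. So
  \<open>w + push r v\<close>, a chain of \<open>P\<close>, replaces \<open>v\<close> in the
  filling.\<close>

lemma mv_inj:
  fixes z :: "'v list \<Rightarrow>\<^sub>0 'k::field"
  assumes P: "simplicial P" and Q: "simplicial Q" and aPQ: "acyclic_along TYPE('k) (P \<inter> Q) r"
    and r: "\<And>S. S \<in> Q \<Longrightarrow> r ` S \<in> P \<inter> Q"
    and z: "z \<in> cycles n P" and b: "z \<in> boundaries n (P \<union> Q)"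
  shows "z \<in> boundaries n P"
proof -
  obtain c where c: "c \<in> chains (Suc n) (P \<union> Q)" "z = dd c"
    using b by (auto simp: boundaries_iff)
  obtain u v where uv: "u \<in> chains (Suc n) P" "v \<in> chains (Suc n) Q" "c = u + v"
    using c chains_Un by metis
  have "dd v = z - dd u" using c uv by simp
  then have "dd v \<in> chains n P"
    using z uv dd_chains [OF P uv(1)] by (simp add: cycles_iff)
  then have "dd v \<in> cycles n (P \<inter> Q)"
    using dd_chains [OF Q uv(2)] uv by (simp add: cycles_iff chains_Int)
  then obtain w where w: "w \<in> chains (Suc n) (P \<inter> Q)" "dd v - push r (dd v) = dd w"
    using acyclic_alongD [OF aPQ] by (metis boundaries_iff)
  have "push r v \<in> chains (Suc n) (P \<inter> Q)"
    using uv r by (auto intro: push_chains [of Q])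
  then have "u + w + push r v \<in> chains (Suc n) P"
    using uv w by (meson chains_mono chains_ops(2) inf_le1)
  moreover have "dd (u + w + push r v) = z"
    using c uv w by (simp add: push_dd [symmetric] flip: w(2))
  ultimately show ?thesis by (rule boundariesI)
qed

section \<open>Acyclic factors and inclusions inducing isomorphisms\<close>

definition retract_snd :: "'b \<Rightarrow> 'a \<times> 'b \<Rightarrow> 'a \<times> 'b" where "retract_snd v p = (fst p, v)"

lemma retract_snd_retract_snd [simp]: "retract_snd v \<circ> retract_snd w = retract_snd v"
  by (auto simp: retract_snd_def)

lemma retract_snd_map_prod: "retract_snd v = map_prod id (\<lambda>_. v)"
  by (auto simp: retract_snd_def)

lemma retract_snd_prod_complex: "S \<in> prod_complex M K \<Longrightarrow> {v} \<in> L \<Longrightarrow> simplicial M \<Longrightarrow> retract_snd v ` S \<in> prod_complex M L"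
proof -
  assume S: "S \<in> prod_complex M K" and v: "{v} \<in> L" and M: "simplicial M"
  then have "S \<noteq> {}" using simplicial_fin [OF M] by (force simp: prod_complex_def)
  then have "snd ` retract_snd v ` S = {v}" "fst ` retract_snd v ` S = fst ` S"
    by (auto simp: retract_snd_def image_image)
  then show ?thesis using S v by (simp add: prod_complex_def)
qed

text \<open>\<open>acyclic_factor k M K\<close>: the projection \<open>M \<times> K \<rightarrow> M\<close> induces an isomorphism in homology.
  \<open>inclusion_iso k M K L\<close>: the inclusion \<open>M \<times> K \<subseteq> M \<times> L\<close> does.\<close>

definition acyclic_factor :: "'k::field itself \<Rightarrow> 'a set set \<Rightarrow> 'b set set \<Rightarrow> bool" where
  "acyclic_factor k M K \<longleftrightarrow> (\<exists>v. {v} \<in> K) \<and> (\<forall>v. {v} \<in> K \<longrightarrow> acyclic_along k (prod_complex M K) (retract_snd v))"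

definition inclusion_iso :: "'k::field itself \<Rightarrow> 'a set set \<Rightarrow> 'b set set \<Rightarrow> 'b set set \<Rightarrow> bool" where
  "inclusion_iso _ M K L \<longleftrightarrow>
     (\<forall>n. \<forall>z :: ('a \<times> 'b) list \<Rightarrow>\<^sub>0 'k. z \<in> cycles n (prod_complex M L) \<longrightarrow>
        (\<exists>z'\<in>cycles n (prod_complex M K). z - z' \<in> boundaries n (prod_complex M L))) \<and>
     (\<forall>n. \<forall>z :: ('a \<times> 'b) list \<Rightarrow>\<^sub>0 'k. z \<in> cycles n (prod_complex M K) \<longrightarrow>
        z \<in> boundaries n (prod_complex M L) \<longrightarrow> z \<in> boundaries n (prod_complex M K))"

lemma inclusion_iso_surj:
  fixes z :: "('a \<times> 'b) list \<Rightarrow>\<^sub>0 'k::field"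
  assumes "inclusion_iso TYPE('k) M K L" "z \<in> cycles n (prod_complex M L)"
  obtains z' where "z' \<in> cycles n (prod_complex M K)" "z - z' \<in> boundaries n (prod_complex M L)"
  using assms unfolding inclusion_iso_def by blast

lemma inclusion_iso_inj:
  fixes z :: "('a \<times> 'b) list \<Rightarrow>\<^sub>0 'k::field"
  shows "inclusion_iso TYPE('k) M K L \<Longrightarrow> z \<in> cycles n (prod_complex M K) \<Longrightarrow>
    z \<in> boundaries n (prod_complex M L) \<Longrightarrow> z \<in> boundaries n (prod_complex M K)"
  unfolding inclusion_iso_def by blast

text \<open>Applying the hypothesis to the cycle \<open>push (retract_snd w) z\<close> compares the
  retractions to \<open>v\<close> and to \<open>w\<close>, so one vertex settles all.\<close>

lemma acyclic_factor_intro: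
  assumes M: "simplicial M" and v: "{v} \<in> K" and a: "acyclic_along TYPE('k::field) (prod_complex M K) (retract_snd v)"
  shows "acyclic_factor TYPE('k) M K"
  unfolding acyclic_factor_def
proof (intro conjI allI impI)
  show "\<exists>v. {v} \<in> K" using v by blast
  fix w assume w: "{w} \<in> K"
  show "acyclic_along TYPE('k) (prod_complex M K) (retract_snd w)"
    unfolding acyclic_along_def
  proof (intro allI impI)
    fix n and z :: "('a \<times> 'b) list \<Rightarrow>\<^sub>0 'k" assume z: "z \<in> cycles n (prod_complex M K)"
    have "push (retract_snd w) z \<in> cycles n (prod_complex M K)"
      by (rule push_cycles [OF retract_snd_prod_complex [OF _ w M] z])
    from acyclic_alongD [OF a this] have "push (retract_snd v) z - push (retract_snd w) z \<in> boundaries n (prod_complex M K)"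
      using boundaries_diff_sym by fastforce
    with acyclic_alongD [OF a z] show "z - push (retract_snd w) z \<in> boundaries n (prod_complex M K)"
      using boundaries_diff_trans by blast
  qed
qed

text \<open>A cone point makes the identity contiguous to the constant map, here simultaneously over
  all of \<open>M\<close>.\<close>

lemma acyclic_factor_cone:
  assumes M: "simplicial M" and K: "simplicial K" and ne: "K \<noteq> {}" and cone: "\<And>S. S \<in> K \<Longrightarrow> insert v S \<in> K"
  shows "acyclic_factor TYPE('k::field) M K"
proof (rule acyclic_factor_intro [OF M])
  show v: "{v} \<in> K"
    using ne cone simplicialD [OF K, of _ "{v}"] by blast
  show "acyclic_along TYPE('k) (prod_complex M K) (retract_snd v)"
    unfolding acyclic_along_def
  proof (intro allI impI)
    fix n and z :: "('a \<times> 'b) list \<Rightarrow>\<^sub>0 'k" assume z: "z \<in> cycles n (prod_complex M K)"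
    have "push id z - push (retract_snd v) z \<in> boundaries n (prod_complex M K)"
    proof (rule contiguous [OF simplicial_prod_complex [OF M K] _ z])
      fix S assume "S \<in> prod_complex M K"
      then have S: "fst ` S \<in> M" "snd ` S \<in> K" by (auto simp: prod_complex_def)
      then have "S \<noteq> {}" using simplicial_fin [OF M] by auto
      then have "snd ` (retract_snd v ` S \<union> id ` S) = insert v (snd ` S)" "fst ` (retract_snd v ` S \<union> id ` S) = fst ` S"
        by (auto simp: retract_snd_def image_Un image_image)
      then show "retract_snd v ` S \<union> id ` S \<in> prod_complex M K"
        using S cone by (simp add: prod_complex_def)
    qed
    moreover have "push id z = z" by (simp add: push_ident)
    ultimately show "z - push (retract_snd v) z \<in> boundaries n (prod_complex M K)" by simp
  qed
qed

lemma acyclic_factor_Un: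
  assumes M: "simplicial M" and U: "simplicial U" and V: "simplicial V"
    and a: "acyclic_factor TYPE('k::field) M U" "acyclic_factor TYPE('k) M V" "acyclic_factor TYPE('k) M (U \<inter> V)"
  shows "acyclic_factor TYPE('k) M (U \<union> V)"
proof -
  obtain v where v: "{v} \<in> U \<inter> V"
    using a(3) by (auto simp: acyclic_factor_def)
  have "acyclic_along TYPE('k) (prod_complex M U \<union> prod_complex M V) (retract_snd v)"
  proof (rule acyclic_along_Un [OF simplicial_prod_complex [OF M U] simplicial_prod_complex [OF M V]])
    show "acyclic_along TYPE('k) (prod_complex M U) (retract_snd v)" "acyclic_along TYPE('k) (prod_complex M V) (retract_snd v)"
      using a v by (auto simp: acyclic_factor_def)
    show "acyclic_along TYPE('k) (prod_complex M U \<inter> prod_complex M V) (retract_snd v)"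
      using a v unfolding acyclic_factor_def by (simp add: prod_complex_Int)
    show "retract_snd v ` S \<in> prod_complex M U \<inter> prod_complex M V" if "S \<in> prod_complex M U \<union> prod_complex M V" for S
      using that v retract_snd_prod_complex [OF _ v M, of S U] retract_snd_prod_complex [OF _ v M, of S V] by (auto simp: prod_complex_Int)
  qed simp
  then show ?thesis
    using v by (intro acyclic_factor_intro [OF M, of v]) (auto simp: prod_complex_Un)
qed

text \<open>This is how a complex grows: \<open>V\<close> will be the star of a new edge, and its
  intersection with the old complex the suspension of the link.\<close>

lemma inclusion_iso_Un:
  assumes M: "simplicial M" and K: "simplicial K" and V: "simplicial V"
    and a: "acyclic_factor TYPE('k::field) M V" "acyclic_factor TYPE('k) M (K \<inter> V)"
  shows "inclusion_iso TYPE('k) M K (K \<union> V)"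
proof -
  obtain v where v: "{v} \<in> K \<inter> V"
    using a(2) by (auto simp: acyclic_factor_def)
  have 1: "acyclic_along TYPE('k) (prod_complex M V) (retract_snd v)"
    using a v by (auto simp: acyclic_factor_def)
  have 2: "acyclic_along TYPE('k) (prod_complex M K \<inter> prod_complex M V) (retract_snd v)"
    using a v unfolding acyclic_factor_def by (simp add: prod_complex_Int)
  have 3: "retract_snd v ` S \<in> prod_complex M K \<inter> prod_complex M V" if "S \<in> prod_complex M V" for S
    using retract_snd_prod_complex [OF that v M] by (simp add: prod_complex_Int)
  note mv = simplicial_prod_complex [OF M K] simplicial_prod_complex [OF M V]
  show ?thesis
    unfolding inclusion_iso_def prod_complex_Un
    by (intro conjI allI impI) (metis mv_surj [OF mv 1 2 3 retract_snd_retract_snd], rule mv_inj [OF mv 2 3])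
qed

lemma inclusion_iso_refl: "inclusion_iso TYPE('k::field) M K K"
  unfolding inclusion_iso_def by (metis boundaries_ops(1) diff_self)

lemma inclusion_iso_trans:
  assumes "inclusion_iso TYPE('k::field) M K L" "inclusion_iso TYPE('k) M L N" "K \<subseteq> L" "L \<subseteq> N"
  shows "inclusion_iso TYPE('k) M K N"
  unfolding inclusion_iso_def
proof (intro conjI allI impI)
  fix n and z :: "('a \<times> 'b) list \<Rightarrow>\<^sub>0 'k" assume "z \<in> cycles n (prod_complex M N)"
  then obtain z' where z': "z' \<in> cycles n (prod_complex M L)" "z - z' \<in> boundaries n (prod_complex M N)"
    using inclusion_iso_surj [OF assms(2)] by blast
  then obtain z'' where z'': "z'' \<in> cycles n (prod_complex M K)" "z' - z'' \<in> boundaries n (prod_complex M L)"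
    using inclusion_iso_surj [OF assms(1)] by blast
  then have "z' - z'' \<in> boundaries n (prod_complex M N)"
    using boundaries_mono [OF prod_complex_mono [OF assms(4)]] by blast
  then show "\<exists>z''\<in>cycles n (prod_complex M K). z - z'' \<in> boundaries n (prod_complex M N)"
    using z' z'' boundaries_diff_trans by blast
next
  fix n and z :: "('a \<times> 'b) list \<Rightarrow>\<^sub>0 'k"
  assume z: "z \<in> cycles n (prod_complex M K)" and b: "z \<in> boundaries n (prod_complex M N)"
  have "z \<in> boundaries n (prod_complex M L)"
    by (rule inclusion_iso_inj [OF assms(2) cycles_mono [OF prod_complex_mono [OF assms(3)] z] b])
  then show "z \<in> boundaries n (prod_complex M K)"
    by (rule inclusion_iso_inj [OF assms(1) z])
qed

text \<open>For \<open>M\<close> a single point the relative statement becomes the absolute one: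
  chains are carried over by \<open>Pair ()\<close> and back by \<open>snd\<close>.\<close>

lemma inclusion_iso_unit:
  fixes z :: "'b list \<Rightarrow>\<^sub>0 'k::field"
  assumes iso: "inclusion_iso TYPE('k) {{()}} K L" and z: "z \<in> cycles n L"
    and ne: "\<And>S. S \<in> L \<Longrightarrow> S \<noteq> {}"
  obtains z' where "z' \<in> cycles n K" "z - z' \<in> boundaries n L"
proof -
  have "push (Pair ()) z \<in> cycles n (prod_complex {{()}} L)"
    by (rule push_cycles [OF _ z]) (use ne in \<open>auto simp: prod_complex_def image_image\<close>)
  then obtain z' where z': "z' \<in> cycles n (prod_complex {{()}} K)"
    "push (Pair ()) z - z' \<in> boundaries n (prod_complex {{()}} L)"
    using inclusion_iso_surj [OF iso] by blast
  have "push snd z' \<in> cycles n K"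
    by (rule push_cycles [OF _ z'(1)]) (auto simp: prod_complex_def)
  moreover have "push snd (push (Pair ()) z - z') \<in> boundaries n L"
    by (rule push_boundaries [OF _ z'(2)]) (auto simp: prod_complex_def)
  moreover have "push snd (push (Pair ()) z) = z"
    by (simp add: push_ident)
  ultimately show thesis using that by simp
qed

section \<open>Products with homology spheres\<close>

text \<open>For a class \<open>\<zeta>\<close> in degree \<open>d\<close>, \<open>(x, y) \<mapsto> x \<times> v\<^sub>0 + y \<times> \<zeta>\<close> identifies
  \<open>H\<^sub>n(M) \<oplus> H\<^bsub>n-d\<^esub>(M)\<close> with \<open>H\<^sub>n(M \<times> K)\<close>.\<close>

definition sphere_factor :: "'a set set \<Rightarrow> 'b set set \<Rightarrow> nat \<Rightarrow> ('b list \<Rightarrow>\<^sub>0 'k::field) \<Rightarrow> 'b \<Rightarrow> bool" where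
  "sphere_factor M K d \<zeta> v0 \<longleftrightarrow> \<zeta> \<in> cycles d K \<and> {v0} \<in> K \<and>
     (\<forall>n. \<forall>z :: ('a \<times> 'b) list \<Rightarrow>\<^sub>0 'k. z \<in> cycles n (prod_complex M K) \<longrightarrow>
        (if n < d then z - push (retract_snd v0) z \<in> boundaries n (prod_complex M K)
         else \<exists>y\<in>cycles (n - d) M. z - push (retract_snd v0) z - cross y \<zeta> \<in> boundaries n (prod_complex M K))) \<and>
     (\<forall>n. \<forall>y\<in>cycles n M. cross y \<zeta> \<in> boundaries (n + d) (prod_complex M K) \<longrightarrow> y \<in> boundaries n M)"

lemma sphere_factor_inclusion_iso_up:
  fixes \<zeta> :: "'b list \<Rightarrow>\<^sub>0 'k::field"
  assumes M: "simplicial M" and K: "simplicial K" and iso: "inclusion_iso TYPE('k) M K L" and KL: "K \<subseteq> L" and s: "sphere_factor M K d \<zeta> v0"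
  shows "sphere_factor M L d \<zeta> v0"
  unfolding sphere_factor_def
proof (intro conjI allI impI ballI)
  show "\<zeta> \<in> cycles d L" "{v0} \<in> L"
    using s KL by (auto simp: sphere_factor_def intro: cycles_mono)
next
  fix n and z :: "('a \<times> 'b) list \<Rightarrow>\<^sub>0 'k" assume "z \<in> cycles n (prod_complex M L)"
  then obtain z' where z': "z' \<in> cycles n (prod_complex M K)" "z - z' \<in> boundaries n (prod_complex M L)"
    using inclusion_iso_surj [OF iso] by blast
  have v0: "{v0} \<in> L" using s KL by (auto simp: sphere_factor_def)
  have "push (retract_snd v0) (z - z') \<in> boundaries n (prod_complex M L)"
    by (rule push_boundaries [OF _ z'(2)]) (rule retract_snd_prod_complex [OF _ v0 M])
  with z' have b: "(z - z') - push (retract_snd v0) (z - z') \<in> boundaries n (prod_complex M L)"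
    by simp
  have m: "c \<in> boundaries n (prod_complex M K) \<Longrightarrow> c \<in> boundaries n (prod_complex M L)" for c :: "('a \<times> 'b) list \<Rightarrow>\<^sub>0 'k"
    using boundaries_mono [OF prod_complex_mono [OF KL]] by blast
  show "if n < d then z - push (retract_snd v0) z \<in> boundaries n (prod_complex M L)
      else \<exists>y\<in>cycles (n - d) M. z - push (retract_snd v0) z - cross y \<zeta> \<in> boundaries n (prod_complex M L)"
  proof (cases "n < d")
    case True
    then have "z' - push (retract_snd v0) z' \<in> boundaries n (prod_complex M L)"
      using s z' m unfolding sphere_factor_def by (metis (no_types, lifting))
    from boundaries_ops(2) [OF this b] True show ?thesis by (simp add: algebra_simps)
  next
    case False
    then obtain y where y: "y \<in> cycles (n - d) M"
      "z' - push (retract_snd v0) z' - cross y \<zeta> \<in> boundaries n (prod_complex M L)"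
      using s z' m unfolding sphere_factor_def by (metis (no_types, lifting))
    from boundaries_ops(2) [OF y(2) b] have "z - push (retract_snd v0) z - cross y \<zeta> \<in> boundaries n (prod_complex M L)"
      by (simp add: algebra_simps)
    with False y show ?thesis by auto
  qed
next
  fix n y assume y: "y \<in> cycles n M" and b: "cross y \<zeta> \<in> boundaries (n + d) (prod_complex M L)"
  have "cross y \<zeta> \<in> cycles (n + d) (prod_complex M K)"
    using cross_cycles [OF M K y] s by (auto simp: sphere_factor_def)
  then have "cross y \<zeta> \<in> boundaries (n + d) (prod_complex M K)"
    using inclusion_iso_inj [OF iso _ b] by blast
  then show "y \<in> boundaries n M"
    using s y unfolding sphere_factor_def by blast
qed

text \<open>Injectivity of the inclusion pulls the relations back to \<open>K\<close>. The class and
  the vertex must be given in \<open>K\<close>, since a representative in \<open>L\<close> need not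
  restrict to it.\<close>

lemma sphere_factor_inclusion_iso_down:
  fixes \<zeta> :: "'b list \<Rightarrow>\<^sub>0 'k::field"
  assumes M: "simplicial M" and K: "simplicial K" and iso: "inclusion_iso TYPE('k) M K L" and KL: "K \<subseteq> L" and s: "sphere_factor M L d \<zeta> v0"
    and \<zeta>: "\<zeta> \<in> cycles d K" and v0: "{v0} \<in> K"
  shows "sphere_factor M K d \<zeta> v0"
  unfolding sphere_factor_def
proof (intro conjI allI impI ballI)
  fix n and z :: "('a \<times> 'b) list \<Rightarrow>\<^sub>0 'k" assume z: "z \<in> cycles n (prod_complex M K)"
  then have zL: "z \<in> cycles n (prod_complex M L)"
    using cycles_mono [OF prod_complex_mono [OF KL]] by blast
  have rz: "push (retract_snd v0) z \<in> cycles n (prod_complex M K)"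
    by (rule push_cycles [OF retract_snd_prod_complex [OF _ v0 M] z])
  show "if n < d then z - push (retract_snd v0) z \<in> boundaries n (prod_complex M K)
      else \<exists>y\<in>cycles (n - d) M. z - push (retract_snd v0) z - cross y \<zeta> \<in> boundaries n (prod_complex M K)"
  proof (cases "n < d")
    case True
    then have "z - push (retract_snd v0) z \<in> boundaries n (prod_complex M L)"
      using s zL unfolding sphere_factor_def by (metis (no_types, lifting))
    then have "z - push (retract_snd v0) z \<in> boundaries n (prod_complex M K)"
      using iso z rz unfolding inclusion_iso_def by simp
    with True show ?thesis by simp
  next
    case False
    then obtain y where y: "y \<in> cycles (n - d) M"
      "z - push (retract_snd v0) z - cross y \<zeta> \<in> boundaries n (prod_complex M L)"
      using s zL unfolding sphere_factor_def by (metis (no_types, lifting))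
    have "cross y \<zeta> \<in> cycles n (prod_complex M K)"
      using cross_cycles [OF M K y(1) \<zeta>] False by simp
    then have "z - push (retract_snd v0) z - cross y \<zeta> \<in> boundaries n (prod_complex M K)"
      using iso z rz y unfolding inclusion_iso_def by simp
    with False y show ?thesis by auto
  qed
next
  fix n y assume y: "y \<in> cycles n M" and b: "cross y \<zeta> \<in> boundaries (n + d) (prod_complex M K)"
  then have "cross y \<zeta> \<in> boundaries (n + d) (prod_complex M L)"
    using boundaries_mono [OF prod_complex_mono [OF KL]] by blast
  then show "y \<in> boundaries n M"
    using s y unfolding sphere_factor_def by blast
qed (use \<zeta> v0 in auto)

lemma sphere_factor_cong:
  fixes \<zeta> :: "'b list \<Rightarrow>\<^sub>0 'k::field"
  assumes M: "simplicial M" and K: "simplicial K" and s: "sphere_factor M K d \<zeta> v0"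
    and \<zeta>': "\<zeta>' \<in> cycles d K" and b: "\<zeta> - \<zeta>' \<in> boundaries d K"
  shows "sphere_factor M K d \<zeta>' v0"
  unfolding sphere_factor_def
proof (intro conjI allI impI ballI)
  have c: "cross y \<zeta> - cross y \<zeta>' \<in> boundaries (n + d) (prod_complex M K)" if "y \<in> cycles n M" for n y
    using cross_boundaries2 [OF M K that b] by simp
  fix n and z :: "('a \<times> 'b) list \<Rightarrow>\<^sub>0 'k" assume z: "z \<in> cycles n (prod_complex M K)"
  show "if n < d then z - push (retract_snd v0) z \<in> boundaries n (prod_complex M K)
      else \<exists>y\<in>cycles (n - d) M. z - push (retract_snd v0) z - cross y \<zeta>' \<in> boundaries n (prod_complex M K)"
  proof (cases "n < d")
    case True
    then show ?thesis
      using s z unfolding sphere_factor_def by (metis (no_types, lifting))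
  next
    case False
    then obtain y where y: "y \<in> cycles (n - d) M"
      "z - push (retract_snd v0) z - cross y \<zeta> \<in> boundaries n (prod_complex M K)"
      using s z unfolding sphere_factor_def by (metis (no_types, lifting))
    have "cross y \<zeta> - cross y \<zeta>' \<in> boundaries n (prod_complex M K)"
      using c [OF y(1)] False by simp
    from boundaries_ops(2) [OF y(2) this]
    have "z - push (retract_snd v0) z - cross y \<zeta>' \<in> boundaries n (prod_complex M K)" by simp
    with False y show ?thesis by auto
  qed
next
  fix n y assume y: "y \<in> cycles n M" and b': "cross y \<zeta>' \<in> boundaries (n + d) (prod_complex M K)"
  have "cross y \<zeta> - cross y \<zeta>' \<in> boundaries (n + d) (prod_complex M K)"
    using cross_boundaries2 [OF M K y b] by simp
  then have "cross y \<zeta> \<in> boundaries (n + d) (prod_complex M K)"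
    using b' boundaries_diff_iff by blast
  then show "y \<in> boundaries n M"
    using s y unfolding sphere_factor_def by blast
qed (use s \<zeta>' in \<open>auto simp: sphere_factor_def\<close>)

text \<open>Ordered chains contain the degenerate tuples \<open>v, ..., v\<close> in every degree;
  coning with \<open>v\<close> fills their cycles of positive degree.\<close>

lemma point_cycle:
  assumes "c \<in> cycles (Suc n) {{v}}"
  shows "c \<in> boundaries (Suc n) {{v}}"
proof (rule boundariesI)
  have c: "\<And>xs. xs \<in> keys c \<Longrightarrow> length xs = Suc (Suc n) \<and> set xs = {v}" "dd c = 0"
    using assms by (auto simp: cycles_iff chains_def)
  then have "da c = 0" using dd_eq_da [of c] by simp
  have *: "\<And>xs. xs \<in> keys (consm v c) \<Longrightarrow> length xs = Suc (Suc (Suc n)) \<and> set xs = {v}"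
    using c by (auto dest!: in_keys_consm)
  then show "consm v c \<in> chains (Suc (Suc n)) {{v}}"
    by (auto simp: chains_def)
  have "dd (consm v c) = da (consm v c)"
    using * by (intro dd_eq_da) auto
  then show "dd (consm v c) = c"
    using \<open>da c = 0\<close> by (simp add: da_consm)
qed

lemma prod_complex_empty [simp]: "prod_complex M {} = {}"
  by (simp add: prod_complex_def)

lemma chains_empty: "c \<in> chains n {} \<Longrightarrow> c = 0"
  by (simp add: chains_def)

text \<open>The sphere of dimension 0, where the induction over cross-polytopes starts. A cycle
  splits into cycles over \<open>U\<close> and \<open>V\<close>, and the projection \<open>y\<close>
  of the first is the coefficient of \<open>p - q\<close>.\<close>

lemma sphere_factor_disjoint:
  assumes M: "simplicial M" and U: "simplicial U" and V: "simplicial V" and disj: "U \<inter> V = {}"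
    and a: "acyclic_factor TYPE('k::field) M U" "acyclic_factor TYPE('k) M V" and pq: "{p} \<in> U" "{q} \<in> V"
  shows "sphere_factor M (U \<union> V) 0 (single [p] (1::'k) - single [q] 1) q"
  unfolding sphere_factor_def
proof (intro conjI allI impI ballI)
  have c: "single [p] (1::'k) \<in> chains 0 (U \<union> V)" "single [q] (1::'k) \<in> chains 0 (U \<union> V)"
    using pq by (auto simp: chains_def)
  then show "single [p] (1::'k) - single [q] 1 \<in> cycles 0 (U \<union> V)"
    using dd_chains0 [OF c(1)] dd_chains0 [OF c(2)] by (auto simp: cycles_iff)
  show "{q} \<in> U \<union> V" using pq by auto
next
  note MU = simplicial_prod_complex [OF M U] and MV = simplicial_prod_complex [OF M V]
  fix n and z :: "('a \<times> 'b) list \<Rightarrow>\<^sub>0 'k" assume "z \<in> cycles n (prod_complex M (U \<union> V))"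
  then have "z \<in> cycles n (prod_complex M U \<union> prod_complex M V)" by (simp add: prod_complex_Un)
  from mv_split [OF MU MV this] obtain u v where uv: "u \<in> chains n (prod_complex M U)" "v \<in> chains n (prod_complex M V)"
    "z = u + v" "dd v = - dd u" and y: "\<And>m. n = Suc m \<Longrightarrow> dd u \<in> cycles m (prod_complex M U \<inter> prod_complex M V)"
    by metis
  have "dd u = 0"
  proof (cases n)
    case 0
    then show ?thesis using uv dd_chains0 by blast
  next
    case (Suc m)
    then show ?thesis
      using y [OF Suc] disj by (auto simp: cycles_iff simp flip: prod_complex_Int dest: chains_empty)
  qed
  then have uv_cycles: "u \<in> cycles n (prod_complex M U)" "v \<in> cycles n (prod_complex M V)"
    using uv by (auto simp: cycles_iff)
  then have "u - push (retract_snd p) u \<in> boundaries n (prod_complex M U)" "v - push (retract_snd q) v \<in> boundaries n (prod_complex M V)"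
    using a pq by (auto simp: acyclic_factor_def intro: acyclic_alongD)
  then have "(u - push (retract_snd p) u) + (v - push (retract_snd q) v) \<in> boundaries n (prod_complex M (U \<union> V))"
    unfolding prod_complex_Un by (meson boundaries_mono boundaries_ops(2) sup_ge1 sup_ge2)
  moreover define y where "y = push fst u"
  have yc: "y \<in> cycles n M"
    unfolding y_def by (rule push_cycles [OF _ uv_cycles(1)]) (auto simp: prod_complex_def)
  then have "cross y (single [p] 1) = push (retract_snd p) u" "cross y (single [q] 1) = push (retract_snd q) u"
    unfolding y_def by (subst cross_vertex [of _ n M], auto simp: cycles_iff comp_def retract_snd_def [abs_def])+
  ultimately have "z - push (retract_snd q) z - cross y (single [p] 1 - single [q] 1) \<in> boundaries n (prod_complex M (U \<union> V))"
    using uv(3) by (simp add: algebra_simps)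
  with yc show "if n < 0 then z - push (retract_snd q) z \<in> boundaries n (prod_complex M (U \<union> V))
      else \<exists>y\<in>cycles (n - 0) M. z - push (retract_snd q) z - cross y (single [p] 1 - single [q] 1)
        \<in> boundaries n (prod_complex M (U \<union> V))"
    by auto
next
  note MU = simplicial_prod_complex [OF M U] and MV = simplicial_prod_complex [OF M V]
  fix n and y :: "'a list \<Rightarrow>\<^sub>0 'k" assume y: "y \<in> cycles n M"
    and b: "cross y (single [p] 1 - single [q] 1) \<in> boundaries (n + 0) (prod_complex M (U \<union> V))"
  obtain c where c: "c \<in> chains (Suc n) (prod_complex M U \<union> prod_complex M V)" "cross y (single [p] 1 - single [q] 1) = dd c"
    using b by (auto simp: boundaries_iff prod_complex_Un)
  obtain u v where uv: "u \<in> chains (Suc n) (prod_complex M U)" "v \<in> chains (Suc n) (prod_complex M V)" "c = u + v"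
    using c chains_Un by metis
  have p: "single [p] (1::'k) \<in> chains 0 U" and q: "single [q] (1::'k) \<in> chains 0 V"
    using pq by (auto simp: chains_def)
  have yc: "y \<in> chains n M" using y by (simp add: cycles_iff)
  \<comment> \<open>This chain lies over \<open>U\<close> and, by the equation for \<open>c\<close>,
    also over \<open>V\<close>. As these are disjoint it is zero, and projecting to \<open>M\<close>
    fills \<open>y\<close>.\<close>
  let ?x = "cross y (single [p] 1) - dd u"
  have "?x \<in> chains n (prod_complex M U)"
    using cross_chains [OF M U yc p] dd_chains [OF MU uv(1)] by simp
  moreover have "?x = cross y (single [q] 1) + dd v"
    using c uv by (simp add: algebra_simps)
  then have "?x \<in> chains n (prod_complex M V)"
    using cross_chains [OF M V yc q] dd_chains [OF MV uv(2)] by simp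
  ultimately have "?x \<in> chains n {}"
    using disj by (metis chains_Int prod_complex_Int prod_complex_empty)
  then have "cross y (single [p] 1) = dd u"
    by (auto dest: chains_empty)
  then have "push fst (cross y (single [p] 1)) = dd (push fst u)"
    by (simp add: push_dd)
  moreover have "push fst (cross y (single [p] 1)) = y"
    using yc by (simp add: cross_vertex comp_def push_ident)
  moreover have "push fst u \<in> chains (Suc n) M"
    by (rule push_chains [OF _ uv(1)]) (auto simp: prod_complex_def)
  ultimately show "y \<in> boundaries n M"
    by (metis boundariesI)
qed

text \<open>Mayer-Vietoris with both halves acyclic: the connecting homomorphism lowers the degree
  by one and sends \<open>a - b\<close> to \<open>\<zeta>\<close>, so the Kuenneth property passes
  from the equator \<open>U \<inter> V\<close> to the union.\<close>

lemma sphere_factor_suspension: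
  fixes \<zeta> a b :: "'b list \<Rightarrow>\<^sub>0 'k::field"
  assumes M: "simplicial M" and U: "simplicial U" and V: "simplicial V"
    and aU: "acyclic_factor TYPE('k) M U" and aV: "acyclic_factor TYPE('k) M V"
    and s: "sphere_factor M (U \<inter> V) d \<zeta> v0"
    and a: "a \<in> chains (Suc d) U" "dd a = \<zeta>" and b: "b \<in> chains (Suc d) V" "dd b = \<zeta>"
  shows "sphere_factor M (U \<union> V) (Suc d) (a - b) v0"
proof -
  note MU = simplicial_prod_complex [OF M U] and MV = simplicial_prod_complex [OF M V]
  have UV: "simplicial (U \<union> V)" using U V by (rule simplicial_Un)
  have v0: "{v0} \<in> U \<inter> V" using s by (auto simp: sphere_factor_def)
  let ?r = "push (retract_snd v0)"
  have ab: "a - b \<in> cycles (Suc d) (U \<union> V)"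
    using a b by (auto simp: cycles_iff intro!: chains_ops intro: chains_mono)
  \<comment> \<open>The patching common to low and high degrees: \<open>A\<close> and
    \<open>B\<close> are zero below the dimension of the sphere and \<open>cross y a\<close>,
    \<open>cross y b\<close> from there on. Corrected by these and by \<open>w\<close>, both halves
    of \<open>z\<close> become cycles, which the acyclic pieces retract.\<close>
  have core: "z - ?r z - (A - B) + ?r (A - B) \<in> boundaries n (prod_complex M (U \<union> V))"
    if z: "z = u + v" "u \<in> chains n (prod_complex M U)" "v \<in> chains n (prod_complex M V)" "dd v = - dd u"
      and w: "w \<in> chains n (prod_complex M (U \<inter> V))"
      and AB: "A \<in> chains n (prod_complex M U)" "B \<in> chains n (prod_complex M V)" "dd A = dd B"
      and y: "dd u - ?r (dd u) - dd A = dd w" for n z u v w and A B :: "('a \<times> 'b) list \<Rightarrow>\<^sub>0 'k"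
  proof -
    have w': "w \<in> chains n (prod_complex M U)" "w \<in> chains n (prod_complex M V)"
      using w by (auto simp: prod_complex_Int intro: chains_mono)
    have "?r u \<in> chains n (prod_complex M U)"
      by (rule push_chains [OF retract_snd_prod_complex z(2)]) (use v0 M in auto)
    then have 1: "u - ?r u - w - A \<in> cycles n (prod_complex M U)"
      using z w' AB by (simp add: cycles_iff y [symmetric] flip: push_dd)
    have "?r v \<in> chains n (prod_complex M V)"
      by (rule push_chains [OF retract_snd_prod_complex z(3)]) (use v0 M in auto)
    then have 2: "v - ?r v + w + B \<in> cycles n (prod_complex M V)"
      using z w' AB by (simp add: cycles_iff y [symmetric] flip: push_dd)
    have "(u - ?r u - w - A) - ?r (u - ?r u - w - A) \<in> boundaries n (prod_complex M (U \<union> V))"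
      using aU v0 acyclic_alongD [OF _ 1] unfolding prod_complex_Un acyclic_factor_def by (meson IntD1 boundaries_mono sup_ge1)
    moreover have "(v - ?r v + w + B) - ?r (v - ?r v + w + B) \<in> boundaries n (prod_complex M (U \<union> V))"
      using aV v0 acyclic_alongD [OF _ 2] unfolding prod_complex_Un acyclic_factor_def by (meson IntD2 boundaries_mono sup_ge2)
    ultimately have "((u - ?r u - w - A) - ?r (u - ?r u - w - A)) + ((v - ?r v + w + B) - ?r (v - ?r v + w + B))
        \<in> boundaries n (prod_complex M (U \<union> V))"
      by (rule boundaries_ops)
    moreover have "((u - ?r u - w - A) - ?r (u - ?r u - w - A)) + ((v - ?r v + w + B) - ?r (v - ?r v + w + B))
        = z - ?r z - (A - B) + ?r (A - B)"
      using z(1) by simp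
    ultimately show ?thesis by (simp only:)
  qed
  show ?thesis
    unfolding sphere_factor_def
  proof (intro conjI allI impI ballI ab)
    show "{v0} \<in> U \<union> V" using v0 by auto
  next
    fix n and z :: "('a \<times> 'b) list \<Rightarrow>\<^sub>0 'k" assume "z \<in> cycles n (prod_complex M (U \<union> V))"
    then have "z \<in> cycles n (prod_complex M U \<union> prod_complex M V)" by (simp add: prod_complex_Un)
    from mv_split [OF MU MV this] obtain u v where uv: "u \<in> chains n (prod_complex M U)" "v \<in> chains n (prod_complex M V)"
      "z = u + v" "dd v = - dd u" and y: "\<And>m. n = Suc m \<Longrightarrow> dd u \<in> cycles m (prod_complex M U \<inter> prod_complex M V)"
      by metis
    show "if n < Suc d then z - ?r z \<in> boundaries n (prod_complex M (U \<union> V))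
      else \<exists>y\<in>cycles (n - Suc d) M. z - ?r z - cross y (a - b) \<in> boundaries n (prod_complex M (U \<union> V))"
    proof (cases "n < Suc d")
      case True
      have "\<exists>w\<in>chains n (prod_complex M (U \<inter> V)). dd u - ?r (dd u) = dd w"
      proof (cases n)
        case 0
        then have "dd u = 0" using uv dd_chains0 by blast
        then show ?thesis by (intro bexI [of _ 0]) auto
      next
        case (Suc m)
        then have "dd u \<in> cycles m (prod_complex M (U \<inter> V))" "m < d"
          using y True by (auto simp: prod_complex_Int)
        then have "dd u - ?r (dd u) \<in> boundaries m (prod_complex M (U \<inter> V))"
          using s unfolding sphere_factor_def by (metis (no_types, lifting))
        then show ?thesis using Suc by (auto simp: boundaries_iff)
      qed
      then obtain w where "w \<in> chains n (prod_complex M (U \<inter> V))" "dd u - ?r (dd u) = dd w" by blast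
      then have "z - ?r z \<in> boundaries n (prod_complex M (U \<union> V))"
        using core [of z u v n w 0 0] uv by simp
      with True show ?thesis by simp
    next
      case False
      then obtain m where m: "n = Suc m" "\<not> m < d" by (cases n) auto
      then have "dd u \<in> cycles m (prod_complex M (U \<inter> V))"
        using y by (auto simp: prod_complex_Int)
      then obtain q where q: "q \<in> cycles (m - d) M"
        "dd u - ?r (dd u) - cross q \<zeta> \<in> boundaries m (prod_complex M (U \<inter> V))"
        using s m unfolding sphere_factor_def by (metis (no_types, lifting))
      then obtain w where w: "w \<in> chains n (prod_complex M (U \<inter> V))" "dd u - ?r (dd u) - cross q \<zeta> = dd w"
        using m by (auto simp: boundaries_iff)
      \<comment> \<open>The Leibniz rule gives \<open>dd (cross y a)\<close> the sign
        \<open>(-1) ^ (m - d)\<close>; scaling \<open>q\<close> by it makes this boundary exactly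
        \<open>cross q \<zeta>\<close>.\<close>
      define e where "e = (-1 :: 'k) ^ (m - d)"
      have ee: "e * e = 1"
        by (simp add: e_def flip: power_add mult_2)
      define y where "y = smul e q"
      have yc: "y \<in> cycles (m - d) M" using q by (simp add: y_def)
      then have yc': "y \<in> chains (m - d) M" "dd y = 0" by (auto simp: cycles_iff)
      have deg: "m - d + Suc d = n" using m by simp
      have A: "cross y a \<in> chains n (prod_complex M U)" "cross y b \<in> chains n (prod_complex M V)"
        using cross_chains [OF M U yc'(1) a(1)] cross_chains [OF M V yc'(1) b(1)] deg by auto
      have dA: "dd (cross y a) = cross q \<zeta>" "dd (cross y b) = cross q \<zeta>"
        using dd_cross [OF yc'(1) a(1)] dd_cross [OF yc'(1) b(1)] a b q(1)
        by (simp_all add: cycles_iff ee y_def flip: e_def)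
      have "z - ?r z - (cross y a - cross y b) + ?r (cross y a - cross y b) \<in> boundaries n (prod_complex M (U \<union> V))"
        using core [OF uv(3,1,2,4) w(1) A] w(2) dA by simp
      \<comment> \<open>Retracting \<open>a - b\<close> to \<open>v0\<close> gives a cycle of
        positive degree on one vertex, which is a boundary there.\<close>
      moreover have "?r (cross y a - cross y b) \<in> boundaries n (prod_complex M (U \<union> V))"
      proof -
        have "push (\<lambda>_. v0) (a - b) \<in> cycles (Suc d) {{v0}}"
          by (rule push_cycles [OF _ ab]) (use simplicial_fin [OF UV] in auto)
        then have "push (\<lambda>_. v0) (a - b) \<in> boundaries (Suc d) (U \<union> V)"
          by (rule boundaries_mono [OF _ point_cycle, rotated]) (use v0 in auto)
        from cross_boundaries2 [OF M UV yc this] have "cross y (push (\<lambda>_. v0) (a - b)) \<in> boundaries n (prod_complex M (U \<union> V))"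
          using deg by simp
        moreover have "?r (cross y a - cross y b) = cross y (push (\<lambda>_. v0) (a - b))"
          unfolding cross_simps(6) [symmetric] retract_snd_map_prod push_cross by (simp add: push_ident)
        ultimately show ?thesis by simp
      qed
      ultimately have "z - ?r z - cross y (a - b) \<in> boundaries n (prod_complex M (U \<union> V))"
        using boundaries_ops(3) by fastforce
      with yc m False show ?thesis by auto
    qed
  next
    fix n y assume y: "y \<in> cycles n M" and bd: "cross y (a - b) \<in> boundaries (n + Suc d) (prod_complex M (U \<union> V))"
    have yc: "y \<in> chains n M" "dd y = 0" using y by (auto simp: cycles_iff)
    obtain c where c: "c \<in> chains (Suc (n + Suc d)) (prod_complex M U \<union> prod_complex M V)" "cross y (a - b) = dd c"
      using bd by (auto simp: boundaries_iff prod_complex_Un)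
    obtain u v where uv: "u \<in> chains (Suc (n + Suc d)) (prod_complex M U)" "v \<in> chains (Suc (n + Suc d)) (prod_complex M V)" "c = u + v"
      using c chains_Un by metis
    \<comment> \<open>Splitting a filling of \<open>cross y (a - b)\<close> over the two halves
      gives a chain of the intersection whose boundary is \<open>cross y \<zeta>\<close> up to
      sign.\<close>
    let ?x = "cross y a - dd u"
    have "?x \<in> chains (n + Suc d) (prod_complex M U)"
      using cross_chains [OF M U yc(1) a(1)] dd_chains [OF MU uv(1)] by simp
    moreover have "?x = cross y b + dd v"
      using c uv by (simp add: algebra_simps)
    then have "?x \<in> chains (n + Suc d) (prod_complex M V)"
      using cross_chains [OF M V yc(1) b(1)] dd_chains [OF MV uv(2)] by simp
    ultimately have x: "?x \<in> chains (Suc (n + d)) (prod_complex M (U \<inter> V))"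
      by (simp add: prod_complex_Int chains_Int)
    define e where "e = (-1 :: 'k) ^ n"
    have ee: "e * e = 1"
      by (simp add: e_def flip: power_add mult_2)
    have "dd (smul e ?x) = cross y \<zeta>"
      using dd_cross [OF yc(1) a(1)] a yc by (simp add: ee flip: e_def)
    then have "cross y \<zeta> \<in> boundaries (n + d) (prod_complex M (U \<inter> V))"
      using x by (intro boundariesI [of "smul e ?x"]) auto
    then show "y \<in> boundaries n M"
      using s y unfolding sphere_factor_def by blast
  qed
qed

subsection \<open>Cross-polytopes\<close>

text \<open>The boundary of the \<open>j\<close>-dimensional cross-polytope with vertices blown up to simplices:
  \<open>idx\<close> is the coordinate axis of a vertex and \<open>sg\<close> its sign.\<close>

definition cross_polytope :: "('v \<Rightarrow> nat) \<Rightarrow> ('v \<Rightarrow> bool) \<Rightarrow> nat \<Rightarrow> 'v set set" where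
  "cross_polytope idx sg j = {S. finite S \<and> S \<noteq> {} \<and> (\<forall>u\<in>S. idx u < j) \<and>
     (\<forall>u\<in>S. \<forall>v\<in>S. idx u = idx v \<longrightarrow> sg u \<longrightarrow> sg v)}"

text \<open>The join of the 0-spheres \<open>p i - q i\<close>, built as an iterated suspension: the
  fundamental cycle of the cross-polytope boundary.\<close>

primrec cross_polytope_cycle :: "(nat \<Rightarrow> 'v) \<Rightarrow> (nat \<Rightarrow> 'v) \<Rightarrow> nat \<Rightarrow> ('v list \<Rightarrow>\<^sub>0 'k::field)" where
  "cross_polytope_cycle p q 0 = single [p 0] 1 - single [q 0] 1"
| "cross_polytope_cycle p q (Suc j) = consm (p (Suc j)) (cross_polytope_cycle p q j) - consm (q (Suc j)) (cross_polytope_cycle p q j)"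

lemma da_cross_polytope_cycle: "da (cross_polytope_cycle p q j) = 0"
  by (induction j) (auto simp: da_consm)

lemma push_cross_polytope_cycle: "push h (cross_polytope_cycle p q j) = cross_polytope_cycle (h \<circ> p) (h \<circ> q) j"
  by (induction j) (auto simp: push_consm)

lemma keys_cross_polytope_cycle:
  fixes p q :: "nat \<Rightarrow> 'v"
  shows "xs \<in> keys (cross_polytope_cycle p q j :: 'v list \<Rightarrow>\<^sub>0 'k::field) \<Longrightarrow>
    length xs = Suc j \<and> set xs \<subseteq> p ` {..j} \<union> q ` {..j}"
proof (induction j arbitrary: xs)
  case 0
  then show ?case by (auto simp: in_keys_iff lookup_minus lookup_single when_def split: if_splits)
next
  case (Suc j)
  let ?c = "cross_polytope_cycle p q j :: 'v list \<Rightarrow>\<^sub>0 'k"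
  have "xs \<in> keys (consm (p (Suc j)) ?c) \<or> xs \<in> keys (consm (q (Suc j)) ?c)"
    using Suc.prems by (auto simp: in_keys_iff lookup_minus)
  then obtain ys where ys: "ys \<in> keys ?c" "xs = p (Suc j) # ys \<or> xs = q (Suc j) # ys"
    by (auto dest!: in_keys_consm)
  from Suc.IH [OF ys(1)] ys(2) show ?case
    by (auto simp: atMost_Suc)
qed

lemma simplicial_cross_polytope: "simplicial (cross_polytope idx sg j)"
  unfolding simplicial_def cross_polytope_def by (auto intro: finite_subset)

lemma cross_polytope_idx: "S \<in> cross_polytope idx sg j \<Longrightarrow> u \<in> S \<Longrightarrow> idx u < j"
  by (simp add: cross_polytope_def)

lemma cross_polytope_ne: "S \<in> cross_polytope idx sg j \<Longrightarrow> S \<noteq> {}"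
  by (simp add: cross_polytope_def)

lemma cross_polytope_sg: "S \<in> cross_polytope idx sg j \<Longrightarrow> u \<in> S \<Longrightarrow> v \<in> S \<Longrightarrow> idx u = idx v \<Longrightarrow> sg u \<Longrightarrow> sg v"
  unfolding cross_polytope_def by blast

lemma cross_polytope_insert:
  assumes "S \<in> cross_polytope idx sg j" "idx w < j" "\<And>u. u \<in> S \<Longrightarrow> idx u = idx w \<Longrightarrow> sg u \<longleftrightarrow> sg w"
  shows "insert w S \<in> cross_polytope idx sg j"
proof -
  have "finite S" using assms(1) by (simp add: cross_polytope_def)
  moreover have "\<forall>u\<in>insert w S. idx u < j"
    using assms(2) cross_polytope_idx [OF assms(1)] by blast
  moreover have "\<forall>u\<in>insert w S. \<forall>v\<in>insert w S. idx u = idx v \<longrightarrow> sg u \<longrightarrow> sg v"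
    using assms(3) cross_polytope_sg [OF assms(1)] by (metis insert_iff)
  ultimately show ?thesis unfolding cross_polytope_def by blast
qed

lemma simplicial_filter:
  "simplicial K \<Longrightarrow> (\<And>S T. S \<in> K \<Longrightarrow> T \<subseteq> S \<Longrightarrow> T \<noteq> {} \<Longrightarrow> P S \<Longrightarrow> P T) \<Longrightarrow> simplicial {S \<in> K. P S}"
proof -
  assume K: "simplicial K" and P: "\<And>S T. S \<in> K \<Longrightarrow> T \<subseteq> S \<Longrightarrow> T \<noteq> {} \<Longrightarrow> P S \<Longrightarrow> P T"
  show ?thesis
    unfolding simplicial_def
    using simplicial_fin [OF K] simplicialD [OF K] P by (metis (no_types, lifting) mem_Collect_eq)
qed

text \<open>Forbidding one sign on the last axis leaves a cone whose apex is \<open>p\<close> or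
  \<open>q\<close> of that axis, even with vertices blown up. The two cones meet in the
  cross-polytope of one dimension less, so the induction is a suspension.\<close>

lemma sphere_factor_cross_polytope:
  fixes p q :: "nat \<Rightarrow> 'v"
  assumes M: "simplicial M" and p: "\<And>i. i < N \<Longrightarrow> idx (p i) = i \<and> sg (p i)" and q: "\<And>i. i < N \<Longrightarrow> idx (q i) = i \<and> \<not> sg (q i)"
  shows "j < N \<Longrightarrow> sphere_factor M (cross_polytope idx sg (Suc j)) j (cross_polytope_cycle p q j :: 'v list \<Rightarrow>\<^sub>0 'k::field) (q 0)"
proof (induction j)
  case 0
  let ?K = "cross_polytope idx sg 1"
  let ?U = "{S \<in> ?K. \<forall>u\<in>S. sg u}" and ?V = "{S \<in> ?K. \<forall>u\<in>S. \<not> sg u}"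
  have "(\<forall>u\<in>S. sg u) \<or> (\<forall>u\<in>S. \<not> sg u)" if "S \<in> ?K" for S
    using cross_polytope_idx [OF that] cross_polytope_sg [OF that] by (metis less_one)
  then have "?K = ?U \<union> ?V" by blast
  moreover have "simplicial ?U" "simplicial ?V"
    by (rule simplicial_filter [OF simplicial_cross_polytope]; blast)+
  moreover have "?U \<inter> ?V = {}"
    using cross_polytope_ne by fastforce
  moreover have pU: "{p 0} \<in> ?U" and qV: "{q 0} \<in> ?V"
    using p q 0 by (auto simp: cross_polytope_def)
  moreover have "acyclic_factor TYPE('k) M ?U"
    by (rule acyclic_factor_cone [OF M \<open>simplicial ?U\<close>, of "p 0"], use pU in blast)
      (use p 0 in \<open>auto intro!: cross_polytope_insert dest: cross_polytope_idx\<close>)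
  moreover have "acyclic_factor TYPE('k) M ?V"
    by (rule acyclic_factor_cone [OF M \<open>simplicial ?V\<close>, of "q 0"], use qV in blast)
      (use q 0 in \<open>auto intro!: cross_polytope_insert dest: cross_polytope_idx\<close>)
  ultimately show ?case
    using sphere_factor_disjoint [OF M, of ?U ?V, where 'k = 'k] by simp
next
  case (Suc j)
  let ?K = "cross_polytope idx sg (Suc (Suc j))" and ?L = "cross_polytope idx sg (Suc j)"
  let ?U = "{S \<in> ?K. \<forall>u\<in>S. idx u = Suc j \<longrightarrow> sg u}" and ?V = "{S \<in> ?K. \<forall>u\<in>S. idx u = Suc j \<longrightarrow> \<not> sg u}"
  let ?p = "p (Suc j)" and ?q = "q (Suc j)"
  let ?c = "cross_polytope_cycle p q j :: 'v list \<Rightarrow>\<^sub>0 'k"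
  have pq: "idx ?p = Suc j" "sg ?p" "idx ?q = Suc j" "\<not> sg ?q"
    using p [OF Suc.prems] q [OF Suc.prems] by auto
  have IH: "sphere_factor M ?L j ?c (q 0)" using Suc by simp
  have "(\<forall>u\<in>S. idx u = Suc j \<longrightarrow> sg u) \<or> (\<forall>u\<in>S. idx u = Suc j \<longrightarrow> \<not> sg u)" if "S \<in> ?K" for S
    using cross_polytope_sg [OF that] by metis
  then have K: "?K = ?U \<union> ?V" by blast
  have "(\<forall>u\<in>S. idx u < Suc (Suc j)) \<and> (\<forall>u\<in>S. idx u \<noteq> Suc j) \<longleftrightarrow> (\<forall>u\<in>S. idx u < Suc j)" for S
    by (auto simp: less_Suc_eq)
  then have L: "?U \<inter> ?V = ?L"
    unfolding cross_polytope_def by blast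
  have cU: "simplicial ?U" and cV: "simplicial ?V"
    by (rule simplicial_filter [OF simplicial_cross_polytope]; blast)+
  have insU: "insert ?p S \<in> ?U" if "S \<in> ?U" for S
    using that pq cross_polytope_insert [of S idx sg "Suc (Suc j)" ?p] by auto
  have insV: "insert ?q S \<in> ?V" if "S \<in> ?V" for S
    using that pq cross_polytope_insert [of S idx sg "Suc (Suc j)" ?q] by auto
  have pU: "{?p} \<in> ?U" and qV: "{?q} \<in> ?V"
    using pq by (auto simp: cross_polytope_def)
  have aU: "acyclic_factor TYPE('k) M ?U"
    by (rule acyclic_factor_cone [OF M cU _ insU]) (use pU in blast)
  have aV: "acyclic_factor TYPE('k) M ?V"
    by (rule acyclic_factor_cone [OF M cV _ insV]) (use qV in blast)
  have cL: "?c \<in> chains j ?L" using IH by (simp add: sphere_factor_def cycles_iff)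
  have cons: "consm x ?c \<in> chains (Suc j) W \<and> dd (consm x ?c) = ?c"
    if "\<And>S. S \<in> ?L \<Longrightarrow> insert x S \<in> W" for x W
  proof
    have *: "length xs = Suc (Suc j) \<and> set xs \<in> W" if "xs \<in> keys (consm x ?c)" for xs
      using in_keys_consm [OF that] cL \<open>\<And>S. S \<in> ?L \<Longrightarrow> insert x S \<in> W\<close> by (auto simp: chains_def)
    then show "consm x ?c \<in> chains (Suc j) W" by (auto simp: chains_def)
    have "dd (consm x ?c) = da (consm x ?c)"
      using * by (intro dd_eq_da) auto
    then show "dd (consm x ?c) = ?c" by (simp add: da_consm da_cross_polytope_cycle)
  qed
  have "consm ?p ?c \<in> chains (Suc j) ?U \<and> dd (consm ?p ?c) = ?c"
    using L insU by (intro cons) blast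
  moreover have "consm ?q ?c \<in> chains (Suc j) ?V \<and> dd (consm ?q ?c) = ?c"
    using L insV by (intro cons) blast
  ultimately show ?case
    using sphere_factor_suspension [OF M cU cV aU aV, of j ?c "q 0" "consm ?p ?c" "consm ?q ?c"] IH L K by simp
qed

text \<open>Covers the star of a vertex (\<open>h\<close> inserts one vertex) and that of an edge
  (\<open>h\<close> inserts two).\<close>

lemma simplicial_star:
  assumes K: "simplicial K" and h: "\<And>S T. T \<subseteq> S \<Longrightarrow> h T \<subseteq> h S" "\<And>T. T \<noteq> {} \<Longrightarrow> h T \<noteq> {}"
  shows "simplicial {S \<in> K. h S \<in> K}"
proof (rule simplicial_filter [OF K])
  fix S T assume "T \<subseteq> S" "T \<noteq> {}" "h S \<in> K"
  then show "h T \<in> K" using simplicialD [OF K, of "h S" "h T"] h by simp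
qed

section \<open>Clique complexes of cyclic graphs\<close>

text \<open>A cyclic graph on \<open>\<int>/n\<close> is given by a monotone map \<open>F\<close> of the integers commuting with the
  translation by \<open>n\<close>: going forward, \<open>u\<close> is adjacent to \<open>u, \<dots>, F u\<close>. All integers serve as
  vertices, so that congruent ones are twins.\<close>

definition cyclic_adj :: "int \<Rightarrow> (int \<Rightarrow> int) \<Rightarrow> int \<Rightarrow> int \<Rightarrow> bool" where
  "cyclic_adj n F u v \<longleftrightarrow> (\<exists>j. u \<le> v + j * n \<and> v + j * n \<le> F u) \<or> (\<exists>j. v \<le> u + j * n \<and> u + j * n \<le> F v)"

definition cyclic_complex :: "int \<Rightarrow> (int \<Rightarrow> int) \<Rightarrow> int set set" where
  "cyclic_complex n F = {S. finite S \<and> S \<noteq> {} \<and> (\<forall>u\<in>S. \<forall>v\<in>S. cyclic_adj n F u v)}"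

definition cyclic_map :: "int \<Rightarrow> (int \<Rightarrow> int) \<Rightarrow> bool" where
  "cyclic_map n F \<longleftrightarrow> n > 0 \<and> mono F \<and> (\<forall>z. F (z + n) = F z + n)"

text \<open>Together these say that the winding fraction lies strictly between \<open>l/(2l+1)\<close> and
  \<open>(l+1)/(2l+3)\<close>.\<close>

definition winding_gt :: "int \<Rightarrow> (int \<Rightarrow> int) \<Rightarrow> nat \<Rightarrow> bool" where
  "winding_gt n F l \<longleftrightarrow> (\<forall>z. (F ^^ (2 * l + 1)) z \<ge> z + int l * n + 1)"

definition winding_lt :: "int \<Rightarrow> (int \<Rightarrow> int) \<Rightarrow> nat \<Rightarrow> bool" where
  "winding_lt n F l \<longleftrightarrow> (\<forall>z. (F ^^ (2 * l + 3)) z \<le> z + (int l + 1) * n - 1)"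

lemma cyclic_mapD:
  assumes "cyclic_map n F"
  shows "n > 0" "\<And>u v. u \<le> v \<Longrightarrow> F u \<le> F v" "\<And>z. F (z + n) = F z + n"
  using assms by (auto simp: cyclic_map_def mono_def)

lemma periodic_nat:
  fixes F :: "int \<Rightarrow> int"
  assumes "\<And>z::int. F (z + n) = F z + n"
  shows "F (z + int k * n) = F z + int k * n"
proof (induction k)
  case (Suc k)
  have "F (z + int (Suc k) * n) = F ((z + int k * n) + n)"
    by (simp add: algebra_simps)
  also have "\<dots> = F z + int k * n + n"
    by (simp only: assms Suc)
  also have "\<dots> = F z + int (Suc k) * n"
    by (simp add: algebra_simps)
  finally show ?case .
qed simp

lemma periodic_int:
  fixes F :: "int \<Rightarrow> int"
  assumes "\<And>z::int. F (z + n) = F z + n"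
  shows "F (z + j * n) = F z + j * n"
proof (cases "j \<ge> 0")
  case True
  then show ?thesis using periodic_nat [where F = F and n = n, OF assms, of z "nat j"] by simp
next
  case False
  then show ?thesis
    using periodic_nat [where F = F and n = n, OF assms, of "z + j * n" "nat (- j)"] by simp
qed

lemma funpow_periodic:
  fixes F :: "int \<Rightarrow> int"
  assumes "\<And>z::int. F (z + n) = F z + n"
  shows "(F ^^ k) (z + n) = (F ^^ k) z + n"
  by (induction k) (simp_all add: assms)

lemma funpow_le:
  fixes F G :: "int \<Rightarrow> int"
  assumes "\<And>u v::int. u \<le> v \<Longrightarrow> F u \<le> F v" "\<And>z. F z \<le> G z"
  shows "u \<le> v \<Longrightarrow> (F ^^ k) u \<le> (G ^^ k) v"
proof (induction k)
  case (Suc k)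
  have "F ((F ^^ k) u) \<le> F ((G ^^ k) v)" using Suc assms(1) by blast
  then show ?case using assms(2) [of "(G ^^ k) v"] by simp
qed simp

text \<open>A point that is not moved forward has its whole orbit at or below it, whereas
  \<open>2l+1\<close> iterations must gain more than \<open>l\<close> turns.\<close>

lemma winding_gt_gt:
  assumes "cyclic_map n F" "winding_gt n F l"
  shows "F z \<ge> z + 1"
proof (rule ccontr)
  assume "\<not> z + 1 \<le> F z"
  then have "F z \<le> z" by simp
  have "(F ^^ k) z \<le> z" for k
  proof (induction k)
    case (Suc k)
    have "F ((F ^^ k) z) \<le> F z" using cyclic_mapD(2) [OF assms(1) Suc] .
    then show ?case using \<open>F z \<le> z\<close> by simp
  qed simp
  moreover have "(F ^^ (2 * l + 1)) z \<ge> z + int l * n + 1"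
    using assms(2) unfolding winding_gt_def by blast
  moreover have "int l * n \<ge> 0"
    using cyclic_mapD(1) [OF assms(1)] by simp
  ultimately show False by (smt (verit))
qed

lemma cyclic_adj_sym: "cyclic_adj n F u v \<longleftrightarrow> cyclic_adj n F v u"
  by (auto simp: cyclic_adj_def)

lemma cyclic_adj_refl: "F u \<ge> u \<Longrightarrow> cyclic_adj n F u u"
  unfolding cyclic_adj_def by (rule disjI1, rule exI [of _ 0]) simp

lemma cyclic_adj_shift1:
  assumes "cyclic_map n F"
  shows "cyclic_adj n F (u + i * n) v \<longleftrightarrow> cyclic_adj n F u v"
proof -
  have F: "F (u + i * n) = F u + i * n"
    by (rule periodic_int) (rule cyclic_mapD(3) [OF assms])
  have "(\<exists>j. u + i * n \<le> v + j * n \<and> v + j * n \<le> F u + i * n) \<longleftrightarrow> (\<exists>j. u \<le> v + j * n \<and> v + j * n \<le> F u)"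
  proof
    assume "\<exists>j. u + i * n \<le> v + j * n \<and> v + j * n \<le> F u + i * n"
    then obtain j where "u + i * n \<le> v + j * n" "v + j * n \<le> F u + i * n" by blast
    then show "\<exists>j. u \<le> v + j * n \<and> v + j * n \<le> F u"
      by (intro exI [of _ "j - i"]) (simp add: algebra_simps)
  next
    assume "\<exists>j. u \<le> v + j * n \<and> v + j * n \<le> F u"
    then obtain j where "u \<le> v + j * n" "v + j * n \<le> F u" by blast
    then show "\<exists>j. u + i * n \<le> v + j * n \<and> v + j * n \<le> F u + i * n"
      by (intro exI [of _ "j + i"]) (simp add: algebra_simps)
  qed
  moreover have "(\<exists>j. v \<le> u + i * n + j * n \<and> u + i * n + j * n \<le> F v) \<longleftrightarrow> (\<exists>j. v \<le> u + j * n \<and> u + j * n \<le> F v)"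
  proof
    assume "\<exists>j. v \<le> u + i * n + j * n \<and> u + i * n + j * n \<le> F v"
    then obtain j where "v \<le> u + i * n + j * n" "u + i * n + j * n \<le> F v" by blast
    then show "\<exists>j. v \<le> u + j * n \<and> u + j * n \<le> F v"
      by (intro exI [of _ "i + j"]) (simp add: algebra_simps)
  next
    assume "\<exists>j. v \<le> u + j * n \<and> u + j * n \<le> F v"
    then obtain j where "v \<le> u + j * n" "u + j * n \<le> F v" by blast
    then show "\<exists>j. v \<le> u + i * n + j * n \<and> u + i * n + j * n \<le> F v"
      by (intro exI [of _ "j - i"]) (simp add: algebra_simps)
  qed
  ultimately show ?thesis unfolding cyclic_adj_def F by simp
qed

lemma cyclic_adj_shift2: "cyclic_map n F \<Longrightarrow> cyclic_adj n F u (v + i * n) \<longleftrightarrow> cyclic_adj n F u v"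
  using cyclic_adj_shift1 cyclic_adj_sym by metis

text \<open>For representatives less than one turn apart, only the translates by zero and by one
  turn can witness adjacency.\<close>

lemma cyclic_adj_rep:
  assumes "cyclic_map n F" "\<And>z. F z \<ge> z" "u \<le> v" "v < u + n"
  shows "cyclic_adj n F u v \<longleftrightarrow> v \<le> F u \<or> u + n \<le> F v"
proof
  have n: "n > 0" using cyclic_mapD(1) [OF assms(1)] .
  assume "cyclic_adj n F u v"
  then show "v \<le> F u \<or> u + n \<le> F v"
    unfolding cyclic_adj_def
  proof (elim disjE exE conjE)
    fix j assume j: "u \<le> v + j * n" "v + j * n \<le> F u"
    then have "j \<ge> 0"
      using assms(4) n by (smt (verit) mult_less_cancel_right2 mult_minus_left)
    then have "j * n \<ge> 0" using n by simp
    then show ?thesis using j by linarith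
  next
    fix j assume j: "v \<le> u + j * n" "u + j * n \<le> F v"
    show ?thesis
    proof (cases "j \<ge> 1")
      case True
      then have "j * n \<ge> n" using n by simp
      then show ?thesis using j by linarith
    next
      case False
      then have "j * n \<le> 0" using n by (simp add: mult_nonpos_nonneg)
      then show ?thesis using j assms(2) [of u] assms(3) by linarith
    qed
  qed
next
  assume "v \<le> F u \<or> u + n \<le> F v"
  then show "cyclic_adj n F u v"
    unfolding cyclic_adj_def
  proof
    assume "v \<le> F u"
    then show "(\<exists>j. u \<le> v + j * n \<and> v + j * n \<le> F u) \<or> (\<exists>j. v \<le> u + j * n \<and> u + j * n \<le> F v)"
      using assms(3) by (intro disjI1 exI [of _ 0]) simp
  next
    assume "u + n \<le> F v"
    then show "(\<exists>j. u \<le> v + j * n \<and> v + j * n \<le> F u) \<or> (\<exists>j. v \<le> u + j * n \<and> u + j * n \<le> F v)"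
      using assms(4) by (intro disjI2 exI [of _ 1]) simp
  qed
qed

lemma simplicial_cyclic: "simplicial (cyclic_complex n F)"
  unfolding simplicial_def cyclic_complex_def by (auto intro: finite_subset)

lemma cyclic_complex_fin: "S \<in> cyclic_complex n F \<Longrightarrow> finite S \<and> S \<noteq> {}"
  by (simp add: cyclic_complex_def)

lemma cyclic_complex_adj: "S \<in> cyclic_complex n F \<Longrightarrow> u \<in> S \<Longrightarrow> v \<in> S \<Longrightarrow> cyclic_adj n F u v"
  by (simp add: cyclic_complex_def)

lemma cyclic_complex_insert:
  assumes "S \<in> cyclic_complex n F" "F w \<ge> w" "\<And>u. u \<in> S \<Longrightarrow> cyclic_adj n F w u"
  shows "insert w S \<in> cyclic_complex n F"
  using assms cyclic_adj_sym [of n F] cyclic_adj_refl [of w F n] unfolding cyclic_complex_def by auto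

lemma cyclic_complex_mono: "(\<And>z. F z \<le> G z) \<Longrightarrow> cyclic_complex n F \<subseteq> cyclic_complex n G"
  unfolding cyclic_complex_def cyclic_adj_def by (auto intro: order_trans) (meson order_trans)

subsection \<open>The link of a new edge\<close>

text \<open>Raising \<open>F x\<close> to \<open>y = F x + 1\<close> adds the edge \<open>{x, y}\<close>. Representing vertices in
  \<open>[x, x + n)\<close>, its link lives on the vertices between \<open>x\<close> and \<open>y\<close> and on those \<open>v\<close> with
  \<open>y < v \<le> F y\<close> and \<open>x + n \<le> F v\<close>. The subcomplex \<open>Kab a b\<close> cut out by the bounds \<open>a\<close> and \<open>b\<close> is
  either contractible or the suspension of \<open>Kab (F b - n) (F a)\<close>, and under the winding
  conditions the iteration ends with exactly one of the two sides being empty.\<close>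

locale edge =
  fixes n :: int and F :: "int \<Rightarrow> int" and x :: int and l :: nat
  assumes F: "cyclic_map n F" and winding_gt: "winding_gt n F l" and step: "F x < F (x + 1)"
    and winding_lt: "winding_lt n (\<lambda>z. if n dvd z - x then F z + 1 else F z) l"
begin

definition "y = F x + 1"
definition "G = (\<lambda>z. if n dvd z - x then F z + 1 else F z)"
definition "rep v = (v - x) mod n + x"

lemma n: "n > 0" and F_mono: "u \<le> v \<Longrightarrow> F u \<le> F v" and F_per: "F (z + n) = F z + n"
  using cyclic_mapD [OF F] by auto

lemma F_gt: "z + 1 \<le> F z"
  using winding_gt_gt [OF F winding_gt] .

lemma F_ge: "z \<le> F z"
  using F_gt [of z] by linarith

lemma F_per': "F (z - n) = F z - n"
  using F_per [of "z - n"] by simp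

lemma F_int: "F (z + j * n) = F z + j * n"
  using periodic_int [of F n] F_per by blast

lemma cyclic_adj_F_refl: "cyclic_adj n F u u"
  by (rule cyclic_adj_refl) (rule F_ge)

lemma y: "x < y" "y \<le> F (x + 1)"
  using F_gt [of x] step by (auto simp: y_def)

lemma FG: "F z \<le> G z"
  by (simp add: G_def)

lemma G_mono: "u \<le> v \<Longrightarrow> G u \<le> G v"
proof -
  assume uv: "u \<le> v"
  have "F u + 1 \<le> F v" if d: "n dvd u - x" "\<not> n dvd v - x"
  proof -
    obtain j where "u = x + j * n"
      using d(1) by (metis add.commute diff_add_cancel dvd_def mult.commute)
    then have "F u < F (u + 1)"
      using step F_int [of x j] F_int [of "x + 1" j] by (simp add: algebra_simps)
    moreover have "u + 1 \<le> v" using uv d by (cases "u = v") auto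
    ultimately show ?thesis using F_mono [of "u + 1" v] by linarith
  qed
  then show ?thesis
    using F_mono [OF uv] by (auto simp: G_def)
qed

lemma G_per: "G (z + n) = G z + n"
proof -
  have "n dvd z + n - x \<longleftrightarrow> n dvd z - x"
    by (metis add_diff_eq diff_add_eq dvd_add_triv_right_iff)
  then show ?thesis by (simp add: G_def F_per)
qed

lemma cyclic_map_G: "cyclic_map n G"
  using n G_mono G_per by (simp add: cyclic_map_def mono_def)

lemma G_ge: "z \<le> G z"
  using F_ge [of z] FG [of z] by linarith

lemma G_x: "G x = y"
  by (simp add: G_def y_def)

lemma winding_lt_G: "(G ^^ (2 * l + 3)) z \<le> z + (int l + 1) * n - 1"
  using winding_lt unfolding winding_lt_def G_def by blast

text \<open>Otherwise two steps of \<open>G\<close> from \<open>x\<close> complete a turn and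
  \<open>2l+2\<close> steps complete \<open>l+1\<close> turns, against the upper winding bound for
  \<open>G\<close>.\<close>

lemma Fy: "F y < x + n"
proof (rule ccontr)
  assume "\<not> F y < x + n"
  then have *: "(G ^^ 2) x \<ge> x + n"
    using FG [of y] by (simp add: numeral_2_eq_2 G_x)
  have "(G ^^ (2 * k)) x \<ge> x + int k * n" for k
  proof (induction k)
    case (Suc k)
    have "(G ^^ 2) (x + int k * n) \<le> (G ^^ 2) ((G ^^ (2 * k)) x)"
      using Suc by (intro funpow_le) (auto intro: G_mono)
    moreover have "(G ^^ 2) (x + int k * n) = (G ^^ 2) x + int k * n"
      by (rule periodic_nat, rule funpow_periodic, rule G_per)
    ultimately show ?case
      using * by (simp add: algebra_simps flip: funpow_add [THEN fun_cong, unfolded comp_def])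
  qed simp
  from this [of "l + 1"] have "x + (int l + 1) * n \<le> (G ^^ (2 * l + 2)) x"
    by (simp add: add.commute)
  also have "\<dots> \<le> G ((G ^^ (2 * l + 2)) x)"
    by (rule G_ge)
  also have "\<dots> = (G ^^ (2 * l + 3)) x"
    by (simp add: eval_nat_numeral)
  finally show False using winding_lt_G [of x] by simp
qed

lemma y_lt: "y < x + n"
  using Fy F_ge [of y] by linarith

lemma rep: "x \<le> rep v" "rep v < x + n" "\<exists>j. v = rep v + j * n"
proof -
  show "x \<le> rep v" "rep v < x + n" using n by (auto simp: rep_def)
  have "v - x = ((v - x) div n) * n + (v - x) mod n" by simp
  then show "\<exists>j. v = rep v + j * n"
    unfolding rep_def by (metis add.commute add_diff_cancel_left' diff_add_cancel group_cancel.add2)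
qed

lemma rep_id: "x \<le> v \<Longrightarrow> v < x + n \<Longrightarrow> rep v = v"
  by (simp add: rep_def)

lemma cyclic_adj_F_rep: "cyclic_adj n F (rep u) v \<longleftrightarrow> cyclic_adj n F u v" "cyclic_adj n F v (rep u) \<longleftrightarrow> cyclic_adj n F v u"
  using rep(3) [of u] cyclic_adj_shift1 [OF F] cyclic_adj_shift2 [OF F] by metis+

lemma cyclic_adj_G_rep: "cyclic_adj n G (rep u) v \<longleftrightarrow> cyclic_adj n G u v" "cyclic_adj n G v (rep u) \<longleftrightarrow> cyclic_adj n G v u"
  using rep(3) [of u] cyclic_adj_shift1 [OF cyclic_map_G] cyclic_adj_shift2 [OF cyclic_map_G] by metis+

lemma cyclic_adj_F:
  assumes "rep u \<le> rep v"
  shows "cyclic_adj n F u v \<longleftrightarrow> rep v \<le> F (rep u) \<or> rep u + n \<le> F (rep v)"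
proof -
  have "cyclic_adj n F u v \<longleftrightarrow> cyclic_adj n F (rep u) (rep v)" by (simp add: cyclic_adj_F_rep)
  also have "\<dots> \<longleftrightarrow> rep v \<le> F (rep u) \<or> rep u + n \<le> F (rep v)"
    by (rule cyclic_adj_rep [OF F F_ge assms]) (use rep [of u] rep [of v] in linarith)
  finally show ?thesis .
qed

lemma cyclic_adj_G:
  assumes "rep u \<le> rep v"
  shows "cyclic_adj n G u v \<longleftrightarrow> rep v \<le> G (rep u) \<or> rep u + n \<le> G (rep v)"
proof -
  have "cyclic_adj n G u v \<longleftrightarrow> cyclic_adj n G (rep u) (rep v)" by (simp add: cyclic_adj_G_rep)
  also have "\<dots> \<longleftrightarrow> rep v \<le> G (rep u) \<or> rep u + n \<le> G (rep v)"
    by (rule cyclic_adj_rep [OF cyclic_map_G G_ge assms]) (use rep [of u] rep [of v] in linarith)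
  finally show ?thesis .
qed

lemma G_rep: "x < rep v \<Longrightarrow> G (rep v) = F (rep v)"
proof -
  assume "x < rep v"
  then have "\<not> n dvd rep v - x"
    using rep(2) [of v] by (auto dest: zdvd_imp_le)
  then show ?thesis by (simp add: G_def)
qed

text \<open>\<open>G\<close> exceeds \<open>F\<close> only at translates of \<open>x\<close>, and
  there it gains just the corresponding translate of \<open>y\<close>.\<close>

lemma cyclic_adj_GF1:
  assumes "u \<le> v + j * n" "v + j * n \<le> G u"
  shows "cyclic_adj n F u v \<or> rep u = x \<and> rep v = y"
proof (cases "v + j * n \<le> F u")
  case True
  then show ?thesis using assms by (auto simp: cyclic_adj_def)
next
  case False
  then have d: "n dvd u - x" and v: "v + j * n = F u + 1"
    using assms by (auto simp: G_def split: if_splits)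
  then obtain i where i: "u = x + i * n"
    by (metis add.commute diff_add_cancel dvd_def mult.commute)
  then have "v = y + (i - j) * n"
    using v F_int [of x i] by (simp add: y_def algebra_simps)
  moreover have "rep (w + k * n) = rep w" for w k
    unfolding rep_def by (metis add_diff_eq diff_add_eq mod_mult_self1)
  ultimately show ?thesis
    using i rep_id [of x] rep_id [of y] y_lt y(1) n by simp
qed

lemma cyclic_adj_GF: "cyclic_adj n G u v \<Longrightarrow> cyclic_adj n F u v \<or> rep u = x \<and> rep v = y \<or> rep u = y \<and> rep v = x"
  using cyclic_adj_GF1 [of u v] cyclic_adj_GF1 [of v u] cyclic_adj_sym [of n F u v] unfolding cyclic_adj_def [of n G] by blast

lemma rep_x: "rep x = x" and rep_y: "rep y = y"
  using rep_id n y(1) y_lt by auto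

lemma not_adj_xy: "rep u = x \<Longrightarrow> rep v = y \<Longrightarrow> \<not> cyclic_adj n F u v"
  using cyclic_adj_F [of u v] y(1) Fy by (simp add: y_def)

definition Kab :: "int \<Rightarrow> int \<Rightarrow> int set set" where
  "Kab a b = {S \<in> cyclic_complex n F. \<forall>v\<in>S. x < rep v \<and> rep v \<le> a \<or> y < rep v \<and> rep v \<le> b \<and> x + n \<le> F (rep v)}"

lemma Kab_cyclic: "S \<in> Kab a b \<Longrightarrow> S \<in> cyclic_complex n F"
  by (simp add: Kab_def)

lemma Kab_cases: "S \<in> Kab a b \<Longrightarrow> v \<in> S \<Longrightarrow> x < rep v \<and> rep v \<le> a \<or> y < rep v \<and> rep v \<le> b \<and> x + n \<le> F (rep v)"
  by (simp add: Kab_def)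

lemma simplicial_Kab: "simplicial (Kab a b)"
  unfolding Kab_def by (rule simplicial_filter [OF simplicial_cyclic]) blast

lemma Kab_insert:
  assumes "S \<in> Kab a b" "x < rep w \<and> rep w \<le> a \<or> y < rep w \<and> rep w \<le> b \<and> x + n \<le> F (rep w)"
    "\<And>u. u \<in> S \<Longrightarrow> cyclic_adj n F w u"
  shows "insert w S \<in> Kab a b"
  using assms cyclic_complex_insert [of S n F w] F_ge unfolding Kab_def by simp

lemma Kab_single:
  assumes "x < rep w \<and> rep w \<le> a \<or> y < rep w \<and> rep w \<le> b \<and> x + n \<le> F (rep w)"
  shows "{w} \<in> Kab a b"
  using assms cyclic_adj_F_refl unfolding Kab_def cyclic_complex_def by simp

text \<open>The vertices between \<open>x\<close> and \<open>y\<close> form a clique because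
  \<open>F\<close> jumps at \<open>x + 1\<close> to \<open>y\<close> or beyond; this is where the
  choice of \<open>x\<close> through \<open>step\<close> enters.\<close>

lemma cyclic_adj_left:
  assumes "x < rep u" "rep u \<le> F x" "x < rep v" "rep v \<le> F x"
  shows "cyclic_adj n F u v"
proof -
  have *: "cyclic_adj n F u v" if "rep u \<le> rep v" "x < rep u" "rep v \<le> F x" for u v
    using that cyclic_adj_F [OF that(1)] F_mono [of "x + 1" "rep u"] y(2) by (simp add: y_def)
  then show ?thesis using assms cyclic_adj_sym [of n F] by (meson linear)
qed

text \<open>A vertex reaching \<open>x + n\<close> reaches every later representative, all of which
  lie below \<open>x + n\<close>. So the link consists of two cliques and the adjacencies between
  them.\<close>

lemma cyclic_adj_right:
  assumes "x + n \<le> F (rep u)" "x + n \<le> F (rep v)"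
  shows "cyclic_adj n F u v"
proof -
  have *: "cyclic_adj n F u v" if "rep u \<le> rep v" "x + n \<le> F (rep u)" for u v
    using that cyclic_adj_F [OF that(1)] rep(2) [of v] by simp
  then show ?thesis using assms cyclic_adj_sym [of n F] by (meson linear)
qed

context
  fixes M :: "'a set set" and k :: "'k::field itself"
  assumes M: "simplicial M"
begin

text \<open>With nothing on the right, only the clique up to \<open>a\<close> is left, and
  \<open>a\<close> is a cone point of it.\<close>

lemma Kab_left:
  assumes "x < a" "a \<le> F x" "\<And>w. y < w \<Longrightarrow> w \<le> b \<Longrightarrow> F w < x + n"
  shows "acyclic_factor TYPE('k) M (Kab a b)"
proof (rule acyclic_factor_cone [OF M simplicial_Kab])
  have a: "rep a = a" using assms y_lt by (intro rep_id) (auto simp: y_def)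
  show "Kab a b \<noteq> {}" using Kab_single [of a a b] a assms by auto
  fix S assume S: "S \<in> Kab a b"
  show "insert a S \<in> Kab a b"
  proof (rule Kab_insert [OF S])
    fix u assume "u \<in> S"
    then have "x < rep u" "rep u \<le> a"
      using Kab_cases [OF S] assms(3) by force+
    then show "cyclic_adj n F a u" using a assms by (intro cyclic_adj_left) auto
  qed (use a assms in auto)
qed

lemma Kab_right:
  assumes "a \<le> x" "y < b" "b \<le> F y" "x + n \<le> F b"
  shows "acyclic_factor TYPE('k) M (Kab a b)"
proof (rule acyclic_factor_cone [OF M simplicial_Kab])
  have b: "rep b = b" using assms Fy y(1) by (intro rep_id) auto
  show "Kab a b \<noteq> {}" using Kab_single [of b a b] b assms by auto
  fix S assume S: "S \<in> Kab a b"
  show "insert b S \<in> Kab a b"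
  proof (rule Kab_insert [OF S])
    fix u assume "u \<in> S"
    then have "x + n \<le> F (rep u)"
      using Kab_cases [OF S] assms(1) by force
    then show "cyclic_adj n F b u" using b assms by (intro cyclic_adj_right) auto
  qed (use b assms in auto)
qed

text \<open>Cover by the stars of the extreme vertices \<open>a\<close> and \<open>b\<close>. If
  these are adjacent, the stars meet in a cone. Otherwise a left vertex is adjacent to
  \<open>b\<close> only around the circle, that is up to \<open>F b - n\<close>, and a right vertex
  to \<open>a\<close> only up to \<open>F a\<close>, which gives a smaller complex of the same
  kind.\<close>

lemma Kab_both:
  assumes a: "x < a" "a \<le> F x" and b: "y < b" "b \<le> F y" "x + n \<le> F b"
    and ind: "\<not> cyclic_adj n F a b \<Longrightarrow> F b - n < a \<Longrightarrow> F a < b \<Longrightarrow> acyclic_factor TYPE('k) M (Kab (F b - n) (F a))"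
  shows "acyclic_factor TYPE('k) M (Kab a b)"
proof -
  have ra: "rep a = a" using a y_lt by (intro rep_id) (auto simp: y_def)
  have rb: "rep b = b" using b Fy y(1) by (intro rep_id) auto
  have ab: "a < b" using a b by (auto simp: y_def)
  let ?U = "{S \<in> Kab a b. insert a S \<in> Kab a b}" and ?V = "{S \<in> Kab a b. insert b S \<in> Kab a b}"
  have cU: "simplicial ?U" and cV: "simplicial ?V"
    by (rule simplicial_star [OF simplicial_Kab]; auto)+
  have sa: "{a} \<in> Kab a b" and sb: "{b} \<in> Kab a b"
    using Kab_single ra rb a b by auto
  have aU: "acyclic_factor TYPE('k) M ?U"
    by (rule acyclic_factor_cone [OF M cU, of a]) (use sa in auto)
  have aV: "acyclic_factor TYPE('k) M ?V"
    by (rule acyclic_factor_cone [OF M cV, of b]) (use sb in auto)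
  \<comment> \<open>A simplex outside the star of \<open>a\<close> has a right vertex
    \<open>v\<close> beyond \<open>F a\<close>. A left vertex \<open>u\<close> of it can be adjacent
    to \<open>v\<close> only around the circle, so in representatives
    \<open>u + n \<le> F v \<le> F b\<close>, and \<open>u\<close> is adjacent to
    \<open>b\<close>.\<close>
  have "insert b S \<in> Kab a b" if S: "S \<in> Kab a b" and nU: "insert a S \<notin> Kab a b" for S
  proof -
    obtain v where v: "v \<in> S" "\<not> cyclic_adj n F a v"
      using nU Kab_insert [OF S, of a] ra a by auto
    have vB: "y < rep v" "rep v \<le> b" "x + n \<le> F (rep v)"
      using Kab_cases [OF S v(1)] v(2) cyclic_adj_left [of a v] ra a by auto
    have av: "F a < rep v" "F (rep v) < a + n"
      using v(2) cyclic_adj_F [of a v] ra vB a by (auto simp: y_def)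
    show ?thesis
    proof (rule Kab_insert [OF S])
      fix u assume u: "u \<in> S"
      show "cyclic_adj n F b u"
      proof (cases "x < rep u \<and> rep u \<le> a")
        case True
        then have "rep v \<le> F (rep u) \<or> rep u + n \<le> F (rep v)"
          using cyclic_complex_adj [OF Kab_cyclic [OF S] u v(1)] cyclic_adj_F [of u v] vB a by (auto simp: y_def)
        then have "rep u + n \<le> F b"
          using F_mono [of "rep u" a] F_mono [of "rep v" b] True av vB by linarith
        then have "cyclic_adj n F u b"
          using cyclic_adj_F [of u b] rb True ab by auto
        then show ?thesis by (simp add: cyclic_adj_sym)
      next
        case False
        then show ?thesis
          using Kab_cases [OF S u] cyclic_adj_right [of b u] rb b by auto
      qed
    qed (use rb b in auto)
  qed
  then have UV: "Kab a b = ?U \<union> ?V" by blast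
  have "acyclic_factor TYPE('k) M (?U \<inter> ?V)"
  proof (cases "cyclic_adj n F a b")
    case True
    show ?thesis
    proof (rule acyclic_factor_cone [OF M simplicial_Int [OF cU cV], of a])
      have "insert a {b} \<in> Kab a b"
        by (rule Kab_insert [OF sb]) (use ra a True in auto)
      moreover have "insert b {a} = insert a {b}" by auto
      ultimately show "?U \<inter> ?V \<noteq> {}"
        using sa by force
      fix S assume S: "S \<in> ?U \<inter> ?V"
      then have 1: "insert a S \<in> Kab a b" and 2: "insert b S \<in> Kab a b" by auto
      have "insert b (insert a S) \<in> Kab a b"
        by (rule Kab_insert [OF 1])
          (use rb b True cyclic_complex_adj [OF Kab_cyclic [OF 2]] cyclic_adj_sym [of n F a b] in auto)
      with 1 show "insert a S \<in> ?U \<inter> ?V" by simp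
    qed
  next
    case False
    then have ab': "F a < b" "F b < a + n"
      using cyclic_adj_F [of a b] ra rb ab by auto
    have "?U \<inter> ?V = Kab (F b - n) (F a)"
    proof (intro set_eqI iffI)
      fix S assume "S \<in> ?U \<inter> ?V"
      then have S: "S \<in> Kab a b" "insert a S \<in> Kab a b" "insert b S \<in> Kab a b" by auto
      have "x < rep v \<and> rep v \<le> F b - n \<or> y < rep v \<and> rep v \<le> F a \<and> x + n \<le> F (rep v)" if v: "v \<in> S" for v
      proof (cases "x < rep v \<and> rep v \<le> a")
        case True
        have "cyclic_adj n F v b"
          using cyclic_complex_adj [OF Kab_cyclic [OF S(3)], of v b] v by simp
        then have "b \<le> F (rep v) \<or> rep v + n \<le> F b"
          using cyclic_adj_F [of v b] rb True ab by simp
        then show ?thesis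
          using F_mono [of "rep v" a] True ab' by linarith
      next
        case False
        then have B: "y < rep v" "rep v \<le> b" "x + n \<le> F (rep v)"
          using Kab_cases [OF S(1) v] by auto
        have "cyclic_adj n F a v"
          using cyclic_complex_adj [OF Kab_cyclic [OF S(2)], of a v] v by simp
        then have "rep v \<le> F a \<or> a + n \<le> F (rep v)"
          using cyclic_adj_F [of a v] ra B a by (simp add: y_def)
        then show ?thesis
          using F_mono [of "rep v" b] B ab' by linarith
      qed
      with S(1) show "S \<in> Kab (F b - n) (F a)" by (simp add: Kab_def)
    next
      fix S assume S: "S \<in> Kab (F b - n) (F a)"
      have S': "S \<in> Kab a b"
        using S ab' unfolding Kab_def by force
      have "insert a S \<in> Kab a b"
      proof (rule Kab_insert [OF S'])
        fix u assume u: "u \<in> S"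
        show "cyclic_adj n F a u"
          using Kab_cases [OF S u] cyclic_adj_left [of a u] cyclic_adj_F [of a u] ra a ab' by (auto simp: y_def)
      qed (use ra a in auto)
      moreover have "insert b S \<in> Kab a b"
      proof (rule Kab_insert [OF S'])
        fix u assume u: "u \<in> S"
        have "cyclic_adj n F u b"
          using Kab_cases [OF S u] cyclic_adj_right [of u b] cyclic_adj_F [of u b] rb b a ab' ab by auto
        then show "cyclic_adj n F b u" by (simp add: cyclic_adj_sym)
      qed (use rb b in auto)
      ultimately show "S \<in> ?U \<inter> ?V" using S' by simp
    qed
    then show ?thesis using ind [OF False] ab' by simp
  qed
  from acyclic_factor_Un [OF M cU cV aU aV this] show ?thesis
    using UV by simp
qed

text \<open>Once the left bound has dropped to \<open>x\<close> it never recovers: two further steps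
  lead at most to \<open>F (F x) \<le> F y < x + n\<close>, below \<open>x\<close> after subtracting
  a turn. At \<open>j = l\<close> this contradicts the lower winding bound.\<close>

lemma left_pos:
  assumes "j \<le> l"
  shows "(F ^^ (2 * j + 1)) x - int j * n \<ge> x + 1"
proof (rule ccontr)
  assume *: "\<not> x + 1 \<le> (F ^^ (2 * j + 1)) x - int j * n"
  have "(F ^^ (2 * (j + i) + 1)) x - int (j + i) * n \<le> x" for i
  proof (induction i)
    case 0
    then show ?case using * by simp
  next
    case (Suc i)
    let ?c = "(F ^^ (2 * (j + i) + 1)) x"
    have "?c + (- int (j + i)) * n \<le> x" using Suc by (simp add: algebra_simps)
    then have "F (F (?c + (- int (j + i)) * n)) \<le> F (F x)"
      by (intro F_mono)
    then have "F (F ?c) - int (j + i) * n \<le> F (F x)"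
      unfolding F_int by (simp add: algebra_simps)
    also have "\<dots> \<le> F y"
      by (rule F_mono) (simp add: y_def)
    also have "\<dots> < x + n" by (rule Fy)
    finally show ?case by (simp add: algebra_simps)
  qed
  from this [of "l - j"] have "(F ^^ (2 * l + 1)) x - int l * n \<le> x"
    using assms by simp
  moreover have "(F ^^ (2 * l + 1)) x \<ge> x + int l * n + 1"
    using winding_gt unfolding winding_gt_def by blast
  ultimately show False by simp
qed

text \<open>Since \<open>y = G x\<close>, the \<open>2l+2\<close> steps of \<open>F\<close> from
  \<open>y\<close> are dominated by \<open>2l+3\<close> steps of \<open>G\<close> from
  \<open>x\<close>, to which the upper winding bound applies.\<close>

lemma right_end: "(F ^^ (2 * l + 2)) y - int l * n < x + n"
proof -
  have "(F ^^ (2 * l + 2)) y \<le> (G ^^ (2 * l + 2)) y"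
    by (rule funpow_le [OF F_mono FG]) auto
  also have "\<dots> = (G ^^ (2 * l + 3)) x"
    by (simp add: eval_nat_numeral funpow_swap1 G_x)
  also have "\<dots> \<le> x + (int l + 1) * n - 1"
    by (rule winding_lt_G)
  finally show ?thesis by (simp add: algebra_simps)
qed

text \<open>Two passages from \<open>(a, b)\<close> to \<open>(F b - n, F a)\<close> make one round
  and increase \<open>j\<close> by one. At full rounds the left side is nonempty by
  \<open>left_pos\<close>, and the right side is empty by round \<open>l\<close> at the latest by
  \<open>right_end\<close>. So the descent stops where exactly one side is empty, and there the
  complex is a cone.\<close>

lemma Kab_iterate:
  assumes "j \<le> l" "(F ^^ (2 * j + 1)) x - int j * n \<le> F x" "(F ^^ (2 * j + 1)) y - int j * n \<le> F y"
  shows "acyclic_factor TYPE('k) M (Kab ((F ^^ (2 * j + 1)) x - int j * n) ((F ^^ (2 * j + 1)) y - int j * n))"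
  using assms
proof (induction "l - j" arbitrary: j rule: less_induct)
  case less
  let ?a = "(F ^^ (2 * j + 1)) x - int j * n" and ?b = "(F ^^ (2 * j + 1)) y - int j * n"
  have a: "x < ?a" "?a \<le> F x" using left_pos [of j] less by auto
  have Fa: "F ?a = F ((F ^^ (2 * j + 1)) x) - int j * n" and Fb: "F ?b = F ((F ^^ (2 * j + 1)) y) - int j * n"
    using F_int [of _ "- int j"] by auto
  show ?case
  proof (cases "y < ?b \<and> x + n \<le> F ?b")
    case False
    have "F w < x + n" if "y < w" "w \<le> ?b" for w
      using False that F_mono [OF that(2)] by linarith
    then show ?thesis by (rule Kab_left [OF a])
  next
    case True
    have jl: "j < l"
    proof (rule ccontr)
      assume "\<not> j < l"
      then have "j = l" using less.prems by simp
      then show False using right_end True unfolding Fb by simp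
    qed
    have pos: "(F ^^ (2 * (j + 1) + 1)) x - int (j + 1) * n \<ge> x + 1"
      using left_pos [of "j + 1"] jl by simp
    have a2: "F (F ?a) - n = (F ^^ (2 * (j + 1) + 1)) x - int (j + 1) * n"
      unfolding Fa using F_int [of _ "- int j"] by (simp add: algebra_simps)
    have b2: "F (F ?b - n) = (F ^^ (2 * (j + 1) + 1)) y - int (j + 1) * n"
      unfolding F_per' Fb using F_int [of _ "- int j"] by (simp add: algebra_simps)
    show ?thesis
    proof (rule Kab_both [OF a])
      show "y < ?b" "?b \<le> F y" "x + n \<le> F ?b" using True less.prems by auto
      assume lt: "F ?b - n < ?a" "F ?a < ?b"
      \<comment> \<open>Survival of the left bound in the next round makes \<open>F ?a\<close> a
        legitimate right bound: it reaches past \<open>x + n\<close>, and it differs from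
        \<open>y\<close>, which does not.\<close>
      have "F (F ?a) \<ge> x + n + 1" using pos a2 by linarith
      have Fa1: "y < F ?a"
      proof -
        have "y \<le> F ?a" using F_mono [of "x + 1" ?a] y(2) a by linarith
        moreover have "F ?a \<noteq> y" using \<open>F (F ?a) \<ge> x + n + 1\<close> Fy by auto
        ultimately show ?thesis by linarith
      qed
      have b1: "F ?a \<le> F y" using lt less.prems by linarith
      have b3: "x + n \<le> F (F ?a)" using \<open>F (F ?a) \<ge> x + n + 1\<close> by linarith
      show "acyclic_factor TYPE('k) M (Kab (F ?b - n) (F ?a))"
      proof (cases "F ?b - n \<le> x")
        case True
        then show ?thesis using Fa1 b1 b3 by (rule Kab_right)
      next
        case False
        show ?thesis
        proof (rule Kab_both [OF _ _ Fa1 b1 b3])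
          show "x < F ?b - n" "F ?b - n \<le> F x" using False lt a by auto
          assume lt2: "F (F ?a) - n < F ?b - n" "F (F ?b - n) < F ?a"
          show "acyclic_factor TYPE('k) M (Kab (F (F ?a) - n) (F (F ?b - n)))"
            unfolding a2 b2
          proof (rule less.hyps)
            show "l - (j + 1) < l - j" "j + 1 \<le> l" using jl by auto
            show "(F ^^ (2 * (j + 1) + 1)) x - int (j + 1) * n \<le> F x"
              using lt lt2 a unfolding a2 [symmetric] by linarith
            show "(F ^^ (2 * (j + 1) + 1)) y - int (j + 1) * n \<le> F y"
              using lt2 b1 unfolding b2 [symmetric] by linarith
          qed
        qed
      qed
    qed
  qed
qed

text \<open>The added simplices lie in the star \<open>?V\<close> of the edge \<open>{x, y}\<close>.
  Its intersection with the old complex splits into a part without copies of \<open>y\<close>, a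
  cone with apex \<open>x\<close>, and a part without copies of \<open>x\<close>, a cone with apex
  \<open>y\<close>. These meet in the link, so the intersection is the suspension of an acyclic
  complex.\<close>

lemma inclusion_iso_edge: "inclusion_iso TYPE('k) M (cyclic_complex n F) (cyclic_complex n G)"
proof -
  let ?V = "{S \<in> cyclic_complex n G. insert x (insert y S) \<in> cyclic_complex n G}"
  have cV: "simplicial ?V"
    by (rule simplicial_star [OF simplicial_cyclic]) auto
  have sub: "cyclic_complex n F \<subseteq> cyclic_complex n G"
    by (rule cyclic_complex_mono) (rule FG)
  have "S \<in> ?V" if S: "S \<in> cyclic_complex n G" "S \<notin> cyclic_complex n F" for S
  proof -
    obtain u v where uv: "u \<in> S" "v \<in> S" "\<not> cyclic_adj n F u v"
      using S by (auto simp: cyclic_complex_def)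
    have "cyclic_adj n G u v" using cyclic_complex_adj [OF S(1)] uv by blast
    then have "rep u = x \<and> rep v = y \<or> rep u = y \<and> rep v = x"
      using cyclic_adj_GF uv(3) by blast
    then obtain u' v' where uv': "u' \<in> S" "v' \<in> S" "rep u' = x" "rep v' = y"
      using uv by blast
    have ax: "cyclic_adj n G x w" if "w \<in> S" for w
      using cyclic_complex_adj [OF S(1) uv'(1) that] uv'(3) cyclic_adj_G_rep(1) [of u' w] by simp
    have ay: "cyclic_adj n G y w" if "w \<in> S" for w
      using cyclic_complex_adj [OF S(1) uv'(2) that] uv'(4) cyclic_adj_G_rep(1) [of v' w] by simp
    have axy: "cyclic_adj n G x y"
      using ax [OF uv'(2)] uv'(4) cyclic_adj_G_rep(2) [of x v'] by simp
    have "insert y S \<in> cyclic_complex n G"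
      by (rule cyclic_complex_insert) (use S(1) G_ge ay in auto)
    then have "insert x (insert y S) \<in> cyclic_complex n G"
      by (rule cyclic_complex_insert) (use G_ge ax axy in auto)
    then show ?thesis using S by simp
  qed
  then have K: "cyclic_complex n G = cyclic_complex n F \<union> ?V" using sub by blast
  have axy: "cyclic_adj n G x y"
    using cyclic_adj_G [of x y] rep_x rep_y y(1) G_x by simp
  then have xy: "insert x {y} \<in> cyclic_complex n G"
    using cyclic_adj_sym [of n G x y] cyclic_adj_refl [of x G n] cyclic_adj_refl [of y G n] G_ge by (auto simp: cyclic_complex_def)
  then have sx: "{x} \<in> ?V" and sy: "{y} \<in> ?V"
    using simplicialD [OF simplicial_cyclic xy] by (auto simp: insert_commute)
  have aV: "acyclic_factor TYPE('k) M ?V"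
  proof (rule acyclic_factor_cone [OF M cV, of x])
    show "insert x S \<in> ?V" if "S \<in> ?V" for S
      using that simplicialD [OF simplicial_cyclic, of "insert x (insert y S)" n G "insert x S"]
      by (auto simp: insert_commute)
  qed (use sx in auto)
  let ?I = "cyclic_complex n F \<inter> ?V"
  let ?U = "{S \<in> ?I. \<forall>v\<in>S. rep v \<noteq> y}" and ?W = "{S \<in> ?I. \<forall>v\<in>S. rep v \<noteq> x}"
  have cI: "simplicial ?I" by (rule simplicial_Int [OF simplicial_cyclic cV])
  have cU: "simplicial ?U" and cW: "simplicial ?W"
    by (rule simplicial_filter [OF cI]; blast)+
  \<comment> \<open>Copies of \<open>x\<close> and \<open>y\<close> are never adjacent for
    \<open>F\<close>, so no simplex of the old complex contains both.\<close>
  have "?I = ?U \<union> ?W"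
    using not_adj_xy cyclic_complex_adj by blast
  have sF: "{w} \<in> cyclic_complex n F" for w
    using cyclic_adj_F_refl by (simp add: cyclic_complex_def)
  have aU: "acyclic_factor TYPE('k) M ?U"
  proof (rule acyclic_factor_cone [OF M cU, of x])
    have "{x} \<in> ?U" using sx sF rep_x y(1) by auto
    then show "?U \<noteq> {}" by blast
    fix S assume S: "S \<in> ?U"
    have "cyclic_adj n F x u" if "u \<in> S" for u
      using S that cyclic_complex_adj [of "insert x (insert y S)" n G x u] cyclic_adj_GF [of x u] rep_x y(1) by auto
    then have "insert x S \<in> cyclic_complex n F"
      using S by (intro cyclic_complex_insert F_ge) auto
    moreover have "insert x (insert y (insert x S)) = insert x (insert y S)" by auto
    then have "insert x S \<in> ?V"
      using S sub calculation by auto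
    ultimately show "insert x S \<in> ?U" using \<open>insert x S \<in> ?V\<close> S rep_x y(1) by auto
  qed
  have aW: "acyclic_factor TYPE('k) M ?W"
  proof (rule acyclic_factor_cone [OF M cW, of y])
    have "{y} \<in> ?W" using sy sF rep_y y(1) by auto
    then show "?W \<noteq> {}" by blast
    fix S assume S: "S \<in> ?W"
    have "cyclic_adj n F y u" if "u \<in> S" for u
      using S that cyclic_complex_adj [of "insert x (insert y S)" n G y u] cyclic_adj_GF [of y u] rep_y y(1) by auto
    then have "insert y S \<in> cyclic_complex n F"
      using S by (intro cyclic_complex_insert F_ge) auto
    moreover have "insert y S \<in> ?V"
      using S sub calculation by (auto simp: insert_commute)
    ultimately show "insert y S \<in> ?W" using S rep_y y(1) by auto
  qed
  have "?U \<inter> ?W = Kab (F x) (F y)"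
  proof (intro set_eqI iffI)
    fix S assume "S \<in> ?U \<inter> ?W"
    then have S: "S \<in> cyclic_complex n F" "insert x (insert y S) \<in> cyclic_complex n G" "\<And>v. v \<in> S \<Longrightarrow> rep v \<noteq> x \<and> rep v \<noteq> y"
      by auto
    have "x < rep v \<and> rep v \<le> F x \<or> y < rep v \<and> rep v \<le> F y \<and> x + n \<le> F (rep v)" if v: "v \<in> S" for v
    proof (cases "rep v < y")
      case True
      then show ?thesis using S(3) [OF v] rep(1) [of v] by (auto simp: y_def)
    next
      case False
      then have yv: "y < rep v" using S(3) [OF v] by auto
      then have Gv: "G (rep v) = F (rep v)" using G_rep y(1) by auto
      have "cyclic_adj n G x v" "cyclic_adj n G y v"
        using cyclic_complex_adj [OF S(2)] v by auto
      then have "rep v \<le> y \<or> x + n \<le> F (rep v)" "rep v \<le> F y \<or> y + n \<le> F (rep v)"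
        using cyclic_adj_G [of x v] cyclic_adj_G [of y v] rep_x rep_y yv y(1) Gv G_x G_rep [of y] by auto
      moreover have "F (rep v) \<le> F x + n"
        using F_mono [of "rep v" "x + n"] rep(2) [of v] F_per by simp
      ultimately show ?thesis using yv by (auto simp: y_def)
    qed
    then show "S \<in> Kab (F x) (F y)" using S by (simp add: Kab_def)
  next
    fix S assume S: "S \<in> Kab (F x) (F y)"
    have ne: "rep v \<noteq> x \<and> rep v \<noteq> y" if "v \<in> S" for v
      using Kab_cases [OF S that] y by (auto simp: y_def)
    have SG: "S \<in> cyclic_complex n G" using S sub Kab_cyclic by blast
    have ax: "cyclic_adj n G x v" if "v \<in> S" for v
      using Kab_cases [OF S that] cyclic_adj_G [of x v] rep_x G_x G_rep [of v] y(1) by (auto simp: y_def)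
    have ay: "cyclic_adj n G y v" if "v \<in> S" for v
      using Kab_cases [OF S that]
    proof
      assume v: "x < rep v \<and> rep v \<le> F x"
      then have "cyclic_adj n G v y"
        using cyclic_adj_G [of v y] rep_y G_rep [of v] F_mono [of "x + 1" "rep v"] y(2) by (auto simp: y_def)
      then show ?thesis by (simp add: cyclic_adj_sym)
    next
      assume v: "y < rep v \<and> rep v \<le> F y \<and> x + n \<le> F (rep v)"
      then show ?thesis
        using cyclic_adj_G [of y v] rep_y G_rep [of y] y(1) by auto
    qed
    have "insert y S \<in> cyclic_complex n G"
      by (rule cyclic_complex_insert) (use SG G_ge ay in auto)
    then have "insert x (insert y S) \<in> cyclic_complex n G"
      by (rule cyclic_complex_insert) (use G_ge ax axy in auto)
    then show "S \<in> ?U \<inter> ?W" using Kab_cyclic [OF S] SG ne by auto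
  qed
  moreover have "acyclic_factor TYPE('k) M (Kab (F x) (F y))"
    using Kab_iterate [of 0] by simp
  ultimately have "acyclic_factor TYPE('k) M (?U \<inter> ?W)" by simp
  from acyclic_factor_Un [OF M cU cW aU aW this] have "acyclic_factor TYPE('k) M ?I"
    using \<open>?I = ?U \<union> ?W\<close> by simp
  from inclusion_iso_Un [OF M simplicial_cyclic cV aV this] show ?thesis
    using K by simp
qed

end

end

text \<open>Follow the plateau of \<open>F\<close> through \<open>z\<close> to its last point. There
  \<open>F\<close> jumps, as \<open>step\<close> requires, and \<open>G\<close> is still larger
  because it is monotone.\<close>

lemma cyclic_complex_raise:
  fixes F G :: "int \<Rightarrow> int"
  assumes F: "cyclic_map n F" and G: "cyclic_map n G" and le: "\<And>z. F z \<le> G z" and z: "F z < G z"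
  obtains x where "F x < F (x + 1)" "F x < G x"
proof -
  define P where "P k \<longleftrightarrow> F (z + int k + 1) > F z" for k
  have n: "n > 0" using cyclic_mapD(1) [OF F] .
  have "P (nat (n - 1))"
    using n cyclic_mapD(3) [OF F, of z] by (simp add: P_def)
  then have P: "P (LEAST k. P k)" by (rule LeastI)
  define k where "k = (LEAST k. P k)"
  have Fk: "F (z + int k) = F z"
  proof (cases k)
    case (Suc j)
    then have "\<not> P j" using not_less_Least [of j P] k_def by simp
    then have "F (z + int k) \<le> F z" using Suc by (simp add: P_def algebra_simps)
    moreover have "F z \<le> F (z + int k)" by (rule cyclic_mapD(2) [OF F]) simp
    ultimately show ?thesis by simp
  qed simp
  show thesis
  proof
    show "F (z + int k) < F (z + int k + 1)"
      using P Fk by (simp add: P_def k_def)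
    have "G z \<le> G (z + int k)" by (rule cyclic_mapD(2) [OF G]) simp
    then show "F (z + int k) < G (z + int k)" using z Fk by simp
  qed
qed

lemma winding_lt_mono:
  fixes F G :: "int \<Rightarrow> int"
  assumes "winding_lt n G l" "\<And>z. F z \<le> G z" "cyclic_map n F"
  shows "winding_lt n F l"
  unfolding winding_lt_def
proof
  fix z
  have "(F ^^ (2 * l + 3)) z \<le> (G ^^ (2 * l + 3)) z"
    by (rule funpow_le [OF cyclic_mapD(2) [OF assms(3)] assms(2)]) auto
  then show "(F ^^ (2 * l + 3)) z \<le> z + (int l + 1) * n - 1"
    using assms(1) unfolding winding_lt_def by (meson order_trans)
qed

lemma winding_gt_mono:
  fixes F G :: "int \<Rightarrow> int"
  assumes "winding_gt n F l" "\<And>z. F z \<le> G z" "cyclic_map n F"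
  shows "winding_gt n G l"
  unfolding winding_gt_def
proof
  fix z
  have "(F ^^ (2 * l + 1)) z \<le> (G ^^ (2 * l + 1)) z"
    by (rule funpow_le [OF cyclic_mapD(2) [OF assms(3)] assms(2)]) auto
  then show "z + int l * n + 1 \<le> (G ^^ (2 * l + 1)) z"
    using assms(1) unfolding winding_gt_def by (meson order_trans)
qed

text \<open>The graph is raised by one edge and its translates at a time, and the sum of the gaps
  over a period decreases. The lower winding bound persists upwards, the upper one is inherited from
  \<open>G\<close>.\<close>

lemma inclusion_iso_cyclic:
  assumes M: "simplicial M"
  shows "cyclic_map n F \<Longrightarrow> cyclic_map n G \<Longrightarrow> (\<And>z. F z \<le> G z) \<Longrightarrow> winding_gt n F l \<Longrightarrow> winding_lt n G l \<Longrightarrow>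
    inclusion_iso TYPE('k::field) M (cyclic_complex n F) (cyclic_complex n G)"
proof (induction "nat (\<Sum>z\<in>{0..<n}. G z - F z)" arbitrary: F rule: less_induct)
  case less
  note F = \<open>cyclic_map n F\<close> and G = \<open>cyclic_map n G\<close> and le = less.prems(3)
  have n: "n > 0" using cyclic_mapD(1) [OF F] .
  show ?case
  proof (cases "F = G")
    case True
    then show ?thesis by (simp add: inclusion_iso_refl)
  next
    case False
    then obtain z where "F z \<noteq> G z" by auto
    then have "F z < G z" using le [of z] by simp
    from cyclic_complex_raise [OF F G le this] obtain x where x: "F x < F (x + 1)" "F x < G x" by metis
    define H where "H = (\<lambda>z. if n dvd z - x then F z + 1 else F z)"
    have HG: "H z \<le> G z" for z
    proof (cases "n dvd z - x")
      case True
      then obtain j where "z = x + j * n"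
        by (metis add.commute diff_add_cancel dvd_def mult.commute)
      then have "F z < G z"
        using x(2) periodic_int [of F n x j] periodic_int [of G n x j] cyclic_mapD(3) [OF F] cyclic_mapD(3) [OF G] by simp
      then show ?thesis by (simp add: H_def)
    qed (use le in \<open>simp add: H_def\<close>)
    have FH: "F z \<le> H z" for z by (simp add: H_def)
    have "cyclic_map n H \<and> inclusion_iso TYPE('k) M (cyclic_complex n F) (cyclic_complex n H)"
    proof (cases "winding_lt n H l")
      case True
      then interpret edge n F x l
        by unfold_locales (use F less.prems x in \<open>simp_all add: H_def\<close>)
      show ?thesis using cyclic_map_G inclusion_iso_edge [OF M, where 'k = 'k] by (simp add: G_def H_def)
    next
      case False
      \<comment> \<open>Monotonicity of \<open>H\<close> is supplied by the locale, which itself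
        assumes the upper bound for \<open>H\<close>; so the orbits are compared through the
        monotonicity of \<open>G\<close>.\<close>
      have "(H ^^ k) z \<le> (G ^^ k) z" for k z
      proof (induction k)
        case (Suc k)
        have "H ((H ^^ k) z) \<le> G ((H ^^ k) z)" by (rule HG)
        also have "\<dots> \<le> G ((G ^^ k) z)" using cyclic_mapD(2) [OF G] Suc by simp
        finally show ?case by simp
      qed simp
      then have "winding_lt n H l" using less.prems(5) unfolding winding_lt_def by (meson order_trans)
      with False show ?thesis by simp
    qed
    then have H: "cyclic_map n H" and iso: "inclusion_iso TYPE('k) M (cyclic_complex n F) (cyclic_complex n H)" by auto
    have "(\<Sum>z\<in>{0..<n}. G z - H z) < (\<Sum>z\<in>{0..<n}. G z - F z)"
    proof (rule sum_strict_mono_ex1)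
      have "n dvd x mod n - x"
        by (metis dvd_minus_iff minus_diff_eq dvd_minus_mod)
      then have "G (x mod n) - H (x mod n) < G (x mod n) - F (x mod n)" "x mod n \<in> {0..<n}"
        using n by (auto simp: H_def)
      then show "\<exists>z\<in>{0..<n}. G z - H z < G z - F z" by blast
    qed (use FH in auto)
    moreover have "0 \<le> (\<Sum>z\<in>{0..<n}. G z - H z)"
      using HG by (intro sum_nonneg) simp
    ultimately have "inclusion_iso TYPE('k) M (cyclic_complex n H) (cyclic_complex n G)"
      using less.hyps [of H] H G HG less.prems(5) winding_gt_mono [OF less.prems(4) FH F] by simp
    from inclusion_iso_trans [OF iso this cyclic_complex_mono [OF FH] cyclic_complex_mono [OF HG]] show ?thesis .
  qed
qed

subsection \<open>Powers of cycles\<close>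

lemma simplicial_point: "simplicial {{v}}"
  by (auto simp: simplicial_def subset_singleton_iff)

definition shift :: "int \<Rightarrow> int \<Rightarrow> int" where "shift k z = z + k"

lemma cyclic_map_shift: "n > 0 \<Longrightarrow> cyclic_map n (shift k)"
  by (simp add: cyclic_map_def shift_def mono_def)

lemma funpow_shift: "(shift k ^^ m) z = z + int m * k"
  by (induction m) (auto simp: shift_def algebra_simps)

lemma winding_gt_shift: "winding_gt n (shift k) l \<longleftrightarrow> (2 * int l + 1) * k \<ge> int l * n + 1"
  by (simp only: winding_gt_def funpow_shift) (simp add: algebra_simps)

lemma winding_lt_shift: "winding_lt n (shift k) l \<longleftrightarrow> (2 * int l + 3) * k \<le> (int l + 1) * n - 1"
  by (simp only: winding_lt_def funpow_shift) (simp add: algebra_simps)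

lemma cyclic_adj_shift: "cyclic_adj n (shift k) u v \<longleftrightarrow> (\<exists>j. \<bar>v + j * n - u\<bar> \<le> k)"
proof
  assume "cyclic_adj n (shift k) u v"
  then show "\<exists>j. \<bar>v + j * n - u\<bar> \<le> k"
    unfolding cyclic_adj_def shift_def
  proof (elim disjE exE)
    fix j assume "v \<le> u + j * n \<and> u + j * n \<le> v + k"
    then show ?thesis by (intro exI [of _ "- j"]) auto
  qed (metis abs_of_nonneg add_le_cancel_left diff_ge_0_iff_ge diff_le_eq add.commute)
next
  assume "\<exists>j. \<bar>v + j * n - u\<bar> \<le> k"
  then obtain j where j: "\<bar>v + j * n - u\<bar> \<le> k" by blast
  show "cyclic_adj n (shift k) u v"
  proof (cases "u \<le> v + j * n")
    case True
    then show ?thesis using j unfolding cyclic_adj_def shift_def by (intro disjI1 exI [of _ j]) auto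
  next
    case False
    then show ?thesis using j unfolding cyclic_adj_def shift_def by (intro disjI2 exI [of _ "- j"]) auto
  qed
qed

text \<open>The blow-up of the \<open>(2l+1)\<close>-st power of the \<open>(4l+4)\<close>-cycle, in which each vertex is adjacent to
  all others except its antipode: a blown-up cross-polytope. Its winding fraction
  \<open>(2l+1)/(4l+4)\<close> is the mediant of \<open>l/(2l+1)\<close> and \<open>(l+1)/(2l+3)\<close>.\<close>

locale blowup =
  fixes l :: nat and c :: int
  assumes c: "c > 0"
begin

definition "H = 2 * int l + 2"
definition "n = 2 * H * c"
text \<open>The largest constant step dominated by \<open>Fb\<close>: from the last vertex of a
  block, \<open>Fb\<close> advances by exactly this amount.\<close>

definition "m = (H - 1) * c"
definition "Fb z = c * (z div c + H - 1) + c - 1"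
definition "blk v = (v div c) mod (2 * H)"
definition "idx v = nat (if blk v < H then blk v else blk v - H)"
definition "sg v \<longleftrightarrow> blk v \<ge> H"
definition "pp i = (int i + H) * c"
definition "qq i = int i * c"

lemma H: "H \<ge> 2" "H > 0" by (auto simp: H_def)

lemma n: "n > 0" using c H by (simp add: n_def)

lemma n_eq: "n = (4 * int l + 4) * c" "m = (2 * int l + 1) * c"
  by (simp_all add: n_def m_def H_def)

lemma shift_div: "(v + j * n) div c = v div c + j * (2 * H)"
proof -
  have "v + j * n = v + (j * (2 * H)) * c" by (simp add: n_def)
  moreover have "(v + (j * (2 * H)) * c) div c = j * (2 * H) + v div c"
    using c by (intro div_mult_self1) simp
  ultimately show ?thesis by (simp only:)
qed

lemma div_bounds: "z - c < c * (z div c)" "c * (z div c) \<le> z"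
  using minus_mod_eq_mult_div [of z c] pos_mod_bound [OF c, of z] pos_mod_sign [OF c, of z]
  by linarith+

lemma div_less: "v < c * k \<longleftrightarrow> v div c < k"
proof
  assume "v < c * k"
  then show "v div c < k"
    using div_bounds(2) [of v] mult_left_mono [of k "v div c" c] c by linarith
next
  assume "v div c < k"
  then have "c * (v div c + 1) \<le> c * k"
    using c by (intro mult_left_mono) auto
  then show "v < c * k"
    using div_bounds(1) [of v] by (simp add: algebra_simps)
qed

lemma le_Fb: "v \<le> Fb u \<longleftrightarrow> v div c \<le> u div c + H - 1"
proof -
  have "Fb u = c * (u div c + H - 1 + 1) - 1"
    by (simp add: Fb_def algebra_simps)
  then have "v \<le> Fb u \<longleftrightarrow> v < c * (u div c + H - 1 + 1)"
    by linarith
  also have "\<dots> \<longleftrightarrow> v div c < u div c + H - 1 + 1"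
    by (rule div_less)
  finally show ?thesis by simp
qed

lemma cyclic_map_Fb: "cyclic_map n Fb"
proof -
  have "Fb (z + n) = Fb z + n" for z
    using shift_div [of z 1] by (simp add: Fb_def n_def algebra_simps)
  moreover have "mono Fb"
  proof (rule monoI)
    fix u v :: int assume "u \<le> v"
    then have "u div c \<le> v div c" using c by (simp add: zdiv_mono1)
    then have "c * (u div c + H - 1) \<le> c * (v div c + H - 1)"
      using c by (intro mult_left_mono) auto
    then show "Fb u \<le> Fb v" by (simp add: Fb_def)
  qed
  ultimately show ?thesis using n by (simp add: cyclic_map_def)
qed

lemma funpow_Fb: "(Fb ^^ Suc k) z = c * (z div c + int (Suc k) * (H - 1)) + c - 1"
proof (induction k)
  case 0
  then show ?case by (simp add: Fb_def algebra_simps)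
next
  case (Suc k)
  have "((Fb ^^ Suc k) z) div c = z div c + int (Suc k) * (H - 1)"
  proof -
    have "(Fb ^^ Suc k) z = (c - 1) + (z div c + int (Suc k) * (H - 1)) * c"
      unfolding Suc by (simp add: algebra_simps)
    then show ?thesis using c by (simp add: div_pos_pos_trivial del: funpow.simps)
  qed
  then have "Fb ((Fb ^^ Suc k) z) = c * (z div c + int (Suc k) * (H - 1) + H - 1) + c - 1"
    unfolding Fb_def [of "(Fb ^^ Suc k) z"] by simp
  then show ?case by (simp add: algebra_simps)
qed

text \<open>\<open>(2l+3)(2l+1) = (l+1)(4l+4) - 1\<close>, so \<open>2l+3\<close> steps end one
  block short of \<open>l+1\<close> turns.\<close>

lemma winding_lt_Fb: "winding_lt n Fb l"
  unfolding winding_lt_def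
proof
  fix z
  have "(Fb ^^ (2 * l + 3)) z = c * (z div c + (2 * int l + 3) * (H - 1)) + c - 1"
    using funpow_Fb [of "2 * l + 2" z] by (simp add: eval_nat_numeral algebra_simps)
  also have "\<dots> \<le> z + (int l + 1) * n - 1"
    using div_bounds(2) [of z] by (simp add: n_eq H_def algebra_simps)
  finally show "(Fb ^^ (2 * l + 3)) z \<le> z + (int l + 1) * n - 1" .
qed

text \<open>\<open>(2l+1)(2l+1) = l(4l+4) + 1\<close>, so the orbit gains \<open>l\<close> turns and
  \<open>c\<close> further points.\<close>

lemma winding_gt_m: "winding_gt n (shift m) l"
  using c by (simp add: winding_gt_shift n_eq algebra_simps)

lemma shift_m_Fb: "shift m z \<le> Fb z"
  using div_bounds(1) [of z] by (simp add: shift_def Fb_def m_def algebra_simps)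

lemma winding_lt_m: "winding_lt n (shift m) l"
  by (rule winding_lt_mono [OF winding_lt_Fb shift_m_Fb cyclic_map_shift [OF n]])

lemma cyclic_adj_Fb: "cyclic_adj n Fb u v \<longleftrightarrow> (\<exists>j. \<bar>v div c + j * (2 * H) - u div c\<bar> \<le> H - 1)"
proof
  have mono: "a div c \<le> b div c" if "a \<le> b" for a b using that c by (simp add: zdiv_mono1)
  assume "cyclic_adj n Fb u v"
  then show "\<exists>j. \<bar>v div c + j * (2 * H) - u div c\<bar> \<le> H - 1"
    unfolding cyclic_adj_def
  proof (elim disjE exE conjE)
    fix j assume "u \<le> v + j * n" "v + j * n \<le> Fb u"
    then show ?thesis
      using mono [of u "v + j * n"] le_Fb [of "v + j * n" u] H unfolding shift_div
      by (intro exI [of _ j]) auto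
  next
    fix j assume "v \<le> u + j * n" "u + j * n \<le> Fb v"
    then show ?thesis
      using mono [of v "u + j * n"] le_Fb [of "u + j * n" v] H unfolding shift_div
      by (intro exI [of _ "- j"]) auto
  qed
next
  assume "\<exists>j. \<bar>v div c + j * (2 * H) - u div c\<bar> \<le> H - 1"
  then obtain j where j: "\<bar>v div c + j * (2 * H) - u div c\<bar> \<le> H - 1" by blast
  show "cyclic_adj n Fb u v"
  proof (cases "u \<le> v + j * n")
    case True
    then show ?thesis
      using j le_Fb [of "v + j * n" u] unfolding shift_div cyclic_adj_def by (intro disjI1 exI [of _ j]) auto
  next
    case False
    then show ?thesis
      using j le_Fb [of "u + (- j) * n" v] unfolding shift_div cyclic_adj_def by (intro disjI2 exI [of _ "- j"]) auto
  qed
qed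

lemma blk: "0 \<le> blk v" "blk v < 2 * H" "\<exists>i. v div c = blk v + i * (2 * H)"
proof -
  show "0 \<le> blk v" "blk v < 2 * H" using H by (auto simp: blk_def)
  show "\<exists>i. v div c = blk v + i * (2 * H)"
    unfolding blk_def by (metis mod_mult_div_eq mult.commute)
qed

lemma cyclic_adj_Fb_idx: "cyclic_adj n Fb u v \<longleftrightarrow> \<not> (idx u = idx v \<and> sg u \<noteq> sg v)"
proof -
  obtain i i' where i: "u div c = blk u + i * (2 * H)" "v div c = blk v + i' * (2 * H)"
    using blk(3) by metis
  have 1: "cyclic_adj n Fb u v \<longleftrightarrow> (\<exists>j. \<bar>blk v - blk u + j * (2 * H)\<bar> \<le> H - 1)"
  proof
    assume "cyclic_adj n Fb u v"
    then obtain j where "\<bar>v div c + j * (2 * H) - u div c\<bar> \<le> H - 1" by (auto simp: cyclic_adj_Fb)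
    then show "\<exists>j. \<bar>blk v - blk u + j * (2 * H)\<bar> \<le> H - 1"
      unfolding i by (intro exI [of _ "j + i' - i"]) (simp add: algebra_simps)
  next
    assume "\<exists>j. \<bar>blk v - blk u + j * (2 * H)\<bar> \<le> H - 1"
    then obtain j where "\<bar>blk v - blk u + j * (2 * H)\<bar> \<le> H - 1" by blast
    then show "cyclic_adj n Fb u v"
      unfolding cyclic_adj_Fb i by (intro exI [of _ "j - i' + i"]) (simp add: algebra_simps)
  qed
  \<comment> \<open>Modulo \<open>2 * H\<close>, every residue other than that of \<open>H\<close>
    has a representative of absolute value at most \<open>H - 1\<close>; an odd multiple of
    \<open>H\<close> is too large.\<close>
  have 2: "(\<exists>j. \<bar>D + j * (2 * H)\<bar> \<le> H - 1) \<longleftrightarrow> \<bar>D\<bar> \<noteq> H" if "\<bar>D\<bar> < 2 * H" for D :: int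
  proof
    assume "\<exists>j. \<bar>D + j * (2 * H)\<bar> \<le> H - 1"
    then obtain j where j: "\<bar>D + j * (2 * H)\<bar> \<le> H - 1" by blast
    show "\<bar>D\<bar> \<noteq> H"
    proof
      assume "\<bar>D\<bar> = H"
      then have "D = H \<or> D = - H" by linarith
      then obtain i where "D + j * (2 * H) = i * H" "odd i"
      proof
        assume "D = H"
        then show thesis using that [of "1 + 2 * j"] by (simp add: algebra_simps)
      next
        assume "D = - H"
        then show thesis using that [of "2 * j - 1"] by (simp add: algebra_simps)
      qed
      then have "\<bar>i\<bar> * H \<le> H - 1" "\<bar>i\<bar> \<ge> 1"
        using j H by (auto simp: abs_mult)
      moreover have "1 * H \<le> \<bar>i\<bar> * H"
        using calculation(2) H by (intro mult_right_mono) auto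
      ultimately show False by linarith
    qed
  next
    assume D: "\<bar>D\<bar> \<noteq> H"
    consider "\<bar>D\<bar> < H" | "D > H" | "D < - H" using D by linarith
    then show "\<exists>j. \<bar>D + j * (2 * H)\<bar> \<le> H - 1"
    proof cases
      case 1
      then show ?thesis by (intro exI [of _ 0]) auto
    next
      case 2
      then show ?thesis using that by (intro exI [of _ "-1"]) auto
    next
      case 3
      then show ?thesis using that by (intro exI [of _ 1]) auto
    qed
  qed
  have "\<bar>blk v - blk u\<bar> < 2 * H" using blk(1,2) [of u] blk(1,2) [of v] by linarith
  from 2 [OF this] show ?thesis
    unfolding 1 idx_def sg_def using blk(1,2) [of u] blk(1,2) [of v] by (auto split: if_splits)
qed

lemma idx_lt: "idx v < 2 * l + 2"
  using blk(1,2) [of v] by (auto simp: idx_def H_def nat_less_iff)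

lemma cyclic_complex_Fb: "cyclic_complex n Fb = cross_polytope idx sg (Suc (2 * l + 1))"
proof (rule set_eqI)
  fix S
  have "(\<forall>u\<in>S. \<forall>v\<in>S. cyclic_adj n Fb u v) \<longleftrightarrow> (\<forall>u\<in>S. \<forall>v\<in>S. idx u = idx v \<longrightarrow> sg u \<longrightarrow> sg v)"
    unfolding cyclic_adj_Fb_idx by metis
  then show "S \<in> cyclic_complex n Fb \<longleftrightarrow> S \<in> cross_polytope idx sg (Suc (2 * l + 1))"
    using idx_lt by (auto simp: cyclic_complex_def cross_polytope_def)
qed

definition chi :: "int list \<Rightarrow>\<^sub>0 'k::field" where "chi = cross_polytope_cycle pp qq (2 * l + 1)"

lemma sphere_factor_Fb:
  assumes "simplicial M"
  shows "sphere_factor M (cyclic_complex n Fb) (2 * l + 1) (chi :: int list \<Rightarrow>\<^sub>0 'k::field) 0"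
proof -
  have "blk (qq i) = int i" "blk (pp i) = int i + H" if "i < 2 * l + 2" for i
    using that c by (auto simp: blk_def qq_def pp_def H_def)
  then have "sphere_factor M (cross_polytope idx sg (Suc (2 * l + 1))) (2 * l + 1) (cross_polytope_cycle pp qq (2 * l + 1) :: int list \<Rightarrow>\<^sub>0 'k) (qq 0)"
    by (intro sphere_factor_cross_polytope [OF assms, of "2 * l + 2"]) (auto simp: idx_def sg_def H_def)
  then show ?thesis by (simp add: cyclic_complex_Fb chi_def qq_def)
qed

text \<open>The vertices of \<open>chi\<close> are first points of blocks, that is multiples of
  \<open>c\<close>. Among these, adjacency for \<open>Fb\<close> means distance at most
  \<open>(H - 1) * c\<close>, so the cycle already lies in the complex of the constant step
  \<open>m\<close>.\<close>

lemma chi_cycles: "(chi :: int list \<Rightarrow>\<^sub>0 'k::field) \<in> cycles (2 * l + 1) (cyclic_complex n (shift m))"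
proof -
  let ?c = "chi :: int list \<Rightarrow>\<^sub>0 'k"
  have Fb: "?c \<in> cycles (2 * l + 1) (cyclic_complex n Fb)"
    using sphere_factor_Fb [OF simplicial_point, of "()", where 'k = 'k] by (simp add: sphere_factor_def)
  have "set xs \<in> cyclic_complex n (shift m)" if xs: "xs \<in> keys ?c" for xs
  proof -
    have S: "set xs \<in> cyclic_complex n Fb"
      using Fb xs by (auto simp: cycles_iff chains_def)
    have "\<exists>a. u = a * c" if "u \<in> set xs" for u
      using keys_cross_polytope_cycle [of xs pp qq "2 * l + 1"] xs that unfolding chi_def by (auto simp: pp_def qq_def)
    moreover have "cyclic_adj n (shift m) u v" if uv: "u \<in> set xs" "v \<in> set xs" "u = a * c" "v = b * c" for u v a b
    proof -
      have "cyclic_adj n Fb u v" using cyclic_complex_adj [OF S] uv by blast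
      then obtain j where "\<bar>b + j * (2 * H) - a\<bar> \<le> H - 1"
        using c unfolding cyclic_adj_Fb uv(3,4) by auto
      then have "\<bar>b + j * (2 * H) - a\<bar> * c \<le> (H - 1) * c"
        using c by (intro mult_right_mono) auto
      moreover have "v + j * n - u = (b + j * (2 * H) - a) * c"
        by (simp add: uv n_def algebra_simps)
      then have "\<bar>b + j * (2 * H) - a\<bar> * c = \<bar>v + j * n - u\<bar>"
        using c by (simp add: abs_mult)
      ultimately show ?thesis unfolding cyclic_adj_shift m_def by auto
    qed
    ultimately show ?thesis using cyclic_complex_fin [OF S] unfolding cyclic_complex_def by blast
  qed
  then show ?thesis using Fb by (auto simp: cycles_iff chains_def)
qed

lemma zero_cyclic: "k \<ge> 0 \<Longrightarrow> {0} \<in> cyclic_complex n (shift k)"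
  using cyclic_adj_refl [of 0 "shift k" n] by (auto simp: cyclic_complex_def shift_def)

lemma m_nonneg: "m \<ge> 0"
  using c H by (simp add: m_def)

lemma sphere_factor_m:
  assumes M: "simplicial M"
  shows "sphere_factor M (cyclic_complex n (shift m)) (2 * l + 1) (chi :: int list \<Rightarrow>\<^sub>0 'k::field) 0"
  by (rule sphere_factor_inclusion_iso_down [OF M simplicial_cyclic inclusion_iso_cyclic [OF M cyclic_map_shift [OF n] cyclic_map_Fb shift_m_Fb winding_gt_m winding_lt_Fb]
        cyclic_complex_mono [OF shift_m_Fb] sphere_factor_Fb [OF M] chi_cycles zero_cyclic [OF m_nonneg]])

lemma shift_le: "k \<le> k' \<Longrightarrow> shift k z \<le> shift k' z"
  by (simp add: shift_def)

lemma sphere_factor_shift_up: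
  assumes M: "simplicial M" and k: "m \<le> k" and winding_lt: "winding_lt n (shift k) l"
  shows "sphere_factor M (cyclic_complex n (shift k)) (2 * l + 1) (chi :: int list \<Rightarrow>\<^sub>0 'k::field) 0"
  by (rule sphere_factor_inclusion_iso_up [OF M simplicial_cyclic
        inclusion_iso_cyclic [OF M cyclic_map_shift [OF n] cyclic_map_shift [OF n] shift_le [OF k] winding_gt_m winding_lt]
        cyclic_complex_mono [OF shift_le [OF k]] sphere_factor_m [OF M]])

lemma sphere_factor_shift_down:
  fixes z0 :: "int list \<Rightarrow>\<^sub>0 'k::field"
  assumes M: "simplicial M" and k: "0 \<le> k" "k \<le> m" and winding_gt: "winding_gt n (shift k) l"
    and z0: "z0 \<in> cycles (2 * l + 1) (cyclic_complex n (shift k))" "chi - z0 \<in> boundaries (2 * l + 1) (cyclic_complex n (shift m))"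
  shows "sphere_factor M (cyclic_complex n (shift k)) (2 * l + 1) z0 0"
proof (rule sphere_factor_inclusion_iso_down [OF M simplicial_cyclic _ cyclic_complex_mono [OF shift_le [OF k(2)]] _ z0(1) zero_cyclic [OF k(1)]])
  show "inclusion_iso TYPE('k) M (cyclic_complex n (shift k)) (cyclic_complex n (shift m))"
    by (rule inclusion_iso_cyclic [OF M cyclic_map_shift [OF n] cyclic_map_shift [OF n] shift_le [OF k(2)] winding_gt winding_lt_m])
  show "sphere_factor M (cyclic_complex n (shift m)) (2 * l + 1) z0 0"
    by (rule sphere_factor_cong [OF M simplicial_cyclic sphere_factor_m [OF M] cycles_mono [OF cyclic_complex_mono [OF shift_le [OF k(2)]] z0(1)] z0(2)])
qed

text \<open>From \<open>m\<close> on, \<open>chi\<close> itself serves. Below \<open>m\<close> it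
  need not lie in the complex, and a homologous cycle is pulled back along the inclusion. The last
  clause repeats the previous one for a point, because \<open>M\<close> there ranges over one fixed
  vertex type.\<close>

lemma sphere_factor_shift:
  assumes winding_gt: "winding_gt n (shift k) l" and winding_lt: "winding_lt n (shift k) l"
  obtains z0 :: "int list \<Rightarrow>\<^sub>0 'k::field" where "z0 \<in> cycles (2 * l + 1) (cyclic_complex n (shift k))"
    "z0 - chi \<in> boundaries (2 * l + 1) (cyclic_complex n (shift (max k m)))"
    "\<And>M :: 'a set set. simplicial M \<Longrightarrow> sphere_factor M (cyclic_complex n (shift k)) (2 * l + 1) z0 0"
    "sphere_factor {{()}} (cyclic_complex n (shift k)) (2 * l + 1) z0 0"
proof (cases "m \<le> k")
  case True
  show thesis
  proof (rule that [of chi])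
    show "chi \<in> cycles (2 * l + 1) (cyclic_complex n (shift k))"
      by (rule cycles_mono [OF cyclic_complex_mono [OF shift_le [OF True]] chi_cycles])
    show "sphere_factor M (cyclic_complex n (shift k)) (2 * l + 1) chi 0" if "simplicial M" for M :: "'a set set"
      by (rule sphere_factor_shift_up [OF that True winding_lt])
    show "sphere_factor {{()}} (cyclic_complex n (shift k)) (2 * l + 1) chi 0"
      by (rule sphere_factor_shift_up [OF simplicial_point True winding_lt])
  qed simp
next
  case False
  then have km: "k \<le> m" by simp
  have iso: "inclusion_iso TYPE('k) {{()}} (cyclic_complex n (shift k)) (cyclic_complex n (shift m))"
    by (rule inclusion_iso_cyclic [OF simplicial_point cyclic_map_shift [OF n] cyclic_map_shift [OF n] shift_le [OF km] winding_gt winding_lt_m])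
  obtain z0 :: "int list \<Rightarrow>\<^sub>0 'k" where z0: "z0 \<in> cycles (2 * l + 1) (cyclic_complex n (shift k))"
    "chi - z0 \<in> boundaries (2 * l + 1) (cyclic_complex n (shift m))"
    using inclusion_iso_unit [OF iso chi_cycles] simplicial_fin [OF simplicial_cyclic] by metis
  have "(0::int) + 1 \<le> shift k 0"
    by (rule winding_gt_gt [OF cyclic_map_shift [OF n] winding_gt])
  then have k: "k \<ge> 0" by (simp add: shift_def)
  show thesis
  proof (rule that [OF z0(1)])
    show "z0 - chi \<in> boundaries (2 * l + 1) (cyclic_complex n (shift (max k m)))"
      using boundaries_diff_sym [OF z0(2)] km by (simp add: max_def)
    show "sphere_factor M (cyclic_complex n (shift k)) (2 * l + 1) z0 0" if "simplicial M" for M :: "'a set set"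
      by (rule sphere_factor_shift_down [OF that k km winding_gt z0])
    show "sphere_factor {{()}} (cyclic_complex n (shift k)) (2 * l + 1) z0 0"
      by (rule sphere_factor_shift_down [OF simplicial_point k km winding_gt z0])
  qed
qed

end

section \<open>Kuenneth bases\<close>

text \<open>\<open>(Z m)\<close> for \<open>m \<in> D\<close> is a basis of the homology of \<open>K\<close>, at most one class in each degree, and
  the Kuenneth formula holds for products with \<open>M\<close>.\<close>

definition kunneth_basis :: "'a set set \<Rightarrow> 'b set set \<Rightarrow> nat set \<Rightarrow> (nat \<Rightarrow> ('b list \<Rightarrow>\<^sub>0 'k::field)) \<Rightarrow> bool" where
  "kunneth_basis M K D Z \<longleftrightarrow> (\<forall>m\<in>D. Z m \<in> cycles m K) \<and>
     (\<forall>n. \<forall>z\<in>cycles n (prod_complex M K). \<exists>w. (\<forall>m\<in>D. m \<le> n \<longrightarrow> w m \<in> cycles (n - m) M) \<and>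
        z - (\<Sum>m | m \<in> D \<and> m \<le> n. cross (w m) (Z m)) \<in> boundaries n (prod_complex M K)) \<and>
     (\<forall>n w. (\<forall>m\<in>D. m \<le> n \<longrightarrow> w m \<in> cycles (n - m) M) \<longrightarrow>
        (\<Sum>m | m \<in> D \<and> m \<le> n. cross (w m) (Z m)) \<in> boundaries n (prod_complex M K) \<longrightarrow>
        (\<forall>m\<in>D. m \<le> n \<longrightarrow> w m \<in> boundaries (n - m) M))"

lemma kunneth_basis_empty: "kunneth_basis M {} {} (Z :: nat \<Rightarrow> ('b list \<Rightarrow>\<^sub>0 'k::field))"
  unfolding kunneth_basis_def by (auto simp: cycles_iff dest!: chains_empty)

lemma cross_vertex_retract_snd:
  fixes z :: "('a \<times> 'b) list \<Rightarrow>\<^sub>0 'k::field"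
  assumes "z \<in> chains n (prod_complex M K)"
  shows "cross (push fst z) (single [v] 1) = push (retract_snd v) z"
proof -
  have "push fst z \<in> chains n M"
    by (rule push_chains [OF _ assms]) (auto simp: prod_complex_def)
  then show ?thesis
    by (simp add: cross_vertex comp_def retract_snd_def [abs_def])
qed

lemma cross_vertex_boundaries:
  fixes w :: "'a list \<Rightarrow>\<^sub>0 'k::field"
  assumes w: "w \<in> chains n M" and b: "cross w (single [v] 1) \<in> boundaries n (prod_complex M K)"
  shows "w \<in> boundaries n M"
proof -
  have "push fst (cross w (single [v] 1)) \<in> boundaries n M"
    by (rule push_boundaries [OF _ b]) (auto simp: prod_complex_def)
  then show ?thesis
    using w by (simp add: cross_vertex comp_def push_ident)
qed

lemma push_fst_cycles: "z \<in> cycles n (prod_complex M K) \<Longrightarrow> push fst z \<in> cycles n M"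
  by (erule push_cycles [rotated]) (auto simp: prod_complex_def)

lemma vertex_cycle: "{v} \<in> K \<Longrightarrow> single [v] (1::'k::field) \<in> cycles 0 K"
  using dd_chains0 [of "single [v] (1::'k)" K] by (auto simp: cycles_iff chains_def)

lemma kunneth_basis_acyclic_along:
  fixes Z :: "nat \<Rightarrow> ('b list \<Rightarrow>\<^sub>0 'k::field)"
  assumes a: "acyclic_factor TYPE('k) M K" and v: "{v} \<in> K" and Z: "Z 0 = single [v] 1"
  shows "kunneth_basis M K {0} Z"
  unfolding kunneth_basis_def
proof (intro conjI allI ballI impI)
  have D: "{m. m \<in> {0} \<and> m \<le> n} = {0::nat}" for n by auto
  show "Z m \<in> cycles m K" if "m \<in> {0}" for m
    using that vertex_cycle [OF v] Z by simp
  fix n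
  show "\<exists>w. (\<forall>m\<in>{0}. m \<le> n \<longrightarrow> w m \<in> cycles (n - m) M) \<and>
      z - (\<Sum>m | m \<in> {0} \<and> m \<le> n. cross (w m) (Z m)) \<in> boundaries n (prod_complex M K)"
    if z: "z \<in> cycles n (prod_complex M K)" for z
  proof -
    have "z - push (retract_snd v) z \<in> boundaries n (prod_complex M K)"
      using a v z by (simp add: acyclic_factor_def acyclic_along_def)
    moreover have "cross (push fst z) (single [v] 1) = push (retract_snd v) z"
      using z by (intro cross_vertex_retract_snd) (auto simp: cycles_iff)
    ultimately show ?thesis
      using push_fst_cycles [OF z] Z by (intro exI [of _ "\<lambda>_. push fst z"]) (unfold D, simp)
  qed
  fix w :: "nat \<Rightarrow> ('a list \<Rightarrow>\<^sub>0 'k)" and m :: nat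
  assume "\<forall>m\<in>{0}. m \<le> n \<longrightarrow> w m \<in> cycles (n - m) M"
    and "(\<Sum>m | m \<in> {0} \<and> m \<le> n. cross (w m) (Z m)) \<in> boundaries n (prod_complex M K)"
    and m: "m \<in> {0}" "m \<le> n"
  then have "w 0 \<in> chains n M" "cross (w 0) (single [v] 1) \<in> boundaries n (prod_complex M K)"
    unfolding D by (auto simp: Z cycles_iff)
  then show "w m \<in> boundaries (n - m) M"
    using cross_vertex_boundaries m by auto
qed

lemma kunneth_basis_sphere_factor:
  fixes Z :: "nat \<Rightarrow> ('b list \<Rightarrow>\<^sub>0 'k::field)"
  assumes M: "simplicial M" and K: "simplicial K" and s: "sphere_factor M K d \<zeta> v" and d: "d \<noteq> 0"
    and Z: "Z 0 = single [v] 1" "Z d = \<zeta>"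
  shows "kunneth_basis M K {0, d} Z"
  unfolding kunneth_basis_def
proof (intro conjI allI ballI impI)
  have v: "{v} \<in> K" and \<zeta>: "\<zeta> \<in> cycles d K" using s by (auto simp: sphere_factor_def)
  have D: "{m. m \<in> {0, d} \<and> m \<le> n} = (if n < d then {0} else {0, d})" for n by auto
  show "Z m \<in> cycles m K" if "m \<in> {0, d}" for m
    using that vertex_cycle [OF v] Z \<zeta> by auto
  fix n
  show "\<exists>w. (\<forall>m\<in>{0, d}. m \<le> n \<longrightarrow> w m \<in> cycles (n - m) M) \<and>
      z - (\<Sum>m | m \<in> {0, d} \<and> m \<le> n. cross (w m) (Z m)) \<in> boundaries n (prod_complex M K)"
    if z: "z \<in> cycles n (prod_complex M K)" for z
  proof -
    have r: "cross (push fst z) (single [v] 1) = push (retract_snd v) z"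
      using z by (intro cross_vertex_retract_snd) (auto simp: cycles_iff)
    show ?thesis
    proof (cases "n < d")
      case True
      then have "z - push (retract_snd v) z \<in> boundaries n (prod_complex M K)"
        using s z unfolding sphere_factor_def by (metis (no_types, lifting))
      then show ?thesis
        using push_fst_cycles [OF z] Z True r by (intro exI [of _ "\<lambda>_. push fst z"]) (unfold D, auto)
    next
      case False
      then obtain y where "y \<in> cycles (n - d) M" "z - push (retract_snd v) z - cross y \<zeta> \<in> boundaries n (prod_complex M K)"
        using s z unfolding sphere_factor_def by (metis (no_types, lifting))
      then show ?thesis
        using push_fst_cycles [OF z] Z False r d
        by (intro exI [of _ "\<lambda>m. if m = 0 then push fst z else y"]) (unfold D, auto simp: diff_diff_eq)
    qed
  qed
  fix w :: "nat \<Rightarrow> ('a list \<Rightarrow>\<^sub>0 'k)" and m :: nat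
  assume w: "\<forall>m\<in>{0, d}. m \<le> n \<longrightarrow> w m \<in> cycles (n - m) M"
    and b: "(\<Sum>m | m \<in> {0, d} \<and> m \<le> n. cross (w m) (Z m)) \<in> boundaries n (prod_complex M K)"
    and m: "m \<in> {0, d}" "m \<le> n"
  have w0: "w 0 \<in> chains n M" using w by (auto simp: cycles_iff)
  show "w m \<in> boundaries (n - m) M"
  proof (cases "n < d")
    case True
    then have "cross (w 0) (single [v] 1) \<in> boundaries n (prod_complex M K)"
      using b unfolding D by (simp add: Z)
    then show ?thesis using cross_vertex_boundaries [OF w0] m True by auto
  next
    case False
    then have wd: "w d \<in> cycles (n - d) M" using w by auto
    have b': "cross (w 0) (single [v] 1) + cross (w d) \<zeta> \<in> boundaries n (prod_complex M K)"
      using b False d unfolding D by (simp add: Z)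
    \<comment> \<open>Retracting to \<open>v\<close> separates the two summands: it fixes the one
      over the vertex and makes the other a boundary, since \<open>\<zeta>\<close> becomes a cycle
      of positive degree on a point.\<close>
    have "push (retract_snd v) (cross (w 0) (single [v] 1) + cross (w d) \<zeta>) \<in> boundaries n (prod_complex M K)"
      by (rule push_boundaries [OF retract_snd_prod_complex [OF _ v M] b'])
    moreover have "push (retract_snd v) (cross (w d) \<zeta>) \<in> boundaries n (prod_complex M K)"
    proof -
      have "push (\<lambda>_. v) \<zeta> \<in> cycles (Suc (d - 1)) {{v}}"
        using d by (simp, intro push_cycles [OF _ \<zeta>]) (use simplicial_fin [OF K] in auto)
      then have "push (\<lambda>_. v) \<zeta> \<in> boundaries d K"
        using point_cycle [of "push (\<lambda>_. v) \<zeta>" "d - 1" v] boundaries_mono [of "{{v}}" K] d v by simp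
      then have "cross (w d) (push (\<lambda>_. v) \<zeta>) \<in> boundaries n (prod_complex M K)"
        using cross_boundaries2 [OF M K wd] False by fastforce
      moreover have "push (retract_snd v) (cross (w d) \<zeta>) = cross (w d) (push (\<lambda>_. v) \<zeta>)"
        unfolding retract_snd_map_prod push_cross by (simp add: push_ident)
      ultimately show ?thesis by simp
    qed
    moreover have "push (retract_snd v) (cross (w 0) (single [v] 1)) = cross (w 0) (single [v] 1)"
      using w0 by (simp add: cross_vertex comp_def retract_snd_def)
    ultimately have b0: "cross (w 0) (single [v] 1) \<in> boundaries n (prod_complex M K)"
      using boundaries_ops(3) by fastforce
    then have "cross (w d) \<zeta> \<in> boundaries n (prod_complex M K)"
      using boundaries_ops(3) [OF b' b0] by simp
    then have "w d \<in> boundaries (n - d) M"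
      using s wd False unfolding sphere_factor_def by (metis le_add_diff_inverse2 linorder_not_less)
    moreover have "w 0 \<in> boundaries n M"
      by (rule cross_vertex_boundaries [OF w0 b0])
    ultimately show ?thesis using m by auto
  qed
qed

section \<open>Vietoris-Rips complexes of a circle\<close>

lemma simplicial_vietoris_rips: "simplicial (vietoris_rips X \<epsilon>)"
  unfolding simplicial_def vietoris_rips_def by (auto intro: finite_subset)

lemma vietoris_rips_mono: "\<epsilon> \<le> \<delta> \<Longrightarrow> vietoris_rips X \<epsilon> \<subseteq> vietoris_rips X \<delta>"
  by (force simp: vietoris_rips_def)

lemma abs_sin_add_int_pi: "\<bar>sin (x + of_int j * pi)\<bar> = \<bar>sin x\<bar>" for x :: real
proof -
  have s: "sin (of_int j * pi) = 0"
    using sin_zero_iff_int2 by blast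
  then have "\<bar>cos (of_int j * pi)\<bar> = 1"
    using sin_cos_squared_add [of "of_int j * pi"] by (auto simp: power2_eq_1_iff)
  then show ?thesis
    by (simp add: sin_add s abs_mult)
qed

text \<open>Subtract the nearest integer from \<open>\<delta>\<close>: in this scaling the absolute
  value of the sine has period 1, and it increases with the absolute value of the argument up to
  \<open>1/2\<close>.\<close>

lemma abs_sin_less_iff:
  fixes \<delta> \<kappa> :: real
  assumes "0 \<le> \<kappa>" "\<kappa> \<le> 1/2"
  shows "\<bar>sin (pi * \<delta>)\<bar> < sin (pi * \<kappa>) \<longleftrightarrow> (\<exists>j::int. \<bar>\<delta> + j\<bar> < \<kappa>)"
proof -
  have *: "\<bar>sin (pi * x)\<bar> < sin (pi * \<kappa>) \<longleftrightarrow> \<bar>x\<bar> < \<kappa>" if x: "\<bar>x\<bar> \<le> 1/2" for x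
  proof -
    have "\<bar>sin (pi * x)\<bar> = sin (pi * \<bar>x\<bar>)"
    proof (cases "x \<ge> 0")
      case True
      then have "sin (pi * x) \<ge> 0" using x by (intro sin_ge_zero) (auto intro!: mult_left_le)
      then show ?thesis using True by simp
    next
      case False
      have "sin (pi * \<bar>x\<bar>) \<ge> 0"
        by (rule sin_ge_zero) (use x in \<open>auto intro!: mult_left_le\<close>)
      then show ?thesis using False by simp
    qed
    moreover have "sin (pi * \<bar>x\<bar>) < sin (pi * \<kappa>) \<longleftrightarrow> pi * \<bar>x\<bar> < pi * \<kappa>"
      by (rule sin_mono_less_eq) (use x assms in \<open>auto simp: field_simps\<close>,
        (smt (verit) pi_gt_zero mult_nonneg_nonneg)+)
    ultimately show ?thesis by simp
  qed
  have periodic: "\<bar>sin (pi * (\<delta> + of_int j))\<bar> = \<bar>sin (pi * \<delta>)\<bar>" for j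
    using abs_sin_add_int_pi [of "pi * \<delta>" j] by (simp add: algebra_simps)
  show ?thesis
  proof
    assume l: "\<bar>sin (pi * \<delta>)\<bar> < sin (pi * \<kappa>)"
    have "\<bar>\<delta> + of_int (- round \<delta>)\<bar> \<le> 1/2"
      using of_int_round_abs_le [of \<delta>] by (simp add: abs_minus_commute)
    with l show "\<exists>j::int. \<bar>\<delta> + j\<bar> < \<kappa>"
      using * [of "\<delta> + of_int (- round \<delta>)"] periodic [of "- round \<delta>"] by (metis (no_types))
  next
    assume "\<exists>j::int. \<bar>\<delta> + j\<bar> < \<kappa>"
    then obtain j :: int where "\<bar>\<delta> + j\<bar> < \<kappa>" by blast
    then show "\<bar>sin (pi * \<delta>)\<bar> < sin (pi * \<kappa>)"
      using * [of "\<delta> + j"] periodic [of j] assms by simp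
  qed
qed

section \<open>Points of the circle, and the left-continuity of scales\<close>

definition circle_of_radius :: "real \<Rightarrow> (real \<times> real) set" where
  "circle_of_radius \<rho> = {p. (snd p)\<^sup>2 + (fst p)\<^sup>2 = \<rho>\<^sup>2}"

text \<open>Angles are counted in full turns, so that the vertices of a cyclic graph on
  \<open>n\<close> points sit at the fractions \<open>z / n\<close>.\<close>

definition circle_point :: "real \<Rightarrow> real \<Rightarrow> real \<times> real" where
  "circle_point \<rho> \<theta> = (\<rho> * cos (2 * pi * \<theta>), \<rho> * sin (2 * pi * \<theta>))"

lemma dist_circle_point:
  assumes "\<rho> \<ge> 0"
  shows "dist (circle_point \<rho> \<theta>) (circle_point \<rho> \<theta>') = 2 * \<rho> * \<bar>sin (pi * (\<theta> - \<theta>'))\<bar>"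
proof -
  let ?a = "2 * pi * \<theta>" and ?b = "2 * pi * \<theta>'"
  have "(\<rho> * cos ?a - \<rho> * cos ?b)\<^sup>2 + (\<rho> * sin ?a - \<rho> * sin ?b)\<^sup>2
      = \<rho>\<^sup>2 * (((sin ?a)\<^sup>2 + (cos ?a)\<^sup>2) + ((sin ?b)\<^sup>2 + (cos ?b)\<^sup>2) - 2 * (cos ?a * cos ?b + sin ?a * sin ?b))"
    by algebra
  also have "\<dots> = \<rho>\<^sup>2 * (2 - 2 * cos (?a - ?b))"
    by (simp only: sin_cos_squared_add cos_diff) simp
  also have "cos (?a - ?b) = 1 - 2 * (sin (pi * (\<theta> - \<theta>')))\<^sup>2"
    using cos_double_sin [of "pi * (\<theta> - \<theta>')"] by (simp add: algebra_simps)
  also have "\<rho>\<^sup>2 * (2 - 2 * (1 - 2 * (sin (pi * (\<theta> - \<theta>')))\<^sup>2)) = (2 * \<rho> * \<bar>sin (pi * (\<theta> - \<theta>'))\<bar>)\<^sup>2"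
    by (simp add: power_mult_distrib)
  finally show ?thesis
    using assms by (simp add: circle_point_def dist_Pair_Pair dist_real_def)
qed

lemma circle_point_circle: "circle_point \<rho> \<theta> \<in> circle_of_radius \<rho>"
  using sin_cos_squared_add [of "2 * pi * \<theta>"]
  by (simp add: circle_of_radius_def circle_point_def power_mult_distrib flip: distrib_left)

lemma circle_of_radius_circle_point:
  assumes "\<rho> > 0" "p \<in> circle_of_radius \<rho>"
  obtains \<theta> where "0 \<le> \<theta>" "\<theta> < 1" "p = circle_point \<rho> \<theta>"
proof -
  have "(fst p / \<rho>)\<^sup>2 + (snd p / \<rho>)\<^sup>2 = 1"
    using assms by (simp add: circle_of_radius_def power_divide add.commute flip: add_divide_distrib)
  then obtain t where t: "0 \<le> t" "t < 2 * pi" "fst p / \<rho> = cos t" "snd p / \<rho> = sin t"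
    by (rule sincos_total_2pi)
  then have "p = circle_point \<rho> (t / (2 * pi))"
    using assms by (simp add: circle_point_def prod_eq_iff field_simps)
  with t show thesis
    by (intro that [of "t / (2 * pi)"]) auto
qed

lemma prod_complex_map:
  assumes "\<And>S. S \<in> K \<Longrightarrow> h ` S \<in> L" "S \<in> prod_complex M K"
  shows "map_prod id h ` S \<in> prod_complex M L"
proof -
  have "fst ` (map_prod id h ` S) = fst ` S" "snd ` (map_prod id h ` S) = h ` (snd ` S)"
    by (auto simp: image_image)
  then show ?thesis using assms by (simp add: prod_complex_def)
qed

lemma push_id [simp]: "push id c = c"
  by (simp add: push_ident)

lemma push_id' [simp]: "push (\<lambda>x. x) c = c"
  by (simp add: push_ident)

lemma cross_polytope_cycle_cong:
  "(\<And>i. i \<le> j \<Longrightarrow> p i = p' i \<and> q i = q' i) \<Longrightarrow> cross_polytope_cycle p q j = cross_polytope_cycle p' q' j"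
  by (induction j) auto

text \<open>A finite chain involves finitely many strict inequalities, and these persist when the
  scale moves slightly.\<close>

lemma chains_vietoris_rips_tendsto:
  assumes c: "c \<in> chains n (prod_complex M (vietoris_rips X \<epsilon>))" and g: "(g \<longlongrightarrow> \<epsilon>) F"
  shows "\<forall>\<^sub>F x in F. c \<in> chains n (prod_complex M (vietoris_rips X (g x)))"
proof -
  have "\<forall>\<^sub>F x in F. \<forall>xs\<in>keys c. set xs \<in> prod_complex M (vietoris_rips X (g x))"
  proof (intro eventually_ball_finite ballI)
    fix xs assume "xs \<in> keys c"
    then have S: "fst ` set xs \<in> M" "snd ` set xs \<in> vietoris_rips X \<epsilon>"
      using c by (auto simp: chains_def prod_complex_def)
    then have "\<forall>\<^sub>F x in F. \<forall>p\<in>snd ` set xs. \<forall>q\<in>snd ` set xs. dist p q < g x"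
      by (intro eventually_ball_finite ballI order_tendstoD(1) [OF g]) (auto simp: vietoris_rips_def)
    then show "\<forall>\<^sub>F x in F. set xs \<in> prod_complex M (vietoris_rips X (g x))"
      by eventually_elim (use S in \<open>auto simp: prod_complex_def vietoris_rips_def\<close>)
  qed simp
  then show ?thesis
    using c by (auto simp: chains_def elim!: eventually_mono)
qed

text \<open>The surjectivity half of \<^const>\<open>sphere_factor\<close>, relative to an inclusion \<open>K' \<subseteq> K\<close>.\<close>

definition sphere_span :: "'a set set \<Rightarrow> 'b set set \<Rightarrow> 'b set set \<Rightarrow> nat \<Rightarrow> ('b list \<Rightarrow>\<^sub>0 'k::field) \<Rightarrow> 'b \<Rightarrow> bool" where
  "sphere_span M K' K d \<xi> v \<longleftrightarrow> (\<forall>n. \<forall>z\<in>cycles n (prod_complex M K').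
     (if n < d then z - push (retract_snd v) z \<in> boundaries n (prod_complex M K)
      else \<exists>y\<in>cycles (n - d) M. z - push (retract_snd v) z - cross y \<xi> \<in> boundaries n (prod_complex M K)))"

lemma sphere_spanI:
  fixes \<xi> :: "'b list \<Rightarrow>\<^sub>0 'k::field"
  assumes "\<And>n (z :: ('a \<times> 'b) list \<Rightarrow>\<^sub>0 'k). z \<in> cycles n (prod_complex M K') \<Longrightarrow> n < d \<Longrightarrow> z - push (retract_snd v) z \<in> boundaries n (prod_complex M K)"
    "\<And>n (z :: ('a \<times> 'b) list \<Rightarrow>\<^sub>0 'k). z \<in> cycles n (prod_complex M K') \<Longrightarrow> \<not> n < d \<Longrightarrow>
      \<exists>y\<in>cycles (n - d) M. z - push (retract_snd v) z - cross y \<xi> \<in> boundaries n (prod_complex M K)"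
  shows "sphere_span M K' K d \<xi> v"
  using assms unfolding sphere_span_def by auto

lemma sphere_span_less:
  fixes \<xi> :: "'b list \<Rightarrow>\<^sub>0 'k::field" and z :: "('a \<times> 'b) list \<Rightarrow>\<^sub>0 'k"
  shows "sphere_span M K' K d \<xi> v \<Longrightarrow> z \<in> cycles n (prod_complex M K') \<Longrightarrow> n < d \<Longrightarrow> z - push (retract_snd v) z \<in> boundaries n (prod_complex M K)"
  unfolding sphere_span_def by (metis (no_types, lifting))

lemma sphere_span_ge:
  fixes \<xi> :: "'b list \<Rightarrow>\<^sub>0 'k::field" and z :: "('a \<times> 'b) list \<Rightarrow>\<^sub>0 'k"
  shows "sphere_span M K' K d \<xi> v \<Longrightarrow> z \<in> cycles n (prod_complex M K') \<Longrightarrow> \<not> n < d \<Longrightarrow>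
    \<exists>y\<in>cycles (n - d) M. z - push (retract_snd v) z - cross y \<xi> \<in> boundaries n (prod_complex M K)"
  unfolding sphere_span_def by (metis (no_types, lifting))

lemma sphere_factor_iff_sphere_span:
  "sphere_factor M K d \<zeta> v \<longleftrightarrow> \<zeta> \<in> cycles d K \<and> {v} \<in> K \<and> sphere_span M K K d \<zeta> v \<and>
    (\<forall>n. \<forall>y\<in>cycles n M. cross y \<zeta> \<in> boundaries (n + d) (prod_complex M K) \<longrightarrow> y \<in> boundaries n M)"
  unfolding sphere_factor_def sphere_span_def by blast

lemma const_boundary:
  fixes z :: "'b list \<Rightarrow>\<^sub>0 'k::field"
  assumes K: "simplicial K" and z: "z \<in> cycles d K" and d: "d \<noteq> 0" and v: "{v} \<in> K"
  shows "push (\<lambda>_. v) z \<in> boundaries d K"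
proof -
  obtain d' where d': "d = Suc d'" using d by (cases d) auto
  have "push (\<lambda>_. v) z \<in> cycles d {{v}}"
    by (rule push_cycles [OF _ z]) (use simplicial_fin [OF K] in auto)
  then have "push (\<lambda>_. v) z \<in> boundaries d {{v}}"
    unfolding d' by (rule point_cycle)
  then show ?thesis
    by (rule boundaries_mono [rotated]) (use v in auto)
qed

lemma unit_cycle:
  fixes z :: "'b list \<Rightarrow>\<^sub>0 'k::field"
  assumes "simplicial K" "z \<in> cycles d K"
  shows "push (Pair ()) z \<in> cycles d (prod_complex {{()}} K)"
  by (rule push_cycles [OF _ assms(2)]) (use simplicial_fin [OF assms(1)] in \<open>auto simp: prod_complex_def image_image\<close>)

lemma unit_boundary: "c \<in> boundaries d (prod_complex M K) \<Longrightarrow> push snd c \<in> boundaries d K"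
  by (erule push_boundaries [rotated]) (auto simp: prod_complex_def)

lemma unit_minus_const:
  fixes z :: "'b list \<Rightarrow>\<^sub>0 'k::field"
  assumes K: "simplicial K" and z: "z \<in> cycles d K" and d: "d \<noteq> 0" and v: "{v} \<in> K"
    and b: "push (Pair ()) z - push (retract_snd v) (push (Pair ()) z) - push (Pair ()) y \<in> boundaries d (prod_complex {{()}} K)"
  shows "z - y \<in> boundaries d K"
proof -
  have "push snd (push (Pair ()) z - push (retract_snd v) (push (Pair ()) z) - push (Pair ()) y) \<in> boundaries d K"
    by (rule unit_boundary [OF b])
  then have "z - push (\<lambda>_. v) z - y \<in> boundaries d K"
    by (simp add: comp_def retract_snd_def)
  from boundaries_ops(2) [OF this const_boundary [OF K z d v]] show ?thesis
    by simp
qed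

lemma set_singleton_replicate: "set xs = {v} \<Longrightarrow> xs = replicate (length xs) v"
  by (metis replicate_length_same singletonD)

lemma point_chain:
  fixes c :: "'v list \<Rightarrow>\<^sub>0 'k::field"
  assumes "c \<in> chains 0 {{v}}"
  shows "c = single [v] (lookup c [v])"
proof (rule poly_mapping_eqI)
  fix xs
  have "lookup c xs = 0" if "xs \<noteq> [v]"
  proof -
    have "length xs = Suc 0 \<Longrightarrow> set xs = {v} \<Longrightarrow> xs = [v]"
      using set_singleton_replicate [of xs v] by simp
    then have "xs \<notin> keys c"
      using assms that unfolding chains_def by (metis (mono_tags, lifting) mem_Collect_eq singletonD)
    then show ?thesis by (simp add: in_keys_iff)
  qed
  then show "lookup c xs = lookup (single [v] (lookup c [v])) xs"
    by (simp add: lookup_single when_def)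
qed

lemma point_boundary:
  fixes c :: "'v list \<Rightarrow>\<^sub>0 'k::field"
  assumes "c \<in> boundaries 0 {{v}}"
  shows "c = 0"
proof -
  obtain w :: "'v list \<Rightarrow>\<^sub>0 'k" where w: "w \<in> chains 1 {{v}}" "c = dd w"
    using assms by (auto simp: boundaries_iff)
  have "(bd xs :: 'v list \<Rightarrow>\<^sub>0 'k) = 0" if "xs \<in> keys w" for xs
  proof -
    have "length xs = Suc (Suc 0)" "set xs = {v}" using w that by (auto simp: chains_def)
    then have "xs = [v, v]" using set_singleton_replicate [of xs v] by simp
    then show ?thesis by (simp add: bd_def)
  qed
  then have "dd w = 0"
    unfolding dd_def by (metis lin_cong lin_fun_0)
  with w(2) show ?thesis by simp
qed

lemma cross_unit:
  fixes \<xi> :: "'b list \<Rightarrow>\<^sub>0 'k::field"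
  assumes "\<xi> \<in> chains d K"
  shows "cross (single [()] a) \<xi> = push (Pair ()) (smul a \<xi>)"
proof -
  have "lin (shuffle [()]) \<xi> = push (Pair ()) \<xi>"
    unfolding push_def
    by (rule lin_cong, rule shuffle_singleton1) (use assms in \<open>auto simp: chains_def\<close>)
  then show ?thesis by (simp add: cross_def)
qed

text \<open>Over a point the coefficient \<open>y\<close> is a multiple of the only vertex, so every
  class of degree \<open>d\<close> coming from \<open>K'\<close> is a multiple of that of
  \<open>\<xi>\<close>.\<close>

lemma sphere_span_unit:
  fixes \<zeta> \<xi> :: "'b list \<Rightarrow>\<^sub>0 'k::field"
  assumes s: "sphere_span {{()}} K' K d \<xi> v" and K': "simplicial K'" and K: "simplicial K" and sub: "K' \<subseteq> K" and d: "d \<noteq> 0"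
    and v: "{v} \<in> K" and \<xi>: "\<xi> \<in> cycles d K" and \<zeta>: "\<zeta> \<in> cycles d K'"
  shows "\<exists>a. \<zeta> - smul a \<xi> \<in> boundaries d K"
proof -
  have "push (Pair ()) \<zeta> \<in> cycles d (prod_complex {{()}} K')"
    by (rule unit_cycle [OF K' \<zeta>])
  then obtain y where y: "y \<in> cycles 0 {{()}}"
    "push (Pair ()) \<zeta> - push (retract_snd v) (push (Pair ()) \<zeta>) - cross y \<xi> \<in> boundaries d (prod_complex {{()}} K)"
    using sphere_span_ge [OF s] by fastforce
  define a where "a = lookup y [()]"
  have "y = single [()] a"
    using y point_chain unfolding a_def by (auto simp: cycles_iff)
  then have "cross y \<xi> = push (Pair ()) (smul a \<xi>)"
    using \<xi> cross_unit by (auto simp: cycles_iff)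
  then show ?thesis
    using unit_minus_const [OF K cycles_mono [OF sub \<zeta>] d v] y(2) by metis
qed

text \<open>Below the dimension of the sphere a cycle equals its retraction to a vertex, which
  bounds in positive degree.\<close>

lemma boundary_of_sphere_span_unit:
  fixes \<zeta> \<xi> :: "'b list \<Rightarrow>\<^sub>0 'k::field"
  assumes s: "sphere_span {{()}} K K d' \<xi> v" and K: "simplicial K" and d: "d \<noteq> 0" "d < d'"
    and v: "{v} \<in> K" and \<zeta>: "\<zeta> \<in> cycles d K"
  shows "\<zeta> \<in> boundaries d K"
  using unit_minus_const [OF K \<zeta> d(1) v, of 0] sphere_span_less [OF s unit_cycle [OF K \<zeta>] d(2)] by simp

lemma boundary_of_acyclic_factor_unit:
  fixes \<zeta> :: "'b list \<Rightarrow>\<^sub>0 'k::field"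
  assumes a: "acyclic_factor TYPE('k) {{()}} K" and K: "simplicial K" and d: "d \<noteq> 0"
    and v: "{v} \<in> K" and \<zeta>: "\<zeta> \<in> cycles d K"
  shows "\<zeta> \<in> boundaries d K"
proof -
  have "acyclic_along TYPE('k) (prod_complex {{()}} K) (retract_snd v)" using a v by (simp add: acyclic_factor_def)
  from acyclic_alongD [OF this unit_cycle [OF K \<zeta>]] show ?thesis
    using unit_minus_const [OF K \<zeta> d v, of 0] by simp
qed

section \<open>Thresholds of the arc length\<close>

definition winding_bound :: "nat \<Rightarrow> real" where "winding_bound l = real l / (2 * real l + 1)"

lemma winding_bound_bounds: "0 \<le> winding_bound l" "winding_bound l < 1/2"
  by (simp_all add: winding_bound_def field_simps)

lemma winding_bound_Suc: "winding_bound (Suc l) = (real l + 1) / (2 * real l + 3)"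
  by (simp add: winding_bound_def add.commute)

lemma winding_bound_less: "winding_bound l < \<kappa> \<longleftrightarrow> real l < \<kappa> * (2 * real l + 1)"
  by (simp add: winding_bound_def pos_divide_less_eq)

text \<open>Room is left for \<open>k + 1\<close> because rounding to the grid and back costs one
  step. The denominator has the form required by \<open>blowup\<close>; the bound \<open>C\<close>
  serves to push a further fraction below a threshold.\<close>

lemma approx_fraction:
  fixes a b :: real
  assumes "a < b"
  obtains c k :: int where "c > 0" "c \<ge> C" "a < k / ((4 * int l + 4) * c)" "(k + 1) / ((4 * int l + 4) * c) < b"
proof -
  obtain N :: nat where N: "real N > 3 / (b - a)"
    using reals_Archimedean2 by blast
  define c where "c = max 1 (max C (int N))"
  define n where "n = (4 * int l + 4) * c"
  have c: "c > 0" "c \<ge> C" "c \<ge> int N" by (auto simp: c_def)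
  have "n \<ge> 1 * c" unfolding n_def using c by (intro mult_right_mono) auto
  then have "real_of_int n \<ge> real N" using c by linarith
  then have nb: "real_of_int n * (b - a) > 3"
    using N assms by (simp add: pos_divide_less_eq) (smt (verit) mult_right_mono)
  have n: "n > 0" using c by (simp add: n_def)
  define k where "k = \<lfloor>n * a\<rfloor> + 1"
  have "real_of_int k > n * a" "real_of_int k + 1 < n * b"
    using nb unfolding k_def by (simp_all add: algebra_simps) linarith+
  then have "a < k / n" "(k + 1) / n < b"
    using n by (simp_all add: field_simps)
  then show thesis using that c by (simp add: n_def)
qed

section \<open>Comparison of the circle with regular grids\<close>

locale circle =
  fixes \<rho> :: real
  assumes \<rho>: "\<rho> > 0"
begin

text \<open>Arcs are measured in turns and \<open>S \<kappa>\<close> is the chord of the arc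
  \<open>\<kappa>\<close>. For \<open>\<kappa>\<close> between 0 and \<open>1/2\<close>, the complex
  \<open>R \<kappa>\<close> joins points at arc distance less than \<open>\<kappa>\<close>.\<close>

definition "S \<kappa> = 2 * \<rho> * sin (pi * \<kappa>)"
definition "R \<kappa> = vietoris_rips (circle_of_radius \<rho>) (S \<kappa>)"
definition "angle_of p = (SOME \<theta>. 0 \<le> \<theta> \<and> \<theta> < 1 \<and> p = circle_point \<rho> \<theta>)"
definition e :: "int \<Rightarrow> int \<Rightarrow> real \<times> real" where "e n z = circle_point \<rho> (z / n)"
definition phi :: "int \<Rightarrow> real \<times> real \<Rightarrow> int" where "phi n p = \<lfloor>n * angle_of p\<rfloor>"
abbreviation "v0 \<equiv> circle_point \<rho> 0"

lemma dist_less: "0 \<le> \<kappa> \<Longrightarrow> \<kappa> \<le> 1/2 \<Longrightarrow>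
    dist (circle_point \<rho> \<theta>) (circle_point \<rho> \<theta>') < S \<kappa> \<longleftrightarrow> (\<exists>j::int. \<bar>\<theta> - \<theta>' + j\<bar> < \<kappa>)"
  using abs_sin_less_iff [of \<kappa> "\<theta> - \<theta>'"] \<rho> dist_circle_point [of \<rho> \<theta> \<theta>'] by (simp add: S_def)

lemma S_less_iff: "0 \<le> \<kappa> \<Longrightarrow> \<kappa> \<le> 1/2 \<Longrightarrow> 0 \<le> \<kappa>' \<Longrightarrow> \<kappa>' \<le> 1/2 \<Longrightarrow> S \<kappa> < S \<kappa>' \<longleftrightarrow> \<kappa> < \<kappa>'"
proof -
  assume *: "0 \<le> \<kappa>" "\<kappa> \<le> 1/2" "0 \<le> \<kappa>'" "\<kappa>' \<le> 1/2"
  have "pi * x \<le> pi / 2" if "x \<le> 1/2" for x :: real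
    using that by simp
  moreover have "- (pi / 2) \<le> pi * x" if "x \<ge> 0" for x :: real
    using that by (smt (verit) mult_nonneg_nonneg pi_half_ge_zero pi_ge_zero)
  ultimately have "sin (pi * \<kappa>) < sin (pi * \<kappa>') \<longleftrightarrow> pi * \<kappa> < pi * \<kappa>'"
    using * by (intro sin_mono_less_eq) auto
  then show ?thesis using \<rho> by (simp add: S_def)
qed

lemma S_mono: "0 \<le> \<kappa> \<Longrightarrow> \<kappa> \<le> \<kappa>' \<Longrightarrow> \<kappa>' \<le> 1/2 \<Longrightarrow> S \<kappa> \<le> S \<kappa>'"
  using S_less_iff [of \<kappa>' \<kappa>] by force

lemma simplicial_R: "simplicial (R \<kappa>)"
  unfolding R_def by (rule simplicial_vietoris_rips)

lemma R_mono: "0 \<le> \<kappa> \<Longrightarrow> \<kappa> \<le> \<kappa>' \<Longrightarrow> \<kappa>' \<le> 1/2 \<Longrightarrow> R \<kappa> \<subseteq> R \<kappa>'"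
  unfolding R_def by (intro vietoris_rips_mono S_mono)

lemma angle_of:
  assumes "p \<in> circle_of_radius \<rho>"
  shows "0 \<le> angle_of p" "angle_of p < 1" "p = circle_point \<rho> (angle_of p)"
proof -
  have "\<exists>\<theta>. 0 \<le> \<theta> \<and> \<theta> < 1 \<and> p = circle_point \<rho> \<theta>"
    using circle_of_radius_circle_point [OF \<rho> assms] by blast
  from someI_ex [OF this] show "0 \<le> angle_of p" "angle_of p < 1" "p = circle_point \<rho> (angle_of p)"
    by (simp_all add: angle_of_def)
qed

lemma angle_of_circle_point:
  assumes "0 \<le> \<theta>" "\<theta> < 1"
  shows "angle_of (circle_point \<rho> \<theta>) = \<theta>"
proof -
  let ?t = "angle_of (circle_point \<rho> \<theta>)"
  have t: "0 \<le> ?t" "?t < 1" "circle_point \<rho> \<theta> = circle_point \<rho> ?t"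
    using angle_of [OF circle_point_circle] by auto
  then have "2 * \<rho> * \<bar>sin (pi * (\<theta> - ?t))\<bar> = 0"
    using dist_circle_point [of \<rho> \<theta> ?t] \<rho> by simp
  then have "sin (pi * (\<theta> - ?t)) = 0" using \<rho> by simp
  then obtain i :: int where "pi * (\<theta> - ?t) = of_int i * pi"
    using sin_zero_iff_int2 by blast
  then have "\<theta> - ?t = of_int i" by simp
  then show ?thesis using t assms by (cases "i = 0") auto
qed

lemma dist_less_circle:
  assumes "p \<in> circle_of_radius \<rho>" "q \<in> circle_of_radius \<rho>" "0 \<le> \<kappa>" "\<kappa> \<le> 1/2"
  shows "dist p q < S \<kappa> \<longleftrightarrow> (\<exists>j::int. \<bar>angle_of p - angle_of q + j\<bar> < \<kappa>)"
  using dist_less [OF assms(3,4), of "angle_of p" "angle_of q"] angle_of(3) [OF assms(1)] angle_of(3) [OF assms(2)] by simp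

lemma R_I:
  assumes "A \<subseteq> circle_of_radius \<rho>" "finite A" "A \<noteq> {}" "\<And>p q. p \<in> A \<Longrightarrow> q \<in> A \<Longrightarrow> dist p q < S \<kappa>"
  shows "A \<in> R \<kappa>"
  using assms by (auto simp: R_def vietoris_rips_def)

lemma R_D:
  assumes "A \<in> R \<kappa>"
  shows "A \<subseteq> circle_of_radius \<rho>" "finite A" "A \<noteq> {}" "\<And>p q. p \<in> A \<Longrightarrow> q \<in> A \<Longrightarrow> dist p q < S \<kappa>"
  using assms by (auto simp: R_def vietoris_rips_def)

text \<open>Adjacent grid points are at arc distance at most \<open>k / n\<close>; the extra step in
  \<open>(k + 1) / n\<close> makes the inequality strict.\<close>

lemma e_map:
  fixes n k :: int
  assumes n: "n > 0" and A: "A \<in> cyclic_complex n (shift k)" and k: "(k + 1) / n \<le> \<kappa>" and \<kappa>: "0 \<le> \<kappa>" "\<kappa> \<le> 1/2"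
  shows "e n ` A \<in> R \<kappa>"
proof (rule R_I)
  show "e n ` A \<subseteq> circle_of_radius \<rho>" by (auto simp: e_def circle_point_circle)
  show "finite (e n ` A)" "e n ` A \<noteq> {}" using cyclic_complex_fin [OF A] by auto
  fix p q assume "p \<in> e n ` A" "q \<in> e n ` A"
  then obtain u v where uv: "u \<in> A" "v \<in> A" "p = e n u" "q = e n v" by blast
  obtain j where j: "\<bar>v + j * n - u\<bar> \<le> k"
    using cyclic_complex_adj [OF A uv(1,2)] by (auto simp: cyclic_adj_shift)
  have "real_of_int u / n - real_of_int v / n + real_of_int (- j) = - (real_of_int (v + j * n - u) / n)"
    using n by (simp add: field_simps)
  then have "\<bar>real_of_int u / n - real_of_int v / n + real_of_int (- j)\<bar> = real_of_int \<bar>v + j * n - u\<bar> / n"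
    using n by (simp add: abs_divide)
  also have "\<dots> \<le> real_of_int k / n"
    using j n by (intro divide_right_mono; simp only: of_int_le_iff)
  also have "\<dots> < (k + 1) / n"
    using n by (simp add: divide_strict_right_mono)
  finally have "\<bar>real_of_int u / n - real_of_int v / n + real_of_int (- j)\<bar> < \<kappa>"
    using k by linarith
  then show "dist p q < S \<kappa>"
    unfolding uv e_def dist_less [OF \<kappa>] by blast
qed

lemma phi_bounds: "n > 0 \<Longrightarrow> phi n p \<le> n * angle_of p" "n > 0 \<Longrightarrow> n * angle_of p < phi n p + 1"
  unfolding phi_def by linarith+

lemma phi_map:
  fixes n k :: int
  assumes n: "n > 0" and A: "A \<in> R \<kappa>" and k: "\<kappa> \<le> k / n" and \<kappa>: "0 \<le> \<kappa>" "\<kappa> \<le> 1/2"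
  shows "phi n ` A \<in> cyclic_complex n (shift k)"
  unfolding cyclic_complex_def
proof (intro CollectI conjI ballI)
  show "finite (phi n ` A)" "phi n ` A \<noteq> {}" using R_D [OF A] by auto
  fix u v assume "u \<in> phi n ` A" "v \<in> phi n ` A"
  then obtain p q where pq: "p \<in> A" "q \<in> A" "u = phi n p" "v = phi n q" by blast
  then obtain j :: int where "\<bar>angle_of p - angle_of q + j\<bar> < \<kappa>"
    using R_D [OF A] dist_less_circle [OF _ _ \<kappa>] by (meson subset_iff)
  then have "\<bar>angle_of p - angle_of q + j\<bar> * n < k"
    using k n by (smt (verit) of_int_0_less_iff pos_less_divide_eq)
  moreover have "\<bar>angle_of p - angle_of q + j\<bar> * n = \<bar>n * angle_of p - n * angle_of q + j * n\<bar>"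
  proof -
    have "n * angle_of p - n * angle_of q + j * n = (angle_of p - angle_of q + j) * n" by (simp add: algebra_simps)
    then show ?thesis using n by (simp add: abs_mult)
  qed
  ultimately have l: "\<bar>n * angle_of p - n * angle_of q + j * n\<bar> < k" by simp
  note b = phi_bounds [OF n, of p] phi_bounds [OF n, of q]
  \<comment> \<open>Rounding down changes the difference of two angles by less than one grid step;
    integrality then turns \<open>< k + 1\<close> into \<open>\<le> k\<close>.\<close>
  have "real_of_int (u - v + j * n) < real_of_int (k + 1)" "real_of_int (v - u - j * n) < real_of_int (k + 1)"
    using l b unfolding pq by simp_all
  then have "u - v + j * n < k + 1" "v - u - j * n < k + 1"
    by (simp_all only: of_int_less_iff)
  then have "\<bar>v + (- j) * n - u\<bar> \<le> k" by simp
  then show "cyclic_adj n (shift k) u v" unfolding cyclic_adj_shift by blast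
qed

text \<open>Rounding moves a point by at most one grid step, for which
  \<open>(k + 1) / n \<le> \<kappa>\<close> leaves room. Hence rounding is contiguous to the
  inclusion of \<open>R \<kappa>'\<close> into \<open>R \<kappa>\<close>.\<close>

lemma contig:
  fixes n k :: int
  assumes n: "n > 0" and A: "A \<in> R \<kappa>'" and k: "\<kappa>' \<le> k / n" "(k + 1) / n \<le> \<kappa>" and \<kappa>: "0 \<le> \<kappa>'" "\<kappa> \<le> 1/2"
  shows "A \<union> e n ` phi n ` A \<in> R \<kappa>"
proof (rule R_I)
  have "real_of_int k / n < (k + 1) / n"
    using n by (simp add: divide_strict_right_mono)
  then have le: "\<kappa>' \<le> \<kappa>" using k by linarith
  note \<kappa>' = \<kappa>(1) order_trans [OF le \<kappa>(2)] and \<kappa>'' = order_trans [OF \<kappa>(1) le] \<kappa>(2)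
  have E: "e n ` phi n ` A \<in> R \<kappa>"
    by (rule e_map [OF n phi_map [OF n A k(1) \<kappa>'] k(2) \<kappa>''])
  have A': "A \<in> R \<kappa>" using R_mono [OF \<kappa>(1) le \<kappa>(2)] A by blast
  show "A \<union> e n ` phi n ` A \<subseteq> circle_of_radius \<rho>" "finite (A \<union> e n ` phi n ` A)" "A \<union> e n ` phi n ` A \<noteq> {}"
    using R_D [OF A'] R_D [OF E] by auto
  have mix: "dist (e n (phi n p)) q < S \<kappa>" if pq: "p \<in> A" "q \<in> A" for p q
  proof -
    have c: "p \<in> circle_of_radius \<rho>" "q \<in> circle_of_radius \<rho>" using pq R_D(1) [OF A] by auto
    obtain j :: int where j: "\<bar>angle_of p - angle_of q + j\<bar> < \<kappa>'"
      using R_D(4) [OF A pq] dist_less_circle [OF c \<kappa>'] by blast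
    have "\<bar>real_of_int (phi n p) / n - angle_of p\<bar> \<le> 1 / n"
    proof -
      have "real_of_int (phi n p) / n - angle_of p = (phi n p - n * angle_of p) / n"
        using n by (simp add: field_simps)
      then have "\<bar>real_of_int (phi n p) / n - angle_of p\<bar> = \<bar>phi n p - n * angle_of p\<bar> / n"
        using n by (simp add: abs_divide)
      also have "\<dots> \<le> 1 / n"
        using phi_bounds [OF n, of p] n by (intro divide_right_mono) auto
      finally show ?thesis .
    qed
    with j have "\<bar>real_of_int (phi n p) / n - angle_of q + j\<bar> < \<kappa>' + 1 / n"
      by linarith
    also have "\<dots> \<le> (k + 1) / n"
      using k(1) by (simp add: add_divide_distrib)
    finally have "\<bar>real_of_int (phi n p) / n - angle_of q + j\<bar> < \<kappa>"
      using k(2) by linarith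
    then have "dist (circle_point \<rho> (real_of_int (phi n p) / n)) (circle_point \<rho> (angle_of q)) < S \<kappa>"
      unfolding dist_less [OF \<kappa>''] by blast
    then show ?thesis using angle_of(3) [OF c(2)] by (simp add: e_def)
  qed
  fix p q assume "p \<in> A \<union> e n ` phi n ` A" "q \<in> A \<union> e n ` phi n ` A"
  then show "dist p q < S \<kappa>"
  proof (elim UnE)
    assume "p \<in> A" "q \<in> A"
    then show ?thesis by (rule R_D(4) [OF A'])
  next
    assume "p \<in> e n ` phi n ` A" "q \<in> e n ` phi n ` A"
    then show ?thesis by (rule R_D(4) [OF E])
  next
    assume "p \<in> e n ` phi n ` A" "q \<in> A"
    then show ?thesis using mix by blast
  next
    assume "p \<in> A" "q \<in> e n ` phi n ` A"
    then obtain p' where "p' \<in> A" "q = e n (phi n p')" by blast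
    then show ?thesis using mix [OF _ \<open>p \<in> A\<close>] by (simp add: dist_commute)
  qed
qed

lemma e_0: "e n 0 = v0"
  by (simp add: e_def)

lemma chains_R_left:
  assumes "c \<in> chains n (prod_complex M (R \<kappa>))" "\<kappa>0 < \<kappa>"
  obtains \<kappa>' where "\<kappa>0 < \<kappa>'" "\<kappa>' < \<kappa>" "c \<in> chains n (prod_complex M (R \<kappa>'))"
proof -
  have "(S \<longlongrightarrow> S \<kappa>) (at_left \<kappa>)"
    unfolding S_def by (intro tendsto_intros)
  then have "\<forall>\<^sub>F x in at_left \<kappa>. c \<in> chains n (prod_complex M (R x))"
    using assms(1) unfolding R_def by (rule chains_vietoris_rips_tendsto [rotated])
  then have "\<forall>\<^sub>F x in at_left \<kappa>. c \<in> chains n (prod_complex M (R x)) \<and> x \<in> {\<kappa>0<..<\<kappa>}"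
    using eventually_at_left_real [OF assms(2)] by (rule eventually_conj)
  then have "\<exists>x. c \<in> chains n (prod_complex M (R x)) \<and> x \<in> {\<kappa>0<..<\<kappa>}"
    by (rule eventually_happens' [OF trivial_limit_at_left_real])
  then show thesis using that by auto
qed

text \<open>Up to contiguity, the inclusion of \<open>R \<kappa>'\<close> into
  \<open>R \<kappa>\<close> factors through the grid complex by \<open>phi\<close> and
  \<open>e\<close>, so it inherits the spanning half of the sphere property.\<close>

lemma sphere_span_R:
  fixes n k :: int and z0 :: "int list \<Rightarrow>\<^sub>0 'k::field"
  assumes M: "simplicial M" and n: "n > 0" and k: "\<kappa>' \<le> k / n" "(k + 1) / n \<le> \<kappa>" and \<kappa>: "0 \<le> \<kappa>'" "\<kappa> \<le> 1/2"
    and s: "sphere_factor M (cyclic_complex n (shift k)) d z0 0"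
  shows "sphere_span M (R \<kappa>') (R \<kappa>) d (push (e n) z0) v0"
proof -
  have "real_of_int k / n < (k + 1) / n"
    using n by (simp add: divide_strict_right_mono)
  then have le: "\<kappa>' \<le> \<kappa>" using k by linarith
  note \<kappa>' = \<kappa>(1) order_trans [OF le \<kappa>(2)] and \<kappa>'' = order_trans [OF \<kappa>(1) le] \<kappa>(2)
  have s': "sphere_span M (cyclic_complex n (shift k)) (cyclic_complex n (shift k)) d z0 0"
    using s by (simp add: sphere_factor_iff_sphere_span)
  let ?f = "map_prod id (phi n) :: 'a \<times> real \<times> real \<Rightarrow> 'a \<times> int"
  let ?g = "map_prod id (e n) :: 'a \<times> int \<Rightarrow> 'a \<times> real \<times> real"
  have f: "push ?f z \<in> cycles i (prod_complex M (cyclic_complex n (shift k)))" if "z \<in> cycles i (prod_complex M (R \<kappa>'))"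
    for i and z :: "('a \<times> real \<times> real) list \<Rightarrow>\<^sub>0 'k"
    by (rule push_cycles [OF prod_complex_map that], rule phi_map [OF n _ k(1) \<kappa>'])
  have g: "push ?g c \<in> boundaries i (prod_complex M (R \<kappa>))" if "c \<in> boundaries i (prod_complex M (cyclic_complex n (shift k)))"
    for i and c :: "('a \<times> int) list \<Rightarrow>\<^sub>0 'k"
    by (rule push_boundaries [OF prod_complex_map that], rule e_map [OF n _ k(2) \<kappa>''])
  have hom: "z - push ?g (push ?f z) \<in> boundaries i (prod_complex M (R \<kappa>))" if z: "z \<in> cycles i (prod_complex M (R \<kappa>'))"
    for i and z :: "('a \<times> real \<times> real) list \<Rightarrow>\<^sub>0 'k"
  proof -
    have "push id z - push (?g \<circ> ?f) z \<in> boundaries i (prod_complex M (R \<kappa>))"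
    proof (rule contiguous [OF simplicial_prod_complex [OF M simplicial_R] _ z])
      fix A assume "A \<in> prod_complex M (R \<kappa>')"
      then have A: "fst ` A \<in> M" "snd ` A \<in> R \<kappa>'" by (auto simp: prod_complex_def)
      have "fst ` ((?g \<circ> ?f) ` A \<union> id ` A) = fst ` A" "snd ` ((?g \<circ> ?f) ` A \<union> id ` A) = snd ` A \<union> e n ` phi n ` snd ` A"
        by (auto simp: image_Un image_image)
      then show "(?g \<circ> ?f) ` A \<union> id ` A \<in> prod_complex M (R \<kappa>)"
        using A contig [OF n A(2) k \<kappa>] by (simp add: prod_complex_def)
    qed
    then show ?thesis by simp
  qed
  have const: "push ?g (push (retract_snd 0) (push ?f z)) = push (retract_snd v0) z" for z :: "('a \<times> real \<times> real) list \<Rightarrow>\<^sub>0 'k"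
  proof -
    have "?g \<circ> (retract_snd 0 \<circ> ?f) = retract_snd v0" by (auto simp: retract_snd_def e_0)
    then show ?thesis by (simp add: comp_assoc)
  qed
  show ?thesis
  proof (rule sphere_spanI)
    fix i and z :: "('a \<times> real \<times> real) list \<Rightarrow>\<^sub>0 'k" assume z: "z \<in> cycles i (prod_complex M (R \<kappa>'))" and i: "i < d"
    from g [OF sphere_span_less [OF s' f [OF z] i]]
    have "push ?g (push ?f z) - push (retract_snd v0) z \<in> boundaries i (prod_complex M (R \<kappa>))"
      by (simp only: push_simps const)
    with hom [OF z] show "z - push (retract_snd v0) z \<in> boundaries i (prod_complex M (R \<kappa>))"
      by (rule boundaries_diff_trans)
  next
    fix i and z :: "('a \<times> real \<times> real) list \<Rightarrow>\<^sub>0 'k" assume z: "z \<in> cycles i (prod_complex M (R \<kappa>'))" and i: "\<not> i < d"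
    from sphere_span_ge [OF s' f [OF z] i] obtain y where y: "y \<in> cycles (i - d) M"
      "push ?f z - push (retract_snd 0) (push ?f z) - cross y z0 \<in> boundaries i (prod_complex M (cyclic_complex n (shift k)))"
      by blast
    from g [OF y(2)] have "push ?g (push ?f z) - push (retract_snd v0) z - cross y (push (e n) z0) \<in> boundaries i (prod_complex M (R \<kappa>))"
      by (simp only: push_simps const push_cross push_id)
    from boundaries_ops(2) [OF hom [OF z] this]
    have "z - push (retract_snd v0) z - cross y (push (e n) z0) \<in> boundaries i (prod_complex M (R \<kappa>))"
      by (simp add: algebra_simps)
    with y(1) show "\<exists>y\<in>cycles (i - d) M. z - push (retract_snd v0) z - cross y (push (e n) z0) \<in> boundaries i (prod_complex M (R \<kappa>))"
      by blast
  qed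
qed

lemma window:
  fixes n k :: int
  assumes n: "n > 0" and k: "winding_bound l < real_of_int k / n" "real_of_int k / n < winding_bound (Suc l)"
  shows "winding_gt n (shift k) l" "winding_lt n (shift k) l"
proof -
  have "real l * n < k * (2 * real l + 1)" "k * (2 * real l + 3) < (real l + 1) * n"
    using k n unfolding winding_bound_Suc unfolding winding_bound_def by (simp_all add: field_simps)
  then have "real_of_int (int l * n) < real_of_int (k * (2 * int l + 1))"
    "real_of_int (k * (2 * int l + 3)) < real_of_int ((int l + 1) * n)"
    by simp_all
  then have "int l * n < k * (2 * int l + 1)" "k * (2 * int l + 3) < (int l + 1) * n"
    by (simp_all only: of_int_less_iff)
  then show "winding_gt n (shift k) l" "winding_lt n (shift k) l"
    by (simp_all add: winding_gt_shift winding_lt_shift algebra_simps)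
qed

text \<open>The window and the gap from \<open>\<kappa>'\<close> to \<open>\<kappa>\<close> are only
  required to overlap. This covers scales inside a bar and also \<open>\<kappa> = 1/2\<close>, which
  is approached by windows of growing index.\<close>

lemma approx_span:
  assumes "0 \<le> \<kappa>'" "\<kappa>' < \<kappa>" "\<kappa> \<le> 1/2" "\<kappa>' < winding_bound (Suc l)" "winding_bound l < \<kappa>" "winding_bound l < winding_bound (Suc l)"
  obtains \<xi> :: "(real \<times> real) list \<Rightarrow>\<^sub>0 'k::field" where "\<xi> \<in> cycles (2 * l + 1) (R \<kappa>)"
    "\<And>M :: 'a set set. simplicial M \<Longrightarrow> sphere_span M (R \<kappa>') (R \<kappa>) (2 * l + 1) \<xi> v0"
    "sphere_span {{()}} (R \<kappa>') (R \<kappa>) (2 * l + 1) \<xi> v0"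
proof -
  have "max \<kappa>' (winding_bound l) < min \<kappa> (winding_bound (Suc l))" using assms by auto
  then obtain c k :: int where ck: "c > 0" "max \<kappa>' (winding_bound l) < k / ((4 * int l + 4) * c)"
    "(k + 1) / ((4 * int l + 4) * c) < min \<kappa> (winding_bound (Suc l))"
    by (rule approx_fraction)
  interpret B: blowup l c by unfold_locales (rule ck)
  have k: "winding_bound l < real_of_int k / B.n" "\<kappa>' \<le> real_of_int k / B.n" "(k + 1) / B.n < winding_bound (Suc l)" "(k + 1) / B.n \<le> \<kappa>"
    using ck by (auto simp: B.n_eq)
  have "real_of_int k / B.n < (k + 1) / B.n"
    using B.n by (simp add: divide_strict_right_mono)
  then have w: "winding_gt B.n (shift k) l" "winding_lt B.n (shift k) l"
    using window [OF B.n k(1)] k(3) by linarith+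
  obtain z0 :: "int list \<Rightarrow>\<^sub>0 'k" where z0: "z0 \<in> cycles (2 * l + 1) (cyclic_complex B.n (shift k))"
    "\<And>M :: 'a set set. simplicial M \<Longrightarrow> sphere_factor M (cyclic_complex B.n (shift k)) (2 * l + 1) z0 0"
    "sphere_factor {{()}} (cyclic_complex B.n (shift k)) (2 * l + 1) z0 0"
    using B.sphere_factor_shift [OF w, where 'k = 'k and 'a = 'a] by metis
  show thesis
  proof (rule that [of "push (e B.n) z0"])
    show "push (e B.n) z0 \<in> cycles (2 * l + 1) (R \<kappa>)"
      by (rule push_cycles [OF e_map z0(1)]) (use B.n k assms in auto)
    show "sphere_span M (R \<kappa>') (R \<kappa>) (2 * l + 1) (push (e B.n) z0) v0" if "simplicial M" for M :: "'a set set"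
      by (rule sphere_span_R [OF that B.n k(2,4) assms(1,3) z0(2) [OF that]])
    show "sphere_span {{()}} (R \<kappa>') (R \<kappa>) (2 * l + 1) (push (e B.n) z0) v0"
      by (rule sphere_span_R [OF simplicial_point B.n k(2,4) assms(1,3) z0(3)])
  qed
qed

section \<open>Generators tied to a reference cycle\<close>

lemma winding_bound_less_Suc: "winding_bound l < winding_bound (Suc l)"
  unfolding winding_bound_less winding_bound_Suc by (simp add: field_simps)

text \<open>Among \<open>4l+4\<close> equally spaced points, number \<open>i\<close> and its
  antipode span axis \<open>i\<close>. The definition is free of \<open>c\<close>, so one cycle
  serves all grids.\<close>

definition chi :: "nat \<Rightarrow> (real \<times> real) list \<Rightarrow>\<^sub>0 'k::field" where
  "chi l = cross_polytope_cycle (\<lambda>i. circle_point \<rho> ((real i + 2 * real l + 2) / (4 * real l + 4)))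
     (\<lambda>i. circle_point \<rho> (real i / (4 * real l + 4))) (2 * l + 1)"

lemma push_e_chi:
  assumes "c > 0"
  shows "push (e (blowup.n l c)) (blowup.chi l c) = chi l"
proof -
  interpret B: blowup l c by unfold_locales (rule assms)
  have "e B.n \<circ> B.pp = (\<lambda>i. circle_point \<rho> ((real i + 2 * real l + 2) / (4 * real l + 4)))"
    using assms by (auto simp: e_def B.pp_def B.n_eq B.H_def add.assoc)
  moreover have "e B.n \<circ> B.qq = (\<lambda>i. circle_point \<rho> (real i / (4 * real l + 4)))"
    using assms by (auto simp: e_def B.qq_def B.n_eq)
  ultimately show ?thesis
    by (simp only: B.chi_def push_cross_polytope_cycle chi_def)
qed

text \<open>The reference points lie on the grid and have angles below a full turn, so rounding
  returns them exactly.\<close>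

lemma push_phi_chi:
  assumes "c > 0"
  shows "push (phi (blowup.n l c)) (chi l) = blowup.chi l c"
proof -
  interpret B: blowup l c by unfold_locales (rule assms)
  have *: "phi B.n (circle_point \<rho> (real j / (4 * real l + 4))) = int j * c" if "j < 4 * l + 4" for j
  proof -
    have "real j < 4 * real l + 4" using that by linarith
    then have "angle_of (circle_point \<rho> (real j / (4 * real l + 4))) = real j / (4 * real l + 4)"
      by (intro angle_of_circle_point) auto
    moreover have "real_of_int B.n * (real j / (4 * real l + 4)) = real_of_int (int j * c)"
      by (simp add: B.n_eq field_simps)
    ultimately have "phi B.n (circle_point \<rho> (real j / (4 * real l + 4))) = \<lfloor>real_of_int (int j * c)\<rfloor>"
      by (simp only: phi_def)
    then show ?thesis by (simp only: floor_of_int)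
  qed
  have "(phi B.n \<circ> (\<lambda>i. circle_point \<rho> ((real i + 2 * real l + 2) / (4 * real l + 4)))) i = B.pp i" if "i \<le> 2 * l + 1" for i
    using * [of "i + 2 * l + 2"] that by (simp add: B.pp_def B.H_def add_ac)
  moreover have "(phi B.n \<circ> (\<lambda>i. circle_point \<rho> (real i / (4 * real l + 4)))) i = B.qq i" if "i \<le> 2 * l + 1" for i
    using * [of i] that by (simp add: B.qq_def)
  ultimately show ?thesis
    unfolding B.chi_def push_cross_polytope_cycle chi_def by (intro cross_polytope_cycle_cong) blast
qed

text \<open>The comparison scale \<open>\<kappa>1\<close> may exceed \<open>\<kappa>\<close>: for
  \<open>\<kappa> \<le> (2l+1)/(4l+4)\<close> the cycle \<open>chi l\<close> does not yet lie in
  \<open>R \<kappa>\<close>.\<close>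

definition generates :: "nat \<Rightarrow> real \<Rightarrow> ((real \<times> real) list \<Rightarrow>\<^sub>0 'k::field) \<Rightarrow> bool" where
  "generates l \<kappa> \<zeta> \<longleftrightarrow> \<zeta> \<in> cycles (2 * l + 1) (R \<kappa>) \<and>
     (\<exists>\<kappa>1. 0 \<le> \<kappa>1 \<and> \<kappa>1 < winding_bound (Suc l) \<and> \<zeta> - chi l \<in> boundaries (2 * l + 1) (R \<kappa>1))"

lemma generates_exists:
  assumes \<kappa>: "winding_bound l < \<kappa>" "\<kappa> \<le> winding_bound (Suc l)"
  shows "\<exists>\<zeta> :: (real \<times> real) list \<Rightarrow>\<^sub>0 'k::field. generates l \<kappa> \<zeta>"
proof -
  have half: "\<kappa> \<le> 1/2" "0 \<le> \<kappa>" using \<kappa> winding_bound_bounds [of l] winding_bound_bounds [of "Suc l"] by auto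
  \<comment> \<open>The bound on \<open>c\<close> puts \<open>(m + 1) / n\<close> below
    \<open>winding_bound (Suc l)\<close>, because \<open>(l+1) n - (2l+3) m = c\<close> must exceed
    \<open>2l+3\<close>.\<close>
  obtain c k :: int where ck: "c > 0" "c \<ge> 2 * int l + 4" "winding_bound l < k / ((4 * int l + 4) * c)"
    "(k + 1) / ((4 * int l + 4) * c) < \<kappa>"
    using approx_fraction [OF \<kappa>(1)] by metis
  interpret B: blowup l c by unfold_locales (rule ck)
  have k: "winding_bound l < real_of_int k / B.n" "(k + 1) / B.n < \<kappa>"
    using ck by (auto simp: B.n_eq)
  have "real_of_int k / B.n < (k + 1) / B.n"
    using B.n by (simp add: divide_strict_right_mono)
  then have w: "winding_gt B.n (shift k) l" "winding_lt B.n (shift k) l"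
    using window [OF B.n k(1)] k(2) \<kappa>(2) by linarith+
  obtain z0 :: "int list \<Rightarrow>\<^sub>0 'k" where z0: "z0 \<in> cycles (2 * l + 1) (cyclic_complex B.n (shift k))"
    "z0 - B.chi \<in> boundaries (2 * l + 1) (cyclic_complex B.n (shift (max k B.m)))"
    using B.sphere_factor_shift [OF w, where 'k = 'k and 'a = unit] by metis
  define \<kappa>1 where "\<kappa>1 = real_of_int (max k B.m + 1) / B.n"
  have "(B.m + 1) / B.n < winding_bound (Suc l)"
  proof -
    have "(B.m + 1) * (2 * int l + 3) < (int l + 1) * B.n"
      using ck(2) by (simp add: B.n_eq algebra_simps)
    then have "real_of_int ((B.m + 1) * (2 * int l + 3)) < real_of_int ((int l + 1) * B.n)"
      by (simp only: of_int_less_iff)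
    then show ?thesis
      unfolding winding_bound_Suc using B.n by (simp add: divide_less_eq less_divide_eq algebra_simps)
  qed
  then have k1: "\<kappa>1 < winding_bound (Suc l)"
    using k(2) \<kappa>(2) by (auto simp: \<kappa>1_def max_def)
  have k11: "\<kappa>1 \<le> 1/2" using k1 winding_bound_bounds(2) [of "Suc l"] by linarith
  have k10: "0 \<le> \<kappa>1" using B.m_nonneg B.n by (simp add: \<kappa>1_def)
  have "push (e B.n) z0 \<in> cycles (2 * l + 1) (R \<kappa>)"
    by (rule push_cycles [OF e_map z0(1)]) (use B.n k half in auto)
  moreover have "push (e B.n) (z0 - B.chi) \<in> boundaries (2 * l + 1) (R \<kappa>1)"
  proof (rule push_boundaries [OF _ z0(2)])
    show "e B.n ` A \<in> R \<kappa>1" if "A \<in> cyclic_complex B.n (shift (max k B.m))" for A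
      by (rule e_map [OF B.n that _ k10 k11]) (simp add: \<kappa>1_def)
  qed
  ultimately show ?thesis
    using k1 k10 unfolding generates_def push_simps push_e_chi [OF ck(1)] by blast
qed

text \<open>A filling at \<open>\<kappa>'\<close> already exists at a smaller
  \<open>\<kappa>2\<close>, which is why \<open>\<kappa>'\<close> may be the right end of the bar.
  At a scale still short of the end, \<open>\<zeta>\<close> is exchanged for the reference cycle and
  the filling is rounded to a grid, where injectivity is known.\<close>

lemma generates_inj:
  fixes \<zeta> :: "(real \<times> real) list \<Rightarrow>\<^sub>0 'k::field"
  assumes g: "generates l \<kappa> \<zeta>" and \<kappa>': "0 < \<kappa>'" "\<kappa>' \<le> winding_bound (Suc l)" and M: "simplicial M" and y: "y \<in> cycles n M"
    and \<kappa>: "0 \<le> \<kappa>" "\<kappa> \<le> \<kappa>'"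
    and b: "cross y \<zeta> \<in> boundaries (n + (2 * l + 1)) (prod_complex M (R \<kappa>'))"
  shows "y \<in> boundaries n M"
proof -
  obtain \<kappa>1 where k1: "0 \<le> \<kappa>1" "\<kappa>1 < winding_bound (Suc l)" "\<zeta> - chi l \<in> boundaries (2 * l + 1) (R \<kappa>1)"
    using g by (auto simp: generates_def)
  obtain w where "w \<in> chains (Suc (n + (2 * l + 1))) (prod_complex M (R \<kappa>'))" "cross y \<zeta> = dd w"
    using b by (auto simp: boundaries_iff)
  then obtain \<kappa>2 where k2: "0 < \<kappa>2" "\<kappa>2 < \<kappa>'" "cross y \<zeta> \<in> boundaries (n + (2 * l + 1)) (prod_complex M (R \<kappa>2))"
    using chains_R_left [OF _ \<kappa>'(1)] by (metis boundariesI)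
  \<comment> \<open>\<open>\<mu> = m / n\<close> is the largest arc between adjacent vertices of the
    reference cycle; staying above it gives \<open>m \<le> k\<close>, where \<open>B.chi\<close> is
    a cycle of the grid complex.\<close>
  define \<mu> where "\<mu> = (2 * real l + 1) / (4 * real l + 4)"
  define \<kappa>3 where "\<kappa>3 = max \<kappa>2 (max \<kappa>1 \<mu>)"
  have "\<mu> < winding_bound (Suc l)" unfolding \<mu>_def winding_bound_Suc by (simp add: field_simps)
  then have k3: "\<kappa>3 < winding_bound (Suc l)" using k1 k2 \<kappa>' by (auto simp: \<kappa>3_def)
  then have half: "\<kappa>3 \<le> 1/2" using winding_bound_bounds [of "Suc l"] by simp
  obtain c k :: int where ck: "c > 0" "\<kappa>3 < k / ((4 * int l + 4) * c)"
    "(k + 1) / ((4 * int l + 4) * c) < winding_bound (Suc l)"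
    using approx_fraction [OF k3] by metis
  interpret B: blowup l c by unfold_locales (rule ck)
  have k: "\<kappa>3 < real_of_int k / B.n" "(k + 1) / B.n < winding_bound (Suc l)"
    using ck by (auto simp: B.n_eq)
  have kk: "real_of_int k / B.n < (k + 1) / B.n"
    using B.n by (simp add: divide_strict_right_mono)
  have \<mu>': "\<mu> < real_of_int k / B.n" using k by (simp add: \<kappa>3_def)
  have "\<mu> = real_of_int B.m / B.n"
    using ck by (simp add: \<mu>_def B.n_eq)
  then have mk: "B.m \<le> k" using \<mu>' B.n by (simp add: divide_less_cancel)
  have "winding_bound l \<le> \<mu>" unfolding \<mu>_def winding_bound_def by (simp add: field_simps)
  then have w: "winding_lt B.n (shift k) l"
    using window(2) [OF B.n, of l k] k kk \<mu>' by linarith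
  have s: "sphere_factor M (cyclic_complex B.n (shift k)) (2 * l + 1) (B.chi :: int list \<Rightarrow>\<^sub>0 'k) 0"
    by (rule B.sphere_factor_shift_up [OF M mk w])
  have "\<kappa>2 \<le> \<kappa>3" "\<kappa>1 \<le> \<kappa>3" by (simp_all add: \<kappa>3_def)
  then have m3: "R \<kappa>2 \<subseteq> R \<kappa>3" "R \<kappa>1 \<subseteq> R \<kappa>3"
    using k1 k2 half by (intro R_mono; simp)+
  have 1: "cross y \<zeta> \<in> boundaries (n + (2 * l + 1)) (prod_complex M (R \<kappa>3))"
    by (rule boundaries_mono [OF prod_complex_mono [OF m3(1)] k2(3)])
  have "cross y (\<zeta> - chi l) \<in> boundaries (n + (2 * l + 1)) (prod_complex M (R \<kappa>3))"
    by (rule cross_boundaries2 [OF M simplicial_R y boundaries_mono [OF m3(2) k1(3)]])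
  then have 2: "cross y (chi l) \<in> boundaries (n + (2 * l + 1)) (prod_complex M (R \<kappa>3))"
    using boundaries_ops(3) [OF 1] by fastforce
  have "push (map_prod id (phi B.n)) (cross y (chi l)) \<in> boundaries (n + (2 * l + 1)) (prod_complex M (cyclic_complex B.n (shift k)))"
  proof (rule push_boundaries [OF prod_complex_map 2])
    show "phi B.n ` A \<in> cyclic_complex B.n (shift k)" if "A \<in> R \<kappa>3" for A
      by (rule phi_map [OF B.n that]) (use k k2 half in \<open>auto simp: \<kappa>3_def\<close>)
  qed
  then have "cross y B.chi \<in> boundaries (n + (2 * l + 1)) (prod_complex M (cyclic_complex B.n (shift k)))"
    by (simp only: push_cross push_id push_phi_chi [OF ck(1)])
  then show ?thesis using s y unfolding sphere_factor_def by blast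
qed

lemma generates_not_boundary:
  fixes \<zeta> :: "(real \<times> real) list \<Rightarrow>\<^sub>0 'k::field"
  assumes g: "generates l \<kappa> \<zeta>" and \<kappa>': "0 < \<kappa>'" "\<kappa>' \<le> winding_bound (Suc l)" and \<kappa>: "0 \<le> \<kappa>" "\<kappa> \<le> \<kappa>'"
  shows "\<zeta> \<notin> boundaries (2 * l + 1) (R \<kappa>')"
proof
  assume b: "\<zeta> \<in> boundaries (2 * l + 1) (R \<kappa>')"
  have y: "single [()] (1::'k) \<in> cycles 0 {{()}}"
    by (rule vertex_cycle) simp
  have "cross (single [()] 1) \<zeta> \<in> boundaries (0 + (2 * l + 1)) (prod_complex {{()}} (R \<kappa>'))"
    by (rule cross_boundaries2 [OF simplicial_point simplicial_R y b])
  from generates_inj [OF g \<kappa>' simplicial_point y \<kappa> this] show False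
    by (metis point_boundary lookup_single_eq lookup_zero zero_neq_one)
qed

lemma v0_R: "0 < \<kappa> \<Longrightarrow> \<kappa> \<le> 1/2 \<Longrightarrow> {v0} \<in> R \<kappa>"
proof -
  assume "0 < \<kappa>" "\<kappa> \<le> 1/2"
  then have "S 0 < S \<kappa>" by (subst S_less_iff) auto
  then show ?thesis by (intro R_I) (auto simp: circle_point_circle S_def)
qed

text \<open>\<open>approx_span\<close> provides a spanning class \<open>\<xi>\<close> that depends
  on the cycle \<open>z\<close> through the choice of \<open>\<kappa>'\<close>. Since
  \<open>\<zeta>\<close> is a multiple of it modulo boundaries, and a nonzero one because
  \<open>\<zeta>\<close> does not bound, \<open>\<zeta>\<close> spans for all cycles at
  once.\<close>

lemma sphere_factor_R:
  fixes \<zeta> :: "(real \<times> real) list \<Rightarrow>\<^sub>0 'k::field"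
  assumes \<kappa>: "winding_bound l < \<kappa>" "\<kappa> \<le> winding_bound (Suc l)" and g: "generates l \<kappa> \<zeta>" and M: "simplicial M"
  shows "sphere_factor M (R \<kappa>) (2 * l + 1) \<zeta> v0"
proof -
  have half: "\<kappa> \<le> 1/2" "0 < \<kappa>" using \<kappa> winding_bound_bounds [of l] winding_bound_bounds [of "Suc l"] by auto
  let ?d = "2 * l + 1"
  have \<zeta>: "\<zeta> \<in> cycles ?d (R \<kappa>)" using g by (simp add: generates_def)
  have sp: "\<exists>\<xi>. (\<exists>a. \<zeta> - smul a \<xi> \<in> boundaries ?d (R \<kappa>) \<and> a \<noteq> 0) \<and> \<xi> \<in> cycles ?d (R \<kappa>) \<and>
      (if n < ?d then z - push (retract_snd v0) z \<in> boundaries n (prod_complex M (R \<kappa>))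
       else \<exists>y\<in>cycles (n - ?d) M. z - push (retract_snd v0) z - cross y \<xi> \<in> boundaries n (prod_complex M (R \<kappa>)))"
    if z: "z \<in> cycles n (prod_complex M (R \<kappa>))" for n z
  proof -
    have "push (Pair ()) \<zeta> \<in> chains ?d (prod_complex {{()}} (R \<kappa>))"
      using unit_cycle [OF simplicial_R \<zeta>] by (simp add: cycles_iff)
    then obtain \<kappa>a where a: "0 < \<kappa>a" "\<kappa>a < \<kappa>" "push (Pair ()) \<zeta> \<in> chains ?d (prod_complex {{()}} (R \<kappa>a))"
      using chains_R_left [OF _ half(2)] by metis
    have "push snd (push (Pair ()) \<zeta>) \<in> chains ?d (R \<kappa>a)"
      by (rule push_chains [OF _ a(3)]) (auto simp: prod_complex_def)
    then have \<zeta>a: "\<zeta> \<in> chains ?d (R \<kappa>a)" by (simp add: comp_def)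
    obtain \<kappa>' where b: "\<kappa>a < \<kappa>'" "\<kappa>' < \<kappa>" "z \<in> chains n (prod_complex M (R \<kappa>'))"
      using chains_R_left [OF _ a(2)] z by (metis cycles_iff)
    have "R \<kappa>a \<subseteq> R \<kappa>'" using a b half by (intro R_mono) auto
    then have \<zeta>': "\<zeta> \<in> cycles ?d (R \<kappa>')" using \<zeta>a \<zeta> chains_mono by (auto simp: cycles_iff)
    have z': "z \<in> cycles n (prod_complex M (R \<kappa>'))" using z b by (simp add: cycles_iff)
    have k0: "0 \<le> \<kappa>'" "\<kappa>' < winding_bound (Suc l)" using a b \<kappa> by auto
    obtain \<xi> :: "(real \<times> real) list \<Rightarrow>\<^sub>0 'k" where \<xi>: "\<xi> \<in> cycles ?d (R \<kappa>)"
      "\<And>M :: 'a set set. simplicial M \<Longrightarrow> sphere_span M (R \<kappa>') (R \<kappa>) ?d \<xi> v0"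
      "sphere_span {{()}} (R \<kappa>') (R \<kappa>) ?d \<xi> v0"
      using approx_span [OF k0(1) b(2) half(1) k0(2) \<kappa>(1) winding_bound_less_Suc, where 'k = 'k and 'a = 'a] by metis
    have "R \<kappa>' \<subseteq> R \<kappa>" using k0 b half by (intro R_mono) auto
    from sphere_span_unit [OF \<xi>(3) simplicial_R simplicial_R this _ v0_R [OF half(2,1)] \<xi>(1) \<zeta>']
    obtain a where a: "\<zeta> - smul a \<xi> \<in> boundaries ?d (R \<kappa>)" by auto
    have "a \<noteq> 0"
    proof
      assume "a = 0"
      then have "\<zeta> \<in> boundaries ?d (R \<kappa>)" using a by simp
      then show False
        using generates_not_boundary [OF g half(2) \<kappa>(2)] half by simp
    qed
    then show ?thesis
      using a \<xi>(1) sphere_span_less [OF \<xi>(2) [OF M] z'] sphere_span_ge [OF \<xi>(2) [OF M] z'] by (intro exI [of _ \<xi>]) auto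
  qed
  have "sphere_span M (R \<kappa>) (R \<kappa>) ?d \<zeta> v0"
  proof (rule sphere_spanI)
    fix n and z :: "('a \<times> real \<times> real) list \<Rightarrow>\<^sub>0 'k" assume z: "z \<in> cycles n (prod_complex M (R \<kappa>))" and n: "n < ?d"
    then show "z - push (retract_snd v0) z \<in> boundaries n (prod_complex M (R \<kappa>))"
      using sp [OF z] by auto
  next
    fix n and z :: "('a \<times> real \<times> real) list \<Rightarrow>\<^sub>0 'k" assume z: "z \<in> cycles n (prod_complex M (R \<kappa>))" and n: "\<not> n < ?d"
    then obtain \<xi> a y where 1: "\<zeta> - smul a \<xi> \<in> boundaries ?d (R \<kappa>)" "a \<noteq> 0" "\<xi> \<in> cycles ?d (R \<kappa>)"
      "y \<in> cycles (n - ?d) M" "z - push (retract_snd v0) z - cross y \<xi> \<in> boundaries n (prod_complex M (R \<kappa>))"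
      using sp [OF z] by auto
    define y' where "y' = smul (1 / a) y"
    have y': "y' \<in> cycles (n - ?d) M" using 1 by (simp add: y'_def)
    have "cross y' (\<zeta> - smul a \<xi>) \<in> boundaries (n - ?d + ?d) (prod_complex M (R \<kappa>))"
      by (rule cross_boundaries2 [OF M simplicial_R y' 1(1)])
    then have "cross y' \<zeta> - cross y \<xi> \<in> boundaries n (prod_complex M (R \<kappa>))"
      using n 1(2) by (simp add: y'_def)
    from boundaries_ops(3) [OF 1(5) this] have "z - push (retract_snd v0) z - cross y' \<zeta> \<in> boundaries n (prod_complex M (R \<kappa>))"
      by simp
    with y' show "\<exists>y\<in>cycles (n - ?d) M. z - push (retract_snd v0) z - cross y \<zeta> \<in> boundaries n (prod_complex M (R \<kappa>))"
      by blast
  qed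
  then show ?thesis
    unfolding sphere_factor_iff_sphere_span
    using \<zeta> v0_R [OF half(2,1)] generates_inj [OF g half(2) \<kappa>(2) M] half by auto
qed

text \<open>A cycle at scale \<open>1/2\<close> lives at some \<open>\<kappa>' < 1/2\<close>.
  Passing back to \<open>1/2\<close> through a window of large index, whose sphere has dimension
  above the degree of the cycle, retracts it.\<close>

lemma acyclic_factor_half:
  assumes M: "simplicial M"
  shows "acyclic_factor TYPE('k::field) M (R (1/2))"
proof (rule acyclic_factor_intro [OF M, of v0])
  show "{v0} \<in> R (1/2)" by (rule v0_R) auto
  show "acyclic_along TYPE('k) (prod_complex M (R (1/2))) (retract_snd v0)"
    unfolding acyclic_along_def
  proof (intro allI impI)
    fix n and z :: "('a \<times> real \<times> real) list \<Rightarrow>\<^sub>0 'k" assume z: "z \<in> cycles n (prod_complex M (R (1/2)))"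
    then have circle_class: "z \<in> chains n (prod_complex M (R (1/2)))" by (simp add: cycles_iff)
    obtain \<kappa>' where k: "0 < \<kappa>'" "\<kappa>' < 1/2" "z \<in> chains n (prod_complex M (R \<kappa>'))"
      using chains_R_left [OF circle_class, of 0] by auto
    have z': "z \<in> cycles n (prod_complex M (R \<kappa>'))" using z k by (simp add: cycles_iff)
    \<comment> \<open>\<open>\<kappa>' < winding_bound (Suc l)\<close> amounts to
      \<open>l + 1 > \<kappa>' / (1 - 2 \<kappa>')\<close>; taking \<open>l \<ge> n\<close> as well
      puts the degree \<open>n\<close> below \<open>2l+1\<close>.\<close>
    obtain L :: nat where L: "real L > \<kappa>' / (1 - 2 * \<kappa>')"
      using reals_Archimedean2 by blast
    define l where "l = max L n"
    have "real (Suc l) > \<kappa>' / (1 - 2 * \<kappa>')" using L by (simp add: l_def)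
    then have "\<kappa>' < winding_bound (Suc l)"
      using k unfolding winding_bound_Suc by (simp add: field_simps)
    then obtain \<xi> :: "(real \<times> real) list \<Rightarrow>\<^sub>0 'k" where
      "\<And>M :: 'a set set. simplicial M \<Longrightarrow> sphere_span M (R \<kappa>') (R (1/2)) (2 * l + 1) \<xi> v0"
      using approx_span [of \<kappa>' "1/2" l, where 'k = 'k and 'a = 'a] k winding_bound_bounds(2) [of l] winding_bound_less_Suc by (metis less_imp_le order_refl)
    from sphere_span_less [OF this [OF M] z'] show "z - push (retract_snd v0) z \<in> boundaries n (prod_complex M (R (1/2)))"
      by (simp add: l_def)
  qed
qed

end

section \<open>Intervals in the scale parameter and transition maps of a circle\<close>

definition circle_interval :: "real \<Rightarrow> nat \<Rightarrow> real set" where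
  "circle_interval \<rho> m = (if m = 0 then {0 <..}
     else if odd m then
       {2 * \<rho> * sin (pi * (real (m div 2) / (2 * real (m div 2) + 1))) <..
        2 * \<rho> * sin (pi * ((real (m div 2) + 1) / (2 * real (m div 2) + 3)))}
     else {})"

text \<open>The transition maps are diagonal up to nonzero scalars; scalars are allowed because a
  generator is chosen separately at each parameter.\<close>

definition carried :: "(real \<Rightarrow> 'v set set) \<Rightarrow> (nat \<Rightarrow> real set) \<Rightarrow> (real \<Rightarrow> nat \<Rightarrow> ('v list \<Rightarrow>\<^sub>0 'k::field)) \<Rightarrow> bool" where
  "carried K J Z \<longleftrightarrow> (\<forall>s t m. s \<le> t \<longrightarrow> s \<in> J m \<longrightarrow>
     (if t \<in> J m then \<exists>c. c \<noteq> 0 \<and> Z s m - smul c (Z t m) \<in> boundaries m (K t)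
      else Z s m \<in> boundaries m (K t)))"

lemma carriedI:
  fixes Z :: "real \<Rightarrow> nat \<Rightarrow> ('v list \<Rightarrow>\<^sub>0 'k::field)"
  assumes "\<And>s t m. s \<le> t \<Longrightarrow> s \<in> J m \<Longrightarrow> t \<in> J m \<Longrightarrow> \<exists>c. c \<noteq> 0 \<and> Z s m - smul c (Z t m) \<in> boundaries m (K t)"
    "\<And>s t m. s \<le> t \<Longrightarrow> s \<in> J m \<Longrightarrow> t \<notin> J m \<Longrightarrow> Z s m \<in> boundaries m (K t)"
  shows "carried K J Z"
  unfolding carried_def using assms by auto

lemma vietoris_rips_empty: "\<epsilon> \<le> 0 \<Longrightarrow> vietoris_rips X \<epsilon> = {}"
  unfolding vietoris_rips_def using zero_le_dist order_trans by fastforce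

lemma vietoris_rips_full_acyclic_factor:
  assumes M: "simplicial M" and v: "v \<in> X" and d: "\<And>p q. p \<in> X \<Longrightarrow> q \<in> X \<Longrightarrow> dist p q < \<epsilon>"
  shows "acyclic_factor TYPE('k::field) M (vietoris_rips X \<epsilon>)"
proof (rule acyclic_factor_cone [OF M simplicial_vietoris_rips])
  have "{v} \<in> vietoris_rips X \<epsilon>" using v d [OF v v] by (simp add: vietoris_rips_def)
  then show "vietoris_rips X \<epsilon> \<noteq> {}" by blast
  show "insert v S \<in> vietoris_rips X \<epsilon>" if "S \<in> vietoris_rips X \<epsilon>" for S
  proof -
    have "insert v S \<subseteq> X" "finite S" using that v by (auto simp: vietoris_rips_def)
    then show ?thesis using d [OF v v] d unfolding vietoris_rips_def by (simp add: subset_iff)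
  qed
qed

context circle
begin

definition "arc_length \<epsilon> = arcsin (\<epsilon> / (2 * \<rho>)) / pi"

lemma arc_length:
  assumes "0 < \<epsilon>" "\<epsilon> \<le> 2 * \<rho>"
  shows "0 < arc_length \<epsilon>" "arc_length \<epsilon> \<le> 1/2" "S (arc_length \<epsilon>) = \<epsilon>"
proof -
  have b: "0 < \<epsilon> / (2 * \<rho>)" "\<epsilon> / (2 * \<rho>) \<le> 1" using assms \<rho> by auto
  have "arcsin 0 < arcsin (\<epsilon> / (2 * \<rho>))"
    using b by (intro arcsin_less_arcsin) auto
  then show "0 < arc_length \<epsilon>" by (simp add: arc_length_def)
  show "arc_length \<epsilon> \<le> 1/2"
    using arcsin_ubound [of "\<epsilon> / (2 * \<rho>)"] b by (simp add: arc_length_def field_simps)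
  show "S (arc_length \<epsilon>) = \<epsilon>"
    using b \<rho> by (simp add: S_def arc_length_def)
qed

lemma R_arc_length: "0 < \<epsilon> \<Longrightarrow> \<epsilon> \<le> 2 * \<rho> \<Longrightarrow> vietoris_rips (circle_of_radius \<rho>) \<epsilon> = R (arc_length \<epsilon>)"
  by (simp add: R_def arc_length)

lemma S_half: "S (1/2) = 2 * \<rho>"
  by (simp add: S_def)

lemma circle_interval_odd: "circle_interval \<rho> (2 * l + 1) = {S (winding_bound l) <.. S (winding_bound (Suc l))}"
  by (simp add: circle_interval_def S_def winding_bound_Suc) (simp add: winding_bound_def)

lemma circle_interval_arc_length:
  assumes "0 < \<epsilon>" "\<epsilon> \<le> 2 * \<rho>"
  shows "\<epsilon> \<in> circle_interval \<rho> (2 * l + 1) \<longleftrightarrow> winding_bound l < arc_length \<epsilon> \<and> arc_length \<epsilon> \<le> winding_bound (Suc l)"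
  using S_less_iff [of "winding_bound l" "arc_length \<epsilon>"] S_less_iff [of "winding_bound (Suc l)" "arc_length \<epsilon>"]
    arc_length [OF assms] winding_bound_bounds [of l] winding_bound_bounds [of "Suc l"] unfolding circle_interval_odd by auto

lemma circle_interval_bounds:
  assumes "\<epsilon> \<in> circle_interval \<rho> m" "m \<noteq> 0"
  shows "0 < \<epsilon>" "\<epsilon> \<le> 2 * \<rho>" "\<exists>l. m = 2 * l + 1"
proof -
  have "odd m" using assms by (auto simp: circle_interval_def split: if_splits)
  then obtain l where l: "m = 2 * l + 1" by (elim oddE)
  then show "\<exists>l. m = 2 * l + 1" by blast
  have e: "S (winding_bound l) < \<epsilon>" "\<epsilon> \<le> S (winding_bound (Suc l))" using assms(1) unfolding l circle_interval_odd by auto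
  have "S 0 \<le> S (winding_bound l)" "S (winding_bound (Suc l)) \<le> S (1/2)"
    using winding_bound_bounds [of l] winding_bound_bounds [of "Suc l"] by (intro S_mono; simp)+
  then show "0 < \<epsilon>" "\<epsilon> \<le> 2 * \<rho>" using e S_half by (auto simp: S_def)
qed

lemma winding_bound_mono: "i \<le> j \<Longrightarrow> winding_bound i \<le> winding_bound j"
  using lift_Suc_mono_le [of winding_bound] winding_bound_less_Suc less_imp_le by blast

lemma window_unique: "winding_bound l < \<kappa> \<Longrightarrow> \<kappa> \<le> winding_bound (Suc l) \<Longrightarrow> winding_bound l' < \<kappa> \<Longrightarrow> \<kappa> \<le> winding_bound (Suc l') \<Longrightarrow> l = l'"
proof (rule ccontr)
  assume *: "winding_bound l < \<kappa>" "\<kappa> \<le> winding_bound (Suc l)" "winding_bound l' < \<kappa>" "\<kappa> \<le> winding_bound (Suc l')" "l \<noteq> l'"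
  then have "Suc l \<le> l' \<or> Suc l' \<le> l" by linarith
  then show False using winding_bound_mono [of "Suc l" l'] winding_bound_mono [of "Suc l'" l] * by linarith
qed

lemma window_exists:
  assumes "0 < \<kappa>" "\<kappa> < 1/2"
  obtains l where "winding_bound l < \<kappa>" "\<kappa> \<le> winding_bound (Suc l)"
proof -
  define q where "q = \<kappa> / (1 - 2 * \<kappa>)"
  have q: "q > 0" using assms by (simp add: q_def)
  \<comment> \<open>\<open>q\<close> inverts \<open>winding_bound\<close>, and the ceiling minus one
    puts \<open>q\<close> into the half-open interval from \<open>l\<close> to \<open>l + 1\<close>,
    closed on the right like the bars.\<close>
  define l where "l = nat (\<lceil>q\<rceil> - 1)"
  have l: "real l < q" "q \<le> real l + 1" using q unfolding l_def by linarith+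
  have "winding_bound l < \<kappa>"
    using l(1) assms unfolding winding_bound_less q_def by (simp add: field_simps)
  moreover have "\<kappa> \<le> winding_bound (Suc l)"
    using l(2) assms unfolding winding_bound_Suc q_def by (simp add: field_simps)
  ultimately show thesis using that by blast
qed

definition circle_class :: "real \<Rightarrow> nat \<Rightarrow> ((real \<times> real) list \<Rightarrow>\<^sub>0 'k::field)" where
  "circle_class \<epsilon> m = (if m = 0 then single [v0] 1 else (SOME \<zeta>. generates (m div 2) (arc_length \<epsilon>) \<zeta>))"

lemma circle_class_generates:
  assumes "winding_bound l < arc_length \<epsilon>" "arc_length \<epsilon> \<le> winding_bound (Suc l)"
  shows "generates l (arc_length \<epsilon>) (circle_class \<epsilon> (2 * l + 1) :: (real \<times> real) list \<Rightarrow>\<^sub>0 'k::field)"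
  using someI_ex [OF generates_exists [OF assms]] by (simp add: circle_class_def)

lemma circle_interval_set:
  assumes "0 < \<epsilon>" "\<epsilon> \<le> 2 * \<rho>"
  shows "{m. \<epsilon> \<in> circle_interval \<rho> m} = {0} \<union> {m. \<exists>l. m = 2 * l + 1 \<and> winding_bound l < arc_length \<epsilon> \<and> arc_length \<epsilon> \<le> winding_bound (Suc l)}"
proof -
  have "\<epsilon> \<in> circle_interval \<rho> m \<longleftrightarrow> (\<exists>l. m = 2 * l + 1 \<and> winding_bound l < arc_length \<epsilon> \<and> arc_length \<epsilon> \<le> winding_bound (Suc l))" if "m \<noteq> 0" for m
    using circle_interval_bounds(3) [OF _ that, of \<epsilon>] circle_interval_arc_length [OF assms] by blast
  moreover have "\<epsilon> \<in> circle_interval \<rho> 0" using assms by (simp add: circle_interval_def)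
  ultimately show ?thesis by auto
qed

lemma circle_interval_window:
  assumes "0 < \<epsilon>" "\<epsilon> \<le> 2 * \<rho>" "winding_bound l < arc_length \<epsilon>" "arc_length \<epsilon> \<le> winding_bound (Suc l)"
  shows "{m. \<epsilon> \<in> circle_interval \<rho> m} = {0, 2 * l + 1}"
  unfolding circle_interval_set [OF assms(1,2)] using window_unique assms(3,4) by auto

lemma circle_interval_large: "2 * \<rho> \<le> \<epsilon> \<Longrightarrow> {m. \<epsilon> \<in> circle_interval \<rho> m} = {0}"
proof -
  assume e: "2 * \<rho> \<le> \<epsilon>"
  have "\<epsilon> \<notin> circle_interval \<rho> m" if m0: "m \<noteq> 0" for m
  proof
    assume m: "\<epsilon> \<in> circle_interval \<rho> m"
    obtain l where l: "m = 2 * l + 1" using circle_interval_bounds(3) [OF m m0] by blast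
    have "S (winding_bound (Suc l)) < S (1/2)"
      using winding_bound_bounds [of "Suc l"] by (subst S_less_iff) auto
    then show False using m e unfolding l circle_interval_odd by (simp add: S_half)
  qed
  moreover have "\<epsilon> \<in> circle_interval \<rho> 0" using e \<rho> by (simp add: circle_interval_def)
  ultimately show ?thesis by auto
qed

lemma dist_le: "p \<in> circle_of_radius \<rho> \<Longrightarrow> q \<in> circle_of_radius \<rho> \<Longrightarrow> dist p q \<le> 2 * \<rho>"
proof -
  assume pq: "p \<in> circle_of_radius \<rho>" "q \<in> circle_of_radius \<rho>"
  have "dist (circle_point \<rho> (angle_of p)) (circle_point \<rho> (angle_of q)) \<le> 2 * \<rho> * 1"
    unfolding dist_circle_point [OF less_imp_le [OF \<rho>]] using \<rho> by (intro mult_left_mono) auto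
  then show ?thesis using angle_of(3) [OF pq(1)] angle_of(3) [OF pq(2)] by simp
qed

lemma acyclic_factor_large:
  assumes M: "simplicial M" and "2 * \<rho> \<le> \<epsilon>"
  shows "acyclic_factor TYPE('k::field) M (vietoris_rips (circle_of_radius \<rho>) \<epsilon>)"
proof (cases "\<epsilon> = 2 * \<rho>")
  case True
  then show ?thesis
    using acyclic_factor_half [OF M] by (simp add: R_def S_half)
next
  case False
  show ?thesis
  proof (rule vietoris_rips_full_acyclic_factor [OF M circle_point_circle])
    show "dist p q < \<epsilon>" if "p \<in> circle_of_radius \<rho>" "q \<in> circle_of_radius \<rho>" for p q
      using dist_le [OF that] assms(2) False by linarith
  qed
qed

lemma v0_vr: "0 < \<epsilon> \<Longrightarrow> {v0} \<in> vietoris_rips (circle_of_radius \<rho>) \<epsilon>"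
  by (simp add: vietoris_rips_def circle_point_circle)

text \<open>Three ranges of scales: no simplices, exactly one window, and an acyclic complex from
  the diameter on. At the diameter itself antipodes are still not joined, and
  \<open>acyclic_factor_half\<close> takes the place of the cone.\<close>

lemma kunneth_basis_circle:
  assumes M: "simplicial M"
  shows "kunneth_basis M (vietoris_rips (circle_of_radius \<rho>) \<epsilon>) {m. \<epsilon> \<in> circle_interval \<rho> m} (circle_class \<epsilon> :: nat \<Rightarrow> ((real \<times> real) list \<Rightarrow>\<^sub>0 'k::field))"
proof -
  consider "\<epsilon> \<le> 0" | "0 < \<epsilon>" "\<epsilon> < 2 * \<rho>" | "2 * \<rho> \<le> \<epsilon>" by linarith
  then show ?thesis
  proof cases
    case 1
    have "\<epsilon> \<notin> circle_interval \<rho> m" for m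
      using 1 circle_interval_bounds(1) [of \<epsilon> m] by (cases "m = 0") (auto simp: circle_interval_def)
    then show ?thesis using 1 kunneth_basis_empty by (simp add: vietoris_rips_empty)
  next
    case 2
    then have a: "0 < arc_length \<epsilon>" "arc_length \<epsilon> < 1/2"
    proof -
      show "0 < arc_length \<epsilon>" using 2 by (intro arc_length) auto
      have "arc_length \<epsilon> \<noteq> 1/2"
      proof
        assume "arc_length \<epsilon> = 1/2"
        then have "S (1/2) = \<epsilon>" using arc_length(3) [of \<epsilon>] 2 by (metis less_imp_le)
        then show False using 2 S_half by simp
      qed
      then show "arc_length \<epsilon> < 1/2" using arc_length(2) [of \<epsilon>] 2 by simp
    qed
    then obtain l where l: "winding_bound l < arc_length \<epsilon>" "arc_length \<epsilon> \<le> winding_bound (Suc l)" by (rule window_exists)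
    have "kunneth_basis M (R (arc_length \<epsilon>)) {0, 2 * l + 1} (circle_class \<epsilon> :: nat \<Rightarrow> ((real \<times> real) list \<Rightarrow>\<^sub>0 'k))"
      by (rule kunneth_basis_sphere_factor [OF M simplicial_R sphere_factor_R [OF l circle_class_generates [OF l] M]]) (simp_all add: circle_class_def)
    then show ?thesis
      using 2 circle_interval_window [OF _ _ l] by (simp add: R_arc_length)
  next
    case 3
    then have "0 < \<epsilon>" using \<rho> by simp
    show ?thesis
      unfolding circle_interval_large [OF 3]
      by (rule kunneth_basis_acyclic_along [OF acyclic_factor_large [OF M 3] v0_vr [OF \<open>0 < \<epsilon>\<close>]]) (simp add: circle_class_def)
  qed
qed

text \<open>Within a bar the homology of odd degree \<open>m\<close> is a line, and the scalar is
  nonzero since a generator survives to the right end. Past the bar the sphere has a dimension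
  greater than \<open>m\<close>, or the complex is acyclic.\<close>

lemma carried_circle:
  "carried (vietoris_rips (circle_of_radius \<rho>)) (circle_interval \<rho>) (circle_class :: real \<Rightarrow> nat \<Rightarrow> ((real \<times> real) list \<Rightarrow>\<^sub>0 'k::field))"
proof (rule carriedI)
  fix s t :: real and m :: nat assume st: "s \<le> t" and s: "s \<in> circle_interval \<rho> m" and t: "t \<in> circle_interval \<rho> m"
  show "\<exists>c. c \<noteq> 0 \<and> (circle_class s m :: (real \<times> real) list \<Rightarrow>\<^sub>0 'k) - smul c (circle_class t m) \<in> boundaries m (vietoris_rips (circle_of_radius \<rho>) t)"
  proof (cases "m = 0")
    case True
    then show ?thesis by (intro exI [of _ 1]) (simp add: circle_class_def)
  next
    case False
    note bs = circle_interval_bounds [OF s False] and bt = circle_interval_bounds [OF t False]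
    obtain l where l: "m = 2 * l + 1" using bs by blast
    have ws: "winding_bound l < arc_length s" "arc_length s \<le> winding_bound (Suc l)" using s bs circle_interval_arc_length unfolding l by auto
    have wt: "winding_bound l < arc_length t" "arc_length t \<le> winding_bound (Suc l)" using t bt circle_interval_arc_length unfolding l by auto
    let ?zs = "circle_class s m :: (real \<times> real) list \<Rightarrow>\<^sub>0 'k" and ?zt = "circle_class t m :: (real \<times> real) list \<Rightarrow>\<^sub>0 'k"
    have gs: "generates l (arc_length s) ?zs" and gt: "generates l (arc_length t) ?zt"
      using circle_class_generates ws wt unfolding l by auto
    have arcs: "arc_length s \<le> arc_length t"
      using S_less_iff [of "arc_length t" "arc_length s"] arc_length [OF bs(1,2)] arc_length [OF bt(1,2)] st by auto
    have "R (arc_length s) \<subseteq> R (arc_length t)"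
      using arcs arc_length [OF bs(1,2)] arc_length [OF bt(1,2)] by (intro R_mono) auto
    then have zs: "?zs \<in> cycles m (R (arc_length t))"
      using gs cycles_mono unfolding generates_def l by blast
    have zt: "?zt \<in> cycles m (R (arc_length t))" using gt unfolding generates_def l by blast
    have "sphere_factor {{()}} (R (arc_length t)) m ?zt v0"
      using sphere_factor_R [OF wt gt simplicial_point] unfolding l .
    then have sp: "sphere_span {{()}} (R (arc_length t)) (R (arc_length t)) m ?zt v0"
      by (simp add: sphere_factor_iff_sphere_span)
    obtain c where c: "?zs - smul c ?zt \<in> boundaries m (R (arc_length t))"
      using sphere_span_unit [OF sp simplicial_R simplicial_R _ False v0_R zt zs] arc_length [OF bt(1,2)] by auto
    have "c \<noteq> 0"
    proof
      assume "c = 0"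
      then have "?zs \<in> boundaries (2 * l + 1) (R (arc_length t))" using c l by simp
      then show False
        using generates_not_boundary [OF gs _ wt(2) _ arcs] arc_length [OF bs(1,2)] arc_length [OF bt(1,2)] by auto
    qed
    then show ?thesis using c bt by (auto simp: R_arc_length)
  qed
next
  fix s t :: real and m :: nat assume st: "s \<le> t" and s: "s \<in> circle_interval \<rho> m" and t: "t \<notin> circle_interval \<rho> m"
  have m: "m \<noteq> 0"
  proof
    assume "m = 0"
    then show False using s t st by (simp add: circle_interval_def)
  qed
  note bs = circle_interval_bounds [OF s m]
  obtain l where l: "m = 2 * l + 1" using bs by blast
  have ws: "winding_bound l < arc_length s" "arc_length s \<le> winding_bound (Suc l)" using s bs circle_interval_arc_length unfolding l by auto
  let ?z = "circle_class s m :: (real \<times> real) list \<Rightarrow>\<^sub>0 'k" and ?K = "vietoris_rips (circle_of_radius \<rho>) t"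
  have gs: "generates l (arc_length s) ?z" using circle_class_generates ws unfolding l by auto
  have "R (arc_length s) \<subseteq> ?K"
    unfolding R_def using arc_length(3) [OF bs(1,2)] st by (simp add: vietoris_rips_mono)
  then have z: "?z \<in> cycles m ?K" using gs cycles_mono unfolding generates_def l by blast
  have t0: "0 < t" using bs st by simp
  show "?z \<in> boundaries m ?K"
  proof (cases "2 * \<rho> \<le> t")
    case True
    show ?thesis
      by (rule boundary_of_acyclic_factor_unit [OF acyclic_factor_large [OF simplicial_point True] simplicial_vietoris_rips m v0_vr [OF t0] z])
  next
    case False
    then have t1: "t \<le> 2 * \<rho>" by simp
    have "arc_length t \<noteq> 1/2"
    proof
      assume "arc_length t = 1/2"
      then have "S (1/2) = t" using arc_length(3) [OF t0 t1] by metis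
      then show False using False S_half by simp
    qed
    then have "0 < arc_length t" "arc_length t < 1/2" using arc_length [OF t0 t1] by auto
    then obtain l' where w: "winding_bound l' < arc_length t" "arc_length t \<le> winding_bound (Suc l')" by (rule window_exists)
    have "arc_length s \<le> arc_length t"
      using S_less_iff [of "arc_length t" "arc_length s"] arc_length [OF bs(1,2)] arc_length [OF t0 t1] st by auto
    then have "winding_bound (Suc l) < arc_length t"
      using t ws circle_interval_arc_length [OF t0 t1, of l] unfolding l by auto
    then have "l < l'"
      using w(2) winding_bound_mono [of "Suc l'" "Suc l"] by (meson leI le_less_trans less_irrefl order_trans Suc_le_mono)
    obtain \<zeta> :: "(real \<times> real) list \<Rightarrow>\<^sub>0 'k" where "generates l' (arc_length t) \<zeta>"
      using generates_exists [OF w] by blast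
    then have "sphere_factor {{()}} (R (arc_length t)) (2 * l' + 1) \<zeta> v0"
      by (rule sphere_factor_R [OF w _ simplicial_point])
    then have "sphere_span {{()}} ?K ?K (2 * l' + 1) \<zeta> v0"
      by (simp add: sphere_factor_iff_sphere_span R_arc_length [OF t0 t1])
    then show ?thesis
      by (rule boundary_of_sphere_span_unit [OF _ simplicial_vietoris_rips m _ v0_vr [OF t0] z]) (use l \<open>l < l'\<close> in simp)
  qed
qed

end

lemma kunneth_circle:
  assumes "\<rho> \<ge> 0"
  shows "\<exists>Z :: real \<Rightarrow> nat \<Rightarrow> ((real \<times> real) list \<Rightarrow>\<^sub>0 'k::field).
    (\<forall>M :: 'a set set. simplicial M \<longrightarrow> (\<forall>\<epsilon>. kunneth_basis M (vietoris_rips (circle_of_radius \<rho>) \<epsilon>) {m. \<epsilon> \<in> circle_interval \<rho> m} (Z \<epsilon>))) \<and>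
    carried (vietoris_rips (circle_of_radius \<rho>)) (circle_interval \<rho>) Z"
proof (cases "\<rho> > 0")
  case True
  then interpret circle \<rho> by unfold_locales
  show ?thesis by (intro exI [of _ circle_class] conjI allI impI kunneth_basis_circle carried_circle)
next
  case False
  \<comment> \<open>A vanishing Fourier coefficient: the circle is a point, and the odd intervals
    are empty because both their ends are 0.\<close>
  then have \<rho>: "\<rho> = 0" using assms by simp
  define Z :: "real \<Rightarrow> nat \<Rightarrow> ((real \<times> real) list \<Rightarrow>\<^sub>0 'k)" where "Z = (\<lambda>_ _. single [(0, 0)] 1)"
  have c: "circle_of_radius 0 = {(0, 0)}" by (auto simp: circle_of_radius_def sum_power2_eq_zero_iff)
  have degenerate: "\<epsilon> \<in> circle_interval 0 m \<longleftrightarrow> 0 < \<epsilon> \<and> m = 0" for \<epsilon> m by (simp add: circle_interval_def)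
  show ?thesis
  proof (intro exI [of _ Z] conjI allI impI)
    fix M :: "'a set set" and \<epsilon> assume M: "simplicial M"
    show "kunneth_basis M (vietoris_rips (circle_of_radius \<rho>) \<epsilon>) {m. \<epsilon> \<in> circle_interval \<rho> m} (Z \<epsilon>)"
    proof (cases "\<epsilon> > 0")
      case True
      have "acyclic_factor TYPE('k) M (vietoris_rips (circle_of_radius 0) \<epsilon>)"
        by (rule vietoris_rips_full_acyclic_factor [OF M, of "(0, 0)"]) (use True in \<open>simp_all add: c\<close>)
      moreover have "{(0, 0)} \<in> vietoris_rips (circle_of_radius 0) \<epsilon>"
        using True by (simp add: vietoris_rips_def c)
      ultimately have "kunneth_basis M (vietoris_rips (circle_of_radius 0) \<epsilon>) {0} (Z \<epsilon>)"
        by (rule kunneth_basis_acyclic_along) (simp add: Z_def)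
      moreover have "{m. \<epsilon> \<in> circle_interval 0 m} = {0}" using True by (auto simp: degenerate)
      ultimately show ?thesis by (simp only: \<rho>)
    next
      case False
      then have "{m. \<epsilon> \<in> circle_interval 0 m} = {}" by (auto simp: degenerate)
      then show ?thesis using False kunneth_basis_empty by (simp only: \<rho> vietoris_rips_empty)
    qed
  next
    show "carried (vietoris_rips (circle_of_radius \<rho>)) (circle_interval \<rho>) Z"
    proof (rule carriedI)
      fix s t m assume "s \<le> t" "s \<in> circle_interval \<rho> m" "t \<notin> circle_interval \<rho> m"
      then show "Z s m \<in> boundaries m (vietoris_rips (circle_of_radius \<rho>) t)" by (simp add: \<rho> degenerate)
    next
      fix s t m
      have "Z s m - smul 1 (Z t m) \<in> boundaries m (vietoris_rips (circle_of_radius \<rho>) t)" by (simp add: Z_def)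
      then show "\<exists>c. c \<noteq> 0 \<and> Z s m - smul c (Z t m) \<in> boundaries m (vietoris_rips (circle_of_radius \<rho>) t)"
        by (intro exI [of _ 1]) simp
    qed
  qed
qed

section \<open>Persistence bases\<close>

text \<open>Coordinates modulo \<open>W\<close> with respect to \<open>e\<close> carry an
  independent family to independent vectors of the free space on \<open>I\<close>, which bounds its
  size. The family \<open>e\<close> attains the bound.\<close>

lemma dim_modulo_eq:
  fixes e :: "'i \<Rightarrow> ('x \<Rightarrow>\<^sub>0 'k::field)"
  assumes W: "pm.subspace W" and I: "finite I" and e: "\<And>i. i \<in> I \<Longrightarrow> e i \<in> U"
    and indep: "\<And>u. (\<Sum>i\<in>I. smul (u i) (e i)) \<in> W \<Longrightarrow> \<forall>i\<in>I. u i = 0"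
    and span: "\<And>c. c \<in> U \<Longrightarrow> \<exists>u. c - (\<Sum>i\<in>I. smul (u i) (e i)) \<in> W"
  shows "dim_modulo U W = enat (card I)"
proof (rule antisym)
  show "dim_modulo U W \<le> enat (card I)"
    unfolding dim_modulo_def
  proof (rule SUP_least)
    fix A assume "A \<in> {A. A \<subseteq> U \<and> independent_modulo W A}"
    then have A: "A \<subseteq> U" "finite A" and
      ind: "\<And>u. (\<Sum>c\<in>A. smul (u c) c) \<in> W \<Longrightarrow> \<forall>c\<in>A. u c = 0"
      by (auto simp: independent_modulo_def smul_def)
    obtain x where x: "\<And>c. c \<in> A \<Longrightarrow> c - (\<Sum>i\<in>I. smul (x c i) (e i)) \<in> W"
      using span A(1) by (metis subset_iff)
    define g where "g c = (\<Sum>i\<in>I. single i (x c i))" for c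
    have key: "\<forall>c\<in>A. u c = 0" if "(\<Sum>c\<in>A. smul (u c) (g c)) = 0" for u
    proof (rule ind)
      have "(\<Sum>c\<in>A. u c * x c i) = 0" if "i \<in> I" for i
      proof -
        have "lookup (\<Sum>c\<in>A. smul (u c) (g c)) i = (\<Sum>c\<in>A. u c * x c i)"
          using I that by (simp add: g_def lookup_sum lookup_single when_def)
        with \<open>(\<Sum>c\<in>A. smul (u c) (g c)) = 0\<close> show ?thesis by simp
      qed
      then have "(\<Sum>i\<in>I. smul (\<Sum>c\<in>A. u c * x c i) (e i)) = 0"
        by simp
      then have "(\<Sum>c\<in>A. smul (u c) (\<Sum>i\<in>I. smul (x c i) (e i))) = 0"
        by (simp add: pm.scale_sum_right pm.scale_sum_left sum.swap [of _ A])
      moreover have "(\<Sum>c\<in>A. smul (u c) (c - (\<Sum>i\<in>I. smul (x c i) (e i)))) \<in> W"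
        using x by (intro pm.subspace_sum [OF W] pm.subspace_scale [OF W]) auto
      ultimately show "(\<Sum>c\<in>A. smul (u c) c) \<in> W"
        by (simp add: pm.scale_right_diff_distrib sum_subtractf)
    qed
    have inj: "inj_on g A"
    proof (rule inj_onI, rule ccontr)
      fix c d assume cd: "c \<in> A" "d \<in> A" "g c = g d" "c \<noteq> d"
      let ?u = "(\<lambda>_. 0)(c := 1, d := - 1) :: _ \<Rightarrow> 'k"
      have "(\<Sum>a\<in>A. smul (?u a) (g a)) = (\<Sum>a\<in>{c, d}. smul (?u a) (g a))"
        by (rule sum.mono_neutral_right) (use A cd in auto)
      also have "\<dots> = 0" using cd by simp
      finally have "\<forall>a\<in>A. ?u a = 0" by (rule key)
      then show False using cd by auto
    qed
    have "pm.independent (g ` A)"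
    proof
      assume "pm.dependent (g ` A)"
      then obtain u where u: "\<exists>v\<in>g ` A. u v \<noteq> 0" "(\<Sum>v\<in>g ` A. smul (u v) v) = 0"
        using pm.dependent_finite [OF finite_imageI [OF A(2)], of g] by blast
      then have "(\<Sum>c\<in>A. smul (u (g c)) (g c)) = 0"
        by (simp add: sum.reindex [OF inj])
      from key [OF this] u(1) show False by auto
    qed
    moreover have "g ` A \<subseteq> pm.span ((\<lambda>i. single i 1) ` I)"
    proof
      fix v assume "v \<in> g ` A"
      then obtain c where "v = g c" by blast
      then have "v = (\<Sum>i\<in>I. smul (x c i) (single i 1))" by (simp add: g_def)
      also have "\<dots> \<in> pm.span ((\<lambda>i. single i 1) ` I)"
        by (intro pm.span_sum pm.span_scale pm.span_base) auto
      finally show "v \<in> pm.span ((\<lambda>i. single i 1) ` I)" .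
    qed
    ultimately have "card (g ` A) \<le> card ((\<lambda>i. single i (1::'k)) ` I)"
      using pm.independent_span_bound I by (metis finite_imageI)
    also have "\<dots> \<le> card I" using I by (rule card_image_le)
    finally show "enat (card A) \<le> enat (card I)"
      using card_image [OF inj] by simp
  qed
next
  have inj: "inj_on e I"
  proof (rule inj_onI, rule ccontr)
    fix i j assume ij: "i \<in> I" "j \<in> I" "e i = e j" "i \<noteq> j"
    let ?u = "(\<lambda>_. 0)(i := 1, j := - 1) :: _ \<Rightarrow> 'k"
    have "(\<Sum>a\<in>I. smul (?u a) (e a)) = (\<Sum>a\<in>{i, j}. smul (?u a) (e a))"
      by (rule sum.mono_neutral_right) (use I ij in auto)
    also have "\<dots> = 0" using ij by simp
    finally have "\<forall>a\<in>I. ?u a = 0" using pm.subspace_0 [OF W] by (intro indep) simp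
    then show False using ij by auto
  qed
  have "independent_modulo W (e ` I)"
    unfolding independent_modulo_def
  proof (intro conjI allI impI)
    show "finite (e ` I)" using I by simp
    fix u assume "(\<Sum>c\<in>e ` I. Poly_Mapping.map ((*) (u c)) c) \<in> W"
    then have "(\<Sum>i\<in>I. smul (u (e i)) (e i)) \<in> W"
      by (simp add: sum.reindex [OF inj] smul_def)
    from indep [OF this] show "\<forall>c\<in>e ` I. u c = 0" by simp
  qed
  then have "e ` I \<in> {A. A \<subseteq> U \<and> independent_modulo W A}" using e by auto
  then have "enat (card (e ` I)) \<le> dim_modulo U W"
    unfolding dim_modulo_def by (rule SUP_upper)
  then show "enat (card I) \<le> dim_modulo U W"
    by (simp add: card_image [OF inj])
qed

text \<open>A basis of the persistence module \<open>H\<^sub>n(F)\<close> for each \<open>n\<close>: \<open>V n t\<close> indexes a basis \<open>z t i\<close> of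
  \<open>H\<^sub>n(F t)\<close>, and the transition maps are diagonal with respect to these bases.\<close>

locale pbasis =
  fixes F :: "real \<Rightarrow> 'v set set" and V :: "nat \<Rightarrow> real \<Rightarrow> 'i set"
    and z :: "real \<Rightarrow> 'i \<Rightarrow> ('v list \<Rightarrow>\<^sub>0 'k::field)"
  assumes simplicial: "simplicial (F t)" and mono: "s \<le> t \<Longrightarrow> F s \<subseteq> F t" and fin: "finite (V n t)"
    and cycle: "i \<in> V n t \<Longrightarrow> z t i \<in> cycles n (F t)"
    and span: "c \<in> cycles n (F t) \<Longrightarrow> \<exists>u. c - (\<Sum>i\<in>V n t. smul (u i) (z t i)) \<in> boundaries n (F t)"
    and indep: "(\<Sum>i\<in>V n t. smul (u i) (z t i)) \<in> boundaries n (F t) \<Longrightarrow> i \<in> V n t \<Longrightarrow> u i = 0"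
    and alive: "s \<le> t \<Longrightarrow> i \<in> V n s \<Longrightarrow> i \<in> V n t \<Longrightarrow>
      \<exists>c. c \<noteq> 0 \<and> z s i - smul c (z t i) \<in> boundaries n (F t)"
    and dead: "s \<le> t \<Longrightarrow> i \<in> V n s \<Longrightarrow> i \<notin> V n t \<Longrightarrow> z s i \<in> boundaries n (F t)"
begin

text \<open>Basis elements at \<open>s\<close> that are alive at \<open>t\<close> become nonzero
  multiples of basis elements at \<open>t\<close>, and the others vanish; so the former give a basis
  of the image.\<close>

lemma homology_rank:
  assumes st: "s \<le> t"
  shows "homology_rank TYPE('k) n (F s) (F t) = enat (card (V n s \<inter> V n t))"
  unfolding homology_rank_def
proof (rule dim_modulo_eq)
  show "pm.subspace (boundaries n (F t) :: ('v list \<Rightarrow>\<^sub>0 'k) set)" by (rule subspace_boundaries)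
  show "finite (V n s \<inter> V n t)" using fin by blast
  show "z s i \<in> cycles n (F s)" if "i \<in> V n s \<inter> V n t" for i using cycle that by blast
next
  fix u :: "'i \<Rightarrow> 'k"
  let ?I = "V n s \<inter> V n t"
  assume b: "(\<Sum>i\<in>?I. smul (u i) (z s i)) \<in> boundaries n (F t)"
  obtain c where c: "\<And>i. i \<in> ?I \<Longrightarrow> c i \<noteq> 0 \<and> z s i - smul (c i) (z t i) \<in> boundaries n (F t)"
    using alive [OF st, of _ n] by (metis Int_iff)
  define w where "w i = (if i \<in> V n s then u i * c i else 0)" for i
  have "(\<Sum>i\<in>?I. smul (u i) (z s i - smul (c i) (z t i))) \<in> boundaries n (F t)"
    by (intro boundaries_ops(5,6)) (use c in blast)
  then have "(\<Sum>i\<in>?I. smul (u i) (z s i)) - (\<Sum>i\<in>?I. smul (u i * c i) (z t i)) \<in> boundaries n (F t)"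
    by (simp add: pm.scale_right_diff_distrib sum_subtractf)
  then have "(\<Sum>i\<in>?I. smul (u i * c i) (z t i)) \<in> boundaries n (F t)"
    using b boundaries_diff_iff by blast
  also have "(\<Sum>i\<in>?I. smul (u i * c i) (z t i)) = (\<Sum>i\<in>V n t. smul (w i) (z t i))"
    by (rule sum.mono_neutral_cong_left) (use fin in \<open>auto simp: w_def\<close>)
  finally have "w i = 0" if "i \<in> V n t" for i using indep that by blast
  then show "\<forall>i\<in>?I. u i = 0" using c unfolding w_def by fastforce
next
  fix x :: "'v list \<Rightarrow>\<^sub>0 'k" assume "x \<in> cycles n (F s)"
  then obtain u where "x - (\<Sum>i\<in>V n s. smul (u i) (z s i)) \<in> boundaries n (F s)" using span by blast
  then have 1: "x - (\<Sum>i\<in>V n s. smul (u i) (z s i)) \<in> boundaries n (F t)"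
    using boundaries_mono [OF mono [OF st]] by blast
  have "(\<Sum>i\<in>V n s - V n t. smul (u i) (z s i)) \<in> boundaries n (F t)"
    using dead [OF st] by (intro boundaries_ops) auto
  moreover have "(\<Sum>i\<in>V n s. smul (u i) (z s i)) - (\<Sum>i\<in>V n s \<inter> V n t. smul (u i) (z s i))
      = (\<Sum>i\<in>V n s - V n t. smul (u i) (z s i))"
    using sum.Int_Diff [OF fin, of "\<lambda>i. smul (u i) (z s i)" n s "V n t"] by simp
  ultimately have "(\<Sum>i\<in>V n s. smul (u i) (z s i)) - (\<Sum>i\<in>V n s \<inter> V n t. smul (u i) (z s i)) \<in> boundaries n (F t)"
    by simp
  with 1 show "\<exists>u. x - (\<Sum>i\<in>V n s \<inter> V n t. smul (u i) (z s i)) \<in> boundaries n (F t)"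
    using boundaries_diff_trans by blast
qed

end

text \<open>Transport along mutually inverse vertex maps, used to pass between pairs, functions on
  an index set and single points.\<close>

lemma pbasis_relabel:
  fixes z :: "real \<Rightarrow> 'i \<Rightarrow> ('v list \<Rightarrow>\<^sub>0 'k::field)" and h :: "'v \<Rightarrow> 'w"
  assumes B: "pbasis F V z"
    and F': "\<And>t. simplicial (F' t)" "\<And>s t. s \<le> t \<Longrightarrow> F' s \<subseteq> F' t"
    and h: "\<And>t S. S \<in> F t \<Longrightarrow> h ` S \<in> F' t" and h': "\<And>t S. S \<in> F' t \<Longrightarrow> h' ` S \<in> F t"
    and hh: "\<And>t S x. S \<in> F t \<Longrightarrow> x \<in> S \<Longrightarrow> h' (h x) = x" "\<And>t S x. S \<in> F' t \<Longrightarrow> x \<in> S \<Longrightarrow> h (h' x) = x"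
  shows "pbasis F' V (\<lambda>t i. push h (z t i))"
proof -
  interpret pbasis F V z by (rule B)
  have B1: "push h c \<in> boundaries n (F' t)" if "c \<in> boundaries n (F t)" for c :: "'v list \<Rightarrow>\<^sub>0 'k" and n t
    by (rule push_boundaries [OF h that])
  have B2: "push h' c \<in> boundaries n (F t)" if "c \<in> boundaries n (F' t)" for c :: "'w list \<Rightarrow>\<^sub>0 'k" and n t
    by (rule push_boundaries [OF h' that])
  have I1: "push h' (push h c) = c" if "c \<in> cycles n (F t)" for c :: "'v list \<Rightarrow>\<^sub>0 'k" and n t
    using that by (auto simp: cycles_iff chains_def intro!: push_ident hh(1))
  have I2: "push h (push h' c) = c" if "c \<in> cycles n (F' t)" for c :: "'w list \<Rightarrow>\<^sub>0 'k" and n t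
    using that by (auto simp: cycles_iff chains_def intro!: push_ident hh(2))
  show ?thesis
  proof
    show "push h (z t i) \<in> cycles n (F' t)" if "i \<in> V n t" for i n t
      by (rule push_cycles [OF h cycle [OF that]])
    show "\<exists>u. c - (\<Sum>i\<in>V n t. smul (u i) (push h (z t i))) \<in> boundaries n (F' t)" if c: "c \<in> cycles n (F' t)" for c n t
    proof -
      have "push h' c \<in> cycles n (F t)" by (rule push_cycles [OF h' c])
      then obtain u where "push h' c - (\<Sum>i\<in>V n t. smul (u i) (z t i)) \<in> boundaries n (F t)"
        using span by blast
      from B1 [OF this] have "c - (\<Sum>i\<in>V n t. smul (u i) (push h (z t i))) \<in> boundaries n (F' t)"
        by (simp only: push_simps I2 [OF c])
      then show ?thesis by blast
    qed
    show "u i = 0" if b: "(\<Sum>i\<in>V n t. smul (u i) (push h (z t i))) \<in> boundaries n (F' t)" and i: "i \<in> V n t" for u n t i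
    proof (rule indep [OF _ i])
      have "push h' (\<Sum>i\<in>V n t. smul (u i) (push h (z t i))) = (\<Sum>i\<in>V n t. smul (u i) (push h' (push h (z t i))))"
        by (simp only: push_simps)
      also have "\<dots> = (\<Sum>i\<in>V n t. smul (u i) (z t i))"
        by (rule sum.cong) (simp_all only: I1 [OF cycle])
      finally show "(\<Sum>i\<in>V n t. smul (u i) (z t i)) \<in> boundaries n (F t)"
        using B2 [OF b] by simp
    qed
    show "\<exists>c. c \<noteq> 0 \<and> push h (z s i) - smul c (push h (z t i)) \<in> boundaries n (F' t)"
      if "s \<le> t" "i \<in> V n s" "i \<in> V n t" for s t i n
      using alive [OF that] B1 by (metis push_simps(3,5))
    show "push h (z s i) \<in> boundaries n (F' t)" if "s \<le> t" "i \<in> V n s" "i \<notin> V n t" for s t i n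
      using dead [OF that] B1 by blast
  qed (use F' fin in auto)
qed

lemma pbasis_reindex:
  assumes B: "pbasis F V z" and g: "\<And>n t i. i \<in> V n t \<Longrightarrow> g' (g i) = i"
  shows "pbasis F (\<lambda>n t. g ` V n t) (\<lambda>t j. z t (g' j))"
proof -
  interpret pbasis F V z by (rule B)
  have inj: "inj_on g (V n t)" for n t using g by (metis inj_on_inverseI)
  have sum: "(\<Sum>j\<in>g ` V n t. smul (u j) (z t (g' j))) = (\<Sum>i\<in>V n t. smul (u (g i)) (z t i))" for u n t
    using g by (simp add: sum.reindex [OF inj] cong: sum.cong)
  show ?thesis
  proof
    show "\<exists>u. c - (\<Sum>i\<in>g ` V n t. smul (u i) (z t (g' i))) \<in> boundaries n (F t)" if c: "c \<in> cycles n (F t)" for c n t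
    proof -
      obtain u where "c - (\<Sum>i\<in>V n t. smul (u i) (z t i)) \<in> boundaries n (F t)" using span [OF c] by blast
      then have "c - (\<Sum>i\<in>V n t. smul ((u \<circ> g') (g i)) (z t i)) \<in> boundaries n (F t)"
        using g by (simp cong: sum.cong)
      then show ?thesis unfolding sum [symmetric] by blast
    qed
    show "u j = 0" if "(\<Sum>i\<in>g ` V n t. smul (u i) (z t (g' i))) \<in> boundaries n (F t)" "j \<in> g ` V n t" for u n t j
      using that indep [where u = "u \<circ> g" and n = n and t = t] unfolding sum by auto
    show "\<exists>c. c \<noteq> 0 \<and> z s (g' j) - smul c (z t (g' j)) \<in> boundaries n (F t)"
      if "s \<le> t" "j \<in> g ` V n s" "j \<in> g ` V n t" for s t j n
      using that alive g by (metis imageE)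
    show "z s (g' j) \<in> boundaries n (F t)" if "s \<le> t" "j \<in> g ` V n s" "j \<notin> g ` V n t" for s t j n
      using that dead g by (metis imageE imageI)
  qed (use simplicial mono fin cycle g in auto)
qed

lemma cross_cong:
  fixes a a' :: "'a list \<Rightarrow>\<^sub>0 'k::field" and b b' :: "'b list \<Rightarrow>\<^sub>0 'k"
  assumes M: "simplicial M" and K: "simplicial K" and ab: "a - a' \<in> boundaries p M" "b - b' \<in> boundaries q K"
    and cycles: "a' \<in> cycles p M" "b \<in> cycles q K"
  shows "cross a b - cross a' b' \<in> boundaries (p + q) (prod_complex M K)"
  using boundaries_ops(2) [OF cross_boundaries1 [OF M K ab(1) cycles(2)] cross_boundaries2 [OF M K cycles(1) ab(2)]]
  by simp

lemma kunneth_basis_span: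
  fixes Z :: "nat \<Rightarrow> ('b list \<Rightarrow>\<^sub>0 'k::field)" and c :: "('a \<times> 'b) list \<Rightarrow>\<^sub>0 'k"
  assumes "kunneth_basis M K D Z" "c \<in> cycles n (prod_complex M K)"
  shows "\<exists>w. (\<forall>m\<in>D. m \<le> n \<longrightarrow> w m \<in> cycles (n - m) M) \<and>
    c - (\<Sum>m | m \<in> D \<and> m \<le> n. cross (w m) (Z m)) \<in> boundaries n (prod_complex M K)"
proof -
  from assms(1) have "\<forall>n. \<forall>z\<in>cycles n (prod_complex M K). \<exists>w. (\<forall>m\<in>D. m \<le> n \<longrightarrow> w m \<in> cycles (n - m) M) \<and>
      z - (\<Sum>m | m \<in> D \<and> m \<le> n. cross (w m) (Z m)) \<in> boundaries n (prod_complex M K)"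
    unfolding kunneth_basis_def by (elim conjE)
  from bspec [OF spec [OF this] assms(2)] show ?thesis .
qed

lemma kunneth_basis_indep:
  fixes Z :: "nat \<Rightarrow> ('b list \<Rightarrow>\<^sub>0 'k::field)" and w :: "nat \<Rightarrow> ('a list \<Rightarrow>\<^sub>0 'k)"
  assumes "kunneth_basis M K D Z" "\<And>m. m \<in> D \<Longrightarrow> m \<le> n \<Longrightarrow> w m \<in> cycles (n - m) M"
    "(\<Sum>m | m \<in> D \<and> m \<le> n. cross (w m) (Z m)) \<in> boundaries n (prod_complex M K)" "m \<in> D" "m \<le> n"
  shows "w m \<in> boundaries (n - m) M"
proof -
  from assms(1) have "\<forall>n w. (\<forall>m\<in>D. m \<le> n \<longrightarrow> w m \<in> cycles (n - m) M) \<longrightarrow>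
      (\<Sum>m | m \<in> D \<and> m \<le> n. cross (w m) (Z m)) \<in> boundaries n (prod_complex M K) \<longrightarrow>
      (\<forall>m\<in>D. m \<le> n \<longrightarrow> w m \<in> boundaries (n - m) M)"
    unfolding kunneth_basis_def by (elim conjE)
  from this [rule_format, OF _ assms(3-5)] show ?thesis
    using assms(2) by blast
qed

text \<open>The Kuenneth property combines the basis of \<open>F t\<close> in degree
  \<open>n - m\<close> with the class of degree \<open>m\<close> into elements indexed by
  \<open>(m, i)\<close>. A cross product dies as soon as one factor does, and otherwise the scalars
  multiply.\<close>

lemma pbasis_prod_complex:
  fixes z :: "real \<Rightarrow> 'i \<Rightarrow> ('v list \<Rightarrow>\<^sub>0 'k::field)" and Z :: "real \<Rightarrow> nat \<Rightarrow> ('w list \<Rightarrow>\<^sub>0 'k)"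
  assumes B: "pbasis F V z" and K: "\<And>t. simplicial (K t)" "\<And>s t. s \<le> t \<Longrightarrow> K s \<subseteq> K t"
    and kunneth_basis: "\<And>t. kunneth_basis (F t) (K t) {m. t \<in> J m} (Z t)" and car: "carried K J Z"
  shows "pbasis (\<lambda>t. prod_complex (F t) (K t)) (\<lambda>n t. SIGMA m:{m. m \<in> {m. t \<in> J m} \<and> m \<le> n}. V (n - m) t)
    (\<lambda>t (m, i). cross (z t i) (Z t m))"
proof -
  interpret pbasis F V z by (rule B)
  let ?D = "\<lambda>n t. {m. m \<in> {m. t \<in> J m} \<and> m \<le> n}"
  let ?V = "\<lambda>n t. SIGMA m:?D n t. V (n - m) t"
  let ?z = "\<lambda>t (m, i). cross (z t i) (Z t m)"
  have D: "finite (?D n t)" for n t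
    by (rule finite_subset [of _ "{..n}"]) auto
  have Z: "Z t m \<in> cycles m (K t)" if "t \<in> J m" for t m
    using kunneth_basis that unfolding kunneth_basis_def by blast
  have sum: "(\<Sum>p\<in>?V n t. smul (u p) (?z t p)) =
      (\<Sum>m\<in>?D n t. cross (\<Sum>i\<in>V (n - m) t. smul (u (m, i)) (z t i)) (Z t m))" for u n t
  proof -
    have "(\<Sum>p\<in>?V n t. smul (u p) (?z t p)) = (\<Sum>(m, i)\<in>?V n t. smul (u (m, i)) (cross (z t i) (Z t m)))"
      by (rule sum.cong) auto
    also have "\<dots> = (\<Sum>m\<in>?D n t. \<Sum>i\<in>V (n - m) t. smul (u (m, i)) (cross (z t i) (Z t m)))"
      by (rule sum.Sigma [symmetric]) (use D fin in auto)
    finally show ?thesis by simp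
  qed
  have mn: "n - m + m = n" if "m \<in> ?D n t" for m n t using that by auto
  show ?thesis
  proof
    show "simplicial (prod_complex (F t) (K t))" for t using simplicial K by (simp add: simplicial_prod_complex)
    show "prod_complex (F s) (K s) \<subseteq> prod_complex (F t) (K t)" if "s \<le> t" for s t
      using mono [OF that] K(2) [OF that] by (auto simp: prod_complex_def)
    show "finite (?V n t)" for n t using D fin by blast
    show "?z t p \<in> cycles n (prod_complex (F t) (K t))" if pV: "p \<in> ?V n t" for p n t
    proof -
      obtain m i where p: "p = (m, i)" "m \<in> ?D n t" "i \<in> V (n - m) t" using pV by auto
      have "cross (z t i) (Z t m) \<in> cycles (n - m + m) (prod_complex (F t) (K t))"
        using p Z by (intro cross_cycles simplicial K cycle) auto
      then show ?thesis using mn [OF p(2)] p(1) by simp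
    qed
    show "\<exists>u. c - (\<Sum>p\<in>?V n t. smul (u p) (?z t p)) \<in> boundaries n (prod_complex (F t) (K t))"
      if c: "c \<in> cycles n (prod_complex (F t) (K t))" for c n t
    proof -
      obtain w where w0: "\<forall>m\<in>{m. t \<in> J m}. m \<le> n \<longrightarrow> w m \<in> cycles (n - m) (F t)"
        "c - (\<Sum>m\<in>?D n t. cross (w m) (Z t m)) \<in> boundaries n (prod_complex (F t) (K t))"
        using kunneth_basis_span [OF kunneth_basis [of t] c] by (elim exE conjE)
      have w1: "w m \<in> cycles (n - m) (F t)" if "m \<in> ?D n t" for m
        using w0(1) [rule_format, of m] that by simp
      have "\<forall>m\<in>?D n t. \<exists>u. w m - (\<Sum>i\<in>V (n - m) t. smul (u i) (z t i)) \<in> boundaries (n - m) (F t)"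
        using span [OF w1] by (intro ballI)
      from bchoice [OF this] obtain u where
        "\<forall>m\<in>?D n t. w m - (\<Sum>i\<in>V (n - m) t. smul (u m i) (z t i)) \<in> boundaries (n - m) (F t)"
        by (elim exE)
      then have u: "w m - (\<Sum>i\<in>V (n - m) t. smul (u m i) (z t i)) \<in> boundaries (n - m) (F t)"
        if "m \<in> ?D n t" for m
        using that by (rule bspec)
      have "cross (w m - (\<Sum>i\<in>V (n - m) t. smul (u m i) (z t i))) (Z t m) \<in> boundaries n (prod_complex (F t) (K t))"
        if "m \<in> ?D n t" for m
      proof -
        have "Z t m \<in> cycles m (K t)" using that Z by auto
        from cross_boundaries1 [OF simplicial K(1) u [OF that] this] show ?thesis by (simp only: mn [OF that])
      qed
      then have "(\<Sum>m\<in>?D n t. cross (w m - (\<Sum>i\<in>V (n - m) t. smul (u m i) (z t i))) (Z t m)) \<in> boundaries n (prod_complex (F t) (K t))"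
        by (rule boundaries_ops)
      then have "(\<Sum>m\<in>?D n t. cross (w m) (Z t m)) - (\<Sum>p\<in>?V n t. smul (case_prod u p) (?z t p)) \<in> boundaries n (prod_complex (F t) (K t))"
        unfolding sum cross_simps sum_subtractf case_prod_conv .
      from boundaries_diff_trans [OF w0(2) this] show ?thesis by blast
    qed
    show "u p = 0" if b: "(\<Sum>p\<in>?V n t. smul (u p) (?z t p)) \<in> boundaries n (prod_complex (F t) (K t))" and p: "p \<in> ?V n t" for u n t p
    proof -
      obtain m i where mi: "p = (m, i)" "m \<in> ?D n t" "i \<in> V (n - m) t" using p by auto
      define w where "w m = (\<Sum>i\<in>V (n - m) t. smul (u (m, i)) (z t i))" for m
      have "w m \<in> cycles (n - m) (F t)" for m
        unfolding w_def by (intro cycles_ops(5,6) cycle)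
      moreover have "(\<Sum>m\<in>?D n t. cross (w m) (Z t m)) \<in> boundaries n (prod_complex (F t) (K t))"
        using b unfolding sum w_def .
      ultimately have "w m \<in> boundaries (n - m) (F t)"
        using kunneth_basis_indep [OF kunneth_basis [of t]] mi(2) by blast
      then show ?thesis
        using indep [where u = "\<lambda>i. u (m, i)" and n = "n - m" and t = t and i = i] mi unfolding w_def by simp
    qed
    fix s t :: real and p n assume st: "s \<le> t" and p: "p \<in> ?V n s"
    obtain m i where mi: "p = (m, i)" "m \<in> ?D n s" "i \<in> V (n - m) s" using p by auto
    have Zs: "Z s m \<in> cycles m (K t)"
      using Z [of s m] mi cycles_mono [OF K(2) [OF st]] by auto
    have zs: "z s i \<in> cycles (n - m) (F t)"
      using cycle [OF mi(3)] cycles_mono [OF mono [OF st]] by auto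
    {
      assume circle_point: "p \<in> ?V n t"
      then have it: "i \<in> V (n - m) t" and mt: "t \<in> J m" using mi by auto
      obtain c where c: "c \<noteq> 0" "z s i - smul c (z t i) \<in> boundaries (n - m) (F t)"
        using alive [OF st mi(3) it] by blast
      obtain c' where c': "c' \<noteq> 0" "Z s m - smul c' (Z t m) \<in> boundaries m (K t)"
        using car st mi(2) mt unfolding carried_def by (metis (no_types, lifting) mem_Collect_eq)
      have "cross (z s i) (Z s m) - cross (smul c (z t i)) (smul c' (Z t m)) \<in> boundaries (n - m + m) (prod_complex (F t) (K t))"
        by (rule cross_cong [OF simplicial K(1) c(2) c'(2) _ Zs]) (use cycle [OF it] in simp)
      then have "?z s p - smul (c * c') (?z t p) \<in> boundaries n (prod_complex (F t) (K t))"
        by (simp add: mi(1) mn [OF mi(2)] mult.commute)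
      then show "\<exists>c. c \<noteq> 0 \<and> ?z s p - smul c (?z t p) \<in> boundaries n (prod_complex (F t) (K t))"
        using c c' by (intro exI [of _ "c * c'"]) auto
    next
      assume "p \<notin> ?V n t"
      then have "i \<notin> V (n - m) t \<or> t \<notin> J m" using mi by auto
      then have "cross (z s i) (Z s m) \<in> boundaries (n - m + m) (prod_complex (F t) (K t))"
      proof
        assume "i \<notin> V (n - m) t"
        from cross_boundaries1 [OF simplicial K(1) dead [OF st mi(3) this] Zs] show ?thesis .
      next
        assume "t \<notin> J m"
        then have "Z s m \<in> boundaries m (K t)"
          using car st mi(2) unfolding carried_def by (metis (no_types, lifting) mem_Collect_eq)
        from cross_boundaries2 [OF simplicial K(1) zs this] show ?thesis .
      qed
      then show "?z s p \<in> boundaries n (prod_complex (F t) (K t))"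
        by (simp add: mi(1) mn [OF mi(2)])
    }
  qed
qed

subsection \<open>Products over a finite index set\<close>

lemma simplicial_product:
  assumes "\<And>i. i \<in> I \<Longrightarrow> simplicial (K i)"
  shows "simplicial (product_complex I K)"
  unfolding simplicial_def
proof (intro ballI conjI allI impI)
  fix S assume S: "S \<in> product_complex I K"
  then show "finite S" "S \<noteq> {}" by (auto simp: product_complex_def)
  fix T assume T: "T \<subseteq> S" "T \<noteq> {}"
  have "(\<lambda>x. x i) ` T \<in> K i" if "i \<in> I" for i
    using simplicialD [OF assms [OF that], of "(\<lambda>x. x i) ` S" "(\<lambda>x. x i) ` T"] S T that
    by (auto simp: product_complex_def image_mono)
  then show "T \<in> product_complex I K"
    using S T by (auto simp: product_complex_def intro: finite_subset)
qed

lemma product_complex_mono: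
  assumes "\<And>i. i \<in> I \<Longrightarrow> K i \<subseteq> L i"
  shows "product_complex I K \<subseteq> product_complex I L"
proof
  fix S assume S: "S \<in> product_complex I K"
  have "S \<subseteq> (\<Pi>\<^sub>E i\<in>I. \<Union>(K i))"
    using S by (simp add: product_complex_def)
  also have "\<dots> \<subseteq> (\<Pi>\<^sub>E i\<in>I. \<Union>(L i))"
    using assms by (intro PiE_mono) blast
  finally have "S \<subseteq> (\<Pi>\<^sub>E i\<in>I. \<Union>(L i))" .
  moreover have "(\<lambda>x. x i) ` S \<in> L i" if "i \<in> I" for i
  proof -
    have "(\<lambda>x. x i) ` S \<in> K i" using S that by (simp add: product_complex_def)
    then show ?thesis using assms [OF that] by (rule subsetD [rotated])
  qed
  ultimately show "S \<in> product_complex I L"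
    using S by (simp add: product_complex_def)
qed

text \<open>These vectors index the homology basis of the product at \<open>t\<close>, each factor
  contributing at most one class per degree.\<close>

definition degree_vectors :: "'j set \<Rightarrow> ('j \<Rightarrow> nat \<Rightarrow> real set) \<Rightarrow> nat \<Rightarrow> real \<Rightarrow> ('j \<Rightarrow> nat) set" where
  "degree_vectors I J n t = {\<nu> \<in> I \<rightarrow>\<^sub>E UNIV. (\<Sum>L\<in>I. \<nu> L) = n \<and> (\<forall>L\<in>I. t \<in> J L (\<nu> L))}"

text \<open>The empty product is a point, with one index, the empty degree vector; this starts the
  induction over the factors.\<close>

lemma pbasis_point:
  "pbasis (\<lambda>t. {{v}}) (\<lambda>n t. if n = 0 then {i} else {}) (\<lambda>t i. single [v] (1 :: 'k::field))"
proof
  show "simplicial {{v}}" by (rule simplicial_point)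
  show "single [v] (1::'k) \<in> cycles n {{v}}" if "j \<in> (if n = 0 then {i} else {})" for n j
    using that vertex_cycle [of v "{{v}}"] by (auto split: if_splits)
  show "\<exists>u. c - (\<Sum>j\<in>(if n = 0 then {i} else {}). smul (u j) (single [v] 1)) \<in> boundaries n {{v}}"
    if c: "c \<in> cycles n {{v}}" for n and c :: "'a list \<Rightarrow>\<^sub>0 'k"
  proof (cases n)
    case 0
    then have "c = single [v] (lookup c [v])" using c point_chain by (auto simp: cycles_iff)
    then have "c - smul (lookup c [v]) (single [v] 1) = 0" by simp
    then show ?thesis using 0 by (intro exI [of _ "\<lambda>_. lookup c [v]"]) simp
  next
    case (Suc m)
    then show ?thesis using c point_cycle by simp
  qed
  show "u j = 0" if "(\<Sum>j\<in>(if n = 0 then {i} else {}). smul (u j) (single [v] (1::'k))) \<in> boundaries n {{v}}"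
    "j \<in> (if n = 0 then {i} else {})" for u :: "'b \<Rightarrow> 'k" and n j
  proof -
    have "n = 0" "j = i" using that(2) by (auto split: if_splits)
    with that(1) have "single [v] (u i) = 0" using point_boundary by fastforce
    then show ?thesis using \<open>j = i\<close> by (metis lookup_single_eq lookup_zero)
  qed
  show "\<exists>c. c \<noteq> 0 \<and> single [v] (1::'k) - smul c (single [v] 1) \<in> boundaries n {{v}}" for n
    by (intro exI [of _ 1]) simp
qed (auto split: if_splits)

text \<open>Induction over the index set, with the product of the factors treated so far in the role
  of \<open>M\<close>. Hence the Kuenneth property is assumed for all complexes whose vertices are
  functions.\<close>

lemma pbasis_product:
  fixes K :: "'j \<Rightarrow> real \<Rightarrow> 'v set set"
  assumes I: "finite I" and K: "\<And>L t. L \<in> I \<Longrightarrow> simplicial (K L t)" "\<And>L s t. L \<in> I \<Longrightarrow> s \<le> t \<Longrightarrow> K L s \<subseteq> K L t"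
    and Z: "\<And>L. L \<in> I \<Longrightarrow> \<exists>Z :: real \<Rightarrow> nat \<Rightarrow> ('v list \<Rightarrow>\<^sub>0 'k::field).
      (\<forall>M :: ('j \<Rightarrow> 'v) set set. simplicial M \<longrightarrow> (\<forall>t. kunneth_basis M (K L t) {m. t \<in> J L m} (Z t))) \<and> carried (K L) (J L) Z"
  shows "\<exists>z :: real \<Rightarrow> ('j \<Rightarrow> nat) \<Rightarrow> (('j \<Rightarrow> 'v) list \<Rightarrow>\<^sub>0 'k).
    pbasis (\<lambda>t. product_complex I (\<lambda>L. K L t)) (degree_vectors I J) z"
  using I K Z
proof (induction I rule: finite_induct)
  case empty
  have "product_complex {} (\<lambda>L. K L t) = {{\<lambda>_. undefined}}" for t
    by (auto simp: product_complex_def subset_singleton_iff)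
  moreover have "degree_vectors {} J n t = (if n = 0 then {\<lambda>_. undefined} else {})" for n t
    by (auto simp: degree_vectors_def)
  then have "degree_vectors {} J = (\<lambda>n t. if n = 0 then {\<lambda>_. undefined} else {})" by (intro ext)
  ultimately show ?case
    using pbasis_point [of "\<lambda>_. undefined" "\<lambda>_. undefined"] by auto
next
  case (insert L I)
  let ?F = "\<lambda>t. product_complex I (\<lambda>L. K L t)" and ?F' = "\<lambda>t. product_complex (insert L I) (\<lambda>L. K L t)"
  obtain z :: "real \<Rightarrow> ('j \<Rightarrow> nat) \<Rightarrow> (('j \<Rightarrow> 'v) list \<Rightarrow>\<^sub>0 'k)" where z: "pbasis ?F (degree_vectors I J) z"
    using insert.IH insert.prems by auto
  obtain Z :: "real \<Rightarrow> nat \<Rightarrow> ('v list \<Rightarrow>\<^sub>0 'k)" where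
    Z: "\<And>M t. simplicial (M :: ('j \<Rightarrow> 'v) set set) \<Longrightarrow> kunneth_basis M (K L t) {m. t \<in> J L m} (Z t)" "carried (K L) (J L) Z"
    using insert.prems(3) [of L] by auto
  have cF: "simplicial (?F t)" for t by (rule simplicial_product) (use insert.prems in auto)
  let ?V = "\<lambda>n t. SIGMA m:{m. m \<in> {m. t \<in> J L m} \<and> m \<le> n}. degree_vectors I J (n - m) t"
  have 1: "pbasis (\<lambda>t. prod_complex (?F t) (K L t)) ?V (\<lambda>t (m, i). cross (z t i) (Z t m))"
    by (rule pbasis_prod_complex [OF z _ _ Z(1) [OF cF] Z(2)]) (use insert.prems in auto)
  \<comment> \<open>The new coordinate is stored at \<open>L\<close>; in the other direction
    \<open>L\<close> is reset to \<open>undefined\<close>, as extensionality on \<open>I\<close>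
    demands.\<close>
  let ?h = "\<lambda>(x, p). x(L := p) :: 'j \<Rightarrow> 'v" and ?h' = "\<lambda>y. (y(L := undefined), y L)"
  have "\<exists>z. pbasis ?F' ?V (z :: real \<Rightarrow> nat \<times> ('j \<Rightarrow> nat) \<Rightarrow> (('j \<Rightarrow> 'v) list \<Rightarrow>\<^sub>0 'k))"
  proof (rule exI, rule pbasis_relabel [OF 1, where h = ?h and h' = ?h'])
    show "simplicial (?F' t)" for t by (rule simplicial_product) (use insert.prems in auto)
    show "?F' s \<subseteq> ?F' t" if "s \<le> t" for s t
      by (rule product_complex_mono) (use insert.prems that in auto)
  next
    fix t S assume S: "S \<in> prod_complex (?F t) (K L t)"
    then have S1: "fst ` S \<subseteq> (\<Pi>\<^sub>E i\<in>I. \<Union>(K i t))" "\<And>i. i \<in> I \<Longrightarrow> (\<lambda>x. x i) ` fst ` S \<in> K i t"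
      and S2: "snd ` S \<in> K L t"
      by (auto simp: prod_complex_def product_complex_def)
    have "simplicial (prod_complex (?F t) (K L t))"
      using cF insert.prems by (simp add: simplicial_prod_complex)
    then have fin: "finite S" "S \<noteq> {}" using S simplicial_fin by blast+
    have "?h p \<in> (\<Pi>\<^sub>E i\<in>insert L I. \<Union>(K i t))" if "p \<in> S" for p
    proof -
      have "fst p \<in> (\<Pi>\<^sub>E i\<in>I. \<Union>(K i t))" "snd p \<in> \<Union>(K L t)" using that S1 S2 by auto
      then show ?thesis by (auto simp: PiE_iff extensional_def split: prod.splits)
    qed
    moreover have "(\<lambda>x. x i) ` ?h ` S \<in> K i t" if i: "i \<in> insert L I" for i
    proof (cases "i = L")
      case True
      then have "(\<lambda>x. x i) ` ?h ` S = snd ` S" by (auto simp: image_image intro!: image_cong)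
      then show ?thesis using S2 True by simp
    next
      case False
      then have "(\<lambda>x. x i) ` ?h ` S = (\<lambda>x. x i) ` fst ` S"
        unfolding image_image by (intro image_cong) auto
      then show ?thesis using S1(2) i False by simp
    qed
    ultimately show "?h ` S \<in> ?F' t"
      using fin by (simp add: product_complex_def image_subset_iff)
    show "?h' (?h p) = p" if "p \<in> S" for p
    proof -
      have "fst p L = undefined" using that S1(1) insert.hyps(2) by (auto simp: PiE_iff extensional_def)
      then have "(fst p)(L := undefined) = fst p" by auto
      then show ?thesis by (simp add: case_prod_beta)
    qed
  next
    fix t S assume S: "S \<in> ?F' t"
    then have S1: "S \<subseteq> (\<Pi>\<^sub>E i\<in>insert L I. \<Union>(K i t))" "\<And>i. i \<in> insert L I \<Longrightarrow> (\<lambda>x. x i) ` S \<in> K i t"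
      "finite S" "S \<noteq> {}"
      by (auto simp: product_complex_def)
    have "(\<lambda>y. y(L := undefined)) ` S \<in> ?F t"
    proof -
      have "y(L := undefined) \<in> (\<Pi>\<^sub>E i\<in>I. \<Union>(K i t))" if "y \<in> S" for y
      proof -
        have "y \<in> (\<Pi>\<^sub>E i\<in>insert L I. \<Union>(K i t))" by (rule subsetD [OF S1(1) that])
        then show ?thesis using insert.hyps(2) by (auto simp: PiE_iff extensional_def)
      qed
      moreover have "(\<lambda>x. x i) ` (\<lambda>y. y(L := undefined)) ` S = (\<lambda>x. x i) ` S" if "i \<in> I" for i
        using that insert.hyps(2) unfolding image_image by (intro image_cong) auto
      ultimately show ?thesis using S1(2,3,4) by (simp add: product_complex_def image_subset_iff)
    qed
    then show "?h' ` S \<in> prod_complex (?F t) (K L t)"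
      using S1(2) by (simp add: prod_complex_def image_image)
    show "?h (?h' y) = y" for y by simp
  qed
  then obtain z' :: "real \<Rightarrow> nat \<times> ('j \<Rightarrow> nat) \<Rightarrow> (('j \<Rightarrow> 'v) list \<Rightarrow>\<^sub>0 'k)" where z': "pbasis ?F' ?V z'" by blast
  let ?g = "\<lambda>(m, \<nu>). \<nu>(L := m) :: 'j \<Rightarrow> nat" and ?g' = "\<lambda>\<nu>. (\<nu> L, \<nu>(L := undefined))"
  have sum: "(\<Sum>i\<in>insert L I. \<nu> i) = \<nu> L + (\<Sum>i\<in>I. \<nu> i)" for \<nu> :: "'j \<Rightarrow> nat"
    using insert.hyps by simp
  have sum': "(\<Sum>i\<in>I. (\<nu>(L := m)) i) = (\<Sum>i\<in>I. \<nu> i)" for \<nu> :: "'j \<Rightarrow> nat" and m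
    using insert.hyps by (intro sum.cong) auto
  have g: "?g' (?g p) = p" if "p \<in> ?V n t" for p n t
  proof -
    have "snd p L = undefined" using that insert.hyps(2) by (auto simp: degree_vectors_def PiE_iff extensional_def)
    then have "(snd p)(L := undefined) = snd p" by auto
    then show ?thesis by (simp add: case_prod_beta)
  qed
  have gV: "?g ` ?V n t = degree_vectors (insert L I) J n t" for n t
  proof (intro set_eqI iffI)
    fix \<nu> assume "\<nu> \<in> ?g ` ?V n t"
    then obtain m \<mu> where m: "t \<in> J L m" "m \<le> n" "\<mu> \<in> degree_vectors I J (n - m) t" "\<nu> = \<mu>(L := m)" by auto
    then show "\<nu> \<in> degree_vectors (insert L I) J n t"
      using insert.hyps sum' [of \<mu> m] unfolding degree_vectors_def by (auto simp: PiE_iff extensional_def)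
  next
    fix \<nu> assume \<nu>: "\<nu> \<in> degree_vectors (insert L I) J n t"
    then have "\<nu> L \<le> n" "t \<in> J L (\<nu> L)" using sum [of \<nu>] by (auto simp: degree_vectors_def)
    moreover have "\<nu>(L := undefined) \<in> degree_vectors I J (n - \<nu> L) t"
      using \<nu> insert.hyps(2) sum [of \<nu>] sum' [of \<nu> undefined] by (auto simp: degree_vectors_def PiE_iff extensional_def)
    ultimately have "(\<nu> L, \<nu>(L := undefined)) \<in> ?V n t" by auto
    moreover have "\<nu> = ?g (\<nu> L, \<nu>(L := undefined))" by simp
    ultimately show "\<nu> \<in> ?g ` ?V n t" by blast
  qed
  have "pbasis ?F' (\<lambda>n t. ?g ` ?V n t) (\<lambda>t j. z' t (?g' j))"
    by (rule pbasis_reindex [OF z', where g = ?g and g' = ?g']) (rule g)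
  then have "pbasis ?F' (\<lambda>n t. degree_vectors (insert L I) J n t) (\<lambda>t j. z' t (?g' j))"
    by (simp only: gV)
  then show ?case by auto
qed

section \<open>Barcodes from ranks\<close>

text \<open>Membership extended to infinite parameters. Excluding \<open>\<infinity>\<close> matches
  the convention that the module is zero there; \<open>-\<infinity>\<close> is excluded by the
  strict inequality.\<close>

definition in_bar :: "ereal \<Rightarrow> ereal \<Rightarrow> ereal \<Rightarrow> bool" where
  "in_bar p q x \<longleftrightarrow> p < x \<and> x \<le> q \<and> x \<noteq> \<infinity>"

lemma bar_in_bar: "t \<in> bar p q \<longleftrightarrow> in_bar p q (ereal t)"
  by (simp add: bar_def in_bar_def)

text \<open>Used to place a corner of a rectangle between \<open>p\<close> and the finitely many
  smaller endpoints.\<close>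

lemma finite_gap_left:
  fixes p y :: ereal
  assumes "finite T" "y < p"
  obtains x where "y < x" "x < p" "\<And>t. t \<in> T \<Longrightarrow> t < p \<Longrightarrow> t < x"
proof -
  let ?S = "insert y {t \<in> T. t < p}"
  have "finite ?S" "?S \<noteq> {}" using assms by auto
  then have "Max ?S < p" using assms by simp
  then obtain x where x: "Max ?S < x" "x < p" using dense by blast
  then have "t < x" if "t \<in> ?S" for t
    using Max_ge [OF \<open>finite ?S\<close> that] x(1) by (meson le_less_trans)
  then show thesis using that x by auto
qed

lemma finite_gap_right:
  fixes p y :: ereal
  assumes "finite T" "p < y"
  obtains x where "p < x" "x < y" "\<And>t. t \<in> T \<Longrightarrow> p < t \<Longrightarrow> x < t"
proof -
  let ?S = "insert y {t \<in> T. p < t}"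
  have "finite ?S" "?S \<noteq> {}" using assms by auto
  then have "p < Min ?S" using assms by simp
  then obtain x where x: "p < x" "x < Min ?S" using dense by blast
  then have "x < t" if "t \<in> ?S" for t
    using Min_le [OF \<open>finite ?S\<close> that] x(2) by (meson less_le_trans)
  then show thesis using that x by auto
qed

lemma bar_real:
  assumes "p < q"
  obtains t where "t \<in> bar p q"
proof -
  obtain t where "p < ereal t" "ereal t < q" using ereal_dense2 [OF assms] by blast
  then have "t \<in> bar p q" by (simp add: bar_def)
  then show thesis by (rule that)
qed

lemma Inf_bar:
  assumes "p < q"
  shows "Inf (ereal ` bar p q) = p"
proof (rule antisym)
  show "p \<le> Inf (ereal ` bar p q)"
    by (rule Inf_greatest) (auto simp: bar_def)
  show "Inf (ereal ` bar p q) \<le> p"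
  proof (rule dense_ge)
    fix y assume "p < y"
    then have "p < min y q" using assms by simp
    then obtain t where t: "p < ereal t" "ereal t < min y q" using ereal_dense2 by blast
    then have "ereal t \<in> ereal ` bar p q" by (auto simp: bar_def)
    then have "Inf (ereal ` bar p q) \<le> ereal t" by (rule Inf_lower)
    then show "Inf (ereal ` bar p q) \<le> y" using t by auto
  qed
qed

lemma Sup_bar:
  assumes "p < q"
  shows "Sup (ereal ` bar p q) = q"
proof (rule antisym)
  show "Sup (ereal ` bar p q) \<le> q"
    by (rule Sup_least) (auto simp: bar_def)
  show "q \<le> Sup (ereal ` bar p q)"
  proof (rule dense_le)
    fix y assume "y < q"
    then have "max p y < q" using assms by simp
    then obtain t where t: "max p y < ereal t" "ereal t < q" using ereal_dense2 by blast
    then have "ereal t \<in> ereal ` bar p q" by (auto simp: bar_def)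
    then have "ereal t \<le> Sup (ereal ` bar p q)" by (rule Sup_upper)
    then show "y \<le> Sup (ereal ` bar p q)" using t by auto
  qed
qed

section \<open>Multiplicities for finitely many bars\<close>

context
  fixes k :: "'k::field itself" and n :: nat and F :: "real \<Rightarrow> 'v set set"
    and I :: "'i set" and P Q :: "'i \<Rightarrow> ereal"
  assumes I: "finite I"
    and rank: "\<And>s t. s < t \<Longrightarrow>
      homology_rank k n (F s) (F t) = enat (card {i \<in> I. s \<in> bar (P i) (Q i) \<and> t \<in> bar (P i) (Q i)})"
begin

lemma persistent_rank_bars:
  assumes "s < t"
  shows "persistent_rank k n F s t = card {i \<in> I. in_bar (P i) (Q i) s \<and> in_bar (P i) (Q i) t}"
proof (cases "s = -\<infinity> \<or> t = \<infinity>")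
  case True
  then show ?thesis by (auto simp: persistent_rank_def in_bar_def)
next
  case False
  then obtain s' t' where "s = ereal s'" "t = ereal t'"
    using assms by (cases s; cases t) auto
  then show ?thesis
    using rank [of s' t'] assms by (simp add: persistent_rank_def bar_in_bar)
qed

text \<open>Inclusion-exclusion among the bars containing both \<open>b\<close> and
  \<open>c\<close>: by convexity, those that also contain \<open>a\<close> and those that also
  contain \<open>d\<close> are subfamilies, with the bars containing \<open>a\<close> and
  \<open>d\<close> as intersection. The alternating sum is a cardinality, so truncation by
  \<open>nat\<close> loses nothing.\<close>

lemma rectangle_measure_bars:
  assumes "a < b" "b < c" "c < d"
  shows "rectangle_measure k n F a b c d =
    card {i \<in> I. \<not> in_bar (P i) (Q i) a \<and> in_bar (P i) (Q i) b \<and> in_bar (P i) (Q i) c \<and> \<not> in_bar (P i) (Q i) d}"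
proof -
  let ?in = "\<lambda>x. {i \<in> I. in_bar (P i) (Q i) x}"
  let ?BC = "?in b \<inter> ?in c" and ?AC = "?in a \<inter> ?in c" and ?BD = "?in b \<inter> ?in d" and ?AD = "?in a \<inter> ?in d"
  have r: "persistent_rank k n F s t = card (?in s \<inter> ?in t)" if "s < t" for s t
    unfolding persistent_rank_bars [OF that] by (rule arg_cong [where f = card]) auto
  have fin: "finite (?in x \<inter> ?in y)" for x y using I by auto
  have conv: "in_bar p q y" if "in_bar p q x" "in_bar p q z" "x < y" "y < z" for p q x y z
    using that by (auto simp: in_bar_def)
  have ab: "?AC \<subseteq> ?BC" using conv assms by blast
  have cd: "?BD \<subseteq> ?BC" using conv assms by blast
  have "?AC \<inter> ?BD = ?AD"
  proof (intro set_eqI iffI)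
    fix i assume "i \<in> ?AD"
    then have i: "i \<in> I" "in_bar (P i) (Q i) a" "in_bar (P i) (Q i) d" by auto
    have "a < c" "b < d" using assms by auto
    then have "in_bar (P i) (Q i) b" "in_bar (P i) (Q i) c"
      using conv [OF i(2,3) assms(1)] conv [OF i(2,3) _ assms(3)] by auto
    then show "i \<in> ?AC \<inter> ?BD" using i by auto
  qed auto
  then have "card ?AC + card ?BD = card (?AC \<union> ?BD) + card ?AD"
    using card_Un_Int [OF fin fin, of a c b d] by simp
  moreover have "card (?BC - (?AC \<union> ?BD)) = card ?BC - card (?AC \<union> ?BD)"
    using fin ab cd by (intro card_Diff_subset) auto
  moreover have "card (?AC \<union> ?BD) \<le> card ?BC"
    using fin ab cd by (intro card_mono) auto
  moreover have "card (?BC - (?AC \<union> ?BD)) = card {i \<in> I. \<not> in_bar (P i) (Q i) a \<and> in_bar (P i) (Q i) b \<and> in_bar (P i) (Q i) c \<and> \<not> in_bar (P i) (Q i) d}"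
    by (rule arg_cong [where f = card]) auto
  moreover have "rectangle_measure k n F a b c d
      = nat (int (card ?BC) - int (card ?AC) - int (card ?BD) + int (card ?AD))"
    using assms by (simp add: rectangle_measure_def r less_trans [of a b c] less_trans [of b c d]
        less_trans [OF less_trans [of a b c]])
  ultimately show ?thesis by linarith
qed

text \<open>Every admissible rectangle counts the bars with ends \<open>p\<close> and
  \<open>q\<close>. Corners placed between these and the finitely many other endpoints give a
  rectangle that counts nothing else.\<close>

lemma diagram_multiplicity_bars:
  assumes pq: "p < q"
  shows "diagram_multiplicity k n F p q = card {i \<in> I. P i = p \<and> Q i = q}"
  unfolding diagram_multiplicity_def
proof (rule cInf_eq_minimum)
  let ?X = "{rectangle_measure k n F a b c d | a b c d.
      (a < p \<or> a = -\<infinity> \<and> p = -\<infinity>) \<and> p < b \<and> b < c \<and> c < q \<and> (q < d \<or> q = \<infinity> \<and> d = \<infinity>)}"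
  show "card {i \<in> I. P i = p \<and> Q i = q} \<le> x" if "x \<in> ?X" for x
  proof -
    obtain a b c d where x: "x = rectangle_measure k n F a b c d"
      and *: "a < p \<or> a = -\<infinity> \<and> p = -\<infinity>" "p < b" "b < c" "c < q" "q < d \<or> q = \<infinity> \<and> d = \<infinity>"
      using \<open>x \<in> ?X\<close> by blast
    have abcd: "a < b" "b < c" "c < d" using * by auto
    show ?thesis
      unfolding x rectangle_measure_bars [OF abcd]
    proof (rule card_mono)
      show "{i \<in> I. P i = p \<and> Q i = q} \<subseteq>
          {i \<in> I. \<not> in_bar (P i) (Q i) a \<and> in_bar (P i) (Q i) b \<and> in_bar (P i) (Q i) c \<and> \<not> in_bar (P i) (Q i) d}"
        using * by (auto simp: in_bar_def)
    qed (use I in auto)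
  qed
  have fin: "finite (P ` I)" "finite (Q ` I)" using I by auto
  \<comment> \<open>At \<open>p = -\<infinity>\<close> the corner sits on the boundary of the
    extended plane; otherwise it lies below \<open>p\<close> and above all smaller left
    ends.\<close>
  obtain a where a: "a < p \<or> a = -\<infinity> \<and> p = -\<infinity>" "\<And>i. i \<in> I \<Longrightarrow> P i < p \<Longrightarrow> P i < a"
  proof (cases "p = -\<infinity>")
    case True
    then show thesis using that [of "-\<infinity>"] by simp
  next
    case False
    then have "-\<infinity> < p" by simp
    from finite_gap_left [OF fin(1) this] show thesis using that by (metis imageI)
  qed
  obtain d where d: "q < d \<or> q = \<infinity> \<and> d = \<infinity>" "\<And>i. i \<in> I \<Longrightarrow> q < Q i \<Longrightarrow> d < Q i"
  proof (cases "q = \<infinity>")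
    case True
    then show thesis using that [of "\<infinity>"] by simp
  next
    case False
    then have "q < \<infinity>" by simp
    from finite_gap_right [OF fin(2) this] show thesis using that by (metis imageI)
  qed
  obtain b where b: "p < b" "b < q" "\<And>i. i \<in> I \<Longrightarrow> p < P i \<Longrightarrow> b < P i"
    using finite_gap_right [OF fin(1) pq] by (metis imageI)
  obtain c where c: "b < c" "c < q" "\<And>i. i \<in> I \<Longrightarrow> Q i < q \<Longrightarrow> Q i < c"
    using finite_gap_left [OF fin(2) b(2)] by (metis imageI)
  have abcd: "a < b" "b < c" "c < d" using a b c d by auto
  have "{i \<in> I. \<not> in_bar (P i) (Q i) a \<and> in_bar (P i) (Q i) b \<and> in_bar (P i) (Q i) c \<and> \<not> in_bar (P i) (Q i) d}
      = {i \<in> I. P i = p \<and> Q i = q}"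
  proof (intro set_eqI iffI)
    fix i assume "i \<in> {i \<in> I. P i = p \<and> Q i = q}"
    then show "i \<in> {i \<in> I. \<not> in_bar (P i) (Q i) a \<and> in_bar (P i) (Q i) b \<and> in_bar (P i) (Q i) c \<and> \<not> in_bar (P i) (Q i) d}"
      using a(1) b(1,2) c(1,2) d(1) by (auto simp: in_bar_def)
  next
    fix i assume "i \<in> {i \<in> I. \<not> in_bar (P i) (Q i) a \<and> in_bar (P i) (Q i) b \<and> in_bar (P i) (Q i) c \<and> \<not> in_bar (P i) (Q i) d}"
    then have i: "i \<in> I" "\<not> in_bar (P i) (Q i) a" "in_bar (P i) (Q i) b" "in_bar (P i) (Q i) c" "\<not> in_bar (P i) (Q i) d"
      by auto
    have "P i < b" "c \<le> Q i" using i by (auto simp: in_bar_def)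
    have "a \<le> Q i" "a \<noteq> \<infinity>" using \<open>c \<le> Q i\<close> abcd by auto
    then have "a \<le> P i" using i(2) by (auto simp: in_bar_def)
    then have "P i = p"
      using a(2) [OF i(1)] b(3) [OF i(1)] \<open>P i < b\<close> by (meson leD less_trans neq_iff order_less_le_trans)
    moreover have "Q i = q"
    proof (rule ccontr)
      assume "Q i \<noteq> q"
      then consider "Q i < q" | "q < Q i" by fastforce
      then show False
      proof cases
        case 1
        then show False using c(3) [OF i(1)] \<open>c \<le> Q i\<close> by auto
      next
        case 2
        then have "d < Q i" by (rule d(2) [OF i(1)])
        moreover have "P i < d" using \<open>P i < b\<close> abcd by auto
        ultimately show False using i(5) by (auto simp: in_bar_def)
      qed
    qed
    ultimately show "i \<in> {i \<in> I. P i = p \<and> Q i = q}" using i(1) by simp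
  qed
  then have "rectangle_measure k n F a b c d = card {i \<in> I. P i = p \<and> Q i = q}"
    unfolding rectangle_measure_bars [OF abcd] by simp
  then show "card {i \<in> I. P i = p \<and> Q i = q} \<in> ?X"
    using a(1) b(1) c(1,2) d(1) by (smt (verit) mem_Collect_eq)
qed

text \<open>A nonempty bar determines its ends as infimum and supremum, so counting by pairs of ends
  agrees with counting by sets. A set that is not a nonempty bar gets 0 on both sides.\<close>

lemma barcode_bars:
  "barcode k n F A = (if A = {} then 0 else card {i \<in> I. bar (P i) (Q i) = A})"
proof (cases "\<exists>p q. p < q \<and> A = bar p q")
  case True
  then obtain p q where pq: "p < q" "A = bar p q" by blast
  then have ne: "A \<noteq> {}" using bar_real by blast
  have "barcode k n F A = diagram_multiplicity k n F p q"
    using True by (simp add: barcode_def Inf_bar [OF pq(1)] Sup_bar [OF pq(1)] flip: pq(2))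
      (simp add: pq(2) Inf_bar [OF pq(1)] Sup_bar [OF pq(1)])
  also have "\<dots> = card {i \<in> I. P i = p \<and> Q i = q}"
    by (rule diagram_multiplicity_bars [OF pq(1)])
  also have "{i \<in> I. P i = p \<and> Q i = q} = {i \<in> I. bar (P i) (Q i) = A}"
  proof -
    have "P i = p \<and> Q i = q" if "bar (P i) (Q i) = A" for i
    proof -
      have "P i < Q i" using that ne by (force simp: bar_def)
      then show ?thesis
        using Inf_bar [of "P i" "Q i"] Sup_bar [of "P i" "Q i"] Inf_bar [OF pq(1)] Sup_bar [OF pq(1)] that pq(2)
        by simp
    qed
    then show ?thesis using pq(2) by blast
  qed
  finally show ?thesis using ne by simp
next
  case False
  have "bar (P i) (Q i) \<noteq> A" if "A \<noteq> {}" for i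
  proof
    assume b: "bar (P i) (Q i) = A"
    then have "P i < Q i" using that by (force simp: bar_def)
    then show False using False b by blast
  qed
  then have "A = {} \<or> {i \<in> I. bar (P i) (Q i) = A} = {}" by blast
  then have "(if A = {} then 0 else card {i \<in> I. bar (P i) (Q i) = A}) = 0"
    by (metis card.empty)
  moreover have "barcode k n F A = 0"
    by (simp only: barcode_def False if_False)
  ultimately show ?thesis by simp
qed

end

section \<open>The Liouville torus\<close>

text \<open>In positive even degrees this and \<open>ray_upper\<close> are both 0, which makes the
  bar empty.\<close>

definition ray_lower :: "(real \<Rightarrow> real) \<Rightarrow> nat \<Rightarrow> (nat \<Rightarrow> real) \<Rightarrow> (nat \<Rightarrow> real) \<Rightarrow> nat \<Rightarrow> nat \<Rightarrow> ereal" where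
  "ray_lower f N a b L m =
     (if m = 0 then ereal (- b L / ray_speed N a L)
      else if odd m then
        ereal ((2 * torus_radius f L * sin (pi * (real (m div 2) / (2 * real (m div 2) + 1))) - b L) / ray_speed N a L)
      else 0)"

definition ray_upper :: "(real \<Rightarrow> real) \<Rightarrow> nat \<Rightarrow> (nat \<Rightarrow> real) \<Rightarrow> (nat \<Rightarrow> real) \<Rightarrow> nat \<Rightarrow> nat \<Rightarrow> ereal" where
  "ray_upper f N a b L m =
     (if m = 0 then \<infinity>
      else if odd m then
        ereal ((2 * torus_radius f L * sin (pi * ((real (m div 2) + 1) / (2 * real (m div 2) + 3))) - b L) / ray_speed N a L)
      else 0)"

lemma ray_interval_bar: "ray_interval f N a b L m = bar (ray_lower f N a b L m) (ray_upper f N a b L m)"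
  by (auto simp: ray_interval_def ray_lower_def ray_upper_def bar_def Let_def zero_ereal_def)

lemma Inter_bar:
  assumes "finite I" "I \<noteq> {}"
  shows "(\<Inter>i\<in>I. bar (P i) (Q i)) = bar (Max (P ` I)) (Min (Q ` I))"
  using assms by (auto simp: bar_def)

lemma torus_radius_nonneg: "0 \<le> torus_radius f L"
  by (simp add: torus_radius_def)

lemma torus_projection_circle:
  assumes "L \<in> {1..N}"
  shows "torus_projection f N L = circle_of_radius (torus_radius f L)"
proof (intro set_eqI iffI)
  fix p assume "p \<in> torus_projection f N L"
  then obtain x where x: "x \<in> liouville_torus f N" "p = x L"
    by (auto simp: torus_projection_def)
  then have "((snd (x L))\<^sup>2 + (fst (x L))\<^sup>2) / 2 = (torus_radius f L)\<^sup>2 / 2"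
    using assms unfolding liouville_torus_def by blast
  then show "p \<in> circle_of_radius (torus_radius f L)"
    using x by (simp add: circle_of_radius_def)
next
  fix p assume p: "p \<in> circle_of_radius (torus_radius f L)"
  let ?x = "\<lambda>i\<in>{1..N}. if i = L then p else (torus_radius f i, 0)"
  have x: "?x \<in> liouville_torus f N"
    using p assms by (auto simp: liouville_torus_def circle_of_radius_def)
  have "p = ?x L" using assms by simp
  then show "p \<in> torus_projection f N L"
    unfolding torus_projection_def using x by (rule image_eqI [where f = "\<lambda>x. x L"])
qed

lemma ray_speed_pos:
  assumes "N \<ge> 1" "\<forall>L\<in>{1..N}. a L > 0" "L \<in> {1..N}"
  shows "ray_speed N a L > 0"
proof -
  have aL: "0 < a L" using bspec [OF assms(2,3)] .
  also have "a L \<le> L2_set a {1..N}" by (rule member_le_L2_set) (use assms in auto)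
  finally show ?thesis using assms(1) aL by (simp add: ray_speed_def)
qed

text \<open>Positive speed makes each coordinate of the ray an increasing affine function of
  \<open>t\<close>; solving for \<open>t\<close> turns scale intervals into ray intervals.\<close>

lemma ray_interval_circle_interval:
  assumes "ray_speed N a L > 0"
  shows "t \<in> ray_interval f N a b L m \<longleftrightarrow> ray N a b t L \<in> circle_interval (torus_radius f L) m"
proof -
  have lower: "c / ray_speed N a L < t \<longleftrightarrow> c < ray_speed N a L * t"
    and upper: "t \<le> c / ray_speed N a L \<longleftrightarrow> ray_speed N a L * t \<le> c" for c
    using assms by (simp_all add: pos_divide_less_eq pos_le_divide_eq mult.commute)
  consider "m = 0" | "m \<noteq> 0" "odd m" | "m \<noteq> 0" "even m" by blast
  then show ?thesis
  proof cases
    case 1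
    show ?thesis
      unfolding 1 by (simp only: ray_interval_def circle_interval_def ray_def simp_thms if_True greaterThan_iff lower) linarith
  next
    case 2
    then show ?thesis
      by (simp only: ray_interval_def circle_interval_def ray_def simp_thms if_True if_False Let_def
          greaterThanAtMost_iff lower upper) linarith
  next
    case 3
    then show ?thesis by (simp add: ray_interval_def circle_interval_def)
  qed
qed

lemma kunneth_circle_filtration:
  assumes a: "N \<ge> 1" "\<forall>L\<in>{1..N}. a L > 0" and L: "L \<in> {1..N}"
  shows "\<exists>Z :: real \<Rightarrow> nat \<Rightarrow> ((real \<times> real) list \<Rightarrow>\<^sub>0 'k::field).
    (\<forall>M :: 'm set set. simplicial M \<longrightarrow>
      (\<forall>t. kunneth_basis M (circle_filtration f N a b L t) {m. t \<in> ray_interval f N a b L m} (Z t))) \<and>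
    carried (circle_filtration f N a b L) (ray_interval f N a b L) Z"
proof -
  note s = ray_speed_pos [OF a L]
  let ?\<rho> = "torus_radius f L" and ?\<epsilon> = "\<lambda>t. ray N a b t L"
  obtain Z :: "real \<Rightarrow> nat \<Rightarrow> ((real \<times> real) list \<Rightarrow>\<^sub>0 'k)" where
    Z: "\<forall>M :: 'm set set. simplicial M \<longrightarrow> (\<forall>\<epsilon>. kunneth_basis M (vietoris_rips (circle_of_radius ?\<rho>) \<epsilon>) {m. \<epsilon> \<in> circle_interval ?\<rho> m} (Z \<epsilon>))"
    "carried (vietoris_rips (circle_of_radius ?\<rho>)) (circle_interval ?\<rho>) Z"
    using kunneth_circle [OF torus_radius_nonneg [of f L], where 'k = 'k and 'a = 'm] by blast
  have K: "circle_filtration f N a b L = (\<lambda>t. vietoris_rips (circle_of_radius ?\<rho>) (?\<epsilon> t))"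
    by (simp add: circle_filtration_def [abs_def] torus_projection_circle [OF L])
  have mono: "?\<epsilon> x \<le> ?\<epsilon> t" if "x \<le> t" for x t
    using s that by (simp add: ray_def)
  have "carried (\<lambda>t. vietoris_rips (circle_of_radius ?\<rho>) (?\<epsilon> t)) (ray_interval f N a b L) (\<lambda>t. Z (?\<epsilon> t))"
    using Z(2) mono unfolding carried_def ray_interval_circle_interval [OF s] by blast
  then show ?thesis
    using Z(1) unfolding K ray_interval_circle_interval [OF s] by (intro exI [of _ "\<lambda>t. Z (?\<epsilon> t)"]) simp
qed

text \<open>The set \<open>I\<close> of factors is arbitrary so that \<open>{1..N}\<close> gives the
  torus and a singleton gives one circle.\<close>

lemma pbasis_circles:
  assumes a: "N \<ge> 1" "\<forall>L\<in>{1..N}. a L > 0" and I: "I \<subseteq> {1..N}"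
  obtains z :: "real \<Rightarrow> (nat \<Rightarrow> nat) \<Rightarrow> ((nat \<Rightarrow> real \<times> real) list \<Rightarrow>\<^sub>0 'k::field)" where
    "pbasis (\<lambda>t. product_complex I (\<lambda>L. circle_filtration f N a b L t)) (degree_vectors I (ray_interval f N a b)) z"
proof -
  have "\<exists>z :: real \<Rightarrow> (nat \<Rightarrow> nat) \<Rightarrow> ((nat \<Rightarrow> real \<times> real) list \<Rightarrow>\<^sub>0 'k).
      pbasis (\<lambda>t. product_complex I (\<lambda>L. circle_filtration f N a b L t)) (degree_vectors I (ray_interval f N a b)) z"
  proof (rule pbasis_product)
    show "finite I" using I finite_subset by blast
    fix L assume L: "L \<in> I"
    then have L': "L \<in> {1..N}" using I by auto
    show "simplicial (circle_filtration f N a b L t)" for t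
      by (simp add: circle_filtration_def simplicial_vietoris_rips)
    show "circle_filtration f N a b L s \<subseteq> circle_filtration f N a b L t" if "s \<le> t" for s t
      using ray_speed_pos [OF a L'] that unfolding circle_filtration_def
      by (intro vietoris_rips_mono) (simp add: ray_def)
    show "\<exists>Z :: real \<Rightarrow> nat \<Rightarrow> ((real \<times> real) list \<Rightarrow>\<^sub>0 'k). (\<forall>M :: (nat \<Rightarrow> real \<times> real) set set. simplicial M \<longrightarrow>
        (\<forall>t. kunneth_basis M (circle_filtration f N a b L t) {m. t \<in> ray_interval f N a b L m} (Z t))) \<and>
        carried (circle_filtration f N a b L) (ray_interval f N a b L) Z"
      by (rule kunneth_circle_filtration [OF a L'])
  qed
  then show thesis using that by blast
qed

text \<open>Unlike \<open>degree_vectors\<close>, this index set does not depend on the parameter,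
  as the count of bars requires.\<close>

definition compositions :: "nat \<Rightarrow> nat \<Rightarrow> (nat \<Rightarrow> nat) set" where
  "compositions N n = {\<nu> \<in> {1..N} \<rightarrow>\<^sub>E UNIV. (\<Sum>L\<in>{1..N}. \<nu> L) = n}"

lemma finite_compositions: "finite (compositions N n)"
proof (rule finite_subset)
  show "compositions N n \<subseteq> {1..N} \<rightarrow>\<^sub>E {..n}"
  proof
    fix \<nu> assume \<nu>: "\<nu> \<in> compositions N n"
    then have "\<nu> L \<le> n" if "L \<in> {1..N}" for L
      using member_le_sum [OF that, of \<nu>] by (simp add: compositions_def)
    then show "\<nu> \<in> {1..N} \<rightarrow>\<^sub>E {..n}" using \<nu> by (auto simp: compositions_def PiE_iff)
  qed
  show "finite ({1..N} \<rightarrow>\<^sub>E {..n})" by (intro finite_PiE) auto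
qed

lemma torus_rank:
  assumes a: "N \<ge> 1" "\<forall>L\<in>{1..N}. a L > 0" and st: "s < t"
  shows "homology_rank TYPE('k::field) n (torus_filtration f N a b s) (torus_filtration f N a b t) =
    enat (card {\<nu> \<in> compositions N n. s \<in> (\<Inter>L\<in>{1..N}. ray_interval f N a b L (\<nu> L)) \<and>
      t \<in> (\<Inter>L\<in>{1..N}. ray_interval f N a b L (\<nu> L))})"
proof -
  obtain z :: "real \<Rightarrow> (nat \<Rightarrow> nat) \<Rightarrow> ((nat \<Rightarrow> real \<times> real) list \<Rightarrow>\<^sub>0 'k)" where
    "pbasis (torus_filtration f N a b) (degree_vectors {1..N} (ray_interval f N a b)) z"
    using pbasis_circles [OF a subset_refl] unfolding torus_filtration_def [abs_def] by metis
  then interpret pbasis "torus_filtration f N a b" "degree_vectors {1..N} (ray_interval f N a b)" z .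
  have "degree_vectors {1..N} (ray_interval f N a b) n s \<inter> degree_vectors {1..N} (ray_interval f N a b) n t =
    {\<nu> \<in> compositions N n. s \<in> (\<Inter>L\<in>{1..N}. ray_interval f N a b L (\<nu> L)) \<and>
      t \<in> (\<Inter>L\<in>{1..N}. ray_interval f N a b L (\<nu> L))}"
    by (auto simp: degree_vectors_def compositions_def)
  then show ?thesis using homology_rank [of s t n] st by simp
qed

text \<open>The basis for the product over \<open>{L}\<close> is transported to the circle by
  evaluation at \<open>L\<close>. The index set \<open>{()}\<close> puts the rank into the form
  counted by \<open>barcode_bars\<close>.\<close>

lemma circle_rank:
  assumes a: "N \<ge> 1" "\<forall>L\<in>{1..N}. a L > 0" and L: "L \<in> {1..N}" and st: "s < t"
  shows "homology_rank TYPE('k::field) m (circle_filtration f N a b L s) (circle_filtration f N a b L t) =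
    enat (card {i \<in> {()}. s \<in> ray_interval f N a b L m \<and> t \<in> ray_interval f N a b L m})"
proof -
  let ?K = "circle_filtration f N a b L"
  obtain z :: "real \<Rightarrow> (nat \<Rightarrow> nat) \<Rightarrow> ((nat \<Rightarrow> real \<times> real) list \<Rightarrow>\<^sub>0 'k)" where
    z: "pbasis (\<lambda>t. product_complex {L} (\<lambda>L. circle_filtration f N a b L t)) (degree_vectors {L} (ray_interval f N a b)) z"
    using pbasis_circles [OF a, of "{L}"] L by blast
  have "pbasis ?K (degree_vectors {L} (ray_interval f N a b)) (\<lambda>t i. push (\<lambda>x. x L) (z t i))"
  proof (rule pbasis_relabel [OF z, where h' = "\<lambda>p. \<lambda>i\<in>{L}. p"])
    show "simplicial (?K t)" for t by (simp add: circle_filtration_def simplicial_vietoris_rips)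
    show "?K s \<subseteq> ?K t" if "s \<le> t" for s t
      using ray_speed_pos [OF a L] that unfolding circle_filtration_def
      by (intro vietoris_rips_mono) (simp add: ray_def)
    show "(\<lambda>x. x L) ` S \<in> ?K t" if "S \<in> product_complex {L} (\<lambda>L. circle_filtration f N a b L t)" for S t
      using that by (simp add: product_complex_def)
    show "(\<lambda>p. \<lambda>i\<in>{L}. p) ` S \<in> product_complex {L} (\<lambda>L. circle_filtration f N a b L t)" if "S \<in> ?K t" for S t
    proof -
      have "finite S" "S \<noteq> {}"
        using that simplicial_fin [OF simplicial_vietoris_rips] unfolding circle_filtration_def by blast+
      moreover have "(\<lambda>x. x L) ` (\<lambda>p. \<lambda>i\<in>{L}. p) ` S = S"
        by (simp add: image_image)
      moreover have "(\<lambda>i\<in>{L}. p) \<in> (\<Pi>\<^sub>E i\<in>{L}. \<Union>(circle_filtration f N a b i t))" if "p \<in> S" for p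
        using that \<open>S \<in> ?K t\<close> by (intro restrict_PiE_iff [THEN iffD2]) blast
      ultimately show ?thesis
        using that by (simp add: product_complex_def image_subset_iff)
    qed
    show "(\<lambda>i\<in>{L}. x L) = x" if "S \<in> product_complex {L} (\<lambda>L. circle_filtration f N a b L t)" "x \<in> S" for S t x
    proof -
      have "x \<in> extensional {L}"
        using that by (auto simp: product_complex_def PiE_iff dest!: subsetD)
      then show ?thesis by (auto simp: extensional_def)
    qed
    show "(\<lambda>i\<in>{L}. p) L = p" for p :: "real \<times> real" by simp
  qed
  then interpret pbasis ?K "degree_vectors {L} (ray_interval f N a b)" "\<lambda>t i. push (\<lambda>x. x L) (z t i)" .
  have deg: "degree_vectors {L} (ray_interval f N a b) m t = (if t \<in> ray_interval f N a b L m then {\<lambda>i\<in>{L}. m} else {})" for t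
  proof -
    have 1: "\<nu> \<in> {L} \<rightarrow>\<^sub>E UNIV \<and> \<nu> L = m \<longleftrightarrow> \<nu> = (\<lambda>i\<in>{L}. m)" for \<nu> :: "nat \<Rightarrow> nat"
      by (auto simp: PiE_iff extensional_def)
    have 2: "degree_vectors {L} (ray_interval f N a b) m t
        = {\<nu>. (\<nu> \<in> {L} \<rightarrow>\<^sub>E UNIV \<and> \<nu> L = m) \<and> t \<in> ray_interval f N a b L m}"
      unfolding degree_vectors_def by (rule Collect_cong) (simp, blast)
    show ?thesis unfolding 2 1 by simp
  qed
  show ?thesis
    using homology_rank [of s t m] st unfolding deg
    by (cases "s \<in> ray_interval f N a b L m"; cases "t \<in> ray_interval f N a b L m") simp_all
qed

lemma circle_barcode:
  assumes a: "N \<ge> 1" "\<forall>L\<in>{1..N}. a L > 0" and L: "L \<in> {1..N}"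
  shows "barcode TYPE('k::field) m (circle_filtration f N a b L) A =
    (if A \<noteq> {} \<and> ray_interval f N a b L m = A then 1 else 0)"
proof -
  have "barcode TYPE('k) m (circle_filtration f N a b L) A = (if A = {} then 0
      else card {i \<in> {()}. bar (ray_lower f N a b L m) (ray_upper f N a b L m) = A})"
    by (rule barcode_bars) (simp_all add: circle_rank [OF a L] flip: ray_interval_bar)
  then show ?thesis by (simp flip: ray_interval_bar)
qed

text \<open>An intersection of bars is the bar from the largest left end to the smallest right end,
  so the ranks of the torus have the form counted by \<open>barcode_bars\<close>.\<close>

lemma torus_barcode:
  assumes a: "N \<ge> 1" "\<forall>L\<in>{1..N}. a L > 0"
  shows "barcode TYPE('k::field) n (torus_filtration f N a b) A = (if A = {} then 0
    else card {\<nu> \<in> compositions N n. (\<Inter>L\<in>{1..N}. ray_interval f N a b L (\<nu> L)) = A})"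
proof -
  let ?P = "\<lambda>\<nu>. Max ((\<lambda>L. ray_lower f N a b L (\<nu> L)) ` {1..N})"
  let ?Q = "\<lambda>\<nu>. Min ((\<lambda>L. ray_upper f N a b L (\<nu> L)) ` {1..N})"
  have *: "(\<Inter>L\<in>{1..N}. ray_interval f N a b L (\<nu> L)) = bar (?P \<nu>) (?Q \<nu>)" for \<nu>
    unfolding ray_interval_bar by (rule Inter_bar) (use a in auto)
  have "barcode TYPE('k) n (torus_filtration f N a b) A = (if A = {} then 0
      else card {\<nu> \<in> compositions N n. bar (?P \<nu>) (?Q \<nu>) = A})"
    by (rule barcode_bars [OF finite_compositions]) (unfold torus_rank [OF a] *, rule refl)
  then show ?thesis unfolding * .
qed

theorem theorem4p5:
  fixes f :: "real \<Rightarrow> real" and N n :: nat and a b :: "nat \<Rightarrow> real"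
  assumes "\<forall>t. f (t + 2 * pi) = f t"
    and "N \<ge> 1"
    and "\<forall>L\<in>{1..N}. a L > 0"
  shows "(\<forall>L\<in>{1..N}. \<forall>m. barcode TYPE('k::field) m (circle_filtration f N a b L) =
            count (if ray_interval f N a b L m = {} then {#} else {# ray_interval f N a b L m #})) \<and>
         barcode TYPE('k) n (torus_filtration f N a b) =
            count (filter_mset (\<lambda>I. I \<noteq> {})
              {# \<Inter>L\<in>{1..N}. ray_interval f N a b L (\<nu> L).
                 \<nu> \<in># mset_set {\<nu> \<in> {1..N} \<rightarrow>\<^sub>E UNIV.
                   (\<forall>L\<in>{1..N}. barcode TYPE('k) (\<nu> L) (circle_filtration f N a b L)
                                  (ray_interval f N a b L (\<nu> L)) > 0) \<and>
                   (\<Sum>L\<in>{1..N}. \<nu> L) = n} #})"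
proof (intro conjI ballI allI)
  note a = assms(2,3)
  show "barcode TYPE('k) m (circle_filtration f N a b L) =
      count (if ray_interval f N a b L m = {} then {#} else {# ray_interval f N a b L m #})"
    if "L \<in> {1..N}" for L m
    by (rule ext) (auto simp: circle_barcode [OF a that])
  let ?C = "{\<nu> \<in> {1..N} \<rightarrow>\<^sub>E UNIV.
     (\<forall>L\<in>{1..N}. barcode TYPE('k) (\<nu> L) (circle_filtration f N a b L) (ray_interval f N a b L (\<nu> L)) > 0) \<and>
     (\<Sum>L\<in>{1..N}. \<nu> L) = n}"
  let ?J = "\<lambda>\<nu>. \<Inter>L\<in>{1..N}. ray_interval f N a b L (\<nu> L)"
  \<comment> \<open>By \<open>circle_barcode\<close>, positive multiplicity in the barcode of a
    circle just means that the interval is nonempty.\<close>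
  have C: "?C = {\<nu> \<in> compositions N n. \<forall>L\<in>{1..N}. ray_interval f N a b L (\<nu> L) \<noteq> {}}"
    by (auto simp: compositions_def circle_barcode [OF a])
  have finC: "finite ?C"
    unfolding C using finite_compositions by (rule rev_finite_subset) blast
  show "barcode TYPE('k) n (torus_filtration f N a b) =
      count (filter_mset (\<lambda>I. I \<noteq> {}) {# ?J \<nu>. \<nu> \<in># mset_set ?C #})"
  proof
    fix A
    have cnt: "count {# ?J \<nu>. \<nu> \<in># mset_set ?C #} A = card {\<nu> \<in> ?C. ?J \<nu> = A}"
    proof -
      have "count {# ?J \<nu>. \<nu> \<in># mset_set ?C #} A = (\<Sum>\<nu>\<in>?J -` {A} \<inter> ?C. count (mset_set ?C) \<nu>)"
        unfolding count_image_mset using finC by simp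
      also have "\<dots> = (\<Sum>\<nu>\<in>?J -` {A} \<inter> ?C. 1)"
        using finC by (intro sum.cong refl count_mset_set(1)) auto
      also have "\<dots> = card {\<nu> \<in> ?C. ?J \<nu> = A}"
        unfolding sum_constant by (simp, rule arg_cong [where f = card], blast)
      finally show ?thesis .
    qed
    \<comment> \<open>A nonempty intersection forces each of its intervals to be nonempty, so the
      two index sets agree on it.\<close>
    have "{\<nu> \<in> ?C. ?J \<nu> = A} = {\<nu> \<in> compositions N n. ?J \<nu> = A}" if "A \<noteq> {}"
      unfolding C using that by blast
    then show "barcode TYPE('k) n (torus_filtration f N a b) A =
        count (filter_mset (\<lambda>I. I \<noteq> {}) {# ?J \<nu>. \<nu> \<in># mset_set ?C #}) A"
      unfolding torus_barcode [OF a] count_filter_mset cnt by simp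
  qed
qed

end
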